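(* Let $M$ be an almost-CR manifold with structure sheaf $\mathcal{Z}$, and let $\mathcal{Y}=\mathfrak{L}(\mathcal{V}_2;\mathcal{H})$ be the sheaf of real vector fields defined in the context. Then $M$ has property (H) at every point $p\in M$ such that $\{Y_p\mid Y\in\mathcal{Y}(M)\}=T_pM$.
   Context: An almost-CR manifold is a smooth real manifold $M$ of dimension $m$ with a smooth complex subbundle $T^{0,1}M\subset\mathbb{C}TM$ of constant rank $n$ such that $T^{0,1}M\cap\overline{T^{0,1}M}=0$; no formal integrability is required. Put $T^{1,0}M=\overline{T^{0,1}M}$, let $\mathcal{Z}$ be the sheaf of smooth sections of $T^{0,1}M$, $H_pM=\{\mathrm{Re}\,Z\mid Z\in T^{0,1}_pM\}$, $\mathcal{H}=\{\mathrm{Re}\,Z\mid Z\in\mathcal{Z}\}$, and $\pi_M:TM\to TM/HM$ the projection. A (complex valued) function or distribution $u$ is CR if $Zu=0$ for all $Z\in\mathcal{Z}$. Property (H): all germs of CR distributions on $M$ are smooth. Property (H) holds at $p$ if it holds when $M$ is replaced by a sufficiently small open neighborhood of $p$. $H^{1,1}_pM$ is the convex hull of $\{Z_p\otimes\bar Z_p\mid Z_p\in T^{0,1}_pM\}$. The vector valued Levi form is the linear extension $\mathcal{L}:H^{1,1}M\to TM/HM$ of $Z_p\otimes\bar Z_p\mapsto-\pi_M(i[Z,\bar Z]_p)$, $Z\in\mathcal{Z}$. Put $[\ker\mathcal{L}]_p=\{\tau\in H^{1,1}_pM\mid\tau\ne0,\ \mathcal{L}(\tau)=0\}$. For $U$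 open, $[\ker\mathcal{L}](U)$ is the set of sections $\tau$ over $U$, with $\tau_p\in[\ker\mathcal{L}]_p$ for all $p\in U$, which can be locally written as finite sums $\tau=\sum_{j=1}^rZ_j\otimes\bar Z_j$ with $Z_j\in\mathcal{Z}$; then $\sum_{j=1}^r[Z_j,\bar Z_j]=\bar L_0-L_0$ for some $L_0\in\mathcal{Z}$. For a family $S$ of real vector fields, $\mathfrak{L}(S)$ is the formally integrable distribution ($C^\infty$-module closed under brackets) generated by $S$ and its iterated commutators. For a local section $\tau$ of $[\ker\mathcal{L}]$, written locally as $\tau=\sum_{j=1}^rZ_j\otimes\bar Z_j$ with $Z_1,\dots,Z_r\in\mathcal{Z}$, and with $L_0\in\mathcal{Z}$ such that $\sum_{j=1}^r[Z_j,\bar Z_j]=\bar L_0-L_0$, put $\mathcal{V}_2(\tau)=\mathfrak{L}(\mathrm{Re}\,Z_1,\dots,\mathrm{Re}\,Z_r,\mathrm{Im}\,Z_1,\dots,\mathrm{Im}\,Z_r,\mathrm{Re}\,L_0)$ (it depends only on $\tau$ and $\mathcal{Z}$). Set $\mathcal{V}_2=\mathfrak{L}\big(\bigcup_{\tau\in[\ker\mathcal{L}]}\mathcal{V}_2(\tau)\big)$ (union over all local sections $\tau$), and $$\mathcal{Y}=\mathfrak{L}(\mathcal{V}_2;\mathcal{H})=\mathcal{H}+[\mathcal{V}_2,\mathcal{H}]+[\mathcal{V}_2,[\mathcal{V}_2,\mathcal{H}]]+\cdots,$$ i.e. the linear combinations with smooth real coefficients of elements of $\mathcal{H}$ and their iterated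 commutators with elements of $\mathcal{V}_2$. *)

theory Defs
  imports "HOL-Analysis.Analysis"
begin

fun C_k_on :: "nat \<Rightarrow> 'e::euclidean_space set \<Rightarrow> ('e \<Rightarrow> 'f::real_normed_vector) \<Rightarrow> bool" where
  "C_k_on 0 S f \<longleftrightarrow> continuous_on S f"
| "C_k_on (Suc k) S f \<longleftrightarrow> (\<forall>x\<in>S. f differentiable (at x)) \<and>
     (\<forall>v. C_k_on k S (\<lambda>x. frechet_derivative f (at x) v))"

text \<open>Only meant for open \<open>S\<close>.\<close>

definition smooth_on :: "'e::euclidean_space set \<Rightarrow> ('e \<Rightarrow> 'f::real_normed_vector) \<Rightarrow> bool" where
  "smooth_on S f \<longleftrightarrow> (\<forall>k. C_k_on k S f)"

definition partial :: "'m::finite \<Rightarrow> (real^'m \<Rightarrow> 'f::real_normed_vector) \<Rightarrow> real^'m \<Rightarrow> 'f" where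
  "partial j f x = frechet_derivative f (at x) (axis j 1)"

definition partials :: "'m::finite list \<Rightarrow> (real^'m \<Rightarrow> 'f::real_normed_vector) \<Rightarrow> real^'m \<Rightarrow> 'f" where
  "partials js f = foldr partial js f"

definition test_functions_supp :: "(real^'m::finite) set \<Rightarrow> (real^'m \<Rightarrow> complex) set" where
  "test_functions_supp K = {g. smooth_on UNIV g \<and> (\<forall>x. x \<notin> K \<longrightarrow> g x = 0)}"

definition test_functions :: "(real^'m::finite) set \<Rightarrow> (real^'m \<Rightarrow> complex) set" where
  "test_functions \<Omega> = (\<Union>K\<in>{K. compact K \<and> K \<subseteq> \<Omega>}. test_functions_supp K)"

text \<open>Complex linear functionals on \<open>C\<^sub>c\<^sup>\<infinity>(\<Omega>)\<close> satisfying the usual seminorm estimates.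
  The values on functions outside \<open>C\<^sub>c\<^sup>\<infinity>(\<Omega>)\<close> are irrelevant.\<close>

definition distribution_on ::
  "(real^'m::finite) set \<Rightarrow> ((real^'m \<Rightarrow> complex) \<Rightarrow> complex) \<Rightarrow> bool" where
  "distribution_on \<Omega> u \<longleftrightarrow>
     (\<forall>g\<in>test_functions \<Omega>. \<forall>h\<in>test_functions \<Omega>. \<forall>a b.
        u (\<lambda>x. a * g x + b * h x) = a * u g + b * u h) \<and>
     (\<forall>K. compact K \<and> K \<subseteq> \<Omega> \<longrightarrow> (\<exists>C N. \<forall>g\<in>test_functions_supp K.
        norm (u g) \<le> C * (\<Sum>js | length js \<le> N. SUP x. norm (partials js g x))))"

text \<open>A chart consists of its domain and its coordinate map; the values of the coordinate map
  outside the domain are irrelevant.\<close>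

type_synonym ('a, 'm) chart = "'a set \<times> ('a \<Rightarrow> real^'m)"

abbreviation dom_of :: "('a, 'm::finite) chart \<Rightarrow> 'a set" where
  "dom_of c \<equiv> fst c"

abbreviation coord :: "('a, 'm::finite) chart \<Rightarrow> 'a \<Rightarrow> real^'m" where
  "coord c \<equiv> snd c"

definition inv_coord :: "('a, 'm::finite) chart \<Rightarrow> real^'m \<Rightarrow> 'a" where
  "inv_coord c = inv_into (dom_of c) (coord c)"

definition trans_map :: "('a, 'm::finite) chart \<Rightarrow> ('a, 'm) chart \<Rightarrow> real^'m \<Rightarrow> real^'m" where
  "trans_map c d = coord d \<circ> inv_coord c"

definition trans_jac :: "('a, 'm::finite) chart \<Rightarrow> ('a, 'm) chart \<Rightarrow> real^'m \<Rightarrow> real^'m^'m" where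
  "trans_jac c d x = matrix (frechet_derivative (trans_map c d) (at x))"

text \<open>The underlying set of the manifold is the whole type \<open>'a\<close>, its dimension is \<open>CARD('m)\<close>.\<close>

locale smooth_manifold =
  fixes atlas :: "('a::{t2_space,second_countable_topology}, 'm::finite) chart set"
  assumes charts_cover: "(\<Union>c\<in>atlas. dom_of c) = UNIV"
    and chart_homeomorphism: "c \<in> atlas \<Longrightarrow>
      open (dom_of c) \<and> open (coord c ` dom_of c) \<and>
      homeomorphism (dom_of c) (coord c ` dom_of c) (coord c) (inv_coord c)"
    and charts_compatible: "c \<in> atlas \<Longrightarrow> d \<in> atlas \<Longrightarrow>
      smooth_on (coord c ` (dom_of c \<inter> dom_of d)) (trans_map c d)"
begin

definition smooth_fun :: "'a set \<Rightarrow> ('a \<Rightarrow> 'f::real_normed_vector) \<Rightarrow> bool" where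
  "smooth_fun U f \<longleftrightarrow> (\<forall>c\<in>atlas. smooth_on (coord c ` (U \<inter> dom_of c)) (f \<circ> inv_coord c))"

text \<open>Every point \<open>p\<close> is given a preferred chart around it, and a tangent vector at \<open>p\<close> is
  identified with its coordinate vector in that chart. Thus \<open>T\<^sub>pM\<close> is the type \<open>real^'m\<close>,
  \<open>\<complex>T\<^sub>pM\<close> is the type \<open>complex^'m\<close> and \<open>\<complex>T\<^sub>pM \<otimes> \<complex>T\<^sub>pM\<close> is the type \<open>complex^'m^'m\<close>. As the
  preferred chart jumps from point to point, smoothness of a vector field has to be tested after
  passing to the coordinates of a fixed chart (\<open>vf_coord\<close>). Real and complex vector fields are
  treated simultaneously, as the cases \<open>'k = real\<close> and \<open>'k = complex\<close>.\<close>

definition chart_at :: "'a \<Rightarrow> ('a, 'm) chart" where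
  "chart_at p = (SOME c. c \<in> atlas \<and> p \<in> dom_of c)"

definition vf_coord :: "('a, 'm) chart \<Rightarrow> ('a \<Rightarrow> 'k::real_normed_field^'m) \<Rightarrow> real^'m \<Rightarrow> 'k^'m" where
  "vf_coord c X x = (let p = inv_coord c x; J = trans_jac (chart_at p) c (coord (chart_at p) p) in
     (\<chi> i. \<Sum>j\<in>UNIV. of_real (J $ i $ j) * X p $ j))"

text \<open>A section over an open set \<open>U\<close> is represented by a function on all of \<open>M\<close> whose values
  outside \<open>U\<close> are irrelevant.\<close>

definition smooth_vf :: "'a set \<Rightarrow> ('a \<Rightarrow> 'k::real_normed_field^'m) \<Rightarrow> bool" where
  "smooth_vf U X \<longleftrightarrow> (\<forall>c\<in>atlas. smooth_on (coord c ` (U \<inter> dom_of c)) (vf_coord c X))"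

definition bracket ::
  "('a \<Rightarrow> 'k::real_normed_field^'m) \<Rightarrow> ('a \<Rightarrow> 'k^'m) \<Rightarrow> 'a \<Rightarrow> 'k^'m" where
  "bracket X Y p = (let c = chart_at p; x = coord c p; X' = vf_coord c X; Y' = vf_coord c Y in
     \<Sum>j\<in>UNIV. X' x $ j *s partial j Y' x - Y' x $ j *s partial j X' x)"

text \<open>A distribution on an open set \<open>W\<close> is a family of distributions in the charts that transform
  into each other like functions under changes of coordinates, so that smooth functions are
  distributions.\<close>

definition distribution ::
  "'a set \<Rightarrow> (('a, 'm) chart \<Rightarrow> (real^'m \<Rightarrow> complex) \<Rightarrow> complex) \<Rightarrow> bool" where
  "distribution W u \<longleftrightarrow>
     (\<forall>c\<in>atlas. distribution_on (coord c ` (W \<inter> dom_of c)) (u c)) \<and>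
     (\<forall>c\<in>atlas. \<forall>d\<in>atlas. \<forall>g\<in>test_functions (coord d ` (W \<inter> dom_of c \<inter> dom_of d)).
        u d g = u c (\<lambda>x. if x \<in> coord c ` (W \<inter> dom_of c \<inter> dom_of d)
                         then of_real \<bar>det (trans_jac c d x)\<bar> * g (trans_map c d x) else 0))"

definition smooth_distribution ::
  "'a set \<Rightarrow> (('a, 'm) chart \<Rightarrow> (real^'m \<Rightarrow> complex) \<Rightarrow> complex) \<Rightarrow> bool" where
  "smooth_distribution W u \<longleftrightarrow> (\<exists>f :: 'a \<Rightarrow> complex. smooth_fun W f \<and>
     (\<forall>c\<in>atlas. \<forall>g\<in>test_functions (coord c ` (W \<inter> dom_of c)).
        u c g = integral\<^sup>L lborel (\<lambda>x. f (inv_coord c x) * g x)))"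

text \<open>The distribution \<open>Zu\<close>: by duality, \<open>\<langle>\<Sum>\<^sub>j Z\<^sub>j \<partial>\<^sub>j u, g\<rangle> = - \<langle>u, \<Sum>\<^sub>j \<partial>\<^sub>j (Z\<^sub>j g)\<rangle>\<close> in each chart.\<close>

definition apply_vf ::
  "('a \<Rightarrow> complex^'m) \<Rightarrow> (('a, 'm) chart \<Rightarrow> (real^'m \<Rightarrow> complex) \<Rightarrow> complex)
    \<Rightarrow> ('a, 'm) chart \<Rightarrow> (real^'m \<Rightarrow> complex) \<Rightarrow> complex" where
  "apply_vf Z u c g = - u c (\<lambda>x. \<Sum>j\<in>UNIV. partial j (\<lambda>y. vf_coord c Z y $ j * g y) x)"

text \<open>For an assignment \<open>G\<close> of sets of local vector fields to open sets: the vector fields that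
  locally belong to \<open>G\<close>.\<close>

definition sheafify ::
  "('a set \<Rightarrow> ('a \<Rightarrow> real^'m) set) \<Rightarrow> 'a set \<Rightarrow> ('a \<Rightarrow> real^'m) set" where
  "sheafify G U = {X. \<forall>p\<in>U. \<exists>W. open W \<and> p \<in> W \<and> W \<subseteq> U \<and> (\<exists>Y\<in>G W. \<forall>q\<in>W. X q = Y q)}"

inductive_set lie_module :: "'a set \<Rightarrow> ('a \<Rightarrow> real^'m) set \<Rightarrow> ('a \<Rightarrow> real^'m) set"
  for U :: "'a set" and S :: "('a \<Rightarrow> real^'m) set" where
  generator: "X \<in> S \<Longrightarrow> X \<in> lie_module U S"
| zero: "(\<lambda>p. 0) \<in> lie_module U S"
| add: "X \<in> lie_module U S \<Longrightarrow> Y \<in> lie_module U S \<Longrightarrow> (\<lambda>p. X p + Y p) \<in> lie_module U S"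
| scale: "X \<in> lie_module U S \<Longrightarrow> smooth_fun U (f :: 'a \<Rightarrow> real) \<Longrightarrow>
    (\<lambda>p. f p *\<^sub>R X p) \<in> lie_module U S"
| bracket: "X \<in> lie_module U S \<Longrightarrow> Y \<in> lie_module U S \<Longrightarrow> bracket X Y \<in> lie_module U S"

text \<open>The formally integrable distribution \<open>\<LL>(S)\<close> of vector fields generated by \<open>S\<close>, where \<open>S W\<close>
  are the generators available over the open set \<open>W\<close>.\<close>

definition lie_sheaf ::
  "('a set \<Rightarrow> ('a \<Rightarrow> real^'m) set) \<Rightarrow> 'a set \<Rightarrow> ('a \<Rightarrow> real^'m) set" where
  "lie_sheaf S = sheafify (\<lambda>W. lie_module W (S W))"

inductive_set iterated_commutators ::
  "('a \<Rightarrow> real^'m) set \<Rightarrow> ('a \<Rightarrow> real^'m) set \<Rightarrow> ('a \<Rightarrow> real^'m) set"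
  for A B :: "('a \<Rightarrow> real^'m) set" where
  base: "X \<in> B \<Longrightarrow> X \<in> iterated_commutators A B"
| step: "V \<in> A \<Longrightarrow> X \<in> iterated_commutators A B \<Longrightarrow> bracket V X \<in> iterated_commutators A B"

definition module_span :: "'a set \<Rightarrow> ('a \<Rightarrow> real^'m) set \<Rightarrow> ('a \<Rightarrow> real^'m) set" where
  "module_span U S = {X. \<exists>k (f :: nat \<Rightarrow> 'a \<Rightarrow> real) Y.
     (\<forall>i<k. smooth_fun U (f i) \<and> Y i \<in> S) \<and> (\<forall>p. X p = (\<Sum>i<k. f i p *\<^sub>R Y i p))}"

text \<open>\<open>\<LL>(A; B) = B + [A, B] + [A, [A, B]] + \<dots>\<close>\<close>

definition relative_lie_sheaf ::
  "('a set \<Rightarrow> ('a \<Rightarrow> real^'m) set) \<Rightarrow> ('a set \<Rightarrow> ('a \<Rightarrow> real^'m) set)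
    \<Rightarrow> 'a set \<Rightarrow> ('a \<Rightarrow> real^'m) set" where
  "relative_lie_sheaf A B = sheafify (\<lambda>W. module_span W (iterated_commutators (A W) (B W)))"

end

definition cnj_vec :: "complex^'m \<Rightarrow> complex^'m" where
  "cnj_vec v = (\<chi> j. cnj (v $ j))"

definition Re_vec :: "complex^'m \<Rightarrow> real^'m" where
  "Re_vec v = (\<chi> j. Re (v $ j))"

definition Im_vec :: "complex^'m \<Rightarrow> real^'m" where
  "Im_vec v = (\<chi> j. Im (v $ j))"

text \<open>The components of \<open>v \<otimes> w\<close>.\<close>

definition tensor :: "complex^'m \<Rightarrow> complex^'m \<Rightarrow> complex^'m^'m" where
  "tensor v w = (\<chi> i j. v $ i * w $ j)"

text \<open>\<open>T01 p\<close> is the fibre of \<open>T\<^sup>0\<^sup>,\<^sup>1M\<close> at \<open>p\<close>. Coordinates are real, so conjugation in \<open>\<complex>T\<^sub>pM\<close> is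
  conjugation of components.\<close>

locale almost_CR_manifold = smooth_manifold atlas
  for atlas :: "('a::{t2_space,second_countable_topology}, 'm::finite) chart set" +
  fixes T01 :: "'a \<Rightarrow> (complex^'m) set" and n :: nat
  assumes local_frames: "\<exists>U E. open U \<and> p \<in> U \<and> (\<forall>i<n. smooth_vf U (E i)) \<and>
      (\<forall>q\<in>U. inj_on (\<lambda>i. E i q) {..<n} \<and> vec.independent ((\<lambda>i. E i q) ` {..<n}) \<and>
             vec.span ((\<lambda>i. E i q) ` {..<n}) = T01 q)"
    and T01_inter_conjugate: "T01 p \<inter> cnj_vec ` T01 p = {0}"
begin

definition Z_sheaf :: "'a set \<Rightarrow> ('a \<Rightarrow> complex^'m) set" where
  "Z_sheaf U = {Z. smooth_vf U Z \<and> (\<forall>p\<in>U. Z p \<in> T01 p)}"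

definition H_space :: "'a \<Rightarrow> (real^'m) set" where
  "H_space p = Re_vec ` T01 p"

definition H_sheaf :: "'a set \<Rightarrow> ('a \<Rightarrow> real^'m) set" where
  "H_sheaf U = (\<lambda>Z. Re_vec \<circ> Z) ` Z_sheaf U"

definition CR_distribution ::
  "'a set \<Rightarrow> (('a, 'm) chart \<Rightarrow> (real^'m \<Rightarrow> complex) \<Rightarrow> complex) \<Rightarrow> bool" where
  "CR_distribution W u \<longleftrightarrow> distribution W u \<and>
     (\<forall>V Z c g. open V \<and> V \<subseteq> W \<and> Z \<in> Z_sheaf V \<and> c \<in> atlas \<and>
        g \<in> test_functions (coord c ` (V \<inter> dom_of c)) \<longrightarrow> apply_vf Z u c g = 0)"

definition property_H :: "'a set \<Rightarrow> bool" where
  "property_H U \<longleftrightarrow> (\<forall>q\<in>U. \<forall>W u. open W \<and> q \<in> W \<and> W \<subseteq> U \<and> CR_distribution W u \<longrightarrow>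
     (\<exists>W'. open W' \<and> q \<in> W' \<and> W' \<subseteq> W \<and> smooth_distribution W' u))"

definition property_H_at :: "'a \<Rightarrow> bool" where
  "property_H_at p \<longleftrightarrow> (\<exists>U. open U \<and> p \<in> U \<and> property_H U)"

text \<open>\<open>T\<^sub>pM/H\<^sub>pM\<close> is the set of cosets of \<open>H\<^sub>pM\<close>.\<close>

definition pi_M :: "'a \<Rightarrow> real^'m \<Rightarrow> (real^'m) set" where
  "pi_M p v = {w. w - v \<in> H_space p}"

definition H11 :: "'a \<Rightarrow> (complex^'m^'m) set" where
  "H11 p = convex hull ((\<lambda>z. tensor z (cnj_vec z)) ` T01 p)"

text \<open>\<open>i[Z, cnj Z]\<close> is already real, \<open>Re_vec\<close> only changes the type.\<close>

definition i_bracket :: "('a \<Rightarrow> complex^'m) \<Rightarrow> 'a \<Rightarrow> real^'m" where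
  "i_bracket Z p = Re_vec (\<i> *s bracket Z (cnj_vec \<circ> Z) p)"

text \<open>The value \<open>\<xi>\<close> of the linear extension is unique: as \<open>(Z, W) \<mapsto> \<pi>\<^sub>M(i[Z, cnj W]\<^sub>p)\<close> is tensorial
  (up to complexification), it does not depend on the combination nor on the choice of the
  sections \<open>Z\<close>.\<close>

definition levi :: "'a \<Rightarrow> complex^'m^'m \<Rightarrow> (real^'m) set" where
  "levi p \<tau> = (THE \<xi>. \<exists>U k (r :: nat \<Rightarrow> real) Z.
     open U \<and> p \<in> U \<and> (\<forall>j<k. Z j \<in> Z_sheaf U) \<and>
     \<tau> = (\<Sum>j<k. r j *\<^sub>R tensor (Z j p) (cnj_vec (Z j p))) \<and>
     \<xi> = pi_M p (\<Sum>j<k. r j *\<^sub>R - i_bracket (Z j) p))"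

definition ker_levi :: "'a \<Rightarrow> (complex^'m^'m) set" where
  "ker_levi p = {\<tau>\<in>H11 p. \<tau> \<noteq> 0 \<and> levi p \<tau> = pi_M p 0}"

definition represents ::
  "'a set \<Rightarrow> ('a \<Rightarrow> complex^'m) list \<Rightarrow> ('a \<Rightarrow> complex^'m^'m) \<Rightarrow> bool" where
  "represents W Zs \<tau> \<longleftrightarrow> set Zs \<subseteq> Z_sheaf W \<and>
     (\<forall>q\<in>W. \<tau> q = (\<Sum>Z\<leftarrow>Zs. tensor (Z q) (cnj_vec (Z q))))"

definition ker_levi_sheaf :: "'a set \<Rightarrow> ('a \<Rightarrow> complex^'m^'m) set" where
  "ker_levi_sheaf U = {\<tau>. (\<forall>p\<in>U. \<tau> p \<in> ker_levi p) \<and>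
     (\<forall>p\<in>U. \<exists>W Zs. open W \<and> p \<in> W \<and> W \<subseteq> U \<and> represents W Zs \<tau>)}"

text \<open>Sections of \<open>\<V>\<^sub>2(\<tau>)\<close>, to be taken over open subsets of the domain of \<open>\<tau>\<close>.\<close>

definition V2_of :: "('a \<Rightarrow> complex^'m^'m) \<Rightarrow> 'a set \<Rightarrow> ('a \<Rightarrow> real^'m) set" where
  "V2_of \<tau> = sheafify (\<lambda>W. {X. \<exists>Zs. \<exists>L\<^sub>0\<in>Z_sheaf W. represents W Zs \<tau> \<and>
     (\<forall>q\<in>W. (\<Sum>Z\<leftarrow>Zs. bracket Z (cnj_vec \<circ> Z) q) = cnj_vec (L\<^sub>0 q) - L\<^sub>0 q) \<and>
     X \<in> lie_module W ((\<lambda>Z. Re_vec \<circ> Z) ` set Zs \<union> (\<lambda>Z. Im_vec \<circ> Z) ` set Zs \<union> {Re_vec \<circ> L\<^sub>0})})"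

definition V2 :: "'a set \<Rightarrow> ('a \<Rightarrow> real^'m) set" where
  "V2 = lie_sheaf (\<lambda>W. \<Union>\<tau>\<in>ker_levi_sheaf W. V2_of \<tau> W)"

definition Y_sheaf :: "'a set \<Rightarrow> ('a \<Rightarrow> real^'m) set" where
  "Y_sheaf = relative_lie_sheaf V2 H_sheaf"

end

end

theory Submission
 imports Defs "HOL-Analysis.Analysis"
begin

text \<open>Near \<open>p\<close> a cut-off distribution is replaced by its Fourier coefficients, a tempered sequence on the
  lattice; first order operators become sums of convolutions and multiplications by frequencies.
  Say that a vector field \<open>Y\<close> gains \<open>eps > 0\<close> if \<open>Y u\<close> lies in \<open>H\<^sup>t\<close>, \<open>t = s + eps - 1\<close>, wherever \<open>u\<close> lies
  in \<open>H\<^sup>s\<close>. If \<open>u\<close> is CR then \<open>Z u = 0\<close> for \<open>Z\<close> of type \<open>(0,1)\<close>, and integration by parts shows that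
  the conjugate of \<open>Z\<close> gains \<open>1/2\<close>. If \<open>\<Sum>\<^sub>j [Z\<^sub>j, conj Z\<^sub>j] = conj L - L\<close>, the same energy identity bounds
  all \<open>conj Z\<^sub>j u\<close> without loss, and brackets of a gaining field with \<open>Z\<^sub>j\<close>, \<open>conj Z\<^sub>j\<close> and \<open>L\<close> gain a fixed
  fraction of its gain; the commutator errors are controlled by weights regularised in a parameter \<open>t\<close>,
  uniformly in \<open>t\<close>. Gaining fields are closed under sums and smooth multiples, so all of \<open>Y_sheaf\<close> gains. Where
  \<open>Y_sheaf\<close> spans the tangent space, all partial derivatives gain, \<open>u\<close> bootstraps through all \<open>H\<^sup>s\<close>, and its
  Fourier series is smooth.\<close>

section \<open>Sequences on the lattice\<close>

text \<open>The obstacle is the bracket with \<open>L\<close>. The ordinary bracket estimate wants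
  gain 1 from a field and from its conjugate. Here \<open>L u = 0\<close>, but the conjugate of
  \<open>L\<close> is only known to gain 1/2. So the adjoint \<open>L'\<close> is eliminated: it is
  the sum of the commutators of \<open>Z j\<close> and \<open>Z' j\<close>, minus \<open>L\<close>,
  minus an error \<open>E\<close>. The energy identity is then used a second time, on a weighted
  copy \<open>w\<close> of \<open>Y u\<close>. First-order terms in \<open>w\<close> have order
  \<open>- 2 dl\<close> and are paired with \<open>w\<close> itself, which must have order
  \<open>2 dl\<close>; this forces \<open>4 dl <= eps\<close>. A bracket with \<open>L\<close> thus
  keeps a quarter of the gain, one with \<open>Z\<close> or its conjugate a half. Cut-offs destroy
  the relation between the \<open>Z j\<close> and \<open>L\<close> away from the support considered,
  so \<open>E\<close> is carried as a first-order operator whose value on \<open>u\<close> is as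
  regular as \<open>u\<close>. All estimates are proved for rapidly decreasing sequences, where
  every pairing converges, and against an unspecified functional \<open>G\<close>. Only afterwards
  are truncations of the coefficients of \<open>u\<close> inserted. The gain must not depend on the
  Sobolev order, since the final bootstrap iterates it.\<close>

type_synonym 'm seq = "int^'m => complex"

abbreviation UI :: "real set" where
 "UI \<equiv> {0<..1}"

abbreviation tests :: "(real^'m::finite) set => (real^'m => complex) set" where
 "tests \<equiv> test_functions"

definition lvec :: "int^'m::finite => real^'m" where
 "lvec k = (\<chi> j. real_of_int (k $ j))"

definition jb :: "int^'m::finite => real" where
 "jb k = sqrt (1 + (norm (lvec k))^2)"

lemma lvec_add: "lvec (k + l) = lvec k + lvec l"
 by (simp add: lvec_def vec_eq_iff)

lemma lvec_minus: "lvec (- k) = - lvec k"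
 by (simp add: lvec_def vec_eq_iff)

lemma jb_ge_1: "1 <= jb k"
 by (simp add: jb_def)

lemma jb_pos [simp]: "0 < jb k"
 using jb_ge_1[of k] by linarith

lemma jb_nonneg [simp]: "0 <= jb k"
 using jb_ge_1[of k] by linarith

lemma jb_nz [simp]: "jb k ~= 0"
 using jb_ge_1[of k] by linarith

lemma jb_square: "(jb k)^2 = 1 + (norm (lvec k))^2"
 by (simp add: jb_def)

lemma norm_le_jb: "norm (lvec k) <= jb k"
 by (rule power2_le_imp_le) (auto simp: jb_square)

lemma component_le_jb: "abs (real_of_int (k $ j)) <= jb k"
 using component_le_norm_cart[of "lvec k" j] norm_le_jb[of k]
 by (simp add: lvec_def)

lemma jb_minus [simp]: "jb (- k) = jb k"
 by (simp add: jb_def lvec_minus)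

lemma jb_le_add_norm: "jb (k + l) <= jb k + norm (lvec l)"
proof (rule power2_le_imp_le)
 have "(jb (k + l))^2 <= 1 + (norm (lvec k) + norm (lvec l))^2"
  unfolding jb_square lvec_add
  by (intro add_left_mono power_mono norm_triangle_ineq) auto
 also have "... = (jb k)^2 + 2 * norm (lvec k) * norm (lvec l) + (norm (lvec l))^2"
  using jb_square[of k] by (simp add: power2_sum)
 also have "... <= (jb k)^2 + 2 * jb k * norm (lvec l) + (norm (lvec l))^2"
  by (intro add_right_mono add_left_mono mult_right_mono mult_left_mono norm_le_jb) auto
 also have "... = (jb k + norm (lvec l))^2"
  by (simp add: power2_eq_square algebra_simps)
 finally show "(jb (k + l))^2 <= (jb k + norm (lvec l))^2" .
qed auto

text \<open>A Peetre-type inequality: a shift by \<open>l\<close> changes \<open>jb\<close> by at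
  most a factor depending on \<open>l\<close> alone. Convolution estimates use it to move weights
  across a shift, at the price of powers that rapid decay absorbs.\<close>

lemma jb_add_le: "jb (k + l) <= 2 * jb k * jb l"
proof -
 have "jb (k + l) <= jb k + jb l"
  using jb_le_add_norm[of k l] norm_le_jb[of l] by linarith
 also have "... <= jb k * jb l + jb k * jb l"
  using jb_ge_1[of k] jb_ge_1[of l] by (intro add_mono) (auto intro: mult_left_mono simp: mult_le_cancel_left1 mult_le_cancel_right1)
 finally show ?thesis by simp
qed

lemma jb_diff_le: "jb (k - l) <= 2 * jb k * jb l"
 using jb_add_le[of k "- l"] by simp

lemma jb_le_diff: "jb k <= 2 * jb (k - l) * jb l"
 using jb_add_le[of "k - l" l] by simp

lemma jb_power_ge_1 [simp]: "1 <= jb k ^ n"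
 by (simp add: jb_ge_1)

lemma jb_power_mono: "n <= n' ==> jb k ^ n <= jb k ^ n'"
 by (simp add: jb_ge_1 power_increasing)

lemma summable_inverse_int_square: "(%i::int. inverse (1 + (real_of_int i)^2)) summable_on UNIV"
proof -
 have "summable (%n::nat. inverse (1 + (real n)^2))"
 proof (rule summable_comparison_test')
  show "summable (%n::nat. inverse ((real n)^2))"
   by (rule inverse_power_summable) simp
  fix n :: nat assume "n >= 1"
  thus "norm (inverse (1 + (real n)^2)) <= inverse ((real n)^2)"
   using zero_le_power2[of "real n"] by (simp add: divide_simps not_less add_nonneg_nonneg)
 qed
 hence *: "(%n::nat. inverse (1 + (real n)^2)) summable_on UNIV"
  by (subst summable_on_UNIV_nonneg_real_iff) auto
 have 1: "(%i::int. inverse (1 + (real_of_int i)^2)) summable_on range int"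
  by (subst summable_on_reindex) (auto simp: o_def * inj_on_def)
 have 2: "(%i::int. inverse (1 + (real_of_int i)^2)) summable_on range (%n. - int n)"
  by (subst summable_on_reindex) (auto simp: o_def * inj_on_def)
 have "(UNIV::int set) = range int Un range (%n. - int n)"
 proof -
  have "i : range int Un range (%n. - int n)" for i
   by (cases i rule: int_cases2) auto
  thus ?thesis by blast
 qed
 with 1 2 show ?thesis
  by (metis (no_types, lifting) summable_on_union)
qed

text \<open>Each factor \<open>(jb k)^2\<close> dominates one \<open>1 + k_j^2\<close>, so the
  product of \<open>CARD('m)\<close> of them is controlled by a product of convergent
  one-dimensional series.\<close>

lemma summable_jb: "(%k::int^'m::finite. inverse (jb k ^ (2 * CARD('m)))) summable_on UNIV"
proof (rule nonneg_bdd_above_summable_on)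
 let ?f = "%i::int. inverse (1 + (real_of_int i)^2)"
 let ?S = "INFSUM i. ?f i"
 show "bdd_above (sum (%k::int^'m. inverse (jb k ^ (2 * CARD('m)))) ` {F. F <= UNIV & finite F})"
 proof (rule bdd_aboveI2)
  fix F :: "(int^'m) set" assume "F : {F. F <= UNIV & finite F}"
  hence F: "finite F" by simp
  \<comment> \<open>\<open>B\<close> collects the coordinate projections of \<open>F\<close>;
    enlarging \<open>F\<close> to their product turns the sum into a product of one-dimensional
    sums.\<close>
  define B where "B = (%j::'m. (%k. k $ j) ` F)"
  have finB: "finite (B j)" for j using F by (simp add: B_def)
  have le: "inverse (jb k ^ (2 * CARD('m))) <= (PROD j:UNIV. ?f (k $ j))" for k :: "int^'m"
  proof -
   have "(PROD j:UNIV. 1 + (real_of_int (k $ j))^2) <= (PROD j:(UNIV::'m set). (jb k)^2)"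
   proof (rule prod_mono, safe)
    fix j :: 'm
    have "(real_of_int (k $ j))^2 <= (norm (lvec k))^2"
     using power_mono[OF component_le_norm_cart[of "lvec k" j], of 2]
     by (simp add: lvec_def)
    thus "1 + (real_of_int (k $ j))^2 <= (jb k)^2" by (simp add: jb_square)
   qed simp
   also have "... = jb k ^ (2 * CARD('m))"
    by (simp add: power_mult)
   finally have "inverse (jb k ^ (2 * CARD('m))) <= inverse (PROD j:UNIV. 1 + (real_of_int (k $ j))^2)"
    by (intro le_imp_inverse_le prod_pos) (auto intro: add_pos_nonneg)
   also have "... = (PROD j:UNIV. ?f (k $ j))"
    using prod_inversef[of "%j. 1 + (real_of_int (k $ j))^2" UNIV] by (simp add: o_def)
   finally show ?thesis .
  qed
  have "(SUM k:F. inverse (jb k ^ (2 * CARD('m)))) <= (SUM k:F. PROD j:UNIV. ?f (k $ j))"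
   by (rule sum_mono) (rule le)
  also have "... = (SUM g:vec_nth ` F. PROD j:UNIV. ?f (g j))"
   by (subst sum.reindex) (auto simp: inj_on_def vec_nth_inject)
  also have "... <= (SUM g:PiE UNIV B. PROD j:UNIV. ?f (g j))"
   by (rule sum_mono2) (auto simp: B_def F intro!: finite_PiE prod_nonneg)
  also have "... = (PROD j:UNIV. SUM i:B j. ?f i)"
   by (rule prod_sum_PiE[symmetric]) (auto simp: finB)
  also have "... <= (PROD j:(UNIV::'m set). ?S)"
   by (intro prod_mono conjI sum_nonneg finite_sum_le_infsum)
    (auto simp: finB summable_inverse_int_square)
  finally show "(SUM k:F. inverse (jb k ^ (2 * CARD('m)))) <= (PROD j:(UNIV::'m set). ?S)" .
 qed
qed simp

section \<open>Rapidly decreasing and polynomially bounded sequences\<close>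

definition rapid :: "'m::finite seq => bool" where
 "rapid a \<longleftrightarrow> (ALL N. EX C. ALL k. cmod (a k) * jb k ^ N <= C)"

text \<open>Coefficients of cut-off distributions are of this kind, those of test functions are
  \<open>rapid\<close>.\<close>

definition temp :: "'m::finite seq => bool" where
 "temp v \<longleftrightarrow> (EX C N. ALL k. cmod (v k) <= C * jb k ^ N)"

lemma rapidD: "rapid a ==> EX C>=0. ALL k. cmod (a k) * jb k ^ N <= C"
 unfolding rapid_def by (metis jb_nonneg mult_nonneg_nonneg norm_ge_zero order_trans zero_le_power)

lemma tempD: "temp a ==> EX C>=0. EX N. ALL k. cmod (a k) <= C * jb k ^ N"
proof -
 assume "temp a"
 then obtain C N where C: "!!k. cmod (a k) <= C * jb k ^ N" by (auto simp: temp_def)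
 have "cmod (a k) <= abs C * jb k ^ N" for k
  using C[of k] by (smt (verit) jb_nonneg mult_right_mono zero_le_power)
 thus ?thesis by (intro exI[of _ "abs C"]) auto
qed

lemma rapid_imp_temp: "rapid a ==> temp a"
proof -
 assume "rapid a"
 from rapidD[OF this, of 0] obtain C where "!!k. cmod (a k) * jb k ^ 0 <= C" by auto
 thus "temp a" unfolding temp_def by (intro exI[of _ C] exI[of _ 0]) auto
qed

lemma rapid_summable:
 fixes a :: "'m::finite seq"
 assumes "rapid a"
 shows "(%k. cmod (a k) * jb k ^ N) summable_on UNIV"
proof -
 obtain C where C: "C >= 0" "!!k. cmod (a k) * jb k ^ (N + 2 * CARD('m)) <= C"
  using rapidD[OF assms] by meson
 show ?thesis
 proof (rule summable_on_comparison_test)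
  show "(%k::int^'m. C * inverse (jb k ^ (2 * CARD('m)))) summable_on UNIV"
   by (intro summable_on_cmult_right summable_jb)
  fix k :: "int^'m"
  show "cmod (a k) * jb k ^ N <= C * inverse (jb k ^ (2 * CARD('m)))"
   using C(2)[of k] by (simp add: field_simps power_add)
 qed auto
qed

lemma rapid_add: "rapid a ==> rapid b ==> rapid (%k. a k + b k)"
proof (unfold rapid_def, intro allI)
 fix N assume "ALL N. EX C. ALL k. cmod (a k) * jb k ^ N <= C" "ALL N. EX C. ALL k. cmod (b k) * jb k ^ N <= C"
 then obtain C C' where "!!k. cmod (a k) * jb k ^ N <= C" "!!k. cmod (b k) * jb k ^ N <= C'"
  by meson
 hence "cmod (a k + b k) * jb k ^ N <= C + C'" for k
  by (smt (verit, best) distrib_right jb_nonneg mult_right_mono norm_triangle_ineq zero_le_power)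
 thus "EX C. ALL k. cmod (a k + b k) * jb k ^ N <= C" by auto
qed

lemma temp_add: assumes "temp a" "temp b" shows "temp (%k. a k + b k)"
proof -
 obtain C N C' N' where C: "C >= 0" "!!k. cmod (a k) <= C * jb k ^ N"
   "C' >= 0" "!!k. cmod (b k) <= C' * jb k ^ N'"
  using tempD[OF assms(1)] tempD[OF assms(2)] by meson
 have "cmod (a k + b k) <= (C + C') * jb k ^ (max N N')" for k
 proof -
  have "C * jb k ^ N <= C * jb k ^ (max N N')" "C' * jb k ^ N' <= C' * jb k ^ (max N N')"
   using C by (auto intro!: mult_left_mono jb_power_mono)
  thus ?thesis using C(2)[of k] C(4)[of k] norm_triangle_ineq[of "a k" "b k"]
   by (simp add: distrib_right)
 qed
 thus ?thesis unfolding temp_def by blast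
qed

section \<open>Multiplication, differentiation and Fourier multipliers on coefficients\<close>

definition star :: "'m::finite seq => 'm seq" where
 "star a k = cnj (a (- k))"

lemma star_star [simp]: "star (star a) = a"
 by (simp add: star_def fun_eq_iff)

lemma rapid_star: "rapid a ==> rapid (star a)"
 unfolding rapid_def star_def by (metis complex_mod_cnj jb_minus)

text \<open>On Fourier coefficients \<open>Dop j\<close> is differentiation in the
  \<open>j\<close>-th variable, \<open>Mop a\<close> is multiplication by the function with
  coefficients \<open>a\<close>, and \<open>Lop w\<close> is a Fourier multiplier, the substitute
  for powers of the Laplacian.\<close>

definition Dop :: "'m::finite => 'm seq => 'm seq" where
 "Dop j v k = \<i> * of_int (k $ j) * v k"

definition Mop :: "'m::finite seq => 'm seq => 'm seq" where
 "Mop a v k = (INFSUM x. a x * v (k - x))"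

definition Lop :: "(int^'m::finite => real) => 'm seq => 'm seq" where
 "Lop w v k = of_real (w k) * v k"

lemma norm_Dop_le: "cmod (Dop j v k) <= jb k * cmod (v k)"
 using component_le_jb[of k j] by (simp add: Dop_def norm_mult mult_right_mono)

lemma rapid_Dop: "rapid a ==> rapid (Dop j a)"
proof (unfold rapid_def, intro allI)
 fix N assume "ALL N. EX C. ALL k. cmod (a k) * jb k ^ N <= C"
 then obtain C where C: "!!k. cmod (a k) * jb k ^ Suc N <= C" by meson
 have "cmod (Dop j a k) * jb k ^ N <= C" for k
  using order_trans[OF mult_right_mono[OF norm_Dop_le[of j a k], of "jb k ^ N"], of C] C[of k] by (simp add: mult_ac)
 thus "EX C. ALL k. cmod (Dop j a k) * jb k ^ N <= C" by auto
qed

lemma temp_Dop: assumes "temp a" shows "temp (Dop j a)"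
proof -
 obtain C N where C: "!!k. cmod (a k) <= C * jb k ^ N" using assms by (auto simp: temp_def)
 have "cmod (Dop j a k) <= C * jb k ^ Suc N" for k
  using order_trans[OF norm_Dop_le[of j a k] mult_left_mono[OF C[of k], of "jb k"]] by (simp add: mult_ac)
 thus ?thesis unfolding temp_def by blast
qed

lemma Mop_summable_gen:
 assumes "rapid a" "temp v"
 shows "(%x. cmod (a x) * jb x ^ N * cmod (v (k - x))) summable_on UNIV"
proof -
 obtain C M where C: "C >= 0" "!!k. cmod (v k) <= C * jb k ^ M"
  using tempD[OF assms(2)] by meson
 show ?thesis
 proof (rule summable_on_comparison_test)
  show "(%x. C * (2 * jb k) ^ M * (cmod (a x) * jb x ^ (N + M))) summable_on UNIV"
   by (intro summable_on_cmult_right rapid_summable assms)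
  fix x
  have "cmod (v (k - x)) <= C * jb (k - x) ^ M" by (rule C)
  also have "... <= C * (2 * jb k * jb x) ^ M"
   using C by (intro mult_left_mono power_mono jb_diff_le) auto
  finally have "cmod (a x) * jb x ^ N * cmod (v (k - x)) <= cmod (a x) * jb x ^ N * (C * (2 * jb k * jb x) ^ M)"
   by (intro mult_left_mono) auto
  also have "... = C * (2 * jb k) ^ M * (cmod (a x) * jb x ^ (N + M))"
   by (simp add: power_mult_distrib power_add)
  finally show "cmod (a x) * jb x ^ N * cmod (v (k - x)) <= C * (2 * jb k) ^ M * (cmod (a x) * jb x ^ (N + M))" .
 qed auto
qed

lemma Mop_abs_summable:
 assumes "rapid a" "temp v"
 shows "(%x. cmod (a x * v (k - x))) summable_on UNIV"
 using Mop_summable_gen[OF assms, of 0 k] by (simp add: norm_mult)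

lemma Mop_summable:
 assumes "rapid a" "temp v"
 shows "(%x. a x * v (k - x)) summable_on UNIV"
 using Mop_abs_summable[OF assms] by (rule abs_summable_summable)

lemma norm_Mop_le:
 assumes "rapid a" "temp v"
 shows "cmod (Mop a v k) <= (INFSUM x. cmod (a x) * cmod (v (k - x)))"
 unfolding Mop_def using norm_infsum_bound[OF Mop_abs_summable[OF assms]] by (simp add: norm_mult)

lemma temp_Mop:
 assumes "rapid a" "temp v"
 shows "temp (Mop a v)"
proof -
 obtain C M where C: "C >= 0" "!!k. cmod (v k) <= C * jb k ^ M"
  using tempD[OF assms(2)] by meson
 have "cmod (Mop a v k) <= (C * 2 ^ M * (INFSUM x. cmod (a x) * jb x ^ M)) * jb k ^ M" for k
 proof -
  have "cmod (Mop a v k) <= (INFSUM x. cmod (a x) * cmod (v (k - x)))"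
   by (rule norm_Mop_le[OF assms])
  also have "... <= (INFSUM x. C * (2 * jb k) ^ M * (cmod (a x) * jb x ^ M))"
  proof (rule infsum_mono)
   show "(%x. cmod (a x) * cmod (v (k - x))) summable_on UNIV"
    using Mop_summable_gen[OF assms, of 0 k] by simp
   show "(%x. C * (2 * jb k) ^ M * (cmod (a x) * jb x ^ M)) summable_on UNIV"
    by (intro summable_on_cmult_right rapid_summable assms)
   fix x
   have "cmod (v (k - x)) <= C * jb (k - x) ^ M" by (rule C)
   also have "... <= C * (2 * jb k * jb x) ^ M"
    using C by (intro mult_left_mono power_mono jb_diff_le) auto
   finally have "cmod (a x) * cmod (v (k - x)) <= cmod (a x) * (C * (2 * jb k * jb x) ^ M)"
    by (intro mult_left_mono) auto
   also have "... = C * (2 * jb k) ^ M * (cmod (a x) * jb x ^ M)"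
    by (simp add: power_mult_distrib)
   finally show "cmod (a x) * cmod (v (k - x)) <= C * (2 * jb k) ^ M * (cmod (a x) * jb x ^ M)" .
  qed
  also have "... = C * (2 * jb k) ^ M * (INFSUM x. cmod (a x) * jb x ^ M)"
   by (rule infsum_cmult_right) (intro rapid_summable assms)
  finally show ?thesis by (simp add: power_mult_distrib mult_ac)
 qed
 thus ?thesis unfolding temp_def by blast
qed

lemma rapid_Mop:
 assumes "rapid a" "rapid v"
 shows "rapid (Mop a v)"
 unfolding rapid_def
proof
 fix N
 obtain C where C: "C >= 0" "!!k. cmod (v k) * jb k ^ N <= C"
  using rapidD[OF assms(2)] by meson
 have "cmod (Mop a v k) * jb k ^ N <= C * 2 ^ N * (INFSUM x. cmod (a x) * jb x ^ N)" for k
 proof -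
  have "cmod (Mop a v k) * jb k ^ N <= (INFSUM x. cmod (a x) * cmod (v (k - x))) * jb k ^ N"
   by (intro mult_right_mono norm_Mop_le assms rapid_imp_temp) auto
  also have "... = (INFSUM x. cmod (a x) * cmod (v (k - x)) * jb k ^ N)"
   by (rule infsum_cmult_left[symmetric])
    (use Mop_summable_gen[OF assms(1) rapid_imp_temp[OF assms(2)], of 0 k] in simp)
  also have "... <= (INFSUM x. C * 2 ^ N * (cmod (a x) * jb x ^ N))"
  proof (rule infsum_mono)
   show "(%x. cmod (a x) * cmod (v (k - x)) * jb k ^ N) summable_on UNIV"
    using Mop_summable_gen[OF assms(1) rapid_imp_temp[OF assms(2)], of 0 k]
    by (intro summable_on_cmult_left) simp
   show "(%x. C * 2 ^ N * (cmod (a x) * jb x ^ N)) summable_on UNIV"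
    by (intro summable_on_cmult_right rapid_summable assms)
   fix x
   have "jb k ^ N <= (2 * jb (k - x) * jb x) ^ N"
    by (intro power_mono jb_le_diff) auto
   hence "cmod (a x) * cmod (v (k - x)) * jb k ^ N
     <= cmod (a x) * cmod (v (k - x)) * (2 * jb (k - x) * jb x) ^ N"
    by (intro mult_left_mono) auto
   also have "... = cmod (a x) * 2 ^ N * jb x ^ N * (cmod (v (k - x)) * jb (k - x) ^ N)"
    by (simp add: power_mult_distrib)
   also have "... <= cmod (a x) * 2 ^ N * jb x ^ N * C"
    by (intro mult_left_mono C) auto
   finally show "cmod (a x) * cmod (v (k - x)) * jb k ^ N <= C * 2 ^ N * (cmod (a x) * jb x ^ N)"
    by (simp add: mult_ac)
  qed
  also have "... = C * 2 ^ N * (INFSUM x. cmod (a x) * jb x ^ N)"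
   by (rule infsum_cmult_right) (intro rapid_summable assms)
  finally show ?thesis .
 qed
 thus "EX C. ALL k. cmod (Mop a v k) * jb k ^ N <= C" by blast
qed

lemma infsum_diff:
 fixes f g :: "'a => 'b::real_normed_vector"
 assumes "f summable_on A" "g summable_on A"
 shows "(INFSUM x:A. f x - g x) = infsum f A - infsum g A"
 using infsum_add[of f A "%x. - g x"] assms by (simp add: infsum_uminus summable_on_uminus)

lemma summable_on_diff:
 fixes f g :: "'a => 'b::real_normed_vector"
 assumes "f summable_on A" "g summable_on A"
 shows "(%x. f x - g x) summable_on A"
 using summable_on_add[of f A "%x. - g x"] assms by (simp add: summable_on_uminus)

lemma infsum_sum':
 fixes f :: "'b => 'a => 'c::real_normed_vector"
 assumes "finite I" "!!i. i : I ==> f i summable_on A"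
 shows "(INFSUM x:A. SUM i:I. f i x) = (SUM i:I. infsum (f i) A) & (%x. SUM i:I. f i x) summable_on A"
 using assms
proof (induction I rule: finite_induct)
 case (insert i I)
 thus ?case by (auto simp: infsum_add summable_on_add)
qed auto

lemma summable_on_times:
 fixes f :: "'a => real" and g :: "'b => real"
 assumes "f summable_on UNIV" "g summable_on UNIV" "!!x. 0 <= f x" "!!y. 0 <= g y"
 shows "(%(x, y). f x * g y) summable_on UNIV \<times> UNIV"
proof (rule summable_on_SigmaI)
 show "((%y. case (x, y) of (x, y) => f x * g y) has_sum f x * infsum g UNIV) UNIV" for x
  using assms(2) by (simp add: has_sum_cmult_right)
 show "(%x. f x * infsum g UNIV) summable_on UNIV"
  by (intro summable_on_cmult_left assms)
qed (use assms in auto)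

lemma Mop_double_summable:
 assumes "rapid a" "rapid b" "temp v"
 shows "(%(x, y). cmod (a x) * jb x ^ N * (cmod (b y) * jb y ^ N') * cmod (v (k - x - y)))
  summable_on UNIV \<times> UNIV"
proof -
 obtain C M where C: "C >= 0" "!!k. cmod (v k) <= C * jb k ^ M"
  using tempD[OF assms(3)] by meson
 have s: "(%z. (C * (4 * jb k) ^ M) * (%(x, y). (cmod (a x) * jb x ^ (N + M)) * (cmod (b y) * jb y ^ (N' + M))) z)
   summable_on UNIV \<times> UNIV"
  by (intro summable_on_cmult_right summable_on_times rapid_summable assms) auto
 show ?thesis
 proof (rule summable_on_comparison_test[OF s])
  fix z :: "(int ^ 'a) \<times> (int ^ 'a)"
  obtain x y where z: "z = (x, y)" by (cases z)
  have "cmod (v (k - x - y)) <= C * jb (k - x - y) ^ M" by (rule C)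
  also have "... <= C * (4 * jb k * jb x * jb y) ^ M"
  proof -
   have "jb (k - x - y) <= 2 * jb (k - x) * jb y" by (rule jb_diff_le)
   also have "... <= 2 * (2 * jb k * jb x) * jb y"
    by (intro mult_right_mono mult_left_mono jb_diff_le) auto
   finally show ?thesis using C(1) by (intro mult_left_mono power_mono) auto
  qed
  finally have "cmod (a x) * jb x ^ N * (cmod (b y) * jb y ^ N') * cmod (v (k - x - y))
    <= cmod (a x) * jb x ^ N * (cmod (b y) * jb y ^ N') * (C * (4 * jb k * jb x * jb y) ^ M)"
   by (intro mult_left_mono) auto
  thus "(case z of (x, y) => cmod (a x) * jb x ^ N * (cmod (b y) * jb y ^ N') * cmod (v (k - x - y)))
   <= (C * (4 * jb k) ^ M) * (%(x, y). (cmod (a x) * jb x ^ (N + M)) * (cmod (b y) * jb y ^ (N' + M))) z"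
   by (simp add: z power_mult_distrib power_add mult_ac)
 qed auto
qed

lemma Mop_Mop_summable:
 assumes "rapid a" "rapid b" "temp v"
 shows "(%(x, y). a x * (b y * v (k - x - y))) summable_on UNIV \<times> UNIV"
proof (rule abs_summable_summable)
 have "(%z. norm ((%(x, y). a x * (b y * v (k - x - y))) z)) =
   (%(x, y). cmod (a x) * jb x ^ 0 * (cmod (b y) * jb y ^ 0) * cmod (v (k - x - y)))"
  by (auto simp: fun_eq_iff norm_mult)
 thus "(%z. norm ((%(x, y). a x * (b y * v (k - x - y))) z)) summable_on UNIV \<times> UNIV"
  using Mop_double_summable[OF assms, of 0 0 k] by simp
qed

lemma Mop_Mop_eq: "Mop a (Mop b v) k = (INFSUM x. INFSUM y. a x * (b y * v (k - x - y)))"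
 by (simp add: Mop_def infsum_cmult_right')

lemma Mop_commute:
 assumes "rapid a" "rapid b" "temp v"
 shows "Mop a (Mop b v) = Mop b (Mop a v)"
proof
 fix k
 have "Mop a (Mop b v) k = (INFSUM y. INFSUM x. a x * (b y * v (k - x - y)))"
  unfolding Mop_Mop_eq using Mop_Mop_summable[OF assms, of k] by (rule infsum_swap_banach)
 also have "... = Mop b (Mop a v) k"
  unfolding Mop_Mop_eq by (intro infsum_cong) (simp add: mult_ac diff_diff_eq add_ac)
 finally show "Mop a (Mop b v) k = Mop b (Mop a v) k" .
qed

text \<open>Holds for arbitrary sequences: the reflection of \<open>x\<close> to
  \<open>k - x\<close> reindexes \<open>infsum\<close> even where the sum diverges and takes its
  default value 0.\<close>

lemma Mop_sym: "Mop a b = Mop b a"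
proof
 fix k
 have "Mop a b k = (INFSUM x. b x * a (k - x))"
  unfolding Mop_def
  by (rule infsum_reindex_bij_witness[of _ "%x. k - x" "%x. k - x"]) auto
 thus "Mop a b k = Mop b a k" by (simp add: Mop_def)
qed

text \<open>The shear \<open>z = x + y\<close> turns the iterated sum into the double sum of
  \<open>Mop_Mop_summable\<close>, whose summability licenses the exchange.\<close>

lemma Mop_assoc:
 assumes "rapid a" "rapid b" "temp v"
 shows "Mop (Mop a b) v = Mop a (Mop b v)"
proof
 fix k
 have "Mop (Mop a b) v k = (INFSUM z. INFSUM x. a x * b (z - x) * v (k - z))"
  by (simp add: Mop_def infsum_cmult_left')
 also have "... = (INFSUM x. INFSUM z. a x * b (z - x) * v (k - z))"
 proof (rule infsum_swap_banach)
  have "(%(x, y). a x * (b y * v (k - x - y))) summable_on UNIV"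
   using Mop_Mop_summable[OF assms, of k] by simp
  also have "?this \<longleftrightarrow> (%(z, x). a x * b (z - x) * v (k - z)) summable_on UNIV \<times> UNIV"
   by (rule summable_on_reindex_bij_witness[of _ "%(z, x). (x, z - x)" "%(x, y). (x + y, x)"])
    (auto simp: algebra_simps)
  finally show "(%(z, x). a x * b (z - x) * v (k - z)) summable_on UNIV \<times> UNIV" .
 qed
 also have "... = (INFSUM x. INFSUM y. a x * (b y * v (k - x - y)))"
 proof (rule infsum_cong)
  fix x
  show "(INFSUM z. a x * b (z - x) * v (k - z)) = (INFSUM y. a x * (b y * v (k - x - y)))"
   by (rule infsum_reindex_bij_witness[of _ "%y. x + y" "%z. z - x"]) (auto simp: algebra_simps)
 qed
 finally show "Mop (Mop a b) v k = Mop a (Mop b v) k" by (simp add: Mop_Mop_eq)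
qed

lemma Mop_add_right:
 assumes "rapid a" "temp u" "temp v"
 shows "Mop a (%k. u k + v k) = (%k. Mop a u k + Mop a v k)"
 unfolding Mop_def using assms by (simp add: distrib_left infsum_add Mop_summable)

lemma Mop_diff_right:
 assumes "rapid a" "temp u" "temp v"
 shows "Mop a (%k. u k - v k) = (%k. Mop a u k - Mop a v k)"
 unfolding Mop_def using assms by (simp add: right_diff_distrib infsum_diff Mop_summable)

lemma Mop_add_left:
 assumes "rapid a" "rapid b" "temp v"
 shows "Mop (%k. a k + b k) v = (%k. Mop a v k + Mop b v k)"
 unfolding Mop_def using assms by (simp add: distrib_right infsum_add Mop_summable)

lemma Mop_minus_left: "Mop (%k. - a k) v = (%k. - Mop a v k)"
 unfolding Mop_def by (simp add: infsum_uminus)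

lemma Mop_zero_left: "Mop (%k. 0) v = (%k. 0)"
 by (simp add: Mop_def fun_eq_iff)

lemma Mop_scale_left: "Mop (%k. c * a k) v = (%k. c * Mop a v k)"
 by (simp add: Mop_def fun_eq_iff mult.assoc infsum_cmult_right')

lemma Dop_add: "Dop j (%k. u k + v k) = (%k. Dop j u k + Dop j v k)"
 by (simp add: Dop_def fun_eq_iff algebra_simps)

lemma Dop_diff: "Dop j (%k. u k - v k) = (%k. Dop j u k - Dop j v k)"
 by (simp add: Dop_def fun_eq_iff algebra_simps)

lemma Lop_add: "Lop w (%k. u k + v k) = (%k. Lop w u k + Lop w v k)"
 by (simp add: Lop_def fun_eq_iff algebra_simps)

lemma Lop_diff: "Lop w (%k. u k - v k) = (%k. Lop w u k - Lop w v k)"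
 by (simp add: Lop_def fun_eq_iff algebra_simps)

text \<open>The Leibniz rule, which on frequencies is the splitting
  \<open>k = x + (k - x)\<close>.\<close>

lemma Dop_Mop:
 assumes "rapid a" "temp v"
 shows "Dop j (Mop a v) = (%k. Mop a (Dop j v) k + Mop (Dop j a) v k)"
proof
 fix k
 have "Mop a (Dop j v) k + Mop (Dop j a) v k = (INFSUM x. a x * Dop j v (k - x) + Dop j a x * v (k - x))"
  unfolding Mop_def by (intro infsum_add[symmetric] Mop_summable assms rapid_Dop temp_Dop)
 also have "... = (INFSUM x. \<i> * of_int (k $ j) * (a x * v (k - x)))"
  by (intro infsum_cong) (simp add: Dop_def algebra_simps)
 also have "... = Dop j (Mop a v) k"
  by (simp add: infsum_cmult_right' Mop_def Dop_def)
 finally show "Dop j (Mop a v) k = Mop a (Dop j v) k + Mop (Dop j a) v k" by simp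
qed

lemma Dop_commute: "Dop i (Dop j v) = Dop j (Dop i v)"
 by (simp add: Dop_def fun_eq_iff)

section \<open>Inner product and weighted square-summable norms\<close>

definition ip :: "'m::finite seq => 'm seq => complex" where
 "ip u v = (INFSUM k. u k * cnj (v k))"

lemma rapid_mult_summable:
 assumes "rapid u" "temp v"
 shows "(%k. cmod (u k) * cmod (v k)) summable_on UNIV"
proof -
 obtain C M where C: "C >= 0" "!!k. cmod (v k) <= C * jb k ^ M"
  using tempD[OF assms(2)] by meson
 show ?thesis
 proof (rule summable_on_comparison_test)
  show "(%k. C * (cmod (u k) * jb k ^ M)) summable_on UNIV"
   by (intro summable_on_cmult_right rapid_summable assms)
  fix k
  show "cmod (u k) * cmod (v k) <= C * (cmod (u k) * jb k ^ M)"
   using mult_left_mono[OF C(2)[of k], of "cmod (u k)"] by (simp add: mult_ac)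
 qed auto
qed

lemma ip_summable:
 assumes "rapid u" "rapid v"
 shows "(%k. u k * cnj (v k)) summable_on UNIV"
 by (rule abs_summable_summable)
  (use rapid_mult_summable[OF assms(1) rapid_imp_temp[OF assms(2)]] in "simp add: norm_mult")

lemma ip_cnj: "cnj (ip u v) = ip v u"
proof -
 have "ip v u = (INFSUM k. cnj (u k * cnj (v k)))"
  unfolding ip_def by (intro infsum_cong) simp
 thus ?thesis by (simp only: ip_def infsum_cnj)
qed

lemma ip_add_left: "rapid u ==> rapid v ==> rapid w ==> ip (%k. u k + v k) w = ip u w + ip v w"
 unfolding ip_def by (simp add: distrib_right infsum_add ip_summable)

lemma ip_diff_left: "rapid u ==> rapid v ==> rapid w ==> ip (%k. u k - v k) w = ip u w - ip v w"
 unfolding ip_def by (simp add: left_diff_distrib infsum_diff ip_summable)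

lemma ip_add_right: "rapid u ==> rapid v ==> rapid w ==> ip u (%k. v k + w k) = ip u v + ip u w"
 unfolding ip_def by (simp add: distrib_left infsum_add ip_summable)

lemma ip_diff_right: "rapid u ==> rapid v ==> rapid w ==> ip u (%k. v k - w k) = ip u v - ip u w"
 unfolding ip_def by (simp add: right_diff_distrib infsum_diff ip_summable)

lemma ip_Dop: "ip (Dop j u) v = ip u (%k. - Dop j v k)"
 unfolding ip_def by (intro infsum_cong) (simp add: Dop_def)

lemma ip_Lop: "ip (Lop w u) v = ip u (Lop w v)"
 unfolding ip_def by (intro infsum_cong) (simp add: Lop_def)

text \<open>The adjoint of multiplication by a function is multiplication by its conjugate, whose
  coefficients are \<open>star a\<close>. The two sides differ by shears of the summation variables
  and one exchange of sums.\<close>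

lemma ip_Mop:
 assumes "rapid a" "rapid u" "rapid v"
 shows "ip (Mop a u) v = ip u (Mop (star a) v)"
proof -
 have "ip (Mop a u) v = (INFSUM k. INFSUM x. a x * u (k - x) * cnj (v k))"
  by (simp add: ip_def Mop_def infsum_cmult_left')
 also have "... = (INFSUM k. INFSUM l. a (k - l) * u l * cnj (v k))"
 proof (rule infsum_cong)
  fix k
  show "(INFSUM x. a x * u (k - x) * cnj (v k)) = (INFSUM l. a (k - l) * u l * cnj (v k))"
   by (rule infsum_reindex_bij_witness[of _ "%l. k - l" "%x. k - x"]) auto
 qed
 also have "... = (INFSUM l. INFSUM k. a (k - l) * u l * cnj (v k))"
 proof (rule infsum_swap_banach)
  obtain C where C: "C >= 0" "!!k. cmod (a k) * jb k ^ 0 <= C"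
   using rapidD[OF assms(1)] by meson
  have "(%z. C * (%(k, l). cmod (v k) * jb k ^ 0 * (cmod (u l) * jb l ^ 0)) z) summable_on UNIV \<times> UNIV"
   by (intro summable_on_cmult_right summable_on_times rapid_summable assms) auto
  hence "(%z. norm ((%(k, l). a (k - l) * u l * cnj (v k)) z)) summable_on UNIV \<times> UNIV"
  proof (rule summable_on_comparison_test)
   fix z :: "(int ^ 'a) \<times> (int ^ 'a)"
   obtain k l where z: "z = (k, l)" by (cases z)
   have "cmod (a (k - l)) * (cmod (u l) * cmod (v k)) <= C * (cmod (u l) * cmod (v k))"
    using C(2)[of "k - l"] by (intro mult_right_mono) auto
   thus "norm ((%(k, l). a (k - l) * u l * cnj (v k)) z)
    <= C * (%(k, l). cmod (v k) * jb k ^ 0 * (cmod (u l) * jb l ^ 0)) z"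
    by (simp add: z norm_mult mult_ac)
  qed auto
  thus "(%(k, l). a (k - l) * u l * cnj (v k)) summable_on UNIV \<times> UNIV"
   by (rule abs_summable_summable)
 qed
 also have "... = (INFSUM l. INFSUM x. a (- x) * u l * cnj (v (l - x)))"
 proof (rule infsum_cong)
  fix l
  show "(INFSUM k. a (k - l) * u l * cnj (v k)) = (INFSUM x. a (- x) * u l * cnj (v (l - x)))"
   by (rule infsum_reindex_bij_witness[of _ "%x. l - x" "%k. l - k"]) auto
 qed
 also have "... = ip u (Mop (star a) v)"
  unfolding ip_def
 proof (rule infsum_cong)
  fix l
  have "(INFSUM x. a (- x) * u l * cnj (v (l - x))) = (INFSUM x. u l * cnj (star a x * v (l - x)))"
   by (intro infsum_cong) (simp add: star_def)
  thus "(INFSUM x. a (- x) * u l * cnj (v (l - x))) = u l * cnj (Mop (star a) v l)"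
   by (simp only: Mop_def infsum_cmult_right' infsum_cnj)
 qed
 finally show ?thesis .
qed

definition Hs :: "(int^'m::finite => real) => 'm seq => bool" where
 "Hs w v \<longleftrightarrow> (%k. (w k * cmod (v k))^2) summable_on UNIV"

text \<open>A divergent \<open>infsum\<close> has the value 0, so a bound on \<open>sq\<close> alone
  says nothing; this is why bounds are always stated together with \<open>Hs\<close>, as in
  \<open>Hle\<close>.\<close>

definition sq :: "(int^'m::finite => real) => 'm seq => real" where
 "sq w v = (INFSUM k. (w k * cmod (v k))^2)"

lemma sq_nonneg [simp]: "0 <= sq w v"
 by (simp add: sq_def infsum_nonneg)

abbreviation Hle ::
 "(int^'m::finite => real) => 'm seq => real => (int^'m => real) => 'm seq => bool" where
 "Hle w h C w0 v \<equiv> Hs w h & sq w h <= C * sq w0 v"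

lemma Hs_mono:
 assumes "Hs w v" "!!k. 0 <= w' k" "!!k. w' k * cmod (v' k) <= C * (w k * cmod (v k))"
 shows "Hle w' v' (C^2) w v"
proof -
 have le: "(w' k * cmod (v' k))^2 <= C^2 * (w k * cmod (v k))^2" for k
 proof -
  have "(w' k * cmod (v' k))^2 <= (C * (w k * cmod (v k)))^2"
   using assms by (intro power_mono) auto
  thus ?thesis by (simp add: power_mult_distrib)
 qed
 have s: "(%k. C^2 * (w k * cmod (v k))^2) summable_on UNIV"
  using assms(1) unfolding Hs_def by (intro summable_on_cmult_right)
 have h: "Hs w' v'"
  unfolding Hs_def using s by (rule summable_on_comparison_test) (use le in auto)
 have "sq w' v' <= (INFSUM k. C^2 * (w k * cmod (v k))^2)"
  unfolding sq_def by (intro infsum_mono s h[unfolded Hs_def] le)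
 also have "... = C^2 * sq w v" unfolding sq_def by (rule infsum_cmult_right')
 finally show ?thesis using h by blast
qed

lemma Hs_add:
 assumes "Hs w u" "Hs w v"
 shows "Hs w (%k. u k + v k) & sq w (%k. u k + v k) <= 2 * sq w u + 2 * sq w v"
proof -
 have le: "(w k * cmod (u k + v k))^2 <= 2 * (w k * cmod (u k))^2 + 2 * (w k * cmod (v k))^2" for k
 proof -
  have "(cmod (u k + v k))^2 <= (cmod (u k) + cmod (v k))^2"
   by (intro power_mono norm_triangle_ineq) auto
  also have "... <= 2 * (cmod (u k))^2 + 2 * (cmod (v k))^2"
   using sum_squares_bound[of "cmod (u k)" "cmod (v k)"] by (simp add: power2_sum)
  finally have "(w k)^2 * (cmod (u k + v k))^2 <= (w k)^2 * (2 * (cmod (u k))^2 + 2 * (cmod (v k))^2)"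
   by (intro mult_left_mono) auto
  thus ?thesis by (simp add: power_mult_distrib algebra_simps)
 qed
 have s: "(%k. 2 * (w k * cmod (u k))^2 + 2 * (w k * cmod (v k))^2) summable_on UNIV"
  using assms unfolding Hs_def by (intro summable_on_add summable_on_cmult_right)
 have h: "Hs w (%k. u k + v k)"
  unfolding Hs_def using s by (rule summable_on_comparison_test) (use le in auto)
 have "sq w (%k. u k + v k) <= (INFSUM k. 2 * (w k * cmod (u k))^2 + 2 * (w k * cmod (v k))^2)"
  unfolding sq_def by (intro infsum_mono s h[unfolded Hs_def] le)
 also have "... = 2 * sq w u + 2 * sq w v" unfolding sq_def
  using assms unfolding Hs_def by (simp add: infsum_add summable_on_cmult_right infsum_cmult_right')
 finally show ?thesis using h by blast
qed

lemma Hs_minus [simp]: "Hs w (%k. - v k) = Hs w v" "sq w (%k. - v k) = sq w v"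
 by (simp_all add: Hs_def sq_def)

lemma Hs_diff:
 assumes "Hs w u" "Hs w v"
 shows "Hs w (%k. u k - v k) & sq w (%k. u k - v k) <= 2 * sq w u + 2 * sq w v"
 using Hs_add[of w u "%k. - v k"] assms by simp

lemma sq_Lop: "sq w (Lop tau v) = sq (%k. w k * tau k) v"
 unfolding sq_def Lop_def
 by (intro infsum_cong) (simp add: norm_mult power_mult_distrib mult_ac)

lemma ip_self:
 assumes "Hs (%k. 1) v"
 shows "ip v v = of_real (sq (%k. 1) v)"
proof -
 have "((%k. of_real ((1 * cmod (v k))^2) :: complex) has_sum of_real (sq (%k. 1) v)) UNIV"
  using assms unfolding Hs_def sq_def by (intro has_sum_of_real has_sum_infsum)
 moreover have "ip v v = (INFSUM k. of_real ((1 * cmod (v k))^2))"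
  unfolding ip_def by (intro infsum_cong) (simp add: complex_norm_square del: of_real_power)
 ultimately show ?thesis using infsumI by metis
qed

text \<open>Cauchy-Schwarz between a weight and its inverse. The parameter \<open>eta\<close> is
  left free so that one of the two terms can be absorbed into the left side, as
  \<open>estimate_drift\<close> does.\<close>

lemma norm_ip_le:
 assumes "rapid u" "rapid v" "Hs w u" "Hs (%k. 1 / w k) v" "!!k. 0 < w k" "0 < eta"
 shows "cmod (ip u v) <= eta * sq w u + (1 / eta) * sq (%k. 1 / w k) v"
proof -
 have s: "(%k. cmod (u k) * cmod (v k)) summable_on UNIV"
  using rapid_mult_summable[OF assms(1) rapid_imp_temp[OF assms(2)]] .
 have "cmod (ip u v) <= (INFSUM k. cmod (u k) * cmod (v k))"
  unfolding ip_def using norm_infsum_bound[of "%k. u k * cnj (v k)" UNIV] s by (simp add: norm_mult)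
 also have "... <= (INFSUM k. eta * (w k * cmod (u k))^2 + (1 / eta) * (1 / w k * cmod (v k))^2)"
 proof (rule infsum_mono[OF s])
  show "(%k. eta * (w k * cmod (u k))^2 + (1 / eta) * (1 / w k * cmod (v k))^2) summable_on UNIV"
   using assms unfolding Hs_def by (intro summable_on_add summable_on_cmult_right)
  fix k
  define a b where "a = w k * cmod (u k)" and "b = 1 / w k * cmod (v k)"
  have ab: "a * b = cmod (u k) * cmod (v k)" "0 <= a" "0 <= b"
   using assms(5)[of k] by (auto simp: a_def b_def)
  have "0 <= (eta * a - b)^2" by simp
  hence "2 * eta * (a * b) <= eta^2 * a^2 + b^2" by (simp add: power2_diff power_mult_distrib mult_ac)
  moreover have "0 <= eta * (a * b)" using assms(6) ab by auto
  ultimately have "eta * (a * b) <= eta * (eta * a^2 + (1 / eta) * b^2)"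
   using assms(6) by (simp add: power2_eq_square algebra_simps)
  hence "a * b <= eta * a^2 + (1 / eta) * b^2"
   using assms(6) by (rule mult_left_le_imp_le)
  thus "cmod (u k) * cmod (v k) <= eta * (w k * cmod (u k))^2 + (1 / eta) * (1 / w k * cmod (v k))^2"
   unfolding ab(1)[symmetric] a_def b_def .
 qed
 also have "... = eta * sq w u + (1 / eta) * sq (%k. 1 / w k) v"
  unfolding sq_def using assms unfolding Hs_def
  by (subst infsum_add) (auto simp: infsum_cmult_right' simp del: times_divide_eq_left intro!: summable_on_cmult_right)
 finally show ?thesis .
qed

text \<open>The sum of \<open>b x * (y x - l)^2\<close> is a nonnegative quadratic polynomial in
  \<open>l\<close>; evaluating it at a suitable \<open>l\<close> gives the Cauchy-Schwarz
  inequality.\<close>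

lemma infsum_CS:
 fixes b y :: "'a => real"
 assumes b: "b summable_on UNIV" "!!x. 0 <= b x" and y: "(%x. b x * (y x)^2) summable_on UNIV"
 shows "(%x. b x * y x) summable_on UNIV &
  (INFSUM x. b x * y x)^2 <= (INFSUM x. b x) * (INFSUM x. b x * (y x)^2)"
proof -
 have s: "(%x. b x * y x) summable_on UNIV"
 proof (rule abs_summable_summable, rule summable_on_comparison_test)
  show "(%x. b x + b x * (y x)^2) summable_on UNIV" using assms by (intro summable_on_add)
  fix x
  have "abs (y x) <= 1 + (y x)^2"
   using sum_squares_bound[of 1 "abs (y x)"] by (simp add: power2_eq_square)
  hence "b x * abs (y x) <= b x * (1 + (y x)^2)" by (intro mult_left_mono b)
  thus "norm (b x * y x) <= b x + b x * (y x)^2"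
   using b(2)[of x] by (simp add: abs_mult algebra_simps)
 qed auto
 define P Q B where "P = (INFSUM x. b x * (y x)^2)" and "Q = (INFSUM x. b x * y x)" and "B = (INFSUM x. b x)"
 have quad: "0 <= P - 2 * l * Q + l^2 * B" for l
 proof -
  have "0 <= (INFSUM x. b x * (y x - l)^2)" by (intro infsum_nonneg mult_nonneg_nonneg b) auto
  also have "... = (INFSUM x. (b x * (y x)^2 - 2 * l * (b x * y x)) + l^2 * b x)"
   by (intro infsum_cong) (simp add: power2_diff algebra_simps)
  also have "... = (INFSUM x. b x * (y x)^2 - 2 * l * (b x * y x)) + (INFSUM x. l^2 * b x)"
   using s y b by (intro infsum_add summable_on_diff summable_on_cmult_right)
  also have "(INFSUM x. b x * (y x)^2 - 2 * l * (b x * y x)) = P - (INFSUM x. 2 * l * (b x * y x))"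
   unfolding P_def using s y b by (intro infsum_diff summable_on_cmult_right)
  finally show ?thesis unfolding Q_def B_def by (simp add: infsum_cmult_right')
 qed
 have B0: "0 <= B" unfolding B_def by (intro infsum_nonneg b)
 have "Q^2 <= B * P"
 proof (cases "B = 0")
  case True
  show ?thesis
  proof (cases "Q = 0")
   case False
   \<comment> \<open>For \<open>B = 0\<close> the polynomial is affine in \<open>l\<close>; at this
     \<open>l\<close> its value would be \<open>-1\<close>.\<close>
   have "2 * ((P + 1) / (2 * Q)) * Q = P + 1" using False by simp
   thus ?thesis using quad[of "(P + 1) / (2 * Q)"] True by simp
  qed (use True in simp)
 next
  case False
  hence "B > 0" using B0 by simp
  have "0 <= B * (P - 2 * (Q / B) * Q + (Q / B)^2 * B)"
   using B0 quad[of "Q / B"] by (intro mult_nonneg_nonneg)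
  also have "... = B * P - Q^2" using False by (simp add: power2_eq_square field_simps)
  finally show ?thesis by simp
 qed
 thus ?thesis using s by (simp add: P_def Q_def B_def)
qed

text \<open>Young's inequality for a summable \<open>b\<close> and a square-summable sequence:
  Cauchy-Schwarz with respect to \<open>b\<close> at each \<open>k\<close>, then translation
  invariance of the sum over \<open>k\<close>. Only domination of \<open>h\<close> is assumed, so
  that operators which are not convolutions are covered too.\<close>

lemma conv_bound:
 fixes b :: "int^'m::finite => real"
 assumes b: "b summable_on UNIV" "!!x. 0 <= b x"
  and w: "!!k. 0 <= w k"
  and v: "Hs w0 v"
  and h: "!!k. w k * cmod (h k) <= (INFSUM x. b x * (w0 (k - x) * cmod (v (k - x))))"
 shows "Hle w h ((INFSUM x. b x)^2) w0 v"
proof -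
 define B where "B = (INFSUM x. b x)"
 have B0: "0 <= B" unfolding B_def by (intro infsum_nonneg b)
 define y where "y = (%k. (w0 k * cmod (v k))^2)"
 have ys: "y summable_on UNIV" using v by (simp add: Hs_def y_def)
 have y0: "0 <= y k" for k by (simp add: y_def)
 have Y: "sum y F <= sq w0 v" if "finite F" for F
  unfolding sq_def y_def[symmetric] using that ys y0 by (intro finite_sum_le_infsum) auto
 have y_le: "y k <= sq w0 v" for k using Y[of "{k}"] by simp
 have bys: "(%x. b x * y (k - x)) summable_on UNIV" for k
 proof (rule summable_on_comparison_test)
  show "(%x. b x * sq w0 v) summable_on UNIV" by (intro summable_on_cmult_left b)
  show "b x * y (k - x) <= b x * sq w0 v" for x by (intro mult_left_mono y_le b)
 qed (use b y0 in auto)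
 have pt: "(w k * cmod (h k))^2 <= B * (INFSUM x. b x * y (k - x))" for k
 proof -
  have "(w k * cmod (h k))^2 <= (INFSUM x. b x * (w0 (k - x) * cmod (v (k - x))))^2"
   using h[of k] w[of k] by (intro power_mono) auto
  also have "... <= B * (INFSUM x. b x * (w0 (k - x) * cmod (v (k - x)))^2)"
   unfolding B_def using infsum_CS[of b "%x. w0 (k - x) * cmod (v (k - x))"] b bys[of k]
   by (simp add: y_def)
  finally show ?thesis by (simp add: y_def)
 qed
 have fin: "(SUM k:F. (w k * cmod (h k))^2) <= B^2 * sq w0 v" if F: "finite F" for F
 proof -
  have "(SUM k:F. (w k * cmod (h k))^2) <= (SUM k:F. B * (INFSUM x. b x * y (k - x)))"
   by (intro sum_mono pt)
  also have "... = B * (INFSUM x. SUM k:F. b x * y (k - x))"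
   using bys F by (simp add: infsum_sum' sum_distrib_left)
  also have "... <= B * (INFSUM x. b x * sq w0 v)"
  proof (intro mult_left_mono infsum_mono B0)
   show "(%x. SUM k:F. b x * y (k - x)) summable_on UNIV" using bys F by (simp add: infsum_sum')
   show "(%x. b x * sq w0 v) summable_on UNIV" by (intro summable_on_cmult_left b)
   fix x
   have "(SUM k:F. y (k - x)) = sum y ((%k. k - x) ` F)"
    by (subst sum.reindex) (auto simp: inj_on_def)
   also have "... <= sq w0 v" using F by (intro Y) auto
   finally show "(SUM k:F. b x * y (k - x)) <= b x * sq w0 v"
    unfolding sum_distrib_left[symmetric] by (intro mult_left_mono b)
  qed
  also have "... = B^2 * sq w0 v" by (simp add: infsum_cmult_left' B_def power2_eq_square)
  finally show ?thesis .
 qed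
 have hs: "Hs w h"
  unfolding Hs_def by (rule nonneg_bdd_above_summable_on) (auto intro!: bdd_aboveI2 fin)
 moreover have "sq w h <= B^2 * sq w0 v"
  unfolding sq_def by (rule infsum_le_finite_sums) (use hs fin in "auto simp: Hs_def sq_def")
 ultimately show ?thesis by (simp add: B_def)
qed

lemma le_mult_right: "0 <= x ==> 1 <= y ==> x <= x * (y::real)"
 using mult_left_mono[of 1 y x] by simp

lemma le_mult_left: "0 <= x ==> 1 <= y ==> x <= y * (x::real)"
 using mult_right_mono[of 1 y x] by simp

lemma ge1_mult: "1 <= x ==> 1 <= y ==> 1 <= x * (y::real)"
 using mult_mono[of 1 x 1 y] by simp

section \<open>Weights and bounded families of operators\<close>

text \<open>Weights depend on a regularisation parameter \<open>t\<close>, and all estimates are uniform in \<open>t\<close>.\<close>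

definition tempered :: "(real => int^'m::finite => real) => bool" where
 "tempered w \<longleftrightarrow> (EX C N. ALL t:UI. ALL k l. 0 < w t k & w t (k + l) <= C * jb l ^ N * w t k)"

lemma temperedE:
 assumes "tempered w"
 obtains C N where "C >= 1" "!!t k. t : UI ==> 0 < w t k"
  "!!t k l. t : UI ==> w t (k + l) <= C * jb l ^ N * w t k"
proof -
 obtain C N where C: "!!t k l. t : UI ==> 0 < w t k & w t (k + l) <= C * jb l ^ N * w t k"
  using assms unfolding tempered_def by metis
 have "w t (k + l) <= max C 1 * jb l ^ N * w t k" if "t : UI" for t k l
 proof -
  have "w t (k + l) <= C * jb l ^ N * w t k" using C that by blast
  also have "... <= max C 1 * jb l ^ N * w t k"
   using C[OF that, of k] by (intro mult_right_mono) (auto intro: less_imp_le)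
  finally show ?thesis .
 qed
 thus ?thesis using that[of "max C 1" N] C by auto
qed

lemma tempered_pos: "tempered w ==> t : UI ==> 0 < w t k"
 unfolding tempered_def by blast

lemma tempered_mult:
 assumes "tempered w" "tempered w'"
 shows "tempered (%t k. w t k * w' t k)"
proof -
 obtain C N where C: "C >= 1" "!!t k. t : UI ==> 0 < w t k"
  "!!t k l. t : UI ==> w t (k + l) <= C * jb l ^ N * w t k"
  by (rule temperedE[OF assms(1)]) blast
 obtain C' N' where C': "C' >= 1" "!!t k. t : UI ==> 0 < w' t k"
  "!!t k l. t : UI ==> w' t (k + l) <= C' * jb l ^ N' * w' t k"
  by (rule temperedE[OF assms(2)]) blast
 show ?thesis unfolding tempered_def
 proof (rule exI[of _ "C * C'"], rule exI[of _ "N + N'"], intro ballI allI conjI)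
  fix t :: real and k l :: "int^'a" assume t: "t : UI"
  show "0 < w t k * w' t k" using C(2)[OF t] C'(2)[OF t] by simp
  have "w t (k + l) * w' t (k + l) <= (C * jb l ^ N * w t k) * (C' * jb l ^ N' * w' t k)"
   using C C' t by (intro mult_mono) (auto intro: less_imp_le)
  thus "w t (k + l) * w' t (k + l) <= C * C' * jb l ^ (N + N') * (w t k * w' t k)"
   by (simp add: power_add mult_ac)
 qed
qed

lemma tempered_inverse:
 assumes "tempered w"
 shows "tempered (%t k. 1 / w t k)"
proof -
 obtain C N where C: "C >= 1" "!!t k. t : UI ==> 0 < w t k"
  "!!t k l. t : UI ==> w t (k + l) <= C * jb l ^ N * w t k"
  by (rule temperedE[OF assms(1)]) blast
 show ?thesis unfolding tempered_def
 proof (rule exI[of _ C], rule exI[of _ N], intro ballI allI conjI)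
  fix t :: real and k l :: "int^'a" assume t: "t : UI"
  show "0 < 1 / w t k" using C(2)[OF t] by simp
  have "w t k <= C * jb l ^ N * w t (k + l)" using C(3)[OF t, of "k + l" "- l"] by simp
  thus "1 / w t (k + l) <= C * jb l ^ N * (1 / w t k)"
   using C(2)[OF t, of k] C(2)[OF t, of "k + l"] by (simp add: field_simps)
 qed
qed

text \<open>A discrete form of symbol estimates: each difference of the weight gains a factor
  \<open>1 / jb k\<close>, at the cost of powers of the shifts. Second differences are recorded
  because \<open>estimate_drift\<close> meets double commutators.\<close>

definition symbol :: "(real => int^'m::finite => real) => bool" where
 "symbol w \<longleftrightarrow> tempered w &
  (EX C>=0. EX N. ALL t:UI. ALL k a. abs (w t (k + a) - w t k) <= C * jb a ^ N * (w t k / jb k)) &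
  (EX C>=0. EX N. ALL t:UI. ALL k a b. abs (w t (k + a + b) - w t (k + a) - w t (k + b) + w t k)
   <= C * (jb a ^ N * jb b ^ N) * (w t k / (jb k)^2))"

lemma abs_ln_diff_le:
 assumes "0 < m" "m <= x" "m <= (y::real)"
 shows "abs (ln x - ln y) <= abs (x - y) / m"
proof -
 have "ln x - ln y <= abs (x - y) / m" if "m <= x" "m <= y" for x y
 proof -
  have "ln x - ln y = ln (x / y)" using that assms(1) by (simp add: ln_div)
  also have "... <= x / y - 1" using that assms(1) by (intro ln_le_minus_one) auto
  also have "... = (x - y) / y" using that assms(1) by (simp add: diff_divide_distrib)
  also have "... <= abs (x - y) / m" using that assms(1) by (intro frac_le) auto
  finally show ?thesis .
 qed
 from this[of x y] this[of y x] show ?thesis using assms by (simp add: abs_minus_commute)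
qed

lemma abs_exp_diff_le:
 assumes "x <= m" "y <= (m::real)"
 shows "abs (exp x - exp y) <= abs (x - y) * exp m"
proof -
 have "exp x - exp y <= abs (x - y) * exp m" if "x <= m" for x y
 proof -
  have "exp x * (1 + (y - x)) <= exp x * exp (y - x)" by (intro mult_left_mono exp_ge_add_one_self) auto
  hence "exp x - exp y <= (x - y) * exp x" by (simp add: algebra_simps flip: exp_add)
  also have "... <= abs (x - y) * exp m" using that by (intro mult_mono) auto
  finally show ?thesis .
 qed
 from this[of x y] this[of y x] show ?thesis using assms by (simp add: abs_minus_commute abs_le_iff)
qed

text \<open>Compare \<open>z\<close> with \<open>x + y\<close>: the error is governed by the second
  difference \<open>z - x - y\<close>, and what remains factors as
  \<open>(exp x - 1) * (exp y - 1)\<close>, a product of first differences.\<close>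

lemma exp_second_difference_le:
 assumes "abs x <= u" "abs y <= v" "abs z <= u + (v::real)"
 shows "abs (exp z - exp x - exp y + 1) <= exp (u + v) * (abs (z - x - y) + abs x * abs y)"
proof -
 have 1: "abs (exp z - exp (x + y)) <= abs (z - (x + y)) * exp (u + v)"
  using assms by (intro abs_exp_diff_le) auto
 have "abs ((exp x - 1) * (exp y - 1)) <= (abs x * exp u) * (abs y * exp v)"
  unfolding abs_mult using assms abs_exp_diff_le[of x u 0] abs_exp_diff_le[of y v 0] by (intro mult_mono) auto
 also have "... = abs x * abs y * exp (u + v)" by (simp add: exp_add)
 finally have "abs (exp z - exp (x + y)) + abs ((exp x - 1) * (exp y - 1)) <= exp (u + v) * (abs (z - x - y) + abs x * abs y)"
  using 1 by (simp add: algebra_simps)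
 moreover have "exp z - exp x - exp y + 1 = (exp z - exp (x + y)) + (exp x - 1) * (exp y - 1)"
  by (simp add: algebra_simps exp_add)
 ultimately show ?thesis by linarith
qed

lemma jb_square_diff: "abs ((jb (k + a))^2 - (jb k)\<^sup>2) <= 3 * jb k * (jb a)^2"
proof -
 have eq: "(jb (k + a))^2 - (jb k)^2 = 2 * (lvec k \<bullet> lvec a) + (norm (lvec a))^2"
  by (simp add: jb_square lvec_add power2_norm_eq_inner inner_add_left inner_add_right inner_commute)
 have "abs (lvec k \<bullet> lvec a) <= jb k * jb a"
  using Cauchy_Schwarz_ineq2[of "lvec k" "lvec a"] mult_mono[OF norm_le_jb norm_le_jb, of k a]
  by (simp add: order_trans)
 also have "... <= jb k * (jb a)^2"
  by (intro mult_left_mono) (auto simp: power2_eq_square intro: le_mult_right jb_ge_1)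
 finally have 1: "abs (lvec k \<bullet> lvec a) <= jb k * (jb a)^2" .
 have "(norm (lvec a))^2 <= (jb a)^2" by (simp add: jb_square)
 also have "... <= jb k * (jb a)^2" by (intro le_mult_left) (auto simp: jb_ge_1)
 finally show ?thesis unfolding eq using 1 zero_le_power2[of "norm (lvec a)"] by linarith
qed

text \<open>Serves both bases \<open>(jb k)^2\<close> and \<open>1 + t * (jb k)^2\<close>. Since
  \<open>c\<close> and \<open>d\<close> do not enter the bounds, these are uniform in
  \<open>t\<close>. Dividing by \<open>f k\<close> gives quotients \<open>q\<close> with explicit
  lower bounds, on which the logarithm is Lipschitz.\<close>

lemma ln_jb_differences:
 fixes k a b :: "int^'m::finite"
 assumes c: "0 <= c" and d: "0 < d"
 defines "f \<equiv> %k::int^'m. c + d * (jb k)^2"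
 shows "abs (ln (f (k + a)) - ln (f k)) <= 2 * ln (2 * jb a)"
  "abs (ln (f (k + a)) - ln (f k)) <= 12 * jb a ^ 4 / jb k"
  "abs (ln (f (k + a + b)) - ln (f (k + a)) - ln (f (k + b)) + ln (f k)) <= 176 * (jb a ^ 4 * jb b ^ 4) / (jb k)^2"
proof -
 have pos: "0 < f l" for l using c d by (simp add: f_def add_nonneg_pos)
 have up: "f (l + x) <= 4 * (jb x)^2 * f l" for l x
 proof -
  have "(jb (l + x))^2 <= (2 * jb l * jb x)^2" by (intro power_mono jb_add_le) auto
  hence "d * (jb (l + x))^2 <= d * (4 * (jb x)^2 * (jb l)^2)"
   using d by (intro mult_left_mono) (auto simp: power_mult_distrib mult_ac)
  moreover have "1 * c <= (4 * (jb x)^2) * c"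
   using c jb_power_ge_1[of x 2] by (intro mult_right_mono) linarith+
  ultimately show ?thesis by (simp add: f_def algebra_simps)
 qed
 define q where "q l = f l / f k" for l
 have lnq: "ln (q l) = ln (f l) - ln (f k)" for l using pos[of l] pos[of k] by (simp add: q_def ln_div)
 have qpos: "0 < q l" for l using pos by (simp add: q_def)
 have lo: "1 / (4 * (jb x)^2) <= q (k + x)" for x
  using up[of "k + x" "- x"] pos by (simp add: q_def field_simps)
 have hi: "q (k + x) <= 4 * (jb x)^2" for x using up[of k x] pos by (simp add: q_def field_simps)
 have sq: "2 * ln (2 * jb a) = ln (4 * (jb a)^2)" for a :: "int^'m"
  using ln_realpow[of "2 * jb a" 2] by (simp add: power_mult_distrib)
 have "ln (1 / (4 * (jb a)^2)) <= ln (q (k + a))" using lo qpos by (subst ln_le_cancel_iff) auto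
 moreover have "ln (q (k + a)) <= ln (4 * (jb a)^2)" using hi qpos by (subst ln_le_cancel_iff) auto
 ultimately show "abs (ln (f (k + a)) - ln (f k)) <= 2 * ln (2 * jb a)"
  unfolding sq lnq[symmetric] by (simp add: ln_div)
 have est: "abs (d * e / f k) <= E / (jb k)^2" if "abs e <= E" for e E
 proof -
  have "abs (d * e / f k) = d * abs e / f k" using d pos[of k] by (simp add: abs_mult)
  also have "... <= d * abs e / (d * (jb k)^2)" using c d pos[of k] by (intro divide_left_mono) (auto simp: f_def)
  also have "... <= E / (jb k)^2" using d that by (simp add: divide_right_mono)
  finally show ?thesis .
 qed
 have q1: "abs (q (k + x) - 1) <= 3 * (jb x)^2 / jb k" for x
 proof -
  have "q (k + x) - 1 = d * ((jb (k + x))^2 - (jb k)^2) / f k"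
   using pos[of k] by (simp add: field_simps q_def) (simp add: f_def algebra_simps)
  thus ?thesis using est[OF jb_square_diff[of k x]] by (simp add: power2_eq_square)
 qed
 have "abs (ln (q (k + a)) - ln 1) <= abs (q (k + a) - 1) / (1 / (4 * (jb a)^2))"
  by (intro abs_ln_diff_le lo) (auto simp: divide_simps intro!: order_trans[OF jb_power_ge_1[of a 2]])
 also have "... <= (3 * (jb a)^2 / jb k) / (1 / (4 * (jb a)^2))" by (intro divide_right_mono q1) auto
 finally show "abs (ln (f (k + a)) - ln (f k)) <= 12 * jb a ^ 4 / jb k"
  unfolding lnq by (simp add: power2_eq_square power4_eq_xxxx mult_ac)
 define x y z where "x = q (k + a)" "y = q (k + b)" "z = q (k + a + b)"
 note defs = this
 have "z - x - y + 1 = (f (k + a + b) - f (k + a) - f (k + b) + f k) / f k"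
  using pos[of k] by (simp add: defs q_def field_simps)
 also have "f (k + a + b) - f (k + a) - f (k + b) + f k = d * (2 * (lvec a \<bullet> lvec b))"
  by (simp add: f_def jb_square lvec_add power2_norm_eq_inner inner_add_left inner_add_right inner_commute algebra_simps)
 also have "abs (d * (2 * (lvec a \<bullet> lvec b)) / f k) <= (2 * ((jb a)^2 * (jb b)^2)) / (jb k)^2"
 proof (rule est)
  have "abs (lvec a \<bullet> lvec b) <= jb a * jb b"
   using Cauchy_Schwarz_ineq2[of "lvec a" "lvec b"] mult_mono[OF norm_le_jb norm_le_jb, of a b]
   by (simp add: order_trans)
  also have "... <= (jb a)^2 * (jb b)^2" by (intro mult_mono) (auto simp: power2_eq_square intro: le_mult_right jb_ge_1)
  finally show "abs (2 * (lvec a \<bullet> lvec b)) <= 2 * ((jb a)^2 * (jb b)^2)" by simp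
 qed
 finally have z1: "abs (z - x - y + 1) <= (2 * ((jb a)^2 * (jb b)^2)) / (jb k)^2" .
 have "abs ((x - 1) * (y - 1)) <= (3 * (jb a)^2 / jb k) * (3 * (jb b)^2 / jb k)"
  unfolding abs_mult using q1[of a] q1[of b] by (intro mult_mono) (auto simp: defs)
 hence "abs (z - x - y + 1) + abs ((x - 1) * (y - 1)) <= 11 * ((jb a)^2 * (jb b)^2) / (jb k)^2"
  using z1 by (simp add: add_divide_distrib[symmetric] power2_eq_square)
 moreover have "z - x * y = (z - x - y + 1) - (x - 1) * (y - 1)" by (simp add: algebra_simps)
 ultimately have zxy: "abs (z - x * y) <= 11 * ((jb a)^2 * (jb b)^2) / (jb k)^2" by linarith
 \<comment> \<open>\<open>m\<close> bounds both \<open>z\<close> and \<open>x * y\<close> from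
   below, so the logarithm has Lipschitz constant \<open>1 / m\<close> there; \<open>16 * 11\<close>
   is the 176 of the claim.\<close>
 define m where "m = 1 / (16 * ((jb a)^2 * (jb b)^2))"
 have "(jb (a + b))^2 <= (2 * jb a * jb b)^2" by (intro power_mono jb_add_le) auto
 hence "m <= 1 / (4 * (jb (a + b))^2)"
  unfolding m_def by (intro divide_left_mono) (auto simp: power_mult_distrib)
 hence "m <= z" using lo[of "a + b"] by (simp add: defs add.assoc)
 moreover have "1 / (4 * (jb a)^2) * (1 / (4 * (jb b)^2)) <= x * y"
  unfolding defs by (intro mult_mono lo) (auto simp: less_imp_le[OF qpos])
 hence "m <= x * y" by (simp add: m_def)
 ultimately have "abs (ln z - ln (x * y)) <= abs (z - x * y) / m" by (intro abs_ln_diff_le) (auto simp: m_def)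
 also have "... <= (11 * ((jb a)^2 * (jb b)^2) / (jb k)^2) / m" by (intro divide_right_mono zxy) (simp add: m_def)
 also have "... = 176 * (jb a ^ 4 * jb b ^ 4) / (jb k)^2" by (simp add: m_def power2_eq_square power4_eq_xxxx mult_ac)
 also have "ln z - ln (x * y) = ln (f (k + a + b)) - ln (f (k + a)) - ln (f (k + b)) + ln (f k)"
  using less_imp_neq[OF qpos] by (simp add: defs ln_mult lnq less_imp_neq[OF qpos, symmetric])
 finally show "abs (ln (f (k + a + b)) - ln (f (k + a)) - ln (f (k + b)) + ln (f k)) <= 176 * (jb a ^ 4 * jb b ^ 4) / (jb k)^2" .
qed

lemma symbol_cong:
 "symbol w ==> (!!t k. t : UI ==> w' t k = w t k) ==> symbol w'"
 unfolding symbol_def tempered_def by (simp del: greaterThanAtMost_iff cong: ball_cong)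

text \<open>Differences are estimated for the logarithm \<open>psi\<close>, where they depend
  linearly on the exponents \<open>al\<close> and \<open>beta\<close>, and are then exponentiated.
  \<open>D1\<close> keeps the exponential below a power of the shift; \<open>P\<close> is rounded up
  to make this a natural power.\<close>

lemma symbol_powr_mult:
 "symbol (%t (k::int^'m::finite). (jb k)\<^sup>2 powr al * (1 + t * (jb k)^2) powr beta)"
proof -
 define psi where "psi t k = al * ln (0 + 1 * (jb k)^2) + beta * ln (1 + t * (jb k)^2)" for t and k :: "int^'m"
 define w where "w t k = exp (psi t k)" for t k
 have weq: "(jb k)\<^sup>2 powr al * (1 + t * (jb k)^2) powr beta = w t k" if "t : UI" for t k
 proof -
  have "0 < 1 + t * (jb k)^2" using that by (simp add: add_pos_nonneg)
  thus ?thesis by (simp add: w_def psi_def powr_def exp_add)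
 qed
 define n P where "n = abs al + abs beta" and "P = nat \<lceil>2 * n\<rceil>"
 have n0: "0 <= n" by (simp add: n_def)
 have comb: "abs (al * x + beta * y) <= n * B" if "abs x <= B" "abs y <= B" for x y B
  using that mult_left_mono[of "abs x" B "abs al"] mult_left_mono[of "abs y" B "abs beta"]
   abs_triangle_ineq[of "al * x" "beta * y"] by (simp add: n_def abs_mult algebra_simps)
 have ln0: "0 <= ln (2 * jb a)" for a :: "int^'m" using jb_ge_1[of a] by (intro ln_ge_zero) simp
 have D1: "abs (psi t (k + a) - psi t k) <= P * ln (2 * jb a)" and D2: "abs (psi t (k + a) - psi t k) <= n * (12 * jb a ^ 4 / jb k)"
  and D3: "abs (psi t (k + a + b) - psi t (k + a) - psi t (k + b) + psi t k) <= n * (176 * (jb a ^ 4 * jb b ^ 4) / (jb k)^2)"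
  if t: "t : UI" for t k a b
 proof -
  have t': "0 < t" using t by simp
  note L = ln_jb_differences[of 0 1 k a] and M = ln_jb_differences[OF zero_le_one t', of k a]
  have eq: "psi t (k + a) - psi t k = al * (ln (0 + 1 * (jb (k + a))^2) - ln (0 + 1 * (jb k)^2))
    + beta * (ln (1 + t * (jb (k + a))^2) - ln (1 + t * (jb k)^2))"
   by (simp add: psi_def algebra_simps)
  have "abs (psi t (k + a) - psi t k) <= n * (2 * ln (2 * jb a))" unfolding eq by (intro comb L M) auto
  also have "... = 2 * n * ln (2 * jb a)" by simp
  also have "... <= P * ln (2 * jb a)" by (intro mult_right_mono ln0) (simp add: P_def of_nat_ceiling)
  finally show "abs (psi t (k + a) - psi t k) <= P * ln (2 * jb a)" .
  show "abs (psi t (k + a) - psi t k) <= n * (12 * jb a ^ 4 / jb k)" unfolding eq by (intro comb L M) auto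
  have "psi t (k + a + b) - psi t (k + a) - psi t (k + b) + psi t k =
    al * (ln (0 + 1 * (jb (k + a + b))^2) - ln (0 + 1 * (jb (k + a))^2) - ln (0 + 1 * (jb (k + b))^2) + ln (0 + 1 * (jb k)^2))
    + beta * (ln (1 + t * (jb (k + a + b))^2) - ln (1 + t * (jb (k + a))^2) - ln (1 + t * (jb (k + b))^2) + ln (1 + t * (jb k)^2))"
   by (simp add: psi_def algebra_simps)
  thus "abs (psi t (k + a + b) - psi t (k + a) - psi t (k + b) + psi t k) <= n * (176 * (jb a ^ 4 * jb b ^ 4) / (jb k)^2)"
   by (simp only:) (intro comb L M; simp)
 qed
 have expu: "exp (P * ln (2 * jb a)) = 2 ^ P * jb a ^ P" for a :: "int^'m"
  by (simp add: exp_of_nat_mult power_mult_distrib)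
 have wd: "w t (k + a) = w t k * exp (psi t (k + a) - psi t k)" for t k a by (simp add: w_def exp_diff)
 have "symbol w" unfolding symbol_def
 proof (intro conjI)
  show "tempered w" unfolding tempered_def
  proof (rule exI[of _ "2 ^ P"], rule exI[of _ P], intro ballI allI conjI)
   fix t :: real and k l :: "int^'m" assume t: "t : UI"
   have "exp (psi t (k + l) - psi t k) <= 2 ^ P * jb l ^ P"
    unfolding expu[symmetric] using D1[OF t, of k l] by (simp add: abs_le_iff)
   thus "w t (k + l) <= 2 ^ P * jb l ^ P * w t k"
    unfolding wd by (simp add: w_def mult.commute)
  qed (simp add: w_def)
  show "EX C>=0. EX N. ALL t:UI. ALL k a. abs (w t (k + a) - w t k) <= C * jb a ^ N * (w t k / jb k)"
  proof (intro exI[of _ "n * 12 * 2 ^ P"] exI[of _ "4 + P"] conjI ballI allI)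
   fix t :: real and k a :: "int^'m" assume t: "t : UI"
   have "abs (exp (psi t (k + a) - psi t k) - exp 0) <= abs (psi t (k + a) - psi t k - 0) * exp (P * ln (2 * jb a))"
    using D1[OF t, of k a] ln0[of a] by (intro abs_exp_diff_le) auto
   also have "... <= n * (12 * jb a ^ 4 / jb k) * (2 ^ P * jb a ^ P)"
    unfolding expu using D2[OF t, of k a] by (intro mult_right_mono) auto
   finally have "w t k * abs (exp (psi t (k + a) - psi t k) - 1) <= w t k * (n * (12 * jb a ^ 4 / jb k) * (2 ^ P * jb a ^ P))"
    by (intro mult_left_mono) (auto simp: w_def)
   moreover have "abs (w t (k + a) - w t k) = w t k * abs (exp (psi t (k + a) - psi t k) - 1)"
    using abs_mult[of "w t k" "exp (psi t (k + a) - psi t k) - 1"]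
    by (simp add: wd right_diff_distrib) (simp add: w_def)
   ultimately show "abs (w t (k + a) - w t k) <= n * 12 * 2 ^ P * jb a ^ (4 + P) * (w t k / jb k)"
    by (simp add: power_add mult_ac)
  qed (use n0 in simp)
  show "EX C>=0. EX N. ALL t:UI. ALL k a b. abs (w t (k + a + b) - w t (k + a) - w t (k + b) + w t k)
   <= C * (jb a ^ N * jb b ^ N) * (w t k / (jb k)^2)"
  proof (intro exI[of _ "4 ^ P * (n * 176 + (n * 12)^2)"] exI[of _ "4 + P"] conjI ballI allI)
   fix t :: real and k a b :: "int^'m" assume t: "t : UI"
   define x y z where "x = psi t (k + a) - psi t k" "y = psi t (k + b) - psi t k" "z = psi t (k + a + b) - psi t k"
   note defs = this
   let ?u = "%a. P * ln (2 * jb a)"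
   have "?u (a + b) <= P * ln ((2 * jb a) * (2 * jb b))"
    using jb_add_le[of a b] by (intro mult_left_mono) auto
   also have "... = ?u a + ?u b" by (subst ln_mult) (auto simp: distrib_left)
   finally have "abs (exp z - exp x - exp y + 1) <= exp (?u a + ?u b) * (abs (z - x - y) + abs x * abs y)"
    using order_trans[OF D1[OF t, of k "a + b"]] D1[OF t]
    by (intro exp_second_difference_le) (auto simp: defs add.assoc)
   also have "... <= (4 ^ P * (jb a ^ P * jb b ^ P)) * (n * (176 * (jb a ^ 4 * jb b ^ 4) / (jb k)^2)
     + (n * (12 * jb a ^ 4 / jb k)) * (n * (12 * jb b ^ 4 / jb k)))"
   proof (intro mult_mono add_mono)
    show "exp (?u a + ?u b) <= 4 ^ P * (jb a ^ P * jb b ^ P)"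
     unfolding exp_add expu using power_mult_distrib[of "2::real" 2 P] by simp
    show "abs (z - x - y) <= n * (176 * (jb a ^ 4 * jb b ^ 4) / (jb k)^2)"
     using D3[OF t, of k a b] by (simp add: defs algebra_simps)
   qed (use D2[OF t, of k] n0 in "auto simp: defs")
   also have "... = 4 ^ P * (n * 176 + (n * 12)^2) * (jb a ^ (4 + P) * jb b ^ (4 + P)) / (jb k)^2"
    by (simp add: power_add power2_eq_square field_simps)
   finally have "w t k * abs (exp z - exp x - exp y + 1) <= w t k * (4 ^ P * (n * 176 + (n * 12)^2) * (jb a ^ (4 + P) * jb b ^ (4 + P)) / (jb k)^2)"
    by (intro mult_left_mono) (auto simp: w_def)
   moreover have "w t (k + a + b) - w t (k + a) - w t (k + b) + w t k = w t k * (exp z - exp x - exp y + 1)"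
    using wd[of t k "a + b"] wd[of t k a] wd[of t k b] by (simp add: defs algebra_simps)
   ultimately show "abs (w t (k + a + b) - w t (k + a) - w t (k + b) + w t k)
    <= 4 ^ P * (n * 176 + (n * 12)^2) * (jb a ^ (4 + P) * jb b ^ (4 + P)) * (w t k / (jb k)^2)"
    by (simp add: abs_mult w_def mult_ac)
  qed (use n0 in simp)
 qed
 thus ?thesis by (rule symbol_cong) (rule weq)
qed

lemma Hs_temp: "Hs w v ==> temp (Lop w v)"
proof -
 assume h: "Hs w v"
 have "(w k * cmod (v k))^2 <= sq w v" for k
  using finite_sum_le_infsum[of "%k. (w k * cmod (v k))^2" UNIV "{k}"] h
  by (simp add: Hs_def sq_def)
 hence "abs (w k * cmod (v k)) <= sqrt (sq w v)" for k
  by (metis real_sqrt_abs real_sqrt_le_iff)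
 thus "temp (Lop w v)"
  unfolding temp_def by (intro exI[of _ "sqrt (sq w v)"] exI[of _ 0]) (auto simp: Lop_def norm_mult abs_mult)
qed

lemma Hs_rapid:
 assumes "rapid v" "!!k. w k <= C * jb k ^ N" "!!k. 0 <= w k"
 shows "Hs w v"
proof -
 obtain D where D: "D >= 0" "!!k. cmod (v k) * jb k ^ N <= D" using rapidD[OF assms(1)] by meson
 have C: "0 <= C" using assms(2,3)[of 0] by (smt (verit) jb_pos mult_neg_pos zero_less_power)
 show ?thesis unfolding Hs_def
 proof (rule summable_on_comparison_test)
  show "(%k. (C * C * D) * (cmod (v k) * jb k ^ N)) summable_on UNIV"
   by (intro summable_on_cmult_right rapid_summable assms)
  fix k
  have 1: "w k * cmod (v k) <= C * (cmod (v k) * jb k ^ N)"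
   using mult_right_mono[OF assms(2)[of k], of "cmod (v k)"] by (simp add: mult_ac)
  have "(w k * cmod (v k))^2 <= (C * (cmod (v k) * jb k ^ N)) * (C * (cmod (v k) * jb k ^ N))"
   unfolding power2_eq_square using assms(3) C by (intro mult_mono 1) auto
  also have "... <= (C * D) * (C * (cmod (v k) * jb k ^ N))"
   using D C by (intro mult_right_mono mult_left_mono) auto
  finally show "(w k * cmod (v k))^2 <= (C * C * D) * (cmod (v k) * jb k ^ N)" by (simp add: mult_ac)
 qed auto
qed

lemma tempered_growth:
 assumes "tempered w" "t : UI"
 shows "EX C N. ALL k. w t k <= C * jb k ^ N"
proof -
 obtain C N where C: "!!t k l. t : UI ==> w t (k + l) <= C * jb l ^ N * w t k"
  by (rule temperedE[OF assms(1)]) blast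
 have "w t k <= (C * w t 0) * jb k ^ N" for k using C[OF assms(2), of 0 k] by (simp add: mult_ac)
 thus ?thesis by blast
qed

lemma Hs_rapid_weight:
 assumes "rapid v" "tempered w" "t : UI"
 shows "Hs (w t) v"
proof -
 obtain C N where "!!k. w t k <= C * jb k ^ N" using tempered_growth[OF assms(2,3)] by blast
 thus ?thesis using tempered_pos[OF assms(2,3)] assms(1) by (intro Hs_rapid[of v _ C N]) (auto intro: less_imp_le)
qed

lemma temp_Lop_weight:
 assumes "temp v" "!!k. w k <= C * jb k ^ N" "!!k. 0 <= w k"
 shows "temp (Lop w v)"
proof -
 obtain D M where D: "D >= 0" "!!k. cmod (v k) <= D * jb k ^ M" using tempD[OF assms(1)] by meson
 have "cmod (Lop w v k) <= (C * D) * jb k ^ (N + M)" for k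
  using mult_mono[OF assms(2)[of k] D(2)[of k]] assms(3)[of k] order_trans[OF assms(3) assms(2), of k]
  by (simp add: Lop_def norm_mult power_add mult_ac)
 thus ?thesis unfolding temp_def by blast
qed

lemma rapid_Lop_weight:
 assumes "rapid v" "!!k. w k <= C * jb k ^ N" "!!k. 0 <= w k"
 shows "rapid (Lop w v)"
 unfolding rapid_def
proof
 fix M
 obtain D where D: "D >= 0" "!!k. cmod (v k) * jb k ^ (N + M) <= D" using rapidD[OF assms(1)] by meson
 have C: "0 <= C" using assms(2,3)[of 0] by (smt (verit) jb_pos mult_neg_pos zero_less_power)
 have "cmod (Lop w v k) * jb k ^ M <= C * D" for k
 proof -
  have "cmod (Lop w v k) * jb k ^ M = w k * (cmod (v k) * jb k ^ M)"
   using assms(3)[of k] by (simp add: Lop_def norm_mult)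
  also have "... <= (C * jb k ^ N) * (cmod (v k) * jb k ^ M)"
   by (intro mult_right_mono assms) auto
  also have "... = C * (cmod (v k) * jb k ^ (N + M))" by (simp add: power_add mult_ac)
  also have "... <= C * D" by (intro mult_left_mono D C)
  finally show ?thesis .
 qed
 thus "EX C. ALL k. cmod (Lop w v k) * jb k ^ M <= C" by blast
qed

text \<open>The version of \<open>conv_bound\<close> for kernels \<open>K\<close> that depend on
  both variables: their polynomial growth in \<open>x\<close> is absorbed by the decay of
  \<open>a\<close>.\<close>

lemma kernel_bound:
 assumes a: "rapid a" and w: "!!k. 0 < w k" "!!k. 0 <= w0 k" and v: "Hs w0 v"
  and h: "!!k. h k = (INFSUM x. a x * K k x)"
  and K: "!!k x. w k * cmod (K k x) <= B * jb x ^ N * (w0 (k - x) * cmod (v (k - x)))"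
  and B: "0 <= B"
 shows "Hle w h ((B * (INFSUM x. cmod (a x) * jb x ^ N))^2) w0 v"
proof -
 define b where "b = (%x. B * (cmod (a x) * jb x ^ N))"
 have bs: "b summable_on UNIV" unfolding b_def by (intro summable_on_cmult_right rapid_summable a)
 have b0: "0 <= b x" for x using B by (simp add: b_def)
 have "Hle w h ((INFSUM x. b x)^2) w0 v"
 proof (rule conv_bound[OF bs b0 _ v])
  show "0 <= w k" for k using w(1)[of k] by simp
  fix k
  have s: "(%x. b x * (w0 (k - x) * cmod (v (k - x)))) summable_on UNIV"
   using summable_on_cmult_right[OF Mop_summable_gen[OF a Hs_temp[OF v], of N k], of B] w(2)
   by (simp add: b_def Lop_def norm_mult mult_ac)
  have le: "w k * cmod (a x * K k x) <= b x * (w0 (k - x) * cmod (v (k - x)))" for x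
   using mult_left_mono[OF K[of k x], of "cmod (a x)"] by (simp add: b_def norm_mult mult_ac)
  have s2: "(%x. w k * cmod (a x * K k x)) summable_on UNIV"
   by (rule summable_on_comparison_test[OF s]) (use le w(1)[of k] in auto)
  have "(%x. (1 / w k) * (w k * cmod (a x * K k x))) summable_on UNIV"
   by (intro summable_on_cmult_right s2)
  hence s3: "(%x. cmod (a x * K k x)) summable_on UNIV" using w(1)[of k] by simp
  have "w k * cmod (h k) <= w k * (INFSUM x. cmod (a x * K k x))"
   unfolding h using w(1)[of k] by (intro mult_left_mono norm_infsum_bound s3) auto
  also have "... = (INFSUM x. w k * cmod (a x * K k x))" by (simp add: infsum_cmult_right')
  also have "... <= (INFSUM x. b x * (w0 (k - x) * cmod (v (k - x))))"
   by (intro infsum_mono s s2 le)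
  finally show "w k * cmod (h k) <= (INFSUM x. b x * (w0 (k - x) * cmod (v (k - x))))" .
 qed
 thus ?thesis by (simp add: b_def infsum_cmult_right')
qed

text \<open>\<open>A\<close> has order \<open>w0\<close> uniformly in \<open>t\<close>: it maps the
  space with weight \<open>w * w0\<close> into the space with weight \<open>w\<close>. Quantifying
  over all tempered \<open>w\<close>, and not just over powers of \<open>jb\<close>, makes the
  notion stable under composition.\<close>

definition bd :: "(real => int^'m::finite => real) => (real => 'm seq => 'm seq) => bool" where
 "bd w0 A \<longleftrightarrow> (ALL t:UI. ALL v. (rapid v --> rapid (A t v)) & (temp v --> temp (A t v))) &
  (ALL w. tempered w --> (EX C>=0. ALL t:UI. ALL v. temp v --> Hs (%k. w t k * w0 t k) v -->
   Hle (w t) (A t v) C (%k. w t k * w0 t k) v))"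

lemma bdI:
 assumes "!!t v. t : UI ==> rapid v ==> rapid (A t v)" "!!t v. t : UI ==> temp v ==> temp (A t v)"
  "!!w. tempered w ==> EX C>=0. ALL t:UI. ALL v. temp v --> Hs (%k. w t k * w0 t k) v -->
   Hle (w t) (A t v) C (%k. w t k * w0 t k) v"
 shows "bd w0 A"
 unfolding bd_def
proof (intro conjI ballI allI)
 fix t :: real and v :: "'a seq" assume t: "t : UI"
 show "rapid v --> rapid (A t v)" using assms(1)[OF t] by simp
 show "temp v --> temp (A t v)" using assms(2)[OF t] by simp
qed (rule impI, rule assms(3))

lemma bdE:
 assumes "bd w0 A" "tempered w"
 obtains C where "C >= 0" "!!t v. t : UI ==> temp v ==> Hs (%k. w t k * w0 t k) v ==> Hle (w t) (A t v) C (%k. w t k * w0 t k) v"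
proof -
 obtain C where "C >= 0" and C: "ALL t:UI. ALL v. temp v --> Hs (%k. w t k * w0 t k) v -->
   Hle (w t) (A t v) C (%k. w t k * w0 t k) v"
  using conjunct2[OF assms(1)[unfolded bd_def], THEN spec, THEN mp, OF assms(2)] by (elim exE conjE)
 have "Hle (w t) (A t v) C (%k. w t k * w0 t k) v"
  if "t : UI" "temp v" "Hs (%k. w t k * w0 t k) v" for t v
  using bspec[OF C that(1), THEN spec, THEN mp, THEN mp, OF that(2,3)] .
 thus thesis using that[OF `C >= 0`] by simp
qed

lemma bd_rapid: "bd w0 A ==> t : UI ==> rapid v ==> rapid (A t v)"
 unfolding bd_def by blast

lemma bd_temp: "bd w0 A ==> t : UI ==> temp v ==> temp (A t v)"
 unfolding bd_def by blast

lemma bd_cong: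
 assumes "bd w0 A" "!!t v. t : UI ==> temp v ==> B t v = A t v"
 shows "bd w0 B"
 unfolding bd_def
proof (intro conjI ballI allI impI)
 fix t :: real and v :: "'a seq" assume t: "t : UI"
 show "rapid (B t v)" if "rapid v" using assms t that rapid_imp_temp[OF that] by (auto simp: bd_def)
 show "temp (B t v)" if "temp v" using assms t that by (auto simp: bd_def)
next
 fix w :: "real => int^'a => real" assume w: "tempered w"
 obtain C where C: "C >= 0" "!!t v. t : UI ==> temp v ==> Hs (%k. w t k * w0 t k) v ==> Hle (w t) (A t v) C (%k. w t k * w0 t k) v"
  by (rule bdE[OF assms(1) w]) blast
 thus "EX C>=0. ALL t:UI. ALL v. temp v --> Hs (%k. w t k * w0 t k) v -->
   Hle (w t) (B t v) C (%k. w t k * w0 t k) v"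
  using assms(2) by (intro exI[of _ C]) auto
qed

lemma bd_comp:
 assumes "bd w1 A" "bd w2 B" "tempered w1"
 shows "bd (%t k. w1 t k * w2 t k) (%t v. A t (B t v))"
proof (rule bdI)
 fix w :: "real => int^'a => real" assume w: "tempered w"
 obtain C where C: "C >= 0" "!!t v. t : UI ==> temp v ==> Hs (%k. w t k * w1 t k) v ==> Hle (w t) (A t v) C (%k. w t k * w1 t k) v"
  by (rule bdE[OF assms(1) w]) blast
 obtain D where D: "D >= 0" "!!t v. t : UI ==> temp v ==> Hs (%k. w t k * w1 t k * w2 t k) v ==> Hle (%k. w t k * w1 t k) (B t v) D (%k. w t k * w1 t k * w2 t k) v"
  by (rule bdE[OF assms(2) tempered_mult[OF w assms(3)]]) blast
 show "EX C>=0. ALL t:UI. ALL v. temp v --> Hs (%k. w t k * (w1 t k * w2 t k)) v -->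
   Hle (w t) (A t (B t v)) C (%k. w t k * (w1 t k * w2 t k)) v"
 proof (rule exI[of _ "C * D"], intro conjI ballI allI impI)
  fix t :: real and v :: "'a seq" assume t: "t : UI" and v: "temp v" "Hs (%k. w t k * (w1 t k * w2 t k)) v"
  have v': "Hs (%k. w t k * w1 t k * w2 t k) v" using v by (simp add: mult.assoc)
  note DD = D(2)[OF t v(1) v']
  note CC = C(2)[OF t bd_temp[OF assms(2) t v(1)] conjunct1[OF DD]]
  show "Hs (w t) (A t (B t v))" by (rule conjunct1[OF CC])
  have "sq (w t) (A t (B t v)) <= C * sq (%k. w t k * w1 t k) (B t v)" by (rule conjunct2[OF CC])
  also have "... <= C * (D * sq (%k. w t k * w1 t k * w2 t k) v)"
   by (intro mult_left_mono conjunct2[OF DD] C)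
  finally show "sq (w t) (A t (B t v)) <= C * D * sq (%k. w t k * (w1 t k * w2 t k)) v" by (simp add: mult.assoc)
 qed (use C D in auto)
qed (simp_all add: bd_rapid[OF assms(1)] bd_rapid[OF assms(2)] bd_temp[OF assms(1)] bd_temp[OF assms(2)])

lemma bd_add:
 assumes "bd w0 A" "bd w0 B"
 shows "bd w0 (%t v k. A t v k + B t v k)"
proof (rule bdI)
 fix w :: "real => int^'a => real" assume w: "tempered w"
 obtain C where C: "C >= 0" "!!t v. t : UI ==> temp v ==> Hs (%k. w t k * w0 t k) v ==> Hle (w t) (A t v) C (%k. w t k * w0 t k) v"
  by (rule bdE[OF assms(1) w]) blast
 obtain D where D: "D >= 0" "!!t v. t : UI ==> temp v ==> Hs (%k. w t k * w0 t k) v ==> Hle (w t) (B t v) D (%k. w t k * w0 t k) v"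
  by (rule bdE[OF assms(2) w]) blast
 show "EX C>=0. ALL t:UI. ALL v. temp v --> Hs (%k. w t k * w0 t k) v -->
   Hle (w t) (%k. A t v k + B t v k) C (%k. w t k * w0 t k) v"
 proof (rule exI[of _ "2 * C + 2 * D"], intro conjI ballI allI impI)
  fix t :: real and v :: "'a seq" assume t: "t : UI" and v: "temp v" "Hs (%k. w t k * w0 t k) v"
  note CD = C(2)[OF t v] D(2)[OF t v]
  note * = Hs_add[OF conjunct1[OF CD(1)] conjunct1[OF CD(2)]]
  show "Hs (w t) (%k. A t v k + B t v k)" using * by blast
  show "sq (w t) (%k. A t v k + B t v k) <= (2 * C + 2 * D) * sq (%k. w t k * w0 t k) v"
   using * CD by (simp add: algebra_simps)
 qed (use C D in auto)
qed (simp_all add: bd_rapid[OF assms(1)] bd_rapid[OF assms(2)] bd_temp[OF assms(1)] bd_temp[OF assms(2)] rapid_add temp_add)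

lemma bd_mono:
 assumes "bd w1 A" "!!t k. t : UI ==> 0 <= w1 t k & w1 t k <= K * w2 t k"
 shows "bd w2 A"
proof (rule bdI)
 fix w :: "real => int^'a => real" assume w: "tempered w"
 obtain C where C: "C >= 0" "!!t v. t : UI ==> temp v ==> Hs (%k. w t k * w1 t k) v ==> Hle (w t) (A t v) C (%k. w t k * w1 t k) v"
  by (rule bdE[OF assms(1) w]) blast
 show "EX C>=0. ALL t:UI. ALL v. temp v --> Hs (%k. w t k * w2 t k) v -->
   Hle (w t) (A t v) C (%k. w t k * w2 t k) v"
 proof (rule exI[of _ "C * K^2"], intro conjI ballI allI impI)
  fix t :: real and v :: "'a seq" assume t: "t : UI" and v: "temp v" "Hs (%k. w t k * w2 t k) v"
  have *: "Hle (%k. w t k * w1 t k) v (K^2) (%k. w t k * w2 t k) v"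
  proof (rule Hs_mono[OF v(2)])
   fix k
   show "0 <= w t k * w1 t k" using assms(2)[OF t] tempered_pos[OF w t] by (simp add: less_imp_le)
   have "w t k * w1 t k <= w t k * (K * w2 t k)"
    using assms(2)[OF t] tempered_pos[OF w t] by (intro mult_left_mono) (auto intro: less_imp_le)
   thus "w t k * w1 t k * cmod (v k) <= K * (w t k * w2 t k * cmod (v k))"
    using mult_right_mono[of _ _ "cmod (v k)"] by (fastforce simp: mult_ac)
  qed
  show "Hs (w t) (A t v)" using C(2)[OF t v(1)] * by blast
  have "sq (w t) (A t v) <= C * sq (%k. w t k * w1 t k) v" using C(2)[OF t v(1)] * by blast
  also have "... <= C * (K^2 * sq (%k. w t k * w2 t k) v)" using * C by (intro mult_left_mono) auto
  finally show "sq (w t) (A t v) <= C * K^2 * sq (%k. w t k * w2 t k) v" by (simp add: mult.assoc)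
 qed (use C in auto)
qed (simp_all add: bd_rapid[OF assms(1)] bd_temp[OF assms(1)])

text \<open>The outer weight is moved from \<open>k\<close> to \<open>k - x\<close> by temperedness;
  this costs a power of \<open>jb x\<close>, again paid by the decay of \<open>a\<close>.\<close>

lemma bd_kernel:
 assumes a: "rapid a" and A: "!!t v. t : UI ==> rapid v ==> rapid (A t v)"
  "!!t v. t : UI ==> temp v ==> temp (A t v)"
  and h: "!!t v k. t : UI ==> temp v ==> A t v k = (INFSUM x. a x * (kap t k x * v (k - x)))"
  and K: "!!t k x. t : UI ==> cmod (kap t k x) <= B * jb x ^ N * w0 t (k - x)"
  and B: "0 <= B" and w0: "!!t k. t : UI ==> 0 <= w0 t k"
 shows "bd w0 A"
proof (rule bdI)
 fix w :: "real => int^'a => real" assume w: "tempered w"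
 obtain C M where C: "C >= 1" "!!t k. t : UI ==> 0 < w t k"
  "!!t k l. t : UI ==> w t (k + l) <= C * jb l ^ M * w t k"
  by (rule temperedE[OF w]) blast
 show "EX C>=0. ALL t:UI. ALL v. temp v --> Hs (%k. w t k * w0 t k) v -->
   Hle (w t) (A t v) C (%k. w t k * w0 t k) v"
 proof (rule exI[of _ "(C * B * (INFSUM x. cmod (a x) * jb x ^ (M + N)))^2"], rule conjI, simp, intro ballI allI impI)
  fix t :: real and v :: "'a seq" assume t: "t : UI" and v: "temp v" "Hs (%k. w t k * w0 t k) v"
  show "Hle (w t) (A t v) ((C * B * (INFSUM x. cmod (a x) * jb x ^ (M + N)))^2) (%k. w t k * w0 t k) v"
  proof (rule kernel_bound[OF a _ _ v(2) h[OF t v(1)]])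
   fix k x
   have "w t k <= C * jb x ^ M * w t (k - x)" using C(3)[OF t, of "k - x" x] by simp
   hence "w t k * cmod (kap t k x) <= (C * jb x ^ M * w t (k - x)) * (B * jb x ^ N * w0 t (k - x))"
    using C(1) C(2)[OF t] by (intro mult_mono K t) (auto intro: less_imp_le)
   hence "w t k * cmod (kap t k x) * cmod (v (k - x))
     <= (C * jb x ^ M * w t (k - x)) * (B * jb x ^ N * w0 t (k - x)) * cmod (v (k - x))"
    by (intro mult_right_mono) auto
   thus "w t k * cmod (kap t k x * v (k - x)) <= C * B * jb x ^ (M + N) * (w t (k - x) * w0 t (k - x) * cmod (v (k - x)))"
    by (simp add: norm_mult power_add mult_ac)
  qed (use C(2)[OF t] w0[OF t] C(1) B in "auto intro: less_imp_le mult_nonneg_nonneg")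
 qed
qed (use A in auto)

lemma bd_Mop: "rapid a ==> bd (%t k. 1) (%t. Mop a)"
 by (rule bd_kernel[where a = a and kap = "%t k x. 1" and B = 1 and N = 0])
  (auto simp: rapid_Mop temp_Mop Mop_def)

lemma bd_multiplier:
 assumes "!!t v k. t : UI ==> cmod (A t v k) <= w0 t k * cmod (v k)"
  "!!t. t : UI ==> EX C N. ALL k. w0 t k <= C * jb k ^ N" "!!t k. t : UI ==> 0 <= w0 t k"
 shows "bd w0 A"
proof (rule bdI)
 fix t :: real and v :: "'a seq" assume t: "t : UI"
 obtain C N where C: "!!k. w0 t k <= C * jb k ^ N" using assms(2)[OF t] by blast
 have le: "cmod (A t v k) <= cmod (Lop (w0 t) v k)" for k
  using assms(1,3)[OF t] by (simp add: Lop_def norm_mult)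
 {
  assume "rapid v"
  hence "rapid (Lop (w0 t) v)" using C assms(3)[OF t] by (rule rapid_Lop_weight)
  thus "rapid (A t v)"
   unfolding rapid_def using le by (meson jb_nonneg mult_right_mono order_trans zero_le_power)
 next
  assume "temp v"
  hence "temp (Lop (w0 t) v)" using C assms(3)[OF t] by (rule temp_Lop_weight)
  thus "temp (A t v)" unfolding temp_def using le by (meson order_trans)
 }
next
 fix w :: "real => int^'a => real" assume w: "tempered w"
 show "EX C>=0. ALL t:UI. ALL v. temp v --> Hs (%k. w t k * w0 t k) v -->
   Hle (w t) (A t v) C (%k. w t k * w0 t k) v"
 proof (rule exI[of _ 1], rule conjI, simp, intro ballI allI impI)
  fix t :: real and v :: "'a seq" assume t: "t : UI" and v: "temp v" "Hs (%k. w t k * w0 t k) v"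
  have "Hle (w t) (A t v) (1^2) (%k. w t k * w0 t k) v"
   by (rule Hs_mono[OF v(2)])
    (use tempered_pos[OF w t] assms(1)[OF t] in "auto simp: mult.assoc intro: less_imp_le mult_left_mono")
  thus "Hle (w t) (A t v) 1 (%k. w t k * w0 t k) v" by simp
 qed
qed

lemma bd_Dop: "bd (%t. jb) (%t. Dop j)"
proof (rule bd_multiplier)
 show "EX C N. ALL k::int^'a. jb k <= C * jb k ^ N" by (rule exI[of _ 1], rule exI[of _ 1]) simp
qed (auto simp: norm_Dop_le)

lemma bd_Lop: "tempered tau ==> bd tau (%t. Lop (tau t))"
proof (rule bd_multiplier)
 fix t k v assume tau: "tempered tau" and t: "t : UI"
 note pos = tempered_pos[OF this, of k]
 show "cmod (Lop (tau t) v k) <= tau t k * cmod (v k)" using pos by (simp add: Lop_def norm_mult)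
 show "0 <= tau t k" using pos by simp
 show "EX C N. ALL k. tau t k <= C * jb k ^ N" by (rule tempered_growth[OF tau t])
qed

section \<open>First-order operators, adjoints and commutators\<close>

definition lin_op :: "('m::finite seq => 'm seq) => bool" where
 "lin_op A \<longleftrightarrow> (ALL u v. temp u --> temp v --> A (%k. u k + v k) = (%k. A u k + A v k) &
  A (%k. u k - v k) = (%k. A u k - A v k))"

lemma lin_op_add: "lin_op A ==> temp u ==> temp v ==> A (%k. u k + v k) = (%k. A u k + A v k)"
 by (simp add: lin_op_def)

lemma lin_op_diff: "lin_op A ==> temp u ==> temp v ==> A (%k. u k - v k) = (%k. A u k - A v k)"
 by (simp add: lin_op_def)

definition cm :: "('m::finite seq => 'm seq) => ('m seq => 'm seq) => 'm seq => 'm seq" where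
 "cm A B v k = A (B v) k - B (A v) k"

text \<open>First-order differential operators whose coefficient functions have rapidly decreasing
  Fourier coefficients. \<open>FO_cong\<close> is a rule of its own because operators are total
  functions, while the identities between them are only available on \<open>temp\<close>
  sequences.\<close>

inductive FO :: "('m::finite seq => 'm seq) => bool" where
 FO_Mop: "rapid a ==> FO (Mop a)"
| FO_Mop_Dop: "rapid a ==> FO (%v. Mop a (Dop j v))"
| FO_add: "FO P ==> FO Q ==> FO (%v k. P v k + Q v k)"
| FO_cong: "FO P ==> (!!v. temp v ==> Q v = P v) ==> FO Q"

lemma rapid_minus: "rapid a ==> rapid (%k. - a k)"
 by (simp add: rapid_def)

lemma temp_minus: "temp a ==> temp (%k. - a k)"
 by (simp add: temp_def)

lemma rapid_diff: "rapid a ==> rapid b ==> rapid (%k. a k - b k)"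
 using rapid_add[of a "%k. - b k"] rapid_minus[of b] by simp

lemma temp_diff: "temp a ==> temp b ==> temp (%k. a k - b k)"
 using temp_add[of a "%k. - b k"] temp_minus[of b] by simp

lemma rapid_zero: "rapid (%k. 0)"
 by (auto simp: rapid_def)

lemma FO_temp: "FO P ==> temp v ==> temp (P v)"
 by (induction arbitrary: v rule: FO.induct) (auto simp: temp_Mop temp_Dop temp_add)

lemma FO_rapid: "FO P ==> rapid v ==> rapid (P v)"
 by (induction arbitrary: v rule: FO.induct) (auto simp: rapid_Mop rapid_Dop rapid_add rapid_imp_temp)

lemma FO_lin: "FO P ==> lin_op P"
proof (induction rule: FO.induct)
 case (FO_add P Q)
 thus ?case by (auto simp: lin_op_def fun_eq_iff)
next
 case (FO_cong P Q)
 thus ?case by (auto simp: lin_op_def temp_add temp_diff)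
qed (auto simp: lin_op_def Mop_add_right Mop_diff_right Dop_add Dop_diff temp_Dop)

lemma FO_minus: "FO P ==> FO (%v k. - P v k)"
proof (induction rule: FO.induct)
 case (FO_Mop a)
 show ?case by (rule FO.FO_cong[OF FO.FO_Mop[OF rapid_minus[OF FO_Mop]]]) (simp add: Mop_minus_left)
next
 case (FO_Mop_Dop a j)
 show ?case by (rule FO.FO_cong[OF FO.FO_Mop_Dop[OF rapid_minus[OF FO_Mop_Dop], of j]]) (simp add: Mop_minus_left)
next
 case (FO_add P Q)
 show ?case by (rule FO.FO_cong[OF FO.FO_add[OF FO_add.IH]]) simp
next
 case (FO_cong P Q)
 show ?case by (rule FO.FO_cong[OF FO_cong.IH]) (simp add: FO_cong)
qed

lemma FO_diff: "FO P ==> FO Q ==> FO (%v k. P v k - Q v k)"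
 using FO_add[of P "%v k. - Q v k"] FO_minus[of Q] by simp

lemma FO_zero: "FO (%v k. 0)"
 by (rule FO_cong[OF FO_Mop[OF rapid_zero]]) (simp add: Mop_zero_left)

lemma FO_sum: "finite J ==> (!!j. j : J ==> FO (P j)) ==> FO (%v k. SUM j:J. P j v k)"
 by (induction J rule: finite_induct) (auto simp: FO_zero FO_add)

text \<open>Tested on rapidly decreasing sequences only, where the pairing converges; the a priori
  estimates are proved there as well.\<close>

definition adjoint :: "('m::finite seq => 'm seq) => ('m seq => 'm seq) => bool" where
 "adjoint P P' \<longleftrightarrow> (ALL u v. rapid u --> rapid v --> ip (P u) v = ip u (P' v))"

lemma adjointD: "adjoint P P' ==> rapid u ==> rapid v ==> ip (P u) v = ip u (P' v)"
 by (simp add: adjoint_def)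

lemma adjoint_sym: "adjoint P P' ==> adjoint P' P"
 unfolding adjoint_def by (metis ip_cnj)

lemma adjoint_Mop: "rapid a ==> adjoint (Mop a) (Mop (star a))"
 by (simp add: adjoint_def ip_Mop)

lemma adjoint_Mop_Dop:
 assumes "rapid a"
 shows "adjoint (%v. Mop a (Dop j v)) (%v k. - Mop (star a) (Dop j v) k - Mop (Dop j (star a)) v k)"
 unfolding adjoint_def
proof (intro allI impI)
 fix u v :: "'a seq" assume uv: "rapid u" "rapid v"
 have "ip (Mop a (Dop j u)) v = ip u (%k. - Dop j (Mop (star a) v) k)"
  by (simp add: ip_Mop assms uv rapid_Dop ip_Dop)
 also have "(%k. - Dop j (Mop (star a) v) k) = (%k. - Mop (star a) (Dop j v) k - Mop (Dop j (star a)) v k)"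
  by (simp add: Dop_Mop rapid_star assms uv rapid_imp_temp)
 finally show "ip (Mop a (Dop j u)) v = ip u (%k. - Mop (star a) (Dop j v) k - Mop (Dop j (star a)) v k)" .
qed

lemma adjoint_add:
 assumes "adjoint P P'" "adjoint Q Q'" "FO P" "FO Q" "FO P'" "FO Q'"
 shows "adjoint (%v k. P v k + Q v k) (%v k. P' v k + Q' v k)"
 using assms by (simp add: adjoint_def ip_add_left ip_add_right FO_rapid)

lemma tempered_one: "tempered (%t k. 1)"
 unfolding tempered_def by (rule exI[of _ 1], rule exI[of _ 0]) auto

lemma tempered_jb: "tempered (%t. jb)"
 unfolding tempered_def
 by (rule exI[of _ 2], rule exI[of _ 1]) (use jb_add_le in "auto simp: mult_ac")

lemma FO_bd: "FO P ==> bd (%t. jb) (%t. P)"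
proof (induction rule: FO.induct)
 case (FO_Mop a)
 show ?case by (rule bd_mono[OF bd_Mop[OF FO_Mop], of 1]) (simp add: jb_ge_1)
next
 case (FO_Mop_Dop a j)
 show ?case using bd_comp[OF bd_Mop[OF FO_Mop_Dop] bd_Dop tempered_one] by simp
next
 case (FO_cong P Q)
 thus ?case using bd_cong by metis
qed (rule bd_add)

lemma FO_cm_Mop: "rapid a ==> FO Q ==> FO (cm (Mop a) Q)"
proof (rotate_tac, induction rule: FO.induct)
 case (FO_Mop b)
 show ?case
  by (rule FO_cong[OF FO_zero]) (use FO_Mop in "simp add: cm_def fun_eq_iff Mop_commute[of a b]")
next
 case (FO_Mop_Dop b j)
 show ?case
 proof (rule FO_cong[OF FO_minus[OF FO_Mop[OF rapid_Mop[OF FO_Mop_Dop(1) rapid_Dop[OF FO_Mop_Dop(2)], of j]]]])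
  fix v :: "'a seq" assume v: "temp v"
  show "cm (Mop a) (%v. Mop b (Dop j v)) v = (%k. - Mop (Mop b (Dop j a)) v k)"
   using FO_Mop_Dop v
   by (simp add: cm_def fun_eq_iff Dop_Mop Mop_add_right Mop_assoc temp_Mop temp_Dop rapid_Dop Mop_commute[of a b])
 qed
next
 case (FO_add P Q)
 show ?case
  by (rule FO_cong[OF FO.FO_add[OF FO_add.IH(1)[OF FO_add.prems] FO_add.IH(2)[OF FO_add.prems]]])
   (use FO_add in "simp add: cm_def fun_eq_iff Mop_add_right FO_temp")
next
 case (FO_cong P Q)
 show ?case
  by (rule FO.FO_cong[OF FO_cong.IH[OF FO_cong.prems]])
   (simp add: cm_def[abs_def] FO_cong temp_Mop)
qed

text \<open>The second-order terms cancel because multiplications commute with each other and so do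
  derivatives; what survives carries a derivative of a coefficient.\<close>

lemma FO_cm_Mop_Dop: "rapid a ==> FO Q ==> FO (cm (%v. Mop a (Dop i v)) Q)"
proof (rotate_tac, induction rule: FO.induct)
 case (FO_Mop b)
 show ?case
  by (rule FO_cong[OF FO_minus[OF FO_cm_Mop[OF FO_Mop(1) FO_Mop_Dop[OF FO_Mop(2), of i]]]])
   (simp add: cm_def fun_eq_iff)
next
 case (FO_Mop_Dop b j)
 have r: "rapid (Mop a (Dop i b))" "rapid (Mop b (Dop j a))" using FO_Mop_Dop by (auto simp: rapid_Mop rapid_Dop)
 show ?case
 proof (rule FO_cong[OF FO_diff[OF FO.FO_Mop_Dop[OF r(1), of j] FO.FO_Mop_Dop[OF r(2), of i]]])
  fix v :: "'a seq" assume v: "temp v"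
  show "cm (%v. Mop a (Dop i v)) (%v. Mop b (Dop j v)) v =
    (%k. Mop (Mop a (Dop i b)) (Dop j v) k - Mop (Mop b (Dop j a)) (Dop i v) k)"
   using FO_Mop_Dop v
   by (simp add: cm_def fun_eq_iff Dop_Mop Mop_add_right Mop_assoc temp_Mop temp_Dop rapid_Dop
     Mop_commute[of a b] Dop_commute[of i j])
 qed
next
 case (FO_add P Q)
 show ?case
  by (rule FO_cong[OF FO.FO_add[OF FO_add.IH(1)[OF FO_add.prems] FO_add.IH(2)[OF FO_add.prems]]])
   (use FO_add in "simp add: cm_def fun_eq_iff Dop_add Mop_add_right FO_temp temp_Dop")
next
 case (FO_cong P Q)
 show ?case
  by (rule FO.FO_cong[OF FO_cong.IH[OF FO_cong.prems]])
   (simp add: cm_def[abs_def] FO_cong temp_Mop temp_Dop)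
qed

lemma FO_cm: "FO P ==> FO Q ==> FO (cm P Q)"
proof (induction rule: FO.induct)
 case (FO_add P P')
 show ?case
  by (rule FO_cong[OF FO.FO_add[OF FO_add.IH(1)[OF FO_add.prems] FO_add.IH(2)[OF FO_add.prems]]])
   (use FO_add in "simp add: cm_def fun_eq_iff lin_op_add[OF FO_lin] FO_temp")
next
 case (FO_cong P P')
 show ?case
  by (rule FO.FO_cong[OF FO_cong.IH[OF FO_cong.prems]])
   (simp add: cm_def[abs_def] FO_cong FO_temp)
qed (simp_all add: FO_cm_Mop FO_cm_Mop_Dop)

section \<open>Commutators with Fourier multipliers\<close>

lemma symbol_tempered: "symbol tau ==> tempered tau"
 by (simp add: symbol_def)

lemma temp_Lop_tempered: "tempered tau ==> t : UI ==> temp v ==> temp (Lop (tau t) v)"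
 by (rule bd_temp[OF bd_Lop])

lemma rapid_Lop_tempered: "tempered tau ==> t : UI ==> rapid v ==> rapid (Lop (tau t) v)"
 by (rule bd_rapid[OF bd_Lop])

lemma Dop_Lop: "Dop j (Lop w v) = Lop w (Dop j v)"
 by (simp add: Dop_def Lop_def fun_eq_iff)

text \<open>Commuting a multiplication with a multiplier puts the first difference of the weight
  into the kernel, which is the source of the gain of one order in
  \<open>bd_cm_Mop_Lop\<close>.\<close>

lemma cm_Mop_Lop_eq:
 assumes "rapid a" "tempered tau" "t : UI" "temp v"
 shows "cm (Mop a) (Lop (tau t)) v k = (INFSUM x. a x * (of_real (tau t (k - x) - tau t k) * v (k - x)))"
proof -
 have "cm (Mop a) (Lop (tau t)) v k = (INFSUM x. a x * Lop (tau t) v (k - x)) - (INFSUM x. of_real (tau t k) * (a x * v (k - x)))"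
  by (simp add: cm_def Mop_def infsum_cmult_right' Lop_def)
 also have "... = (INFSUM x. a x * Lop (tau t) v (k - x) - of_real (tau t k) * (a x * v (k - x)))"
  by (intro infsum_diff[symmetric] summable_on_cmult_right Mop_summable temp_Lop_tempered assms)
 also have "... = (INFSUM x. a x * (of_real (tau t (k - x) - tau t k) * v (k - x)))"
  by (intro infsum_cong) (simp add: Lop_def algebra_simps)
 finally show ?thesis .
qed

lemma bd_cm_Mop_Lop:
 assumes a: "rapid a" and tau: "symbol tau"
 shows "bd (%t k. tau t k * (1 / jb k)) (%t. cm (Mop a) (Lop (tau t)))"
proof -
 note tw = symbol_tempered[OF tau]
 obtain C N where C: "0 <= C" "!!t k x. t : UI ==> abs (tau t (k + x) - tau t k) <= C * jb x ^ N * (tau t k / jb k)"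
  using tau unfolding symbol_def by metis
 show ?thesis
 proof (rule bd_kernel[where a = a and kap = "%t k x. of_real (tau t (k - x) - tau t k)" and B = C and N = N])
  fix t :: real and v :: "'a seq" assume t: "t : UI"
  show "rapid (cm (Mop a) (Lop (tau t)) v)" if "rapid v"
   unfolding cm_def[abs_def] by (intro rapid_diff rapid_Mop rapid_Lop_tempered[OF tw t] a that)
  show "temp (cm (Mop a) (Lop (tau t)) v)" if "temp v"
   unfolding cm_def[abs_def] by (intro temp_diff temp_Mop temp_Lop_tempered[OF tw t] a that)
 next
  fix t :: real and k x :: "int^'a" assume t: "t : UI"
  show "cmod (of_real (tau t (k - x) - tau t k)) <= C * jb x ^ N * (tau t (k - x) * (1 / jb (k - x)))"
   using C(2)[OF t, of "k - x" x] by (simp add: abs_minus_commute del: of_real_diff)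
  show "0 <= tau t k * (1 / jb k)" using tempered_pos[OF tw t, of k] by simp
 qed (use C a in "auto simp: cm_Mop_Lop_eq[OF a tw]")
qed

text \<open>A second commutator with a multiplication turns the kernel into the second difference
  \<open>dl\<close> of the weight, hence two orders are gained. The double sum is estimated by
  convolving with \<open>b\<close> first, which gives the majorant \<open>g\<close>, and with
  \<open>a\<close> afterwards.\<close>

lemma bd_cm_Mop_cm_Mop_Lop:
 assumes a: "rapid a" and b: "rapid b" and tau: "symbol tau"
 shows "bd (%t k. tau t k * (1 / (jb k)^2)) (%t. cm (Mop b) (cm (Mop a) (Lop (tau t))))"
proof (rule bdI)
 note tw = symbol_tempered[OF tau]
 fix t :: real and v :: "'a seq" assume t: "t : UI"
 show "rapid (cm (Mop b) (cm (Mop a) (Lop (tau t))) v)" if "rapid v"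
  unfolding cm_def[abs_def] by (intro rapid_diff rapid_Mop rapid_Lop_tempered[OF tw t] a b that)
 show "temp (cm (Mop b) (cm (Mop a) (Lop (tau t))) v)" if "temp v"
  unfolding cm_def[abs_def] by (intro temp_diff temp_Mop temp_Lop_tempered[OF tw t] a b that)
next
 note tw = symbol_tempered[OF tau]
 fix w :: "real => int^'a => real" assume w: "tempered w"
 obtain C N where C: "0 <= C" "!!t k x. t : UI ==> abs (tau t (k + x) - tau t k) <= C * jb x ^ N * (tau t k / jb k)"
  using tau unfolding symbol_def by metis
 obtain C2 N2 where C2: "0 <= C2" "!!t k x y. t : UI ==> abs (tau t (k + x + y) - tau t (k + x) - tau t (k + y) + tau t k)
   <= C2 * (jb x ^ N2 * jb y ^ N2) * (tau t k / (jb k)^2)"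
  using tau unfolding symbol_def by metis
 obtain T L where T: "T >= 1" "!!t k. t : UI ==> 0 < tau t k"
  "!!t k l. t : UI ==> tau t (k + l) <= T * jb l ^ L * tau t k"
  by (rule temperedE[OF tw]) blast
 obtain D M where D: "D >= 1" "!!t k. t : UI ==> 0 < w t k"
  "!!t k l. t : UI ==> w t (k + l) <= D * jb l ^ M * w t k"
  by (rule temperedE[OF w]) blast
 define p where "p = N2 + M"
 define E where "E = D * 2 ^ M * C2"
 have E: "0 <= E" using D(1) C2(1) by (simp add: E_def)
 define Na Nb where "Na = (INFSUM x. cmod (a x) * jb x ^ p)" and "Nb = (INFSUM x. cmod (b x) * jb x ^ p)"
 show "EX C>=0. ALL t:UI. ALL v. temp v --> Hs (%k. w t k * (tau t k * (1 / (jb k)^2))) v -->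
   Hle (w t) (cm (Mop b) (cm (Mop a) (Lop (tau t))) v) C (%k. w t k * (tau t k * (1 / (jb k)^2))) v"
 proof (rule exI[of _ "(E * Na)^2 * Nb^2"], rule conjI, simp, intro ballI allI impI)
  fix t :: real and v :: "'a seq"
  assume t: "t : UI" and v: "temp v" and hs: "Hs (%k. w t k * (tau t k * (1 / (jb k)^2))) v"
  define w0 where "w0 = (%k. w t k * (tau t k * (1 / (jb k)^2)))"
  have hs0: "Hs w0 v" using hs by (simp add: w0_def)
  have w0: "0 <= w0 k" for k using T(2)[OF t, of k] D(2)[OF t, of k] by (simp add: w0_def)
  define A where "A = cm (Mop a) (Lop (tau t))"
  have A: "A u k = (INFSUM x. a x * (of_real (tau t (k - x) - tau t k) * u (k - x)))" if "temp u" for u k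
   unfolding A_def by (rule cm_Mop_Lop_eq[OF a tw t that])
  define dl where "dl k x y = (tau t (k - y - x) - tau t (k - y)) - (tau t (k - x) - tau t k)" for k x y
  define K where "K k x = (INFSUM y. b y * (of_real (dl k x y) * v (k - x - y)))" for k x
  define g where "g m = complex_of_real (INFSUM y. cmod (b y) * jb y ^ p * (w0 (m - y) * cmod (v (m - y))))" for m
  have g: "cmod (g m) = (INFSUM y. cmod (b y) * jb y ^ p * (w0 (m - y) * cmod (v (m - y))))" for m
   unfolding g_def norm_of_real by (intro abs_of_nonneg infsum_nonneg) (simp add: w0)
  have gH: "Hle (%k. 1) g (Nb^2) w0 v"
   unfolding Nb_def by (rule conv_bound[OF rapid_summable[OF b] _ _ hs0]) (simp_all add: g)
  have hK: "cm (Mop b) A v k = (INFSUM x. a x * K k x)" for k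
  proof -
   \<comment> \<open>\<open>S c\<close> is the double sum with coefficient \<open>c\<close>; the two
     orders of composition have coefficients \<open>c1\<close> and \<open>c2\<close>, and
     \<open>c1 - c2\<close> is \<open>dl k\<close>.\<close>
   define S where "S c = (INFSUM (x, y):UNIV \<times> UNIV. a x * (b y * (of_real (c x y) * v (k - x - y))))" for c :: "int^'a => int^'a => real"
   define c1 c2 where "c1 x y = tau t (k - y - x) - tau t (k - y)" and "c2 x y = tau t (k - x) - tau t k" for x y :: "int^'a"
   define B where "B = C * (T * tau t k)"
   have B: "0 <= B" using C(1) T(1) T(2)[OF t, of k] by (simp add: B_def)
   have dB: "abs (tau t (l - x) - tau t l) <= B * (jb x ^ N * jb y ^ L)" if "tau t l <= T * jb y ^ L * tau t k" for l x y
   proof -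
    have "tau t l / jb l <= T * jb y ^ L * tau t k / 1"
     using that T(2)[OF t, of l] by (intro frac_le) (auto simp: jb_ge_1 less_imp_le order_trans)
    hence "C * jb x ^ N * (tau t l / jb l) <= C * jb x ^ N * (T * jb y ^ L * tau t k)"
     using C(1) by (intro mult_left_mono) auto
    thus ?thesis using C(2)[OF t, of l "- x"] by (simp add: B_def mult_ac)
   qed
   have sp: "(%(x, y). a x * (b y * (of_real (c x y) * v (k - x - y)))) summable_on UNIV \<times> UNIV"
    if c: "!!x y. abs (c x y) <= B * (jb x ^ N * jb y ^ L)" for c
   proof (rule abs_summable_summable, rule summable_on_comparison_test)
    show "(%z. B * (case z of (x, y) => cmod (a x) * jb x ^ N * (cmod (b y) * jb y ^ L) * cmod (v (k - x - y)))) summable_on UNIV \<times> UNIV"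
     by (intro summable_on_cmult_right Mop_double_summable a b v)
    fix z :: "(int^'a) \<times> (int^'a)"
    obtain x y where z: "z = (x, y)" by (cases z)
    have "cmod (a x) * (cmod (b y) * (abs (c x y) * cmod (v (k - x - y)))) <=
      cmod (a x) * (cmod (b y) * (B * (jb x ^ N * jb y ^ L) * cmod (v (k - x - y))))"
     by (intro mult_left_mono mult_right_mono c) auto
    thus "cmod (case z of (x, y) => a x * (b y * (of_real (c x y) * v (k - x - y)))) <=
      B * (case z of (x, y) => cmod (a x) * jb x ^ N * (cmod (b y) * jb y ^ L) * cmod (v (k - x - y)))"
     by (simp add: z norm_mult mult_ac)
   qed auto
   have s1: "(%(x, y). a x * (b y * (of_real (c1 x y) * v (k - x - y)))) summable_on UNIV \<times> UNIV"
   proof (rule sp)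
    show "abs (c1 x y) <= B * (jb x ^ N * jb y ^ L)" for x y
     unfolding c1_def using T(3)[OF t, of k "- y"] by (intro dB) simp
   qed
   have s2: "(%(x, y). a x * (b y * (of_real (c2 x y) * v (k - x - y)))) summable_on UNIV \<times> UNIV"
   proof (rule sp)
    show "abs (c2 x y) <= B * (jb x ^ N * jb y ^ L)" for x y
     unfolding c2_def using T(1) T(2)[OF t, of k] jb_power_ge_1[of y L] by (intro dB le_mult_left ge1_mult) auto
   qed
   have "Mop b (A v) k = (INFSUM y. INFSUM x. a x * (b y * (of_real (c1 x y) * v (k - x - y))))"
    unfolding Mop_def A[OF v] infsum_cmult_right'[symmetric]
    by (intro infsum_cong) (simp add: c1_def mult_ac diff_diff_eq add.commute)
   also have "... = (INFSUM x. INFSUM y. a x * (b y * (of_real (c1 x y) * v (k - x - y))))"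
    by (rule infsum_swap_banach[symmetric, OF s1])
   also have "... = S c1" unfolding S_def using infsum_Sigma_banach[OF s1] by simp
   finally have e1: "Mop b (A v) k = S c1" .
   have "A (Mop b v) k = (INFSUM x. INFSUM y. a x * (b y * (of_real (c2 x y) * v (k - x - y))))"
    unfolding A[OF temp_Mop[OF b v]] Mop_def infsum_cmult_right'[symmetric]
    by (intro infsum_cong) (simp add: c2_def mult_ac)
   also have "... = S c2" unfolding S_def using infsum_Sigma_banach[OF s2] by simp
   finally have e2: "A (Mop b v) k = S c2" .
   have eq: "(%z. (%(x, y). a x * (b y * (of_real (c1 x y) * v (k - x - y)))) z
     - (%(x, y). a x * (b y * (of_real (c2 x y) * v (k - x - y)))) z)
    = (%(x, y). a x * (b y * (of_real (dl k x y) * v (k - x - y))))"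
    by (auto simp: c1_def c2_def dl_def algebra_simps)
   have "cm (Mop b) A v k = (INFSUM (x, y):UNIV \<times> UNIV. a x * (b y * (of_real (dl k x y) * v (k - x - y))))"
    unfolding cm_def e1 e2 S_def infsum_diff[OF s1 s2, symmetric] eq ..
   also have "... = (INFSUM x. INFSUM y. a x * (b y * (of_real (dl k x y) * v (k - x - y))))"
    using infsum_Sigma_banach[OF summable_on_diff[OF s1 s2, unfolded eq]] by simp
   finally show ?thesis by (simp add: K_def infsum_cmult_right')
  qed
  have "Hle (w t) (cm (Mop b) A v) ((E * Na)^2) (%k. 1) g"
   unfolding Na_def
  proof (rule kernel_bound[OF a D(2)[OF t] _ conjunct1[OF gH] hK _ E])
   fix k x :: "int^'a"
   define m where "m = k - x"
   have wp: "0 < w t k" by (rule D(2)[OF t])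
   have le: "cmod (b y * (of_real (dl k x y) * v (m - y)))
     <= E * jb x ^ p / w t k * (cmod (b y) * jb y ^ p * (w0 (m - y) * cmod (v (m - y))))" for y
   proof -
    define l where "l = m - y"
    have kl: "k - y - x = l" "k - y = l + x" "k - x = l + y" "k = l + x + y" by (auto simp: l_def m_def)
    have d: "abs (dl k x y) <= C2 * (jb x ^ N2 * jb y ^ N2) * (tau t l / (jb l)^2)"
    proof -
     have "dl k x y = tau t (l + x + y) - tau t (l + x) - tau t (l + y) + tau t l"
      unfolding dl_def kl(1-3) by (simp add: kl(4))
     thus ?thesis using C2(2)[OF t, of l x y] by simp
    qed
    have "w t k <= D * jb (x + y) ^ M * w t l" using D(3)[OF t, of l "x + y"] by (simp add: kl(4) add.assoc)
    also have "... <= D * (2 * jb x * jb y) ^ M * w t l"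
     using D(1) D(2)[OF t, of l] by (intro mult_right_mono mult_left_mono power_mono jb_add_le) auto
    finally have "w t k * abs (dl k x y) <= (D * (2 * jb x * jb y) ^ M * w t l) * (C2 * (jb x ^ N2 * jb y ^ N2) * (tau t l / (jb l)^2))"
     using D(1) D(2)[OF t, of l] by (intro mult_mono d) auto
    also have "... = E * jb x ^ p * jb y ^ p * w0 l"
     by (simp add: E_def p_def w0_def power_add power_mult_distrib mult_ac)
    finally have "abs (dl k x y) <= E * jb x ^ p * jb y ^ p * w0 l / w t k"
     using wp by (simp add: field_simps)
    hence "cmod (b y) * cmod (v l) * abs (dl k x y) <= cmod (b y) * cmod (v l) * (E * jb x ^ p * jb y ^ p * w0 l / w t k)"
     by (intro mult_left_mono) auto
    thus ?thesis by (simp add: norm_mult l_def mult_ac)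
   qed
   have s: "(%y. E * jb x ^ p / w t k * (cmod (b y) * jb y ^ p * (w0 (m - y) * cmod (v (m - y))))) summable_on UNIV"
    using summable_on_cmult_right[OF Mop_summable_gen[OF b Hs_temp[OF hs0], of p m], of "E * jb x ^ p / w t k"] w0
    by (simp add: Lop_def norm_mult mult_ac)
   have s': "(%y. cmod (b y * (of_real (dl k x y) * v (m - y)))) summable_on UNIV"
    by (rule summable_on_comparison_test[OF s]) (use le in auto)
   have "cmod (K k x) <= (INFSUM y. cmod (b y * (of_real (dl k x y) * v (m - y))))"
    unfolding K_def m_def[symmetric] by (rule norm_infsum_bound[OF s'])
   also have "... <= (INFSUM y. E * jb x ^ p / w t k * (cmod (b y) * jb y ^ p * (w0 (m - y) * cmod (v (m - y)))))"
    by (rule infsum_mono[OF s' s le])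
   also have "... = E * jb x ^ p / w t k * cmod (g m)" unfolding g infsum_cmult_right' ..
   finally show "w t k * cmod (K k x) <= E * jb x ^ p * (1 * cmod (g (k - x)))"
    using wp by (simp add: m_def field_simps)
  qed simp
  moreover have "(E * Na)^2 * sq (%k. 1) g <= (E * Na)^2 * (Nb^2 * sq w0 v)"
   using gH by (intro mult_left_mono) auto
  ultimately show "Hle (w t) (cm (Mop b) (cm (Mop a) (Lop (tau t))) v) ((E * Na)^2 * Nb^2) (%k. w t k * (tau t k * (1 / (jb k)^2))) v"
   by (simp add: A_def w0_def mult.assoc)
 qed
qed

lemma Dop_cm_Mop_Lop:
 assumes "rapid a" "tempered tau" "t : UI" "temp v"
 shows "Dop i (cm (Mop a) (Lop (tau t)) v) =
  (%k. cm (Mop a) (Lop (tau t)) (Dop i v) k + cm (Mop (Dop i a)) (Lop (tau t)) v k)"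
 unfolding cm_def[abs_def]
 by (simp add: Dop_diff Dop_Mop Dop_Lop Lop_add temp_Lop_tempered[OF assms(2,3)] assms temp_Dop rapid_Dop fun_eq_iff)

lemma lin_op_cm_Lop:
 assumes "FO P" "tempered tau" "t : UI"
 shows "lin_op (cm P (Lop (tau t)))"
 unfolding lin_op_def cm_def[abs_def]
 using assms
 by (simp add: Lop_add Lop_diff lin_op_add[OF FO_lin] lin_op_diff[OF FO_lin] temp_Lop_tempered[OF assms(2,3)] fun_eq_iff)

lemma tempered_div_jb:
 "tempered tau ==> tempered (%t k. tau t k * (1 / jb k))"
 by (intro tempered_mult tempered_inverse tempered_jb)

lemma tempered_div_jb2:
 "tempered tau ==> tempered (%t k. tau t k * (1 / (jb k)^2))"
 using tempered_div_jb[OF tempered_div_jb[of tau]] by (simp add: power2_eq_square)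

lemma div_jb_le:
 assumes "tempered tau" "t : UI"
 shows "0 <= tau t k * (1 / jb k) & tau t k * (1 / jb k) <= 1 * tau t k"
  "0 <= tau t k * (1 / (jb k)^2) & tau t k * (1 / (jb k)^2) <= 1 * (tau t k * (1 / jb k))"
  "0 <= tau t k * (1 / (jb k)^2) * jb k & tau t k * (1 / (jb k)^2) * jb k <= 1 * (tau t k * (1 / jb k))"
proof -
 have "0 < tau t k" by (rule tempered_pos[OF assms])
 moreover have "1 / jb k <= 1" "1 / (jb k)^2 <= 1 / jb k"
  by (simp_all add: jb_ge_1 power2_eq_square divide_simps)
 ultimately show "0 <= tau t k * (1 / jb k) & tau t k * (1 / jb k) <= 1 * tau t k"
  "0 <= tau t k * (1 / (jb k)^2) & tau t k * (1 / (jb k)^2) <= 1 * (tau t k * (1 / jb k))"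
  "0 <= tau t k * (1 / (jb k)^2) * jb k & tau t k * (1 / (jb k)^2) * jb k <= 1 * (tau t k * (1 / jb k))"
  using mult_left_mono[of "1 / jb k" 1 "tau t k"] mult_left_mono[of "1 / (jb k)^2" "1 / jb k" "tau t k"]
  by (simp_all add: power2_eq_square)
qed

text \<open>The coefficients of the constant function 1; they exhibit \<open>Dop j\<close> as an
  instance of \<open>FO\<close>.\<close>

definition unit_seq :: "'m::finite seq" where
 "unit_seq k = (if k = 0 then 1 else 0)"

lemma rapid_unit_seq: "rapid (unit_seq :: 'm::finite seq)"
proof -
 have "ALL k::int^'m. cmod (unit_seq k) * jb k ^ N <= (jb (0::int^'m)) ^ N" for N
  by (auto simp: unit_seq_def)
 thus ?thesis unfolding rapid_def by blast
qed

lemma Mop_unit_seq: "Mop unit_seq v = v"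
proof
 fix k
 have "Mop unit_seq v k = (INFSUM x:{0}. unit_seq x * v (k - x))"
  unfolding Mop_def by (rule infsum_cong_neutral) (auto simp: unit_seq_def)
 thus "Mop unit_seq v k = v k" by (simp add: unit_seq_def)
qed

lemma FO_Dop: "FO (Dop j)"
 by (rule FO_cong[OF FO_Mop_Dop[OF rapid_unit_seq, of j]]) (simp add: Mop_unit_seq)

text \<open>The order that the coefficient gains in its commutator with the weight pays for the
  derivative, which itself commutes with the weight.\<close>

lemma bd_FO_cm_Lop: "FO P ==> symbol tau ==> bd tau (%t. cm P (Lop (tau t)))"
proof (induction rule: FO.induct)
 case (FO_Mop a)
 show ?case
  by (rule bd_mono[OF bd_cm_Mop_Lop[OF FO_Mop]]) (rule div_jb_le(1)[OF symbol_tempered[OF FO_Mop(2)]])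
next
 case (FO_Mop_Dop a j)
 have "bd (%t k. tau t k * (1 / jb k) * jb k) (%t v. cm (Mop a) (Lop (tau t)) (Dop j v))"
  by (rule bd_comp[OF bd_cm_Mop_Lop[OF FO_Mop_Dop] bd_Dop])
   (intro tempered_div_jb symbol_tempered FO_Mop_Dop)
 thus ?case by (simp add: cm_def[abs_def] Dop_Lop)
next
 case (FO_add P Q)
 have "bd tau (%t v k. cm P (Lop (tau t)) v k + cm Q (Lop (tau t)) v k)"
  by (intro bd_add FO_add)
 thus ?case by (simp add: cm_def[abs_def] Lop_add algebra_simps)
next
 case (FO_cong P Q)
 note tw = symbol_tempered[OF FO_cong(4)]
 show ?case
  by (rule bd_cong[OF FO_cong.IH[OF FO_cong.prems]])
   (simp add: cm_def[abs_def] FO_cong(2) temp_Lop_tempered[OF tw])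
qed

text \<open>The inner commutator with a multiplication gains one order, and the outer one with a
  first-order operator does not lose it.\<close>

lemma bd_cm_FO_cm_Mop_Lop:
 assumes "rapid a" "symbol tau" "FO P'"
 shows "bd (%t k. tau t k * (1 / jb k)) (%t. cm P' (cm (Mop a) (Lop (tau t))))"
 using assms(3)
proof (induction rule: FO.induct)
 note tw = symbol_tempered[OF assms(2)]
 case (FO_Mop b)
 show ?case
  by (rule bd_mono[OF bd_cm_Mop_cm_Mop_Lop[OF assms(1) FO_Mop assms(2)]]) (rule div_jb_le(2)[OF tw])
next
 note tw = symbol_tempered[OF assms(2)]
 case (FO_Mop_Dop b i)
 have 1: "bd (%t k. tau t k * (1 / jb k)) (%t v. cm (Mop b) (cm (Mop a) (Lop (tau t))) (Dop i v))"
  by (rule bd_mono[OF bd_comp[OF bd_cm_Mop_cm_Mop_Lop[OF assms(1) FO_Mop_Dop assms(2)] bd_Dop]])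
   (rule tempered_div_jb2[OF tw] div_jb_le(3)[OF tw])+
 have 2: "bd (%t k. tau t k * (1 / jb k)) (%t v. Mop b (cm (Mop (Dop i a)) (Lop (tau t)) v))"
  using bd_comp[OF bd_Mop[OF FO_Mop_Dop] bd_cm_Mop_Lop[OF rapid_Dop[OF assms(1), of i] assms(2)] tempered_one] by simp
 show ?case
 proof (rule bd_cong[OF bd_add[OF 1 2]])
  fix t :: real and v :: "'a seq" assume t: "t : UI" and v: "temp v"
  have tm: "temp (cm (Mop a) (Lop (tau t)) u)" if "rapid a" "temp u" for a u
   by (rule bd_temp[OF bd_FO_cm_Lop[OF FO_Mop[OF that(1)] assms(2)] t that(2)])
  show "cm (%v. Mop b (Dop i v)) (cm (Mop a) (Lop (tau t))) v =
    (%k. cm (Mop b) (cm (Mop a) (Lop (tau t))) (Dop i v) k + Mop b (cm (Mop (Dop i a)) (Lop (tau t)) v) k)"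
   unfolding cm_def[of "%v. Mop b (Dop i v)", abs_def] cm_def[of "Mop b", abs_def] Dop_cm_Mop_Lop[OF assms(1) tw t v]
   by (simp add: Mop_add_right FO_Mop_Dop tm assms rapid_Dop temp_Dop v algebra_simps)
 qed
next
 case (FO_add P Q)
 note tw = symbol_tempered[OF assms(2)]
 show ?case
 proof (rule bd_cong[OF bd_add[OF FO_add.IH]])
  fix t :: real and v :: "'a seq" assume t: "t : UI" and v: "temp v"
  show "cm (%v k. P v k + Q v k) (cm (Mop a) (Lop (tau t))) v =
    (%k. cm P (cm (Mop a) (Lop (tau t))) v k + cm Q (cm (Mop a) (Lop (tau t))) v k)"
   unfolding cm_def[of _ "cm (Mop a) (Lop (tau t))", abs_def]
   using lin_op_add[OF lin_op_cm_Lop[OF FO_Mop[OF assms(1)] tw t]] FO_add.hyps v by (simp add: FO_temp fun_eq_iff)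
 qed
next
 case (FO_cong P Q)
 note tw = symbol_tempered[OF assms(2)]
 show ?case
 proof (rule bd_cong[OF FO_cong.IH])
  fix t :: real and v :: "'a seq" assume t: "t : UI" and v: "temp v"
  have tm: "temp (cm (Mop a) (Lop (tau t)) v)"
   by (rule bd_temp[OF bd_FO_cm_Lop[OF FO_Mop[OF assms(1)] assms(2)] t v])
  show "cm Q (cm (Mop a) (Lop (tau t))) v = cm P (cm (Mop a) (Lop (tau t))) v"
   unfolding cm_def[of _ "cm (Mop a) (Lop (tau t))", abs_def] by (simp add: FO_cong(2) v tm)
 qed
qed

text \<open>Commutators with first-order operators preserve the order of the weight, here twice in
  succession. In the case of \<open>Mop a\<close> after \<open>Dop j\<close>, the order gained in
  \<open>bd_cm_FO_cm_Mop_Lop\<close> pays for \<open>Dop j\<close>.\<close>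

lemma bd_cm_FO_cm_FO_Lop:
 assumes "FO P" "FO P'" "symbol tau"
 shows "bd tau (%t. cm P' (cm P (Lop (tau t))))"
 using assms(1)
proof (induction rule: FO.induct)
 case (FO_Mop a)
 show ?case
  by (rule bd_mono[OF bd_cm_FO_cm_Mop_Lop[OF FO_Mop assms(3,2)]])
   (rule div_jb_le(1)[OF symbol_tempered[OF assms(3)]])
next
 note tw = symbol_tempered[OF assms(3)]
 case (FO_Mop_Dop a j)
 have tm: "temp (cm (Mop a) (Lop (tau t)) v)" if "t : UI" "temp v" for t v
  by (rule bd_temp[OF bd_FO_cm_Lop[OF FO_Mop[OF FO_Mop_Dop] assms(3)] that])
 have 1: "bd tau (%t v. cm P' (cm (Mop a) (Lop (tau t))) (Dop j v))"
  using bd_comp[OF bd_cm_FO_cm_Mop_Lop[OF FO_Mop_Dop assms(3,2)] bd_Dop tempered_div_jb[OF tw], of j] by simp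
 have 2: "bd tau (%t v. cm (Mop a) (Lop (tau t)) (cm P' (Dop j) v))"
  using bd_comp[OF bd_cm_Mop_Lop[OF FO_Mop_Dop assms(3)] FO_bd[OF FO_cm[OF assms(2) FO_Dop[of j]]] tempered_div_jb[OF tw]] by simp
 show ?case
 proof (rule bd_cong[OF bd_add[OF 1 2]])
  fix t :: real and v :: "'a seq" assume t: "t : UI" and v: "temp v"
  have "cm (%v. Mop a (Dop j v)) (Lop (tau t)) = (%v. cm (Mop a) (Lop (tau t)) (Dop j v))"
   by (simp add: cm_def[abs_def] Dop_Lop)
  moreover have "cm (Mop a) (Lop (tau t)) (cm P' (Dop j) v) =
    (%k. cm (Mop a) (Lop (tau t)) (P' (Dop j v)) k - cm (Mop a) (Lop (tau t)) (Dop j (P' v)) k)"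
   unfolding cm_def[of P' "Dop j", abs_def]
   by (rule lin_op_diff[OF lin_op_cm_Lop[OF FO_Mop[OF FO_Mop_Dop] tw t]]) (simp_all add: FO_temp[OF assms(2)] temp_Dop v)
  ultimately show "cm P' (cm (%v. Mop a (Dop j v)) (Lop (tau t))) v =
   (%k. cm P' (cm (Mop a) (Lop (tau t))) (Dop j v) k + cm (Mop a) (Lop (tau t)) (cm P' (Dop j) v) k)"
   by (simp add: cm_def[of P', abs_def])
 qed
next
 note tw = symbol_tempered[OF assms(3)]
 case (FO_add P Q)
 show ?case
 proof (rule bd_cong[OF bd_add[OF FO_add.IH]])
  fix t :: real and v :: "'a seq" assume t: "t : UI" and v: "temp v"
  have tm: "temp (cm P (Lop (tau t)) v)" if "FO P" for P
   by (rule bd_temp[OF bd_FO_cm_Lop[OF that assms(3)] t v])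
  have eq: "cm (%v k. P v k + Q v k) (Lop (tau t)) u = (%k. cm P (Lop (tau t)) u k + cm Q (Lop (tau t)) u k)" for u
   by (simp add: cm_def[abs_def] Lop_add algebra_simps)
  show "cm P' (cm (%v k. P v k + Q v k) (Lop (tau t))) v =
    (%k. cm P' (cm P (Lop (tau t))) v k + cm P' (cm Q (Lop (tau t))) v k)"
   unfolding cm_def[of P', abs_def] eq
   by (simp add: lin_op_add[OF FO_lin[OF assms(2)]] tm FO_add.hyps algebra_simps)
 qed
next
 note tw = symbol_tempered[OF assms(3)]
 case (FO_cong P Q)
 show ?case
 proof (rule bd_cong[OF FO_cong.IH])
  fix t :: real and v :: "'a seq" assume t: "t : UI" and v: "temp v"
  have "cm Q (Lop (tau t)) u = cm P (Lop (tau t)) u" if "temp u" for u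
   unfolding cm_def[abs_def] by (simp add: FO_cong(2) that temp_Lop_tempered[OF tw t])
  thus "cm P' (cm Q (Lop (tau t))) v = cm P' (cm P (Lop (tau t))) v"
   unfolding cm_def[of P', abs_def] by (simp add: v FO_temp[OF assms(2)])
 qed
qed

text \<open>For \<open>b < 0\<close> and fixed \<open>t\<close> the second factor lowers the order
  by \<open>2 |b|\<close>, while for \<open>t\<close> tending to 0 the weight tends to
  \<open>jb k powr a\<close>. Estimates uniform in \<open>t\<close> therefore survive both for
  sequences of unknown order and in the limit.\<close>

definition wt :: "real => real => real => int^'m::finite => real" where
 "wt a b t k = jb k powr a * (1 + t * (jb k)^2) powr b"

lemma wt_base_ge1: "t : UI ==> 1 <= 1 + t * (jb k)^2"
 by simp

lemma wt_base_nz: "t : UI ==> 1 + t * (jb k)^2 ~= 0"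
 using wt_base_ge1[of t k] by linarith

lemma symbol_wt: "symbol (wt a b :: real => int^'m::finite => real)"
proof -
 have "((jb k)^2) powr (a / 2) = jb k powr a" for k :: "int^'m"
  using powr_powr[of "jb k" 2 "a / 2"] by simp
 thus ?thesis by (intro symbol_cong[OF symbol_powr_mult[of "a / 2" b]]) (simp add: wt_def)
qed

lemma tempered_wt: "tempered (wt a b)"
 by (rule symbol_tempered[OF symbol_wt])

lemma wt_mult: "t : UI ==> wt a b t k * wt c d t k = wt (a + c) (b + d) t k"
 by (simp add: wt_def powr_add mult_ac)

lemma wt_0 [simp]: "t : UI ==> wt 0 0 t k = 1"
 using wt_base_nz[of t k] by (simp add: wt_def)

lemma wt_pos: "t : UI ==> 0 < wt a b t k"
 by (rule tempered_pos[OF tempered_wt])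

lemma wt_inverse: "t : UI ==> 1 / wt a b t k = wt (- a) (- b) t k"
 by (simp add: wt_def powr_minus_divide)

lemma wt_mono: "t : UI ==> a <= a' ==> b <= b' ==> wt a b t k <= wt a' b' t k"
 unfolding wt_def by (intro mult_mono powr_mono jb_ge_1) auto

lemma wt_jb: "t : UI ==> jb k = wt 1 0 t k"
 using wt_base_nz[of t k] by (simp add: wt_def)

lemma Lop_Lop: "Lop w (Lop w' v) = Lop (%k. w k * w' k) v"
 by (simp add: Lop_def fun_eq_iff)

lemma Lop_wt_Lop_wt: "t : UI ==> Lop (wt a b t) (Lop (wt c d t) v) = Lop (wt (a + c) (b + d) t) v"
 by (simp add: Lop_Lop wt_mult)

section \<open>Uniform estimates\<close>

text \<open>\<open>G\<close> stays abstract: an estimate says that whatever controls the inputs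
  controls the output, which avoids tracking constants and lists of norms. In
  \<open>regularity_from_estimate\<close> it becomes the sum of the norms of the inputs.\<close>

definition dominated :: "(real => 'm::finite seq => real) => (real => 'm seq => real) => bool" where
 "dominated F G \<longleftrightarrow> (EX C>=0. ALL t:UI. ALL v. rapid v --> F t v <= C * G t v)"

lemma dominatedI: "0 <= C ==> (!!t v. t : UI ==> rapid v ==> F t v <= C * G t v) ==> dominated F G"
 unfolding dominated_def by auto

lemma dominatedE:
 assumes "dominated F G"
 obtains C where "0 <= C" "!!t v. t : UI ==> rapid v ==> F t v <= C * G t v"
 using assms unfolding dominated_def by auto

lemma dominated_le:
 assumes "dominated F' G" "0 <= K" "!!t v. t : UI ==> rapid v ==> F t v <= K * F' t v"
 shows "dominated F G"
proof -
 obtain C where C: "0 <= C" "!!t v. t : UI ==> rapid v ==> F' t v <= C * G t v"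
  by (rule dominatedE[OF assms(1)]) blast
 show ?thesis
 proof (rule dominatedI)
  fix t :: real and v :: "'a seq" assume tv: "t : UI" "rapid v"
  have "F t v <= K * F' t v" by (rule assms(3)[OF tv])
  also have "... <= K * (C * G t v)" by (intro mult_left_mono C tv assms)
  finally show "F t v <= (K * C) * G t v" by (simp add: mult.assoc)
 qed (use C assms in auto)
qed

lemma dominated_add:
 assumes "dominated F1 G" "dominated F2 G"
 shows "dominated (%t v. F1 t v + F2 t v) G"
proof -
 obtain C where C: "0 <= C" "!!t v. t : UI ==> rapid v ==> F1 t v <= C * G t v"
  by (rule dominatedE[OF assms(1)]) blast
 obtain D where D: "0 <= D" "!!t v. t : UI ==> rapid v ==> F2 t v <= D * G t v"
  by (rule dominatedE[OF assms(2)]) blast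
 show ?thesis
  by (rule dominatedI[of "C + D"]) (use C D in "auto simp: distrib_right intro: add_mono")
qed

lemma dominated_sum:
 assumes "finite J" "!!j. j : J ==> dominated (F j) G"
 shows "dominated (%t v. SUM j:J. F j t v) G"
 using assms
proof (induction J rule: finite_induct)
 case empty
 show ?case by (rule dominatedI[of 0]) auto
next
 case (insert j J)
 thus ?case by (auto intro: dominated_add)
qed

definition Q :: "real => real => (real => 'm::finite seq => 'm seq) => real => 'm seq => real" where
 "Q a b A t v = sq (wt a b t) (A t v)"

abbreviation Qdom where
 "Qdom a b A \<equiv> dominated (Q a b A)"

definition rp :: "(real => 'm::finite seq => 'm seq) => bool" where
 "rp A \<longleftrightarrow> (ALL t:UI. ALL v. rapid v --> rapid (A t v))"

lemma rpD: "rp A ==> t : UI ==> rapid v ==> rapid (A t v)"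
 by (simp add: rp_def)

lemma rp_id: "rp (%t v. v)"
 by (simp add: rp_def)

lemma rp_bd: "bd w A ==> rp B ==> rp (%t v. A t (B t v))"
 by (simp add: rp_def bd_rapid)

lemma rp_FO: "FO P ==> rp B ==> rp (%t v. P (B t v))"
 by (simp add: rp_def FO_rapid)

lemma rp_Lop: "rp B ==> rp (%t v. Lop (wt a b t) (B t v))"
 by (rule rp_bd[OF bd_Lop[OF tempered_wt]])

lemma Hs_wt: "rapid v ==> t : UI ==> Hs (wt a b t) v"
 by (rule Hs_rapid_weight[OF _ tempered_wt])

lemma Hs_one: "rapid v ==> Hs (%k. 1) v"
 using Hs_wt[of v 1 0 0] by (simp add: Hs_def)

lemma sq_Lop_wt: "t : UI ==> sq (wt c d t) (Lop (wt a b t) v) = sq (wt (c + a) (d + b) t) v"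
 unfolding sq_Lop by (simp add: wt_mult)

lemma Q_Lop: "Qdom (c + a) (d + b) B G ==> Qdom c d (%t v. Lop (wt a b t) (B t v)) G"
 by (rule dominated_le[of _ _ 1]) (auto simp: Q_def sq_Lop_wt)

lemma Q_mono:
 assumes "Qdom a' b' A G" "a <= a'" "b <= b'" "rp A"
 shows "Qdom a b A G"
proof (rule dominated_le[OF assms(1), of "1^2"])
 fix t :: real and v :: "'a seq" assume tv: "t : UI" "rapid v"
 have "Hle (wt a b t) (A t v) (1^2) (wt a' b' t) (A t v)"
  by (rule Hs_mono[OF Hs_wt[OF rpD[OF assms(4) tv] tv(1)]])
   (simp_all add: less_imp_le[OF wt_pos[OF tv(1)]] mult_right_mono[OF wt_mono[OF tv(1) assms(2,3)]])
 thus "Q a b A t v <= 1^2 * Q a' b' A t v" by (simp add: Q_def)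
qed simp

lemma Q_bd:
 assumes "bd (wt a b) A" "rp B" "Qdom (c + a) (d + b) B G"
 shows "Qdom c d (%t v. A t (B t v)) G"
proof -
 obtain C where C0: "C >= 0" and C: "!!t v. t : UI ==> temp v ==> Hs (%k. wt c d t k * wt a b t k) v ==> Hle (wt c d t) (A t v) C (%k. wt c d t k * wt a b t k) v"
  by (rule bdE[OF assms(1) tempered_wt[of c d]], rule that)
 show ?thesis
 proof (rule dominated_le[OF assms(3) C0])
  fix t :: real and v :: "'a seq" assume tv: "t : UI" "rapid v"
  have "sq (wt c d t) (A t (B t v)) <= C * sq (%k. wt c d t k * wt a b t k) (B t v)"
   using rpD[OF assms(2) tv] tv by (intro conjunct2[OF C]) (auto simp: wt_mult rapid_imp_temp Hs_wt[of _ t "c + a" "d + b"])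
  thus "Q c d (%t v. A t (B t v)) t v <= C * Q (c + a) (d + b) B t v"
   using tv by (simp add: Q_def wt_mult)
 qed
qed

lemma Q_FO:
 assumes "FO P" "rp B" "Qdom (c + 1) d B G"
 shows "Qdom c d (%t v. P (B t v)) G"
proof (rule Q_bd[of 1 0 "%t. P" B])
 show "bd (wt 1 0) (%t. P)"
  by (rule bd_mono[OF FO_bd[OF assms(1)], of 1]) (simp flip: wt_jb)
qed (use assms in auto)

lemma Q_add:
 assumes "Qdom a b A G" "Qdom a b B G" "rp A" "rp B"
 shows "Qdom a b (%t v k. A t v k + B t v k) G"
proof (rule dominated_le[OF dominated_add[OF assms(1,2)], of 2])
 fix t :: real and v :: "'a seq" assume tv: "t : UI" "rapid v"
 show "Q a b (%t v k. A t v k + B t v k) t v <= 2 * (Q a b A t v + Q a b B t v)"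
  using Hs_add[OF Hs_wt[OF rpD[OF assms(3) tv] tv(1)] Hs_wt[OF rpD[OF assms(4) tv] tv(1)], of a b]
  by (simp add: Q_def)
qed simp

lemma Q_diff:
 assumes "Qdom a b A G" "Qdom a b B G" "rp A" "rp B"
 shows "Qdom a b (%t v k. A t v k - B t v k) G"
proof (rule dominated_le[OF dominated_add[OF assms(1,2)], of 2])
 fix t :: real and v :: "'a seq" assume tv: "t : UI" "rapid v"
 show "Q a b (%t v k. A t v k - B t v k) t v <= 2 * (Q a b A t v + Q a b B t v)"
  using Hs_diff[OF Hs_wt[OF rpD[OF assms(3) tv] tv(1)] Hs_wt[OF rpD[OF assms(4) tv] tv(1)], of a b]
  by (simp add: Q_def)
qed simp

lemma Q_cong:
 assumes "Qdom a b A G" "!!t v. t : UI ==> rapid v ==> B t v = A t v"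
 shows "Qdom a b B G"
 by (rule dominated_le[OF assms(1), of 1]) (simp_all add: Q_def assms(2))

lemma dominated_ip:
 assumes "rp A" "rp B" "Qdom a b A G" "Qdom (- a) (- b) B G"
 shows "dominated (%t v. cmod (ip (A t v) (B t v))) G"
proof (rule dominated_le[OF dominated_add[OF assms(3,4)], of 1])
 fix t :: real and v :: "'a seq" assume tv: "t : UI" "rapid v"
 have r: "rapid (A t v)" "rapid (B t v)" using rpD tv assms by auto
 have "cmod (ip (A t v) (B t v)) <= 1 * sq (wt a b t) (A t v) + (1 / 1) * sq (%k. 1 / wt a b t k) (B t v)"
  using tv r by (intro norm_ip_le) (auto simp: wt_pos Hs_wt wt_inverse[OF tv(1)])
 thus "cmod (ip (A t v) (B t v)) <= 1 * (Q a b A t v + Q (- a) (- b) B t v)"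
  using tv by (simp add: Q_def wt_inverse)
qed simp

lemma sq_wt_ip:
 assumes "rapid x" "t : UI"
 shows "of_real (sq (wt a b t) x) = ip x (Lop (wt (2 * a) (2 * b) t) x)"
proof -
 have r: "rapid (Lop (wt a b t) x)" by (rule rapid_Lop_tempered[OF tempered_wt assms(2,1)])
 have "of_real (sq (wt a b t) x) = of_real (sq (%k. 1) (Lop (wt a b t) x))"
  by (simp add: sq_Lop)
 also have "... = ip (Lop (wt a b t) x) (Lop (wt a b t) x)"
  by (rule ip_self[OF Hs_one[OF r], symmetric])
 also have "... = ip x (Lop (wt (2 * a) (2 * b) t) x)"
  by (simp add: ip_Lop Lop_wt_Lop_wt[OF assms(2)] flip: mult_2)
 finally show ?thesis .
qed

lemma sq_one_ip: "rapid x ==> of_real (sq (%k. 1) x) = ip x x"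
 by (rule ip_self[OF Hs_one, symmetric])

lemma cmod_of_real_sq: "of_real (sq w x) = z ==> sq w x = cmod z"
 by (metis abs_of_nonneg norm_of_real sq_nonneg)

lemma bd_cm_Lop_wt: "FO P ==> bd (wt a b) (%t. cm P (Lop (wt a b t)))"
 by (rule bd_FO_cm_Lop[OF _ symbol_wt])

lemma bd_wt_FO:
 assumes "bd (wt a b) A" "FO P"
 shows "bd (wt (a + 1) b) (%t v. A t (P v))"
 by (rule bd_mono[OF bd_comp[OF assms(1) FO_bd[OF assms(2)] tempered_wt], of 1])
  (simp add: wt_jb wt_mult less_imp_le[OF wt_pos])

lemma bd_Lop_FO: "FO K ==> bd (wt (a + 1) b) (%t v. Lop (wt a b t) (K v))"
 by (rule bd_wt_FO[OF bd_Lop[OF tempered_wt]])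

lemma bd_cm_Lop_FO:
 assumes "FO P" "FO K"
 shows "bd (wt (a + 1) b) (%t. cm P (%v. Lop (wt a b t) (K v)))"
proof (rule bd_cong[OF bd_add[OF bd_wt_FO[OF bd_cm_Lop_wt[OF assms(1)] assms(2)] bd_Lop_FO[OF FO_cm[OF assms]]]])
 fix t :: real and v :: "'a seq"
 show "cm P (%v. Lop (wt a b t) (K v)) v =
  (%k. cm P (Lop (wt a b t)) (K v) k + Lop (wt a b t) (cm P K v) k)"
  unfolding cm_def[abs_def] by (simp add: Lop_diff fun_eq_iff)
qed

lemma bd_cm_cm_Lop_FO:
 assumes "FO P'" "FO P" "FO K"
 shows "bd (wt (a + 1) b) (%t. cm P' (cm P (%v. Lop (wt a b t) (K v))))"
proof (rule bd_cong[OF bd_add[OF bd_add[OF bd_wt_FO[OF bd_cm_FO_cm_FO_Lop[OF assms(2,1) symbol_wt] assms(3)]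
   bd_wt_FO[OF bd_cm_Lop_wt[OF assms(2)] FO_cm[OF assms(1,3)]]] bd_cm_Lop_FO[OF assms(1) FO_cm[OF assms(2,3)]]]])
 fix t :: real and v :: "'a seq" assume t: "t : UI" and v: "temp v"
 let ?L = "Lop (wt a b t)"
 note tw = tempered_wt[of a b]
 have tL: "temp (?L u)" if "temp u" for u by (rule temp_Lop_tempered[OF tw t that])
 have tm: "temp (cm P ?L u)" if "temp u" for u
  by (rule bd_temp[OF bd_cm_Lop_wt[OF assms(2)] t that])
 have eq: "cm P (%v. ?L (K v)) u = (%k. cm P ?L (K u) k + ?L (cm P K u) k)" for u
  unfolding cm_def[abs_def] by (simp add: Lop_diff fun_eq_iff)
 have tK: "temp (cm P K v)" by (rule FO_temp[OF FO_cm[OF assms(2,3)] v])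
 have "cm P ?L (cm P' K v) = (%k. cm P ?L (P' (K v)) k - cm P ?L (K (P' v)) k)"
  unfolding cm_def[of P' K, abs_def]
  by (rule lin_op_diff[OF lin_op_cm_Lop[OF assms(2) tw t]]) (simp_all add: FO_temp assms v)
 moreover have "P' (%k. cm P ?L (K v) k + ?L (cm P K v) k) = (%k. P' (cm P ?L (K v)) k + P' (?L (cm P K v)) k)"
  by (rule lin_op_add[OF FO_lin[OF assms(1)]]) (simp_all add: tm tL tK FO_temp assms v)
 ultimately show "cm P' (cm P (%v. ?L (K v))) v =
  (%k. cm P' (cm P ?L) (K v) k + cm P ?L (cm P' K v) k + cm P' (%v. ?L (cm P K v)) v k)"
  unfolding cm_def[of P', abs_def] eq by (simp add: fun_eq_iff)
qed

text \<open>The commutator of \<open>P\<close> with the weight has no more order than the weight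
  itself, so moving \<open>P\<close> across costs only a norm of \<open>B\<close>.\<close>

lemma Q_FO_Lop:
 assumes "FO P" "rp B" "Qdom (c + a) (d + b) (%t v. P (B t v)) G" "Qdom (c + a) (d + b) B G"
 shows "Qdom c d (%t v. P (Lop (wt a b t) (B t v))) G"
proof (rule Q_cong)
 show "Qdom c d (%t v k. Lop (wt a b t) (P (B t v)) k + cm P (Lop (wt a b t)) (B t v) k) G"
  by (rule Q_add[OF Q_Lop[OF assms(3)] Q_bd[OF bd_cm_Lop_wt[OF assms(1)] assms(2,4)]
     rp_Lop[OF rp_FO[OF assms(1,2)]] rp_bd[OF bd_cm_Lop_wt[OF assms(1)] assms(2)]])
qed (simp add: cm_def fun_eq_iff)

lemma Q_Lop_FO_reverse:
 assumes "FO P" "rp B" "Qdom c d (%t v. P (Lop (wt a b t) (B t v))) G" "Qdom (c + a) (d + b) B G"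
 shows "Qdom c d (%t v. Lop (wt a b t) (P (B t v))) G"
proof (rule Q_cong)
 show "Qdom c d (%t v k. P (Lop (wt a b t) (B t v)) k - cm P (Lop (wt a b t)) (B t v) k) G"
  by (rule Q_diff[OF assms(3) Q_bd[OF bd_cm_Lop_wt[OF assms(1)] assms(2,4)]
     rp_FO[OF assms(1) rp_Lop[OF assms(2)]] rp_bd[OF bd_cm_Lop_wt[OF assms(1)] assms(2)]])
qed (simp add: cm_def fun_eq_iff)

section \<open>A priori estimates for brackets and adjoints\<close>

lemma dominated_cmod_diff:
 assumes "dominated (%t v. cmod (f t v)) G" "dominated (%t v. cmod (g t v)) G"
 shows "dominated (%t v. cmod (f t v - g t v)) G"
 by (rule dominated_le[OF dominated_add[OF assms], of 1]) (auto simp: norm_triangle_ineq4)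

lemma dominated_cmod_add:
 assumes "dominated (%t v. cmod (f t v)) G" "dominated (%t v. cmod (g t v)) G"
 shows "dominated (%t v. cmod (f t v + g t v)) G"
 by (rule dominated_le[OF dominated_add[OF assms], of 1]) (auto simp: norm_triangle_ineq)

lemma dominated_cong:
 "dominated F G ==> (!!t v. t : UI ==> rapid v ==> F' t v = F t v) ==> dominated F' G"
 by (erule dominated_le[of _ _ 1]) auto

lemma Q_00: "t : UI ==> Q 0 0 A t v = sq (%k. 1) (A t v)"
 by (simp add: Q_def sq_def)

text \<open>The square of the norm is the pairing of \<open>cm X Y v\<close> with
  \<open>Gop t v\<close>, which contains the squared weight. Taking adjoints and moving
  \<open>X'\<close> and \<open>Y'\<close> across \<open>Gop t\<close> leaves four pairings, two of
  them with commutators that have the same order as \<open>Gop\<close>. The condition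
  \<open>2 * dl <= eps\<close> is what the pairings with \<open>Y v\<close> and \<open>Y' v\<close>
  require. The term \<open>main\<close> with \<open>X' v\<close> is left to the caller, since
  \<open>L' v\<close> is not controlled in the case \<open>X = L\<close>.\<close>

lemma dominated_sq_commutator:
 assumes K: "FO X" "FO X'" "adjoint X X'" "FO Y" "FO Y'" "adjoint Y Y'"
  and dl: "2 * dl <= eps" "eps <= 1"
  and d0: "Qdom s beta (%t v. v) G"
  and dX: "Qdom s beta (%t v. X v) G"
  and dY: "Qdom (s + eps - 1) beta (%t v. Y v) G" "Qdom (s + eps - 1) beta (%t v. Y' v) G"
  and main: "dominated (%t v. cmod (ip (Y v) (Lop (wt (2 * s + 2 * dl - 2) (2 * beta) t) (cm X Y (X' v))))) G"
 shows "Qdom (s + dl - 1) beta (%t v. cm X Y v) G"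
proof -
 define Gop where "Gop = (%t v. Lop (wt (2 * s + 2 * dl - 2) (2 * beta) t) (cm X Y v))"
 have FOK: "FO (cm X Y)" by (rule FO_cm[OF K(1,4)])
 have bG: "bd (wt (2 * s + 2 * dl - 2 + 1) (2 * beta)) Gop" unfolding Gop_def by (rule bd_Lop_FO[OF FOK])
 have bcG: "bd (wt (2 * s + 2 * dl - 2 + 1) (2 * beta)) (%t. cm P (Gop t))" if "FO P" for P
  unfolding Gop_def by (rule bd_cm_Lop_FO[OF that FOK])
 have main': "dominated (%t v. cmod (ip (Y v) (Gop t (X' v)))) G"
  using main by (simp add: Gop_def)
 have rpY: "rp (%t v. Y v)" "rp (%t v. Y' v)" "rp (%t v. X v)" "rp (%t v. X' v)"
  using K by (auto intro: rp_FO rp_id)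
 have 2: "dominated (%t v. cmod (ip (Y v) (cm X' (Gop t) v))) G"
  by (rule dominated_ip[OF rpY(1) rp_bd[OF bcG[OF K(2)] rp_id] dY(1)], rule Q_bd[OF bcG[OF K(2)] rp_id],
    rule Q_mono[OF d0 _ _ rp_id]) (use dl in auto)
 have 3: "dominated (%t v. cmod (ip (X v) (Gop t (Y' v)))) G"
  by (rule dominated_ip[OF rpY(3) rp_bd[OF bG rpY(2)] dX], rule Q_bd[OF bG rpY(2)],
    rule Q_mono[OF dY(2) _ _ rpY(2)]) (use dl in auto)
 have 4: "dominated (%t v. cmod (ip (X v) (cm Y' (Gop t) v))) G"
  by (rule dominated_ip[OF rpY(3) rp_bd[OF bcG[OF K(5)] rp_id] dX], rule Q_bd[OF bcG[OF K(5)] rp_id],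
    rule Q_mono[OF d0 _ _ rp_id]) (use dl in auto)
 show ?thesis
 proof (rule dominated_cong[OF dominated_cmod_diff[OF dominated_cmod_add[OF main' 2] dominated_cmod_add[OF 3 4]]])
  fix t :: real and v :: "'a seq" assume tv: "t : UI" "rapid v"
  have rG: "rapid (Gop t u)" if "rapid u" for u by (rule bd_rapid[OF bG tv(1) that])
  have r: "rapid (X v)" "rapid (X' v)" "rapid (Y v)" "rapid (Y' v)" "rapid (X (Y v))" "rapid (Y (X v))"
   using K tv by (simp_all add: FO_rapid)
  have r': "rapid (X' (Gop t v))" "rapid (Y' (Gop t v))" using K rG tv by (simp_all add: FO_rapid)
  have "of_real (Q (s + dl - 1) beta (%t v. cm X Y v) t v) = ip (cm X Y v) (Gop t v)"
   unfolding Q_def Gop_def using sq_wt_ip[OF FO_rapid[OF FOK tv(2)] tv(1), of "s + dl - 1" beta]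
   by (simp add: algebra_simps)
  also have "... = ip (X (Y v)) (Gop t v) - ip (Y (X v)) (Gop t v)"
   unfolding cm_def[of X Y, abs_def] by (rule ip_diff_left) (use r rG tv in auto)
  also have "... = ip (Y v) (X' (Gop t v)) - ip (X v) (Y' (Gop t v))"
   using adjointD[OF K(3) r(3) rG[OF tv(2)]] adjointD[OF K(6) r(1) rG[OF tv(2)]] by simp
  also have "ip (Y v) (X' (Gop t v)) = ip (Y v) (Gop t (X' v)) + ip (Y v) (cm X' (Gop t) v)"
  proof -
   have "X' (Gop t v) = (%k. Gop t (X' v) k + cm X' (Gop t) v k)" by (simp add: cm_def fun_eq_iff)
   thus ?thesis using r rG r' by (simp only:) (subst ip_add_right, simp_all add: cm_def[abs_def] rapid_diff)
  qed
  also have "ip (X v) (Y' (Gop t v)) = ip (X v) (Gop t (Y' v)) + ip (X v) (cm Y' (Gop t) v)"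
  proof -
   have "Y' (Gop t v) = (%k. Gop t (Y' v) k + cm Y' (Gop t) v k)" by (simp add: cm_def fun_eq_iff)
   thus ?thesis using r rG r' by (simp only:) (subst ip_add_right, simp_all add: cm_def[abs_def] rapid_diff)
  qed
  finally show "Q (s + dl - 1) beta (%t v. cm X Y v) t v =
   cmod ((ip (Y v) (Gop t (X' v)) + ip (Y v) (cm X' (Gop t) v)) - (ip (X v) (Gop t (Y' v)) + ip (X v) (cm Y' (Gop t) v)))"
   unfolding Q_def by (rule cmod_of_real_sq)
 qed
qed

section \<open>The energy identity and its applications\<close>

context
  fixes Z Z' :: "'i => 'm::finite seq => 'm seq"
  and J :: "'i set" and L L' E :: "'m seq => 'm seq"
 assumes J: "finite J" and Z: "!!j. j : J ==> FO (Z j)" "!!j. j : J ==> FO (Z' j)" "!!j. j : J ==> adjoint (Z j) (Z' j)"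
  and L: "FO L" "FO L'" "adjoint L L'"
  and E: "!!v k. E v k = (SUM j:J. cm (Z j) (Z' j) v k) - L v k - L' v k"
begin

text \<open>For each \<open>j\<close> the squared norms of \<open>Z' j w\<close> and
  \<open>Z j w\<close> differ by the pairing of the commutator with \<open>w\<close>, and the
  commutators add up to \<open>E + L + L'\<close>. The pairings with \<open>L\<close> and
  \<open>L'\<close> are conjugate to each other, whence the factor 2.\<close>

lemma energy_identity:
 assumes w: "rapid w"
 shows "(SUM j:J. sq (%k. 1) (Z' j w)) <= (SUM j:J. sq (%k. 1) (Z j w)) + cmod (ip (E w) w) + 2 * cmod (ip (L w) w)"
proof -
 have sumip: "finite J ==> (!!j. j : J ==> rapid (f j)) ==> rapid (%k. SUM j:J. f j k) &
   ip (%k. SUM j:J. f j k) w = (SUM j:J. ip (f j) w)" for f and J :: "'i set"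
 proof (induction J rule: finite_induct)
  case empty
  thus ?case by (simp add: rapid_zero ip_def)
 next
  case (insert j J)
  thus ?case by (simp add: ip_add_left w rapid_add)
 qed
 have each: "of_real (sq (%k. 1) (Z' j w)) = of_real (sq (%k. 1) (Z j w)) + ip (cm (Z j) (Z' j) w) w" if j: "j : J" for j
 proof -
  have r: "rapid (Z' j w)" "rapid (Z j w)" "rapid (Z j (Z' j w))" "rapid (Z' j (Z j w))"
   using Z j w by (simp_all add: FO_rapid)
  have "of_real (sq (%k. 1) (Z' j w)) = ip (Z j (Z' j w)) w"
   using adjointD[OF Z(3)[OF j] r(1) w] by (simp add: sq_one_ip r)
  moreover have "of_real (sq (%k. 1) (Z j w)) = ip (Z' j (Z j w)) w"
   using adjointD[OF adjoint_sym[OF Z(3)[OF j]] r(2) w] by (simp add: sq_one_ip r)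
  ultimately show ?thesis unfolding cm_def[abs_def] by (simp add: ip_diff_left r w)
 qed
 have rE: "rapid (E w)" "rapid (L w)" "rapid (L' w)"
  and rc: "!!j. j : J ==> rapid (cm (Z j) (Z' j) w)"
 proof -
  show rc: "!!j. j : J ==> rapid (cm (Z j) (Z' j) w)" using Z w by (simp add: FO_rapid FO_cm)
  show "rapid (L w)" "rapid (L' w)" using L w by (simp_all add: FO_rapid)
  thus "rapid (E w)" unfolding E[abs_def] using sumip[OF J, of "%j. cm (Z j) (Z' j) w"] rc by (intro rapid_diff) auto
 qed
 have "(%k. SUM j:J. cm (Z j) (Z' j) w k) = (%k. (E w k + L w k) + L' w k)"
  by (simp add: E fun_eq_iff)
 hence "(SUM j:J. ip (cm (Z j) (Z' j) w) w) = ip (E w) w + ip (L w) w + ip (L' w) w"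
  using sumip[OF J, of "%j. cm (Z j) (Z' j) w"] rc rE w by (simp add: ip_add_left rapid_add)
 moreover have "ip (L' w) w = cnj (ip (L w) w)"
  using adjointD[OF adjoint_sym[OF L(3)] w w] by (simp add: ip_cnj)
 ultimately have "of_real (SUM j:J. sq (%k. 1) (Z' j w)) =
   of_real (SUM j:J. sq (%k. 1) (Z j w)) + (ip (E w) w + (ip (L w) w + cnj (ip (L w) w)))"
  by (simp add: each sum.distrib)
 from arg_cong[OF this, of Re] have "(SUM j:J. sq (%k. 1) (Z' j w)) =
   (SUM j:J. sq (%k. 1) (Z j w)) + (Re (ip (E w) w) + 2 * Re (ip (L w) w))"
  by simp
 moreover have "Re (ip (E w) w) <= cmod (ip (E w) w)" "Re (ip (L w) w) <= cmod (ip (L w) w)"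
  by (rule complex_Re_le_cmod)+
 ultimately show ?thesis by linarith
qed

lemma dominated_energy:
 assumes w: "rp w"
  and dZ: "!!j. j : J ==> Qdom 0 0 (%t v. Z j (w t v)) G"
  and dE: "dominated (%t v. cmod (ip (E (w t v)) (w t v))) G"
  and dL: "dominated (%t v. cmod (ip (L (w t v)) (w t v))) G"
  and i: "i : J"
 shows "Qdom 0 0 (%t v. Z' i (w t v)) G"
proof (rule dominated_le)
 show "dominated (%t v. (SUM j:J. Q 0 0 (%t v. Z j (w t v)) t v) +
   (cmod (ip (E (w t v)) (w t v)) + (cmod (ip (L (w t v)) (w t v)) + cmod (ip (L (w t v)) (w t v))))) G"
  by (intro dominated_add dominated_sum J dZ dE dL)
 fix t :: real and v :: "'m seq" assume tv: "t : UI" "rapid v"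
 have "Q 0 0 (%t v. Z' i (w t v)) t v = sq (%k. 1) (Z' i (w t v))" using tv by (simp add: Q_00)
 also have "... <= (SUM j:J. sq (%k. 1) (Z' j (w t v)))"
  by (rule member_le_sum[OF i]) (auto simp: J)
 also have "... <= (SUM j:J. sq (%k. 1) (Z j (w t v))) + cmod (ip (E (w t v)) (w t v)) + 2 * cmod (ip (L (w t v)) (w t v))"
  by (rule energy_identity[OF rpD[OF w tv]])
 finally show "Q 0 0 (%t v. Z' i (w t v)) t v <= 1 * ((SUM j:J. Q 0 0 (%t v. Z j (w t v)) t v) +
   (cmod (ip (E (w t v)) (w t v)) + (cmod (ip (L (w t v)) (w t v)) + cmod (ip (L (w t v)) (w t v)))))"
  using tv by (simp add: Q_00)
qed simp

text \<open>Apply the energy identity to \<open>w\<close>, the sequence \<open>v\<close> with a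
  weight of order \<open>s\<close>. Every term on the right is a norm of order \<open>s\<close> that
  is already controlled, so nothing is lost.\<close>

lemma estimate_full:
 assumes E2: "FO E"
  and d0: "Qdom s beta (%t v. v) G"
  and dZ: "!!j. j : J ==> Qdom s beta (%t v. Z j v) G"
  and dL: "Qdom s beta (%t v. L v) G" and dE: "Qdom s beta (%t v. E v) G"
  and i: "i : J"
 shows "Qdom s beta (%t v. Z' i v) G"
proof -
 define w where "w = (%t v. Lop (wt s beta t) v :: 'm seq)"
 have w: "rp w" unfolding w_def by (rule rp_Lop[OF rp_id])
 have w0: "Qdom 0 0 w G" unfolding w_def by (rule Q_Lop) (use d0 in simp)
 have P: "Qdom 0 0 (%t v. P (w t v)) G" if "FO P" "Qdom s beta (%t v. P v) G" for P
  unfolding w_def by (rule Q_FO_Lop[OF that(1) rp_id]) (use that d0 in auto)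
 have ipP: "dominated (%t v. cmod (ip (P (w t v)) (w t v))) G" if "FO P" "Qdom s beta (%t v. P v) G" for P
  by (rule dominated_ip[OF rp_FO[OF that(1) w] w P[OF that]]) (use w0 in simp)
 have "Qdom 0 0 (%t v. Z' i (w t v)) G"
  by (rule dominated_energy[OF w _ ipP[OF E2 dE] ipP[OF L(1) dL] i]) (auto intro: P Z dZ)
 hence "Qdom 0 0 (%t v. Lop (wt s beta t) (Z' i v)) G"
  unfolding w_def by (intro Q_Lop_FO_reverse[OF Z(2)[OF i] rp_id]) (use d0 in auto)
 thus ?thesis
  by (rule dominated_cong) (simp add: Q_def sq_Lop_wt)
qed

text \<open>To obtain the term \<open>main\<close> of \<open>dominated_sq_commutator\<close>,
  \<open>L'\<close> is replaced by the commutators of \<open>Z j\<close> and \<open>Z' j\<close>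
  minus \<open>L\<close> and \<open>E\<close>. In the commutator terms one factor is moved onto
  \<open>Y v\<close>; the resulting \<open>Z' j w\<close> and \<open>Z j w\<close> are bounded by
  the energy identity for \<open>w\<close>.\<close>

lemma estimate_drift:
 assumes E2: "FO E"
  and Y: "FO Y" "FO Y'" "adjoint Y Y'"
  and dl: "0 <= dl" "4 * dl <= eps" "eps <= 1"
  and d0: "Qdom s beta (%t v. v) G"
  and dZ: "!!j. j : J ==> Qdom s beta (%t v. Z j v) G" "!!j. j : J ==> Qdom s beta (%t v. Z' j v) G"
  and dL: "Qdom s beta (%t v. L v) G" and dE: "Qdom s beta (%t v. E v) G"
  and dY: "Qdom (s + eps - 1) beta (%t v. Y v) G" "Qdom (s + eps - 1) beta (%t v. Y' v) G"
  and dYZ: "!!j. j : J ==> Qdom (s + eps - 1) beta (%t v. Y (Z j v)) G"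
 shows "Qdom (s + dl - 1) beta (%t v. cm L Y v) G"
proof (rule dominated_sq_commutator[OF L Y _ dl(3) d0 dL dY])
 show "2 * dl <= eps" using dl by simp
 define Gop where "Gop = (%t v. Lop (wt (2 * s + 2 * dl - 2) (2 * beta) t) (cm L Y v))"
 \<comment> \<open>The order \<open>s + 2 * dl - 1\<close> is a balance: \<open>w\<close> has order
   \<open>2 * dl\<close> as soon as \<open>4 * dl <= eps\<close>, and \<open>P w\<close> has order
   \<open>- 2 * dl\<close> for every first-order \<open>P\<close> with \<open>P v\<close> of order
   \<open>s\<close>, so the two can be paired.\<close>
 define w where "w = (%t v. Lop (wt (s + 2 * dl - 1) beta t) (Y v))"
 have FOK: "FO (cm L Y)" by (rule FO_cm[OF L(1) Y(1)])
 have bG: "bd (wt (2 * s + 2 * dl - 2 + 1) (2 * beta)) Gop" unfolding Gop_def by (rule bd_Lop_FO[OF FOK])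
 have bcG: "bd (wt (2 * s + 2 * dl - 2 + 1) (2 * beta)) (%t. cm P (Gop t))" if "FO P" for P
  unfolding Gop_def by (rule bd_cm_Lop_FO[OF that FOK])
 have bw: "bd (wt (s + 2 * dl - 1 + 1) beta) w" unfolding w_def by (rule bd_Lop_FO[OF Y(1)])
 have bcw: "bd (wt (s + 2 * dl - 1 + 1) beta) (%t. cm P (w t))" if "FO P" for P
  unfolding w_def by (rule bd_cm_Lop_FO[OF that Y(1)])
 have bccw: "bd (wt (s + 2 * dl - 1 + 1) beta) (%t. cm P' (cm P (w t)))" if "FO P'" "FO P" for P P'
  unfolding w_def by (rule bd_cm_cm_Lop_FO[OF that Y(1)])
 have rpw: "rp w" using rp_bd[OF bw rp_id] by simp
 have rpY: "rp (%t v. Y v)" by (rule rp_FO[OF Y(1) rp_id])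
 have rpZ: "rp (%t v. Z j v)" "rp (%t v. Z' j v)" if "j : J" for j
  using rp_FO[OF Z(1)[OF that] rp_id] rp_FO[OF Z(2)[OF that] rp_id] by auto
 have w2: "Qdom (2 * dl) 0 w G"
  unfolding w_def by (rule Q_Lop, rule Q_mono[OF dY(1) _ _ rpY]) (use dl in auto)
 have ipw: "dominated (%t v. cmod (ip (B t v) (w t v))) G"
  if "rp B" "Qdom (- (2 * dl)) 0 B G" for B
 proof (rule dominated_cong[OF dominated_ip[OF rpw that(1) w2]])
  show "Qdom (- (2 * dl)) (- 0) B G" using that by simp
  show "cmod (ip (B t v) (w t v)) = cmod (ip (w t v) (B t v))" for t v
   by (metis complex_mod_cnj ip_cnj)
 qed
 have ipPw: "dominated (%t v. cmod (ip (P (w t v)) (w t v))) G"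
  if P: "FO P" "Qdom s beta (%t v. P v) G" for P
 proof (rule ipw[OF rp_FO[OF P(1) rpw]])
  have rpP: "rp (%t v. P v)" by (rule rp_FO[OF P(1) rp_id])
  have 1: "Qdom (- (2 * dl)) 0 (%t v. w t (P v)) G"
   by (rule Q_bd[OF bw rpP]) (use P in simp)
  have 2: "Qdom (- (2 * dl)) 0 (%t v. cm P (w t) v) G"
   by (rule Q_bd[OF bcw[OF P(1)] rp_id]) (use d0 in simp)
  show "Qdom (- (2 * dl)) 0 (%t v. P (w t v)) G"
   by (rule Q_cong[OF Q_add[OF 1 2 rp_bd[OF bw rpP] rp_bd[OF bcw[OF P(1)] rp_id]]]) (simp add: cm_def fun_eq_iff)
 qed
 \<comment> \<open>Commuting \<open>Z j\<close> with \<open>w t\<close> gives a main part containing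
   \<open>Y (Z j v)\<close>, which is controlled by \<open>dYZ\<close>. The commutator part is
   paired with \<open>u\<close> and \<open>Z j\<close> is integrated by parts once more; this
   produces the double commutator.\<close>
 have Zw: "Qdom 0 0 (%t v. Z j (w t v)) G" if j: "j : J" for j
 proof -
  note FZ = Z(1)[OF j] Z(2)[OF j]
  have rp1: "rp (%t v. w t (Z j v))" by (rule rp_bd[OF bw rpZ(1)[OF j]])
  have rp2: "rp (%t v. cm (Z j) (w t) v)" by (rule rp_bd[OF bcw[OF FZ(1)] rp_id])
  have 1: "Qdom 0 0 (%t v. w t (Z j v)) G"
   unfolding w_def by (rule Q_Lop, rule Q_mono[OF dYZ[OF j] _ _ rp_FO[OF Y(1) rpZ(1)[OF j]]]) (use dl in auto)
  have 2: "dominated (%t v. cmod (ip (cm (Z j) (w t) (Z' j v)) (w t v))) G"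
   by (rule ipw[OF rp_bd[OF bcw[OF FZ(1)] rpZ(2)[OF j]]], rule Q_bd[OF bcw[OF FZ(1)] rpZ(2)[OF j]])
    (use dZ(2)[OF j] in simp)
  have 3: "dominated (%t v. cmod (ip (cm (Z' j) (cm (Z j) (w t)) v) (w t v))) G"
   by (rule ipw[OF rp_bd[OF bccw[OF FZ(2,1)] rp_id]], rule Q_bd[OF bccw[OF FZ(2,1)] rp_id])
    (use d0 in simp)
  show ?thesis
  proof (rule dominated_le[OF dominated_add[OF 1 dominated_add[OF 2 3]], of 4])
   fix t :: real and v :: "'m seq" assume tv: "t : UI" "rapid v"
   note r = rpD[OF rpw tv] rpD[OF rp1 tv] rpD[OF rp2 tv]
   define u where "u = Z j (w t v)"
   have ru: "rapid u" unfolding u_def by (rule FO_rapid[OF FZ(1) r(1)])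
   have eq: "u = (%k. w t (Z j v) k + cm (Z j) (w t) v k)" by (simp add: u_def cm_def fun_eq_iff)
   have rr: "rapid (cm (Z j) (w t) (Z' j v))" "rapid (cm (Z' j) (cm (Z j) (w t)) v)"
    using bd_rapid[OF bcw[OF FZ(1)] tv(1) FO_rapid[OF FZ(2) tv(2)]] bd_rapid[OF bccw[OF FZ(2,1)] tv] by auto
   have "ip (cm (Z j) (w t) v) u = ip (Z' j (cm (Z j) (w t) v)) (w t v)"
    unfolding u_def using adjointD[OF adjoint_sym[OF Z(3)[OF j]] r(3) r(1)] by simp
   also have "Z' j (cm (Z j) (w t) v) = (%k. cm (Z j) (w t) (Z' j v) k + cm (Z' j) (cm (Z j) (w t)) v k)"
    by (simp add: cm_def[of "Z' j"] fun_eq_iff)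
   finally have e: "ip (cm (Z j) (w t) v) u =
     ip (cm (Z j) (w t) (Z' j v)) (w t v) + ip (cm (Z' j) (cm (Z j) (w t)) v) (w t v)"
    by (simp add: ip_add_left rr r)
   have "of_real (sq (%k. 1) u) = ip u u" by (rule sq_one_ip[OF ru])
   also have "... = ip (w t (Z j v)) u + ip (cm (Z j) (w t) v) u"
    by (subst (1) eq) (rule ip_add_left[OF r(2,3) ru])
   finally have "sq (%k. 1) u = cmod (ip (w t (Z j v)) u + ip (cm (Z j) (w t) v) u)"
    by (rule cmod_of_real_sq)
   also have "... <= cmod (ip (w t (Z j v)) u) + (cmod (ip (cm (Z j) (w t) (Z' j v)) (w t v)) +
     cmod (ip (cm (Z' j) (cm (Z j) (w t)) v) (w t v)))"
    unfolding e by (intro order_trans[OF norm_triangle_ineq] add_left_mono norm_triangle_ineq)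
   \<comment> \<open>The factor \<open>1 / 2\<close> lets \<open>sq u\<close> be absorbed on the
     left, which explains the constant 4.\<close>
   also have "cmod (ip (w t (Z j v)) u) <= 2 * sq (%k. 1) (w t (Z j v)) + (1 / 2) * sq (%k. 1 / 1) u"
    using r ru by (intro norm_ip_le) (auto simp: Hs_one)
   finally show "Q 0 0 (%t v. Z j (w t v)) t v <= 4 * (Q 0 0 (%t v. w t (Z j v)) t v +
    (cmod (ip (cm (Z j) (w t) (Z' j v)) (w t v)) + cmod (ip (cm (Z' j) (cm (Z j) (w t)) v) (w t v))))"
    using tv norm_ge_zero[of "ip (cm (Z j) (w t) (Z' j v)) (w t v)"]
     norm_ge_zero[of "ip (cm (Z' j) (cm (Z j) (w t)) v) (w t v)"]
    by (simp add: Q_00 u_def del: norm_ge_zero)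
  qed simp
 qed
 have Z'w: "Qdom 0 0 (%t v. Z' j (w t v)) G" if j: "j : J" for j
  by (rule dominated_energy[OF rpw Zw ipPw[OF E2 dE] ipPw[OF L(1) dL] j])
 have T1: "dominated (%t v. cmod (ip (Y v) (Gop t (P v)))) G"
  if P: "FO P" "Qdom s beta (%t v. P v) G" for P
 proof -
  have rpP: "rp (%t v. P v)" by (rule rp_FO[OF P(1) rp_id])
  show ?thesis
   by (rule dominated_ip[OF rpY rp_bd[OF bG rpP] dY(1)], rule Q_bd[OF bG rpP],
     rule Q_mono[OF P(2) _ _ rpP]) (use dl in auto)
 qed
 \<comment> \<open>Here \<open>Gop\<close> is split into two factors, one of which turns \<open>Y v\<close> into \<open>w\<close>.\<close>
 have T2: "dominated (%t v. cmod (ip (Y v) (Gop t (P (P' v))))) G"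
  if P: "FO P" "FO P'" "adjoint P P'" and dP: "Qdom s beta (%t v. P' v) G"
   and Pw: "Qdom 0 0 (%t v. P' (w t v)) G" for P P'
 proof -
  define H where "H = (%t v. Lop (wt (s - 1) beta t) (cm L Y v))"
  have bH: "bd (wt (s - 1 + 1) beta) H" unfolding H_def by (rule bd_Lop_FO[OF FOK])
  have rpP': "rp (%t v. P' v)" by (rule rp_FO[OF P(2) rp_id])
  have rp1: "rp (%t v. Lop (wt (s + 2 * dl - 1) beta t) (P' (Y v)))" by (rule rp_Lop[OF rp_FO[OF P(2) rpY]])
  have rp2: "rp (%t v. H t (P' v))" by (rule rp_bd[OF bH rpP'])
  have 1: "Qdom 0 0 (%t v. Lop (wt (s + 2 * dl - 1) beta t) (P' (Y v))) G"
   by (rule Q_Lop_FO_reverse[OF P(2) rpY Pw[unfolded w_def]], rule Q_mono[OF dY(1) _ _ rpY]) (use dl in auto)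
  have 2: "Qdom 0 0 (%t v. H t (P' v)) G"
   by (rule Q_bd[OF bH rpP']) (use dP in simp)
  have A: "dominated (%t v. cmod (ip (Lop (wt (s + 2 * dl - 1) beta t) (P' (Y v))) (H t (P' v)))) G"
   by (rule dominated_ip[OF rp1 rp2 1]) (use 2 in simp)
  have B: "dominated (%t v. cmod (ip (Y v) (cm P (Gop t) (P' v)))) G"
   by (rule dominated_ip[OF rpY rp_bd[OF bcG[OF P(1)] rpP'] dY(1)], rule Q_bd[OF bcG[OF P(1)] rpP'],
     rule Q_mono[OF dP _ _ rpP']) (use dl in auto)
  show ?thesis
  proof (rule dominated_cong[OF dominated_cmod_diff[OF A B]])
   fix t :: real and v :: "'m seq" assume tv: "t : UI" "rapid v"
   have r: "rapid (Y v)" "rapid (P' v)" "rapid (P' (Y v))" "rapid (P (P' v))"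
    using Y P tv by (simp_all add: FO_rapid)
   have rG: "rapid (Gop t u)" if "rapid u" for u by (rule bd_rapid[OF bG tv(1) that])
   have "Gop t (P (P' v)) = (%k. P (Gop t (P' v)) k - cm P (Gop t) (P' v) k)"
    by (simp add: cm_def fun_eq_iff)
   hence "ip (Y v) (Gop t (P (P' v))) = ip (Y v) (P (Gop t (P' v))) - ip (Y v) (cm P (Gop t) (P' v))"
    using r rG P by (simp only:) (subst ip_diff_right, simp_all add: cm_def[abs_def] rapid_diff FO_rapid)
   also have "ip (Y v) (P (Gop t (P' v))) = ip (P' (Y v)) (Gop t (P' v))"
    using adjointD[OF adjoint_sym[OF P(3)] r(1) rG[OF r(2)]] by simp
   also have "Gop t (P' v) = Lop (wt (s + 2 * dl - 1) beta t) (H t (P' v))"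
   proof -
    have "s + 2 * dl - 1 + (s - 1) = 2 * s + 2 * dl - 2" "beta + beta = 2 * beta" by auto
    thus ?thesis
     unfolding Gop_def H_def Lop_wt_Lop_wt[OF tv(1), of "s + 2 * dl - 1" beta "s - 1" beta]
     by (simp add: algebra_simps)
   qed
   finally show "cmod (ip (Y v) (Gop t (P (P' v)))) =
     cmod (ip (Lop (wt (s + 2 * dl - 1) beta t) (P' (Y v))) (H t (P' v)) - ip (Y v) (cm P (Gop t) (P' v)))"
    by (simp add: ip_Lop)
  qed
 qed
 have "dominated (%t v. cmod (ip (Y v) (Gop t (L' v)))) G"
 proof (rule dominated_le)
  show "dominated (%t v. (SUM j:J. cmod (ip (Y v) (Gop t (Z j (Z' j v)))) + cmod (ip (Y v) (Gop t (Z' j (Z j v))))) +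
    (cmod (ip (Y v) (Gop t (L v))) + cmod (ip (Y v) (Gop t (E v))))) G"
  proof (rule dominated_add[OF dominated_sum[OF J] dominated_add[OF T1[OF L(1) dL] T1[OF E2 dE]]])
   fix j assume j: "j : J"
   show "dominated (%t v. cmod (ip (Y v) (Gop t (Z j (Z' j v)))) + cmod (ip (Y v) (Gop t (Z' j (Z j v))))) G"
    by (rule dominated_add[OF T2[OF Z[OF j] dZ(2)[OF j] Z'w[OF j]]
       T2[OF Z(2,1)[OF j] adjoint_sym[OF Z(3)[OF j]] dZ(1)[OF j] Zw[OF j]]])
  qed
  fix t :: real and v :: "'m seq" assume tv: "t : UI" "rapid v"
  have rG: "rapid (Gop t u)" if "rapid u" for u by (rule bd_rapid[OF bG tv(1) that])
  have Gadd: "Gop t (%k. a k + b k) = (%k. Gop t a k + Gop t b k)"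
   "Gop t (%k. a k - b k) = (%k. Gop t a k - Gop t b k)" if "rapid a" "rapid b" for a b
   unfolding Gop_def using that
   by (simp_all add: lin_op_add[OF FO_lin[OF FOK]] lin_op_diff[OF FO_lin[OF FOK]] rapid_imp_temp Lop_add Lop_diff)
  have G0: "Gop t (%k. 0) = (%k. 0)"
   using Gadd(2)[of "%k. 0" "%k. 0"] by (simp add: rapid_zero)
  have Y: "rapid (Y v)" using Y tv by (simp add: FO_rapid)
  have sumG: "finite J ==> (!!j. j : J ==> rapid (f j)) ==> rapid (%k. SUM j:J. f j k) &
   ip (Y v) (Gop t (%k. SUM j:J. f j k)) = (SUM j:J. ip (Y v) (Gop t (f j)))" for f and J :: "'i set"
  proof (induction J rule: finite_induct)
   case empty
   thus ?case by (simp add: rapid_zero G0 ip_def)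
  next
   case (insert j J)
   thus ?case by (simp add: Gadd ip_add_right rapid_add Y rG)
  qed
  have rc: "rapid (Z j (Z' j v))" "rapid (Z' j (Z j v))" if "j : J" for j
   using Z[OF that] tv by (simp_all add: FO_rapid)
  have rcm: "rapid (cm (Z j) (Z' j) v)" if "j : J" for j
   using Z[OF that] tv by (simp add: FO_rapid FO_cm)
  have rL: "rapid (L v)" "rapid (E v)" using L E2 tv by (simp_all add: FO_rapid)
  have "L' v = (%k. (SUM j:J. cm (Z j) (Z' j) v k) - L v k - E v k)" by (simp add: E fun_eq_iff)
  hence "ip (Y v) (Gop t (L' v)) = (SUM j:J. ip (Y v) (Gop t (cm (Z j) (Z' j) v))) -
    ip (Y v) (Gop t (L v)) - ip (Y v) (Gop t (E v))"
   using sumG[OF J, of "%j. cm (Z j) (Z' j) v"] rcm rL Y rG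
   by (simp add: Gadd ip_diff_right rapid_diff)
  also have "(SUM j:J. ip (Y v) (Gop t (cm (Z j) (Z' j) v))) =
    (SUM j:J. ip (Y v) (Gop t (Z j (Z' j v))) - ip (Y v) (Gop t (Z' j (Z j v))))"
   unfolding cm_def[abs_def] by (intro sum.cong refl) (simp add: Gadd rc ip_diff_right Y rG)
  finally have "cmod (ip (Y v) (Gop t (L' v))) <=
    cmod (SUM j:J. ip (Y v) (Gop t (Z j (Z' j v))) - ip (Y v) (Gop t (Z' j (Z j v)))) +
    cmod (ip (Y v) (Gop t (L v))) + cmod (ip (Y v) (Gop t (E v)))"
   by (metis (no_types, lifting) add_right_mono norm_triangle_ineq4 order_trans)
  also have "cmod (SUM j:J. ip (Y v) (Gop t (Z j (Z' j v))) - ip (Y v) (Gop t (Z' j (Z j v)))) <=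
    (SUM j:J. cmod (ip (Y v) (Gop t (Z j (Z' j v)))) + cmod (ip (Y v) (Gop t (Z' j (Z j v)))))"
   by (intro sum_norm_le norm_triangle_ineq4)
  finally show "cmod (ip (Y v) (Gop t (L' v))) <=
   1 * ((SUM j:J. cmod (ip (Y v) (Gop t (Z j (Z' j v)))) + cmod (ip (Y v) (Gop t (Z' j (Z j v))))) +
    (cmod (ip (Y v) (Gop t (L v))) + cmod (ip (Y v) (Gop t (E v)))))"
   by simp
 qed simp
 thus "dominated (%t v. cmod (ip (Y v) (Lop (wt (2 * s + 2 * dl - 2) (2 * beta) t) (cm L Y (L' v))))) G"
  by (simp add: Gop_def)
qed

end

text \<open>A single field without drift, so that the whole commutator is the error
  \<open>E\<close>. With a weight of order \<open>s - 1/2\<close> the sequence \<open>w\<close> has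
  half a derivative to spare, and \<open>cm Z Z'\<close>, of order one, uses half a derivative on
  each side of the pairing.\<close>

lemma estimate_half:
 fixes Z Z' :: "'m::finite seq => 'm seq"
 assumes Z: "FO Z" "FO Z'" "adjoint Z Z'"
  and d0: "Qdom s beta (%t v. v) G"
  and dZ: "Qdom (s - 1/2) beta (%t v. Z v) G"
 shows "Qdom (s - 1/2) beta (%t v. Z' v) G"
proof -
 define w where "w = (%t v. Lop (wt (s - 1/2) beta t) v :: 'm seq)"
 have w: "rp w" unfolding w_def by (rule rp_Lop[OF rp_id])
 have d0': "Qdom (s - 1/2) beta (%t v. v) G" by (rule Q_mono[OF d0 _ _ rp_id]) auto
 have *: "Qdom 0 0 (%t v. Z (w t v)) G"
  unfolding w_def by (rule Q_FO_Lop[OF Z(1) rp_id]) (use dZ d0' in auto)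
 have wh: "Qdom (1/2) 0 w G" unfolding w_def by (rule Q_Lop) (use d0 in simp)
 have FOc: "FO (cm Z Z')" by (rule FO_cm[OF Z(1,2)])
 have "Qdom 0 0 (%t v. Z' (w t v)) G"
 proof (rule dominated_energy[where J = "{()}" and Z = "%_. Z" and Z' = "%_. Z'" and L = "%v k. 0" and L' = "%v k. 0"
    and E = "cm Z Z'" and i = "()"])
  show "adjoint (%v k. 0) (%v k. 0 :: complex)" by (simp add: adjoint_def ip_def)
  show "dominated (%t v. cmod (ip (%k. 0) (w t v))) G" by (rule dominatedI[of 0]) (auto simp: ip_def)
  show "dominated (%t v. cmod (ip (cm Z Z' (w t v)) (w t v))) G"
  proof (rule dominated_ip[OF rp_FO[OF FOc w] w])
   show "Qdom (- 1/2) 0 (%t v. cm Z Z' (w t v)) G"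
    by (rule Q_FO[OF FOc w]) (use wh in simp)
   show "Qdom (- (- 1/2)) (- 0) w G" using wh by simp
  qed
 qed (use Z w * in "auto simp: FO_zero")
 hence "Qdom 0 0 (%t v. Lop (wt (s - 1/2) beta t) (Z' v)) G"
  unfolding w_def by (intro Q_Lop_FO_reverse[OF Z(2) rp_id]) (use d0' in auto)
 thus ?thesis
  by (rule dominated_cong) (simp add: Q_def sq_Lop_wt)
qed

text \<open>Here \<open>X' v\<close> is controlled like \<open>X v\<close>, so the remaining pairing
  is bounded directly.\<close>

lemma estimate_commutator:
 assumes K: "FO X" "FO X'" "adjoint X X'" "FO Y" "FO Y'" "adjoint Y Y'"
  and dl: "2 * dl <= eps" "eps <= 1"
  and d0: "Qdom s beta (%t v. v) G"
  and dX: "Qdom s beta (%t v. X v) G" "Qdom s beta (%t v. X' v) G"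
  and dY: "Qdom (s + eps - 1) beta (%t v. Y v) G" "Qdom (s + eps - 1) beta (%t v. Y' v) G"
 shows "Qdom (s + dl - 1) beta (%t v. cm X Y v) G"
proof (rule dominated_sq_commutator[OF K dl d0 dX(1) dY])
 have bG: "bd (wt (2 * s + 2 * dl - 2 + 1) (2 * beta)) (%t v. Lop (wt (2 * s + 2 * dl - 2) (2 * beta) t) (cm X Y v))"
  by (rule bd_Lop_FO[OF FO_cm[OF K(1,4)]])
 have rp: "rp (%t v. Y v)" "rp (%t v. X' v)" using K by (auto intro: rp_FO rp_id)
 show "dominated (%t v. cmod (ip (Y v) (Lop (wt (2 * s + 2 * dl - 2) (2 * beta) t) (cm X Y (X' v))))) G"
  by (rule dominated_ip[OF rp(1) rp_bd[OF bG rp(2)] dY(1)], rule Q_bd[OF bG rp(2)],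
    rule Q_mono[OF dX(2) _ _ rp(2)]) (use dl in auto)
qed

section \<open>From a priori estimates to regularity\<close>

definition Hsob :: "real => 'm::finite seq => bool" where
 "Hsob s v \<longleftrightarrow> Hs (%k. jb k powr s) v"

definition order_op :: "nat => ('m::finite seq => 'm seq) => bool" where
 "order_op r A \<longleftrightarrow> lin_op A & bd (wt (real r) 0) (%t. A)"

lemma order_op_FO: "FO P ==> order_op 1 P"
 unfolding order_op_def
 by (auto intro!: FO_lin bd_mono[OF FO_bd, of _ 1] simp flip: wt_jb)

lemma order_op_id: "order_op 0 (%v. v)"
proof -
 have "bd (wt 0 0) (%t v. v)"
  by (rule bd_multiplier) (auto intro: exI[of _ 1])
 thus ?thesis by (simp add: order_op_def lin_op_def)
qed

text \<open>Covers \<open>Y (Z j v)\<close> in the hypothesis \<open>dYZ\<close> of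
  \<open>estimate_drift\<close>; this is the reason why \<open>regularity_from_estimate\<close>
  admits operators of order 2.\<close>

lemma order_op_comp:
 assumes "FO P" "FO P'"
 shows "order_op 2 (%v. P (P' v))"
 unfolding order_op_def
proof
 show "lin_op (%v. P (P' v))"
  using FO_lin[OF assms(1)] FO_lin[OF assms(2)] assms by (simp add: lin_op_def FO_temp)
 have "bd (wt 1 0) (%t. P)" using order_op_FO[OF assms(1)] by (simp add: order_op_def)
 from bd_wt_FO[OF this assms(2)] show "bd (wt (real 2) 0) (%t v. P (P' v))" by simp
qed

lemma truncation_tendsto:
 assumes "Hs w v"
 shows "((%F. sq w (%k. v k - (if k : F then v k else 0))) \<longlongrightarrow> 0) (finite_subsets_at_top UNIV)"
proof -
 let ?f = "%k. (w k * cmod (v k))^2"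
 have s: "?f summable_on UNIV" using assms by (simp add: Hs_def)
 have eq: "sq w (%k. v k - (if k : F then v k else 0)) = infsum ?f UNIV - sum ?f F" if "finite F" for F
 proof -
  have "infsum ?f UNIV - sum ?f F = infsum (%k. ?f k - (if k : F then ?f k else 0)) UNIV"
  proof (subst infsum_diff[OF s])
   have "((%k. if k : F then ?f k else 0) has_sum sum ?f F) F"
    using that by (intro has_sum_finiteI) auto
   hence h: "((%k. if k : F then ?f k else 0) has_sum sum ?f F) UNIV"
    by (rule has_sum_cong_neutral[THEN iffD1, rotated -1]) auto
   thus "(%k. if k : F then ?f k else 0) summable_on UNIV" by (rule has_sum_imp_summable)
   show "infsum ?f UNIV - sum ?f F = infsum ?f UNIV - infsum (%k. if k : F then ?f k else 0) UNIV"
    using infsumI[OF h] by simp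
  qed
  also have "... = sq w (%k. v k - (if k : F then v k else 0))"
   unfolding sq_def by (intro infsum_cong) auto
  finally show ?thesis by simp
 qed
 have "((%F. infsum ?f UNIV - sum ?f F) \<longlongrightarrow> infsum ?f UNIV - infsum ?f UNIV) (finite_subsets_at_top UNIV)"
  by (intro tendsto_intros infsum_tendsto s)
 hence "((%F. infsum ?f UNIV - sum ?f F) \<longlongrightarrow> 0) (finite_subsets_at_top UNIV)" by simp
 thus ?thesis
  by (rule Lim_transform_eventually) (auto simp: eventually_finite_subsets_at_top eq intro!: exI[of _ "{}"])
qed

lemma rapid_truncation: "finite F ==> rapid (%k. if k : F then v k else 0)"
proof (unfold rapid_def, intro allI)
 fix N assume F: "finite F"
 have "cmod (if k : F then v k else 0) * jb k ^ N <= (SUM k:F. cmod (v k) * jb k ^ N)" for k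
  using member_le_sum[of k F "%k. cmod (v k) * jb k ^ N"] F by (auto intro: sum_nonneg)
 thus "EX C. ALL k. cmod (if k : F then v k else 0) * jb k ^ N <= C" by blast
qed

text \<open>The power \<open>N\<close> is cancelled by \<open>- real N\<close>, and the remaining
  \<open>- real CARD('m)\<close> becomes, after squaring, the exponent of
  \<open>summable_jb\<close>.\<close>

lemma poly_Hsob:
 fixes v :: "'m::finite seq"
 assumes "!!k. cmod (v k) <= C * jb k ^ N" "s <= - real N - real CARD('m)"
 shows "Hsob s v"
 unfolding Hsob_def Hs_def
proof (rule summable_on_comparison_test)
 show "(%k::int^'m. C^2 * inverse (jb k ^ (2 * CARD('m)))) summable_on UNIV"
  by (intro summable_on_cmult_right summable_jb)
 fix k :: "int^'m"
 have C: "0 <= C * jb k ^ N" using assms(1)[of k] norm_ge_zero order_trans by blast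
 have "jb k powr s * cmod (v k) <= jb k powr (- real N - real CARD('m)) * (C * jb k ^ N)"
  using assms C by (intro mult_mono powr_mono jb_ge_1) auto
 also have "... = C * (jb k powr (- real N - real CARD('m)) * jb k powr real N)" by (simp add: powr_realpow)
 also have "... = C * jb k powr (- real CARD('m))" unfolding powr_add[symmetric] by simp
 also have "... = C * inverse (jb k ^ CARD('m))" by (simp add: powr_minus powr_realpow)
 finally have "(jb k powr s * cmod (v k))^2 <= (C * inverse (jb k ^ CARD('m)))^2"
  by (intro power_mono) auto
 thus "(jb k powr s * cmod (v k))^2 <= C^2 * inverse (jb k ^ (2 * CARD('m)))"
  by (simp add: power_mult_distrib power_inverse power_mult[symmetric] mult.commute)
qed auto

lemma temp_Hsob: "temp v ==> EX s0. ALL s<=s0. Hsob s v"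
 unfolding temp_def using poly_Hsob by blast

lemma wt_le_jb:
 assumes t: "t : UI" and "0 <= R"
 shows "wt s (- R) t k <= t powr (- R) * jb k powr (s - 2 * R)" "wt s (- R) t k <= jb k powr s"
proof -
 have "(1 + t * (jb k)^2) powr (- R) <= (t * (jb k)^2) powr (- R)"
  using assms by (intro powr_mono2') auto
 also have "... = t powr (- R) * (jb k)\<^sup>2 powr (- R)" using t by (simp add: powr_mult)
 also have "(jb k)\<^sup>2 powr (- R) = jb k powr (- (2 * R))"
  using powr_powr[of "jb k" 2 "- R"] by simp
 finally have "wt s (- R) t k <= jb k powr s * (t powr (- R) * jb k powr (- (2 * R)))"
  unfolding wt_def by (intro mult_left_mono) auto
 thus "wt s (- R) t k <= t powr (- R) * jb k powr (s - 2 * R)"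
  by (simp add: powr_diff powr_minus_divide)
 have "wt s (- R) t k <= wt s 0 t k" using assms by (intro wt_mono) auto
 thus "wt s (- R) t k <= jb k powr s" using wt_base_nz[OF t, of k] by (simp add: wt_def)
qed

text \<open>For fixed \<open>t\<close> and large \<open>R\<close> the weight \<open>wt s (- R) t\<close> decays fast enough for truncations
  to converge; afterwards \<open>t\<close> tends to \<open>0\<close>.\<close>

theorem regularity_from_estimate:
 fixes A :: "'i => 'm::finite seq => 'm seq"
 assumes I: "finite I" and A: "!!i. i : I ==> order_op 2 (A i)" and A0: "order_op 2 A0"
  and est: "!!beta G. (!!i. i : I ==> Qdom (s i) beta (%t. A i) G) ==> Qdom s0 beta (%t. A0) G"
  and v: "temp v" "!!i. i : I ==> Hsob (s i) (A i v)"
 shows "Hsob s0 (A0 v)"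
proof -
 obtain \<sigma> where \<sigma>: "!!s. s <= \<sigma> ==> Hsob s v" using temp_Hsob[OF v(1)] by blast
 define S where "S = abs s0 + (SUM i:I. abs (s i))"
 \<comment> \<open>Chosen so that \<open>c + 2 - 2 * R\<close> is at most \<sigma> for every
   \<open>c <= S\<close>: even after an operator of order 2, the regularised weight asks for no more
   than the known order of \<open>v\<close>.\<close>
 define R where "R = (S + 2 + abs (\<sigma>)) / 2"
 have R0: "0 <= R" unfolding R_def S_def by (auto intro!: add_nonneg_nonneg sum_nonneg)
 have sS: "s0 <= S" "!!i. i : I ==> s i <= S"
 proof -
  have nn: "0 <= (SUM i:I. abs (s i))" by (intro sum_nonneg) auto
  thus "s0 <= S" using abs_ge_self[of s0] unfolding S_def by linarith
  fix i assume "i : I"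
  hence "abs (s i) <= (SUM i:I. abs (s i))" using I by (intro member_le_sum) auto
  thus "s i <= S" by (simp add: S_def)
 qed
 define beta where "beta = - R"
 define G where "G = (%t u. SUM i:I. Q (s i) beta (%t. A i) t u)"
 have "Qdom s0 beta (%t. A0) G"
 proof (rule est)
  fix i assume i: "i : I"
  show "Qdom (s i) beta (%t. A i) G"
   by (rule dominatedI[of 1]) (auto simp: G_def Q_def intro!: member_le_sum[OF i] I)
 qed
 then obtain C where C: "0 <= C" "!!t u. t : UI ==> rapid u ==> Q s0 beta (%t. A0) t u <= C * G t u"
  by (rule dominatedE) blast
 \<comment> \<open>The bound is uniform in \<open>t\<close>; 4 is the product of the factors 2 in
   \<open>Hs_add\<close> and \<open>Hs_diff\<close>.\<close>
 define K where "K = 4 * C * (SUM i:I. sq (%k. jb k powr s i) (A i v))"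
 have main: "Hs (wt s0 beta t) (A0 v) & sq (wt s0 beta t) (A0 v) <= K" if t: "t : UI" for t
 proof -
  let ?F = "finite_subsets_at_top (UNIV :: (int^'m) set)"
  define v' where "v' = (%F k. if k : F then v k else 0)"
  define d where "d = (%F k. v k - v' F k)"
  have rv: "rapid (v' F)" if "finite F" for F unfolding v'_def by (rule rapid_truncation[OF that])
  have td: "temp (d F)" if "finite F" for F unfolding d_def by (intro temp_diff v rapid_imp_temp rv that)
  have wv: "Hs (%k. wt c beta t k * wt (real 2) 0 t k) v" if "c <= S" for c
  proof -
   have "Hsob (c + 2 - 2 * R) v" using that by (intro \<sigma>) (simp add: R_def field_simps)
   hence "Hle (%k. wt c beta t k * wt (real 2) 0 t k) v ((t powr (- R))^2) (%k. jb k powr (c + 2 - 2 * R)) v"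
    unfolding Hsob_def
   proof (rule Hs_mono)
    fix k :: "int^'m"
    show "0 <= wt c beta t k * wt (real 2) 0 t k" using t by (simp add: wt_pos less_imp_le)
    have "wt c beta t k * wt (real 2) 0 t k <= t powr (- R) * jb k powr (c + 2 - 2 * R)"
     using wt_le_jb(1)[OF t R0, of "c + 2" k] t by (simp add: wt_mult beta_def)
    thus "wt c beta t k * wt (real 2) 0 t k * cmod (v k) <= t powr (- R) * (jb k powr (c + 2 - 2 * R) * cmod (v k))"
     using mult_right_mono[of _ _ "cmod (v k)"] by (fastforce simp: mult_ac)
   qed
   thus ?thesis by blast
  qed
  have conv: "((%F. sq (wt c beta t) (B (d F))) \<longlongrightarrow> 0) ?F & Hs (wt c beta t) (B v) & (ALL F. finite F --> Hs (wt c beta t) (B (d F)))"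
   if B: "order_op 2 B" and c: "c <= S" for B c
  proof -
   have b: "bd (wt (real 2) 0) (%t. B)" using B by (simp add: order_op_def)
   obtain D where D: "D >= 0" "!!t v. t : UI ==> temp v ==> Hs (%k. wt c beta t k * wt (real 2) 0 t k) v ==> Hle (wt c beta t) (B v) D (%k. wt c beta t k * wt (real 2) 0 t k) v"
    by (rule bdE[OF b tempered_wt[of c beta]], rule that)
   let ?w = "%k. wt c beta t k * wt (real 2) 0 t k"
   have dH: "Hs ?w (d F)" for F
    using Hs_mono[OF wv[OF c], of ?w "d F" 1] t by (simp add: d_def v'_def wt_pos less_imp_le)
   have lim: "((%F. sq ?w (d F)) \<longlongrightarrow> 0) ?F"
    using truncation_tendsto[OF wv[OF c]] by (simp add: d_def v'_def)
   have "((%F. sq (wt c beta t) (B (d F))) \<longlongrightarrow> 0) ?F"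
   proof (rule tendsto_sandwich[OF _ _ tendsto_const])
    show "((%F. D * sq ?w (d F)) \<longlongrightarrow> 0) ?F" using tendsto_mult_right_zero[OF lim] by simp
    show "\<forall>\<^sub>F F in ?F. sq (wt c beta t) (B (d F)) <= D * sq ?w (d F)"
     using D(2)[OF t td dH] by (auto simp: eventually_finite_subsets_at_top intro!: exI[of _ "{}"])
   qed auto
   thus ?thesis using D(2)[OF t v(1) wv[OF c]] D(2)[OF t td dH] by auto
  qed
  have split: "B v = (%k. B (v' F) k + B (d F) k)" "B (v' F) = (%k. B v k - B (d F) k)"
   if "order_op 2 B" "finite F" for B F
  proof -
   have "v = (%k. v' F k + d F k)" by (simp add: d_def)
   thus "B v = (%k. B (v' F) k + B (d F) k)"
    using lin_op_add[of B "v' F" "d F"] that rv td by (simp add: order_op_def rapid_imp_temp)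
   thus "B (v' F) = (%k. B v k - B (d F) k)" by simp
  qed
  note c0 = conv[OF A0 sS(1)]
  have bound: "sq (wt s0 beta t) (A0 v) <= 2 * (C * (SUM i:I. 2 * sq (wt (s i) beta t) (A i v) + 2 * sq (wt (s i) beta t) (A i (d F))))
    + 2 * sq (wt s0 beta t) (A0 (d F))" if F: "finite F" for F
  proof -
   have "Hs (wt s0 beta t) (A0 (v' F))"
    unfolding split(2)[OF A0 F] using Hs_diff c0 F by blast
   hence "sq (wt s0 beta t) (A0 v) <= 2 * sq (wt s0 beta t) (A0 (v' F)) + 2 * sq (wt s0 beta t) (A0 (d F))"
    using Hs_add[of "wt s0 beta t" "A0 (v' F)" "A0 (d F)"] c0 F unfolding split(1)[OF A0 F] by blast
   also have "sq (wt s0 beta t) (A0 (v' F)) <= C * (SUM i:I. sq (wt (s i) beta t) (A i (v' F)))"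
    using C(2)[OF t rv[OF F]] by (simp add: Q_def G_def)
   also have "... <= C * (SUM i:I. 2 * sq (wt (s i) beta t) (A i v) + 2 * sq (wt (s i) beta t) (A i (d F)))"
   proof (intro mult_left_mono sum_mono C)
    fix i assume i: "i : I"
    show "sq (wt (s i) beta t) (A i (v' F)) <= 2 * sq (wt (s i) beta t) (A i v) + 2 * sq (wt (s i) beta t) (A i (d F))"
     unfolding split(2)[OF A[OF i] F] using Hs_diff conv[OF A[OF i] sS(2)[OF i]] F by blast
   qed
   finally show ?thesis by simp
  qed
  have "((%F. 2 * (C * (SUM i:I. 2 * sq (wt (s i) beta t) (A i v) + 2 * sq (wt (s i) beta t) (A i (d F))))
    + 2 * sq (wt s0 beta t) (A0 (d F))) \<longlongrightarrow> 2 * (C * (SUM i:I. 2 * sq (wt (s i) beta t) (A i v) + 2 * 0)) + 2 * 0) ?F"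
   using c0 conv[OF A sS(2)] by (intro tendsto_intros) auto
  hence "sq (wt s0 beta t) (A0 v) <= 2 * (C * (SUM i:I. 2 * sq (wt (s i) beta t) (A i v) + 2 * 0)) + 2 * 0"
   by (rule tendsto_lowerbound) (use bound in \<open>auto simp: eventually_finite_subsets_at_top intro!: exI[of _ "{}"]\<close>)
  also have "... = 4 * C * (SUM i:I. sq (wt (s i) beta t) (A i v))"
   by (simp add: sum_distrib_left[symmetric])
  also have "... <= K"
   unfolding K_def
  proof (intro mult_left_mono sum_mono)
   fix i assume i: "i : I"
   have "Hle (wt (s i) beta t) (A i v) (1^2) (%k. jb k powr s i) (A i v)"
    by (rule Hs_mono[OF v(2)[OF i, unfolded Hsob_def]])
     (simp_all add: less_imp_le[OF wt_pos[OF t]] beta_def mult_right_mono[OF wt_le_jb(2)[OF t R0]])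
   thus "sq (wt (s i) beta t) (A i v) <= sq (%k. jb k powr s i) (A i v)" by simp
  qed (use C in simp)
  finally show ?thesis using c0 by blast
 qed
 have fin: "(SUM k:F. (jb k powr s0 * cmod (A0 v k))^2) <= K" if F: "finite F" for F
 proof (rule tendsto_upperbound[where F = "at_right 0" and f = "%t. SUM k:F. (wt s0 beta t k * cmod (A0 v k))^2"])
  have "((%t. wt s0 beta t k) \<longlongrightarrow> jb k powr s0 * (1 + 0 * (jb k)^2) powr beta) (at_right 0)" for k :: "int^'m"
   unfolding wt_def by (intro tendsto_intros) auto
  thus "((%t. SUM k:F. (wt s0 beta t k * cmod (A0 v k))^2) \<longlongrightarrow> (SUM k:F. (jb k powr s0 * cmod (A0 v k))^2)) (at_right 0)"
   by (intro tendsto_intros) simp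
  have "(SUM k:F. (wt s0 beta t k * cmod (A0 v k))^2) <= K" if "t : UI" for t
  proof -
   have "(SUM k:F. (wt s0 beta t k * cmod (A0 v k))^2) <= sq (wt s0 beta t) (A0 v)"
    unfolding sq_def using main[OF that] F by (intro finite_sum_le_infsum) (auto simp: Hs_def)
   thus ?thesis using main[OF that] by linarith
  qed
  thus "\<forall>\<^sub>F t in at_right 0. (SUM k:F. (wt s0 beta t k * cmod (A0 v k))^2) <= K"
   by (auto simp: eventually_at_right_field intro!: exI[of _ 1])
 qed simp
 show ?thesis unfolding Hsob_def Hs_def
  by (rule nonneg_bdd_above_summable_on) (auto intro!: bdd_aboveI2 fin)
qed

section \<open>Smooth functions and distributions on Euclidean space\<close>

lemma C_k_on_subset: "C_k_on k S f ==> T <= S ==> C_k_on k T f"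
 by (induction k arbitrary: f) (auto intro: continuous_on_subset)

lemma frechet_derivative_cong_open:
 assumes "open S" "x : S" "!!y. y : S ==> f y = g y" "f differentiable (at x)"
 shows "g differentiable (at x)" "frechet_derivative g (at x) = frechet_derivative f (at x)"
proof -
 have "(f has_derivative frechet_derivative f (at x)) (at x)"
  using assms(4) by (simp add: frechet_derivative_works)
 hence "(g has_derivative frechet_derivative f (at x)) (at x)"
  by (rule has_derivative_transform_within_open[OF _ assms(1,2)]) (simp add: assms(3))
 thus "g differentiable (at x)" "frechet_derivative g (at x) = frechet_derivative f (at x)"
  by (auto simp: differentiable_def dest: frechet_derivative_at)
qed

lemma C_k_on_cong:
 assumes "open S" "!!x. x : S ==> f x = g x" "C_k_on k S f"
 shows "C_k_on k S g"
 using assms(2,3)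
proof (induction k arbitrary: f g)
 case 0
 thus ?case by (simp cong: continuous_on_cong)
next
 case (Suc k)
 have d: "g differentiable (at x)" "frechet_derivative g (at x) = frechet_derivative f (at x)" if "x : S" for x
  using frechet_derivative_cong_open[OF assms(1) that, of f g] Suc.prems that by auto
 have "C_k_on k S (%x. frechet_derivative g (at x) v)" for v
  by (rule Suc.IH[of "%x. frechet_derivative f (at x) v"]) (use d Suc.prems in auto)
 thus ?case using d by simp
qed

lemma C_k_on_SucI:
 assumes "open S" "!!x. x : S ==> (f has_derivative f' x) (at x)" "!!v. C_k_on k S (%x. f' x v)"
 shows "C_k_on (Suc k) S f"
proof -
 have "frechet_derivative f (at x) = f' x" if "x : S" for x
  using frechet_derivative_at[OF assms(2)[OF that]] by simp
 hence "C_k_on k S (%x. frechet_derivative f (at x) v)" for v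
  by (intro C_k_on_cong[OF assms(1) _ assms(3)[of v]]) simp
 thus ?thesis using assms(2) by (auto simp: differentiable_def)
qed

lemma C_k_on_Suc_derivative:
 "C_k_on (Suc k) S f ==> x : S ==> (f has_derivative frechet_derivative f (at x)) (at x)"
 by (simp add: frechet_derivative_works)

lemma C_k_on_Suc: "C_k_on (Suc k) S f ==> C_k_on k S f"
proof (induction k arbitrary: f)
 case 0
 thus ?case
  by (simp add: continuous_at_imp_continuous_on differentiable_imp_continuous_within)
next
 case (Suc k)
 have "C_k_on k S (%x. frechet_derivative f (at x) v)" for v
  by (rule Suc.IH) (use Suc.prems in auto)
 thus ?case using Suc.prems by auto
qed

lemma C_k_on_const: "C_k_on k S (%x. c)"
proof (induction k arbitrary: c)
 case (Suc k)
 have "frechet_derivative (%x. c) (at x) = (%v. 0)" for x :: 'a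
  using frechet_derivative_at[OF has_derivative_const] by metis
 thus ?case using Suc[of 0] by simp
qed (simp add: continuous_on_const)

lemma C_k_on_bounded_linear:
 assumes "bounded_linear h" "open S" "C_k_on k S f"
 shows "C_k_on k S (%x. h (f x))"
 using assms(3)
proof (induction k arbitrary: f)
 case 0
 thus ?case
  by (simp add: bounded_linear.continuous_on[OF assms(1)])
next
 case (Suc k)
 show ?case
 proof (rule C_k_on_SucI[OF assms(2)])
  show "((%x. h (f x)) has_derivative (%v. h (frechet_derivative f (at x) v))) (at x)" if "x : S" for x
   by (rule bounded_linear.has_derivative[OF assms(1) C_k_on_Suc_derivative[OF Suc.prems that]])
  show "C_k_on k S (%x. h (frechet_derivative f (at x) v))" for v
   by (rule Suc.IH) (use Suc.prems in simp)
 qed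
qed

lemma C_k_on_add:
 assumes "open S" "C_k_on k S f" "C_k_on k S g"
 shows "C_k_on k S (%x. f x + g x)"
 using assms(2,3)
proof (induction k arbitrary: f g)
 case 0
 thus ?case by (simp add: continuous_on_add)
next
 case (Suc k)
 show ?case
 proof (rule C_k_on_SucI[OF assms(1)])
  show "((%x. f x + g x) has_derivative (%v. frechet_derivative f (at x) v + frechet_derivative g (at x) v)) (at x)"
   if "x : S" for x
   by (rule has_derivative_add[OF C_k_on_Suc_derivative[OF Suc.prems(1) that] C_k_on_Suc_derivative[OF Suc.prems(2) that]])
  show "C_k_on k S (%x. frechet_derivative f (at x) v + frechet_derivative g (at x) v)" for v
   by (rule Suc.IH) (use Suc.prems in simp_all)
 qed
qed

lemma C_k_on_bilinear:
 assumes "bounded_bilinear h" "open S" "C_k_on k S f" "C_k_on k S g"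
 shows "C_k_on k S (%x. h (f x) (g x))"
 using assms(3,4)
proof (induction k arbitrary: f g)
 case 0
 thus ?case by (simp add: bounded_bilinear.continuous_on[OF assms(1)])
next
 case (Suc k)
 show ?case
 proof (rule C_k_on_SucI[OF assms(2)])
  show "((%x. h (f x) (g x)) has_derivative
    (%v. h (f x) (frechet_derivative g (at x) v) + h (frechet_derivative f (at x) v) (g x))) (at x)"
   if "x : S" for x
   by (rule bounded_bilinear.FDERIV[OF assms(1) C_k_on_Suc_derivative[OF Suc.prems(1) that] C_k_on_Suc_derivative[OF Suc.prems(2) that]])
  show "C_k_on k S (%x. h (f x) (frechet_derivative g (at x) v) + h (frechet_derivative f (at x) v) (g x))" for v
  proof (rule C_k_on_add[OF assms(2)])
   show "C_k_on k S (%x. h (f x) (frechet_derivative g (at x) v))"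
    by (rule Suc.IH[OF C_k_on_Suc[OF Suc.prems(1)]]) (use Suc.prems in simp)
   show "C_k_on k S (%x. h (frechet_derivative f (at x) v) (g x))"
    by (rule Suc.IH[OF _ C_k_on_Suc[OF Suc.prems(2)]]) (use Suc.prems in simp)
  qed
 qed
qed

lemma C_k_on_sum:
 assumes "open S" "finite I" "!!i. i : I ==> C_k_on k S (f i)"
 shows "C_k_on k S (%x. SUM i:I. f i x)"
 using assms(2,3) by (induction I rule: finite_induct) (auto intro: C_k_on_const C_k_on_add[OF assms(1)])

lemma C_k_on_compose:
 fixes f :: "'e::euclidean_space => 'g::euclidean_space"
 assumes "open S" "open T" "f ` S <= T" "C_k_on k S f" "C_k_on k T g"
 shows "C_k_on k S (%x. g (f x))"
 using assms(4,5)
proof (induction k arbitrary: g)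
 case 0
 thus ?case using continuous_on_compose2[of T g S f] assms(3) by auto
next
 case (Suc k)
 \<comment> \<open>The chain rule is written as a finite sum over a basis: each summand is a product
   of a derivative of \<open>f\<close> and a composite with \<open>f\<close>, and the induction
   hypothesis applies to the composite.\<close>
 let ?D = "%x v. SUM b:Basis. (frechet_derivative f (at x) v \<bullet> b) *\<^sub>R frechet_derivative g (at (f x)) b"
 show ?case
 proof (rule C_k_on_SucI[OF assms(1)])
  fix x assume x: "x : S"
  have df: "(f has_derivative frechet_derivative f (at x)) (at x)"
   by (rule C_k_on_Suc_derivative[OF Suc.prems(1) x])
  have dg: "(g has_derivative frechet_derivative g (at (f x))) (at (f x))"
   by (rule C_k_on_Suc_derivative[OF Suc.prems(2)]) (use x assms(3) in auto)
  have lin: "linear (frechet_derivative g (at (f x)))" using dg by (rule has_derivative_linear)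
  have repr: "frechet_derivative g (at (f x)) w = (SUM b:Basis. (w \<bullet> b) *\<^sub>R frechet_derivative g (at (f x)) b)" for w
  proof -
   have "frechet_derivative g (at (f x)) w = frechet_derivative g (at (f x)) (SUM b:Basis. (w \<bullet> b) *\<^sub>R b)"
    by (simp only: euclidean_representation)
   thus ?thesis unfolding linear_sum[OF lin] linear_scale[OF lin] .
  qed
  have eq: "(%v. frechet_derivative g (at (f x)) (frechet_derivative f (at x) v)) = ?D x"
   by (rule ext) (rule repr)
  have "((%x. g (f x)) has_derivative (%v. frechet_derivative g (at (f x)) (frechet_derivative f (at x) v))) (at x)"
   by (rule has_derivative_compose[OF df dg])
  thus "((%x. g (f x)) has_derivative ?D x) (at x)" unfolding eq .
 next
  fix v
  show "C_k_on k S (%x. ?D x v)"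
  proof (intro C_k_on_sum C_k_on_bilinear[OF bounded_bilinear_scaleR] assms finite_Basis)
   fix b :: 'g assume "b : Basis"
   show "C_k_on k S (%x. frechet_derivative f (at x) v \<bullet> b)"
    by (rule C_k_on_bounded_linear[OF bounded_linear_inner_left assms(1)]) (use Suc.prems in simp)
   show "C_k_on k S (%x. frechet_derivative g (at (f x)) b)"
    by (rule Suc.IH[OF C_k_on_Suc[OF Suc.prems(1)], of "%y. frechet_derivative g (at y) b"])
     (use Suc.prems in simp)
  qed
 qed
qed

lemma smooth_onI: "(!!k. C_k_on k S f) ==> smooth_on S f"
 by (simp add: smooth_on_def)

lemma smooth_on_subset: "smooth_on S f ==> T <= S ==> smooth_on T f"
 by (auto simp: smooth_on_def intro: C_k_on_subset)

lemma smooth_on_cong: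
 "open S ==> (!!x. x : S ==> f x = g x) ==> smooth_on S f ==> smooth_on S g"
 unfolding smooth_on_def using C_k_on_cong by metis

lemma smooth_on_const [simp]: "smooth_on S (%x. c)"
 by (simp add: smooth_on_def C_k_on_const)

lemma smooth_on_linear: "bounded_linear h ==> open S ==> smooth_on S f ==> smooth_on S (%x. h (f x))"
 by (simp add: smooth_on_def C_k_on_bounded_linear)

lemma smooth_on_bilinear:
 "bounded_bilinear h ==> open S ==> smooth_on S f ==> smooth_on S g ==> smooth_on S (%x. h (f x) (g x))"
 by (simp add: smooth_on_def C_k_on_bilinear)

lemma smooth_on_add: "open S ==> smooth_on S f ==> smooth_on S g ==> smooth_on S (%x. f x + g x)"
 by (simp add: smooth_on_def C_k_on_add)

lemma smooth_on_minus: "open S ==> smooth_on S f ==> smooth_on S (%x. - f x)"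
 by (rule smooth_on_linear[OF bounded_linear_minus[OF bounded_linear_ident]])

lemma smooth_on_diff: "open S ==> smooth_on S f ==> smooth_on S g ==> smooth_on S (%x. f x - g x)"
 using smooth_on_add[of S f "%x. - g x"] smooth_on_minus[of S g] by simp

lemma smooth_on_sum:
 "open S ==> finite I ==> (!!i. i : I ==> smooth_on S (f i)) ==> smooth_on S (%x. SUM i:I. f i x)"
 by (simp add: smooth_on_def C_k_on_sum)

lemma smooth_on_mult:
 fixes f g :: "'e::euclidean_space => 'a::real_normed_algebra"
 shows "open S ==> smooth_on S f ==> smooth_on S g ==> smooth_on S (%x. f x * g x)"
 by (rule smooth_on_bilinear[OF bounded_bilinear_mult])

lemma smooth_on_scaleR: "open S ==> smooth_on S f ==> smooth_on S g ==> smooth_on S (%x. f x *\<^sub>R g x)"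
 by (rule smooth_on_bilinear[OF bounded_bilinear_scaleR])

lemma smooth_on_prod:
 fixes f :: "'i => 'e::euclidean_space => 'a::real_normed_field"
 assumes "open S" "finite I" "!!i. i : I ==> smooth_on S (f i)"
 shows "smooth_on S (%x. PROD i:I. f i x)"
 using assms(2,3) by (induction I rule: finite_induct) (auto intro: smooth_on_mult[OF assms(1)])

lemma smooth_on_compose:
 fixes f :: "'e::euclidean_space => 'g::euclidean_space"
 assumes "open S" "open T" "f ` S <= T" "smooth_on S f" "smooth_on T g"
 shows "smooth_on S (%x. g (f x))"
 using assms by (simp add: smooth_on_def C_k_on_compose)

lemma smooth_on_ident: "open S ==> smooth_on S (%x. x)"
proof (rule smooth_onI)
 fix k assume S: "open S"
 show "C_k_on k S (%x. x)"
 proof (cases k)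
  case (Suc k')
  thus ?thesis
   using C_k_on_SucI[OF S, of "%x. x" "%x v. v"] by (auto intro: C_k_on_const)
 qed (simp add: continuous_on_id)
qed

lemma smooth_on_bounded_linear: "bounded_linear h ==> open S ==> smooth_on S h"
 by (rule smooth_on_linear[OF _ _ smooth_on_ident])

lemma smooth_on_derivative: "smooth_on S f ==> smooth_on S (%x. frechet_derivative f (at x) v)"
 unfolding smooth_on_def using C_k_on.simps(2) by blast

lemma smooth_on_has_derivative:
 "smooth_on S f ==> x : S ==> (f has_derivative frechet_derivative f (at x)) (at x)"
 using C_k_on_Suc_derivative unfolding smooth_on_def by blast

lemma smooth_on_continuous: "smooth_on S f ==> continuous_on S f"
 unfolding smooth_on_def by (metis C_k_on.simps(1))

lemma smooth_on_open_Union: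
 assumes "!!x. x : S ==> EX T. open T & x : T & smooth_on T f"
 shows "smooth_on S f"
proof (rule smooth_onI)
 fix k
 have "!!x. x : S ==> EX T. open T & x : T & C_k_on k T f"
  using assms unfolding smooth_on_def by blast
 thus "C_k_on k S f"
 proof (induction k arbitrary: f)
  case 0
  have "continuous (at x within S) f" if x: "x : S" for x
  proof -
   obtain T where "open T" "x : T" "continuous_on T f" using 0[OF x] by auto
   thus ?thesis by (meson continuous_at_imp_continuous_at_within continuous_on_eq_continuous_at)
  qed
  thus ?case by (simp add: continuous_on_eq_continuous_within)
 next
  case (Suc k)
  have "f differentiable (at x)" if "x : S" for x using Suc.prems[OF that] by auto
  moreover have "C_k_on k S (%x. frechet_derivative f (at x) v)" for v
  proof (rule Suc.IH)
   fix x assume "x : S"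
   then obtain T where "open T" "x : T" "C_k_on (Suc k) T f" using Suc.prems by blast
   thus "EX T. open T & x : T & C_k_on k T (%x. frechet_derivative f (at x) v)" by auto
  qed
  ultimately show ?case by simp
 qed
qed

text \<open>A family whose derivatives inherit every order of differentiability of the family is
  smooth; the induction on \<open>k\<close> runs over all members at once. It is used for powers of
  the inverse and for \<open>flat_exp\<close>.\<close>

lemma smooth_on_real_induct:
 fixes F :: "nat => real => real"
 assumes "open T" "!!n x. x : T ==> (F n has_real_derivative F' n x) (at x)"
  "!!n k. (!!i. C_k_on k T (F i)) ==> C_k_on k T (F' n)"
 shows "smooth_on T (F n)"
proof (rule smooth_onI)
 show "C_k_on k T (F n)" for k
 proof (induction k arbitrary: n)
  case 0
  show ?case using assms(2)[of _ n] by (auto intro: DERIV_continuous_on has_field_derivative_at_within)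
 next
  case (Suc k)
  show ?case
  proof (rule C_k_on_SucI[OF assms(1)])
   show "(F n has_derivative (*) (F' n x)) (at x)" if "x : T" for x
    using assms(2)[OF that] by (simp add: has_field_derivative_def)
   show "C_k_on k T (%x. F' n x * v)" for v
    by (rule C_k_on_bounded_linear[OF bounded_linear_mult_left assms(1)]) (intro assms(3) Suc)
  qed
 qed
qed

lemma smooth_on_inverse_real: "smooth_on {x::real. x ~= 0} inverse"
proof -
 have "smooth_on {x::real. x ~= 0} (%x. inverse x ^ Suc n)" for n
 proof (rule smooth_on_real_induct[where F = "%n x. inverse x ^ Suc n" and F' = "%n x. - real (Suc n) * inverse x ^ Suc (Suc n)"])
  show "open {x::real. x ~= 0}" by (simp add: open_delete[of UNIV 0, simplified] Collect_neg_eq[symmetric] open_Collect_neq)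
  show "((%x. inverse x ^ Suc n) has_real_derivative - real (Suc n) * inverse x ^ Suc (Suc n)) (at x)"
   if "x : {x::real. x ~= 0}" for n x
  proof -
   have "(inverse has_real_derivative - (inverse x ^ Suc (Suc 0))) (at x)" using that by (intro DERIV_inverse) simp
   from DERIV_power[OF this, of "Suc n"] show ?thesis by (simp add: algebra_simps)
  qed
  show "C_k_on k {x::real. x ~= 0} (%x. - real (Suc n) * inverse x ^ Suc (Suc n))"
   if "!!i. C_k_on k {x::real. x ~= 0} (%x. inverse x ^ Suc i)" for n k
   by (rule C_k_on_bounded_linear[OF bounded_linear_mult_right _ that])
    (simp add: open_Collect_neq)
 qed
 from this[of 0] show ?thesis by simp
qed

lemma smooth_on_inverse:
 fixes f :: "'e::euclidean_space => real"
 assumes "open S" "smooth_on S f" "!!x. x : S ==> f x ~= 0"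
 shows "smooth_on S (%x. inverse (f x))"
 by (rule smooth_on_compose[OF assms(1) _ _ assms(2) smooth_on_inverse_real])
  (use assms(3) in "auto simp: open_Collect_neq")

lemma smooth_on_vec_nth: "open S ==> smooth_on S f ==> smooth_on S (%x. f x $ i)"
 by (rule smooth_on_linear[OF bounded_linear_vec_nth])

lemma smooth_on_vec_lambda:
 fixes f :: "'i::finite => 'e::euclidean_space => 'f::real_normed_vector"
 assumes "open S" "!!i. smooth_on S (f i)"
 shows "smooth_on S (%x. \<chi> i. f i x)"
proof -
 have bl: "bounded_linear (%c::'f. (\<chi> j. if j = i then c else 0) :: 'f^'i)" for i :: 'i
 proof (rule bounded_linear_intro[where K = 1])
  fix c :: 'f
  have "norm ((\<chi> j. if j = i then c else 0) :: 'f^'i) <= (SUM j:UNIV. norm (((\<chi> j. if j = i then c else 0) :: 'f^'i) $ j))"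
   unfolding norm_vec_def by (rule L2_set_le_sum) auto
  also have "... = norm c" by (simp add: if_distrib[of norm] cong: if_cong)
  finally show "norm ((\<chi> j. if j = i then c else 0) :: 'f^'i) <= norm c * 1" by simp
 qed (auto simp: vec_eq_iff)
 have "smooth_on S (%x. SUM i:UNIV. (\<chi> j. if j = i then f i x else 0) :: 'f^'i)"
  by (intro smooth_on_sum assms(1) finite smooth_on_linear[OF bl assms(1) assms(2)])
 moreover have "(SUM i:UNIV. (\<chi> j. if j = i then f i x else 0) :: 'f^'i) = (\<chi> i. f i x)" for x
  by (simp add: vec_eq_iff if_distrib cong: if_cong)
 ultimately show ?thesis by simp
qed

text \<open>The flat function \<open>exp (- 1 / x)\<close>, extended by 0. The powers of
  \<open>inverse x\<close> make the family closed under differentiation.\<close>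

definition flat_exp :: "nat => real => real" where
 "flat_exp n x = (if 0 < x then inverse x ^ n / exp (inverse x) else 0)"

lemma flat_exp_tendsto_0: "(flat_exp n \<longlongrightarrow> 0) (at 0)"
proof -
 have "((%x::real. inverse x ^ n / exp (inverse x)) \<longlongrightarrow> 0) (at_right 0)"
  by (rule filterlim_compose[OF tendsto_power_div_exp_0 filterlim_inverse_at_top_right])
 hence 1: "(flat_exp n \<longlongrightarrow> 0) (at_right 0)"
  by (rule Lim_transform_eventually) (auto simp: flat_exp_def eventually_at_right_field intro!: exI[of _ 1])
 have "((%x::real. 0) \<longlongrightarrow> (0::real)) (at_left 0)" by simp
 hence 2: "(flat_exp n \<longlongrightarrow> 0) (at_left 0)"
  by (rule Lim_transform_eventually) (auto simp: flat_exp_def eventually_at_left_field intro!: exI[of _ "-1"])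
 show ?thesis using 1 2 by (simp add: filterlim_at_split)
qed

lemma flat_exp_derivative:
 "(flat_exp n has_real_derivative (- real n * flat_exp (Suc n) x + flat_exp (Suc (Suc n)) x)) (at x)"
proof -
 consider "x > 0" | "x < 0" | "x = 0" by linarith
 thus ?thesis
 proof cases
  case 1
  have inv: "(inverse has_real_derivative - (inverse x ^ Suc (Suc 0))) (at x)" using 1 by (intro DERIV_inverse) simp
  have "((%x. inverse x ^ n * exp (- inverse x)) has_real_derivative
    (- real n * inverse x ^ Suc n * exp (- inverse x) + inverse x ^ Suc (Suc n) * exp (- inverse x))) (at x)"
  proof -
   have e: "((%x. exp (- inverse x)) has_real_derivative (exp (- inverse x) * (inverse x * inverse x))) (at x)"
    using 1 by (auto intro!: derivative_eq_intros)
   show ?thesis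
   proof (cases n)
    case 0
    thus ?thesis using e by (simp add: mult_ac)
   next
    case (Suc k)
    show ?thesis
     using DERIV_mult[OF DERIV_power[OF inv, of n] e] by (simp add: Suc algebra_simps)
   qed
  qed
  hence "((%x. inverse x ^ n * exp (- inverse x)) has_real_derivative
   (- real n * flat_exp (Suc n) x + flat_exp (Suc (Suc n)) x)) (at x)"
   using 1 by (simp add: flat_exp_def exp_minus divide_inverse mult.assoc)
  thus ?thesis
   by (rule has_field_derivative_transform_within_open[where S = "{0<..}"])
    (use 1 in "auto simp: flat_exp_def exp_minus divide_inverse")
 next
  case 2
  have "((%x. 0) has_real_derivative (- real n * flat_exp (Suc n) x + flat_exp (Suc (Suc n)) x)) (at x)"
   using 2 by (simp add: flat_exp_def)
  thus ?thesis
   by (rule has_field_derivative_transform_within_open[where S = "{..<0}"]) (use 2 in "auto simp: flat_exp_def")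
 next
  case 3
  \<comment> \<open>The difference quotient at 0 is \<open>flat_exp (Suc n)\<close>.\<close>
  have "((%h. (flat_exp n (0 + h) - flat_exp n 0) / h) \<longlongrightarrow> 0) (at 0)"
   by (rule Lim_transform_eventually[OF flat_exp_tendsto_0[of "Suc n"]])
    (auto simp: flat_exp_def divide_inverse mult_ac)
  thus ?thesis using 3 by (simp add: DERIV_def flat_exp_def)
 qed
qed

lemma smooth_flat_exp: "smooth_on UNIV (flat_exp n)"
proof (rule smooth_on_real_induct[where F' = "%n x. - real n * flat_exp (Suc n) x + flat_exp (Suc (Suc n)) x"])
 fix n k assume "!!i. C_k_on k UNIV (flat_exp i)"
 thus "C_k_on k UNIV (%x. - real n * flat_exp (Suc n) x + flat_exp (Suc (Suc n)) x)"
  by (intro C_k_on_add C_k_on_bounded_linear[OF bounded_linear_mult_right]) auto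
qed (rule open_UNIV flat_exp_derivative)+

lemma smooth_cutoff:
 fixes x0 :: "'e::euclidean_space"
 assumes "0 < a" "a < b"
 obtains psi :: "'e => real" where "smooth_on UNIV psi" "!!x. x : cball x0 a ==> psi x = 1"
  "!!x. x ~: ball x0 b ==> psi x = 0"
proof
 define s where "s = (%x. (x - x0) \<bullet> (x - x0))"
 define f where "f = flat_exp 0"
 have f: "f y = 0 \<longleftrightarrow> y <= 0" "0 <= f y" for y by (auto simp: f_def flat_exp_def)
 have s: "s x = (dist x0 x)^2" for x
  by (simp add: s_def dist_norm norm_minus_commute flip: power2_norm_eq_inner)
 \<comment> \<open>The numerator vanishes outside the ball of radius \<open>b\<close>, the second
   summand of the denominator on that of radius \<open>a\<close>. As \<open>a < b\<close>, the two
   summands never vanish together.\<close>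
 define psi where "psi = (%x. f (b^2 - s x) * inverse (f (b^2 - s x) + f (s x - a^2)))"
 have ab: "a^2 < b^2" using assms by (intro power_strict_mono) auto
 have sm: "smooth_on UNIV s" unfolding s_def
  by (intro smooth_on_bilinear[OF bounded_bilinear_inner] smooth_on_diff smooth_on_ident smooth_on_const) auto
 have c: "smooth_on UNIV (%x. f (g x))" if "smooth_on UNIV g" for g :: "'e => real"
  unfolding f_def by (rule smooth_on_compose[OF open_UNIV open_UNIV subset_UNIV that smooth_flat_exp])
 show "smooth_on UNIV psi"
  unfolding psi_def
 proof (intro smooth_on_mult smooth_on_inverse c smooth_on_add smooth_on_diff sm smooth_on_const open_UNIV)
  fix x
  have "f (b^2 - s x) ~= 0 \<or> f (s x - a^2) ~= 0" using ab by (auto simp: f)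
  thus "f (b^2 - s x) + f (s x - a^2) ~= 0" using f(2)[of "b^2 - s x"] f(2)[of "s x - a^2"] by linarith
 qed
 fix x
 show "psi x = 1" if "x : cball x0 a"
 proof -
  have "s x <= a^2" using that by (auto simp: s intro: power_mono)
  hence "f (s x - a^2) = 0" "f (b^2 - s x) ~= 0" using ab by (auto simp: f)
  thus ?thesis by (simp add: psi_def)
 qed
 show "psi x = 0" if "x ~: ball x0 b"
 proof -
  have "b^2 <= s x" using that assms by (auto simp: s intro: power_mono)
  thus ?thesis by (simp add: psi_def f)
 qed
qed

section \<open>Partial derivatives and test functions\<close>

lemma partial_has_derivative: "(f has_derivative f') (at x) ==> partial j f x = f' (axis j 1)"
 unfolding partial_def by (drule frechet_derivative_at) simp

lemma smooth_on_partial: "smooth_on S f ==> smooth_on S (partial j f)"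
 using smooth_on_derivative[of S f "axis j 1"] by (simp add: partial_def[abs_def])

lemma partial_cong:
 assumes "open S" "x : S" "!!y. y : S ==> f y = g y" "smooth_on S f"
 shows "partial j g x = partial j f x"
 unfolding partial_def
 by (simp only: frechet_derivative_cong_open(2)[OF assms(1,2,3) differentiableI[OF smooth_on_has_derivative[OF assms(4,2)]]])

lemma partial_bilinear:
 assumes "bounded_bilinear h" "smooth_on S f" "smooth_on S g" "x : S"
 shows "partial j (%x. h (f x) (g x)) x = h (partial j f x) (g x) + h (f x) (partial j g x)"
proof -
 have "((%x. h (f x) (g x)) has_derivative
   (%v. h (f x) (frechet_derivative g (at x) v) + h (frechet_derivative f (at x) v) (g x))) (at x)"
  by (rule bounded_bilinear.FDERIV[OF assms(1) smooth_on_has_derivative[OF assms(2,4)] smooth_on_has_derivative[OF assms(3,4)]])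
 from partial_has_derivative[OF this] show ?thesis by (simp add: partial_def add.commute)
qed

lemma partial_mult:
 fixes f g :: "real^'m::finite => 'a::real_normed_algebra"
 assumes "smooth_on S f" "smooth_on S g" "x : S"
 shows "partial j (%x. f x * g x) x = partial j f x * g x + f x * partial j g x"
 by (rule partial_bilinear[OF bounded_bilinear_mult assms])

lemma partial_linear:
 assumes "bounded_linear h" "smooth_on S f" "x : S"
 shows "partial j (%x. h (f x)) x = h (partial j f x)"
proof -
 have "((%x. h (f x)) has_derivative (%v. h (frechet_derivative f (at x) v))) (at x)"
  by (rule bounded_linear.has_derivative[OF assms(1) smooth_on_has_derivative[OF assms(2,3)]])
 from partial_has_derivative[OF this] show ?thesis by (simp add: partial_def)
qed

lemma partial_add:
 assumes "smooth_on S f" "smooth_on S g" "x : S"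
 shows "partial j (%x. f x + g x) x = partial j f x + partial j g x"
proof -
 have "((%x. f x + g x) has_derivative (%v. frechet_derivative f (at x) v + frechet_derivative g (at x) v)) (at x)"
  by (rule has_derivative_add[OF smooth_on_has_derivative[OF assms(1,3)] smooth_on_has_derivative[OF assms(2,3)]])
 from partial_has_derivative[OF this] show ?thesis by (simp add: partial_def)
qed

lemma partial_const [simp]: "partial j (%x. c) x = 0"
 by (rule partial_has_derivative[OF has_derivative_const])

lemma partial_minus: "smooth_on S f ==> x : S ==> partial j (%x. - f x) x = - partial j f x"
 by (rule partial_linear[OF bounded_linear_minus[OF bounded_linear_ident]])

lemma partial_diff:
 "open S ==> smooth_on S f ==> smooth_on S g ==> x : S ==> partial j (%x. f x - g x) x = partial j f x - partial j g x"
 using partial_add[of S f "%x. - g x" x j] by (simp add: smooth_on_minus partial_minus)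

lemma partial_sum:
 assumes "open S" "finite I" "!!i. i : I ==> smooth_on S (f i)" "x : S"
 shows "partial j (%x. SUM i:I. f i x) x = (SUM i:I. partial j (f i) x)"
 using assms(2,3)
proof (induction I rule: finite_induct)
 case (insert i I)
 thus ?case
  by (simp add: partial_add[OF _ smooth_on_sum[OF assms(1) insert.hyps(1)] assms(4)])
qed simp

lemma partials_Nil [simp]: "partials [] f = f"
 by (simp add: partials_def)

lemma partials_Cons: "partials (j # js) f = partial j (partials js f)"
 by (simp add: partials_def)

lemma partials_snoc: "partials (js @ [j]) f = partials js (partial j f)"
 by (simp add: partials_def)

lemma smooth_on_partials: "smooth_on S f ==> smooth_on S (partials js f)"
 by (induction js) (auto simp: partials_Cons smooth_on_partial)

lemma partials_add:
 "smooth_on UNIV f ==> smooth_on UNIV g ==> partials js (%x. f x + g x) = (%x. partials js f x + partials js g x)"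
proof (induction js)
 case (Cons j js)
 hence IH: "partials js (%x. f x + g x) = (%x. partials js f x + partials js g x)" by blast
 show ?case
  unfolding partials_Cons IH
  by (rule ext, rule partial_add[OF smooth_on_partials[OF Cons.prems(1)] smooth_on_partials[OF Cons.prems(2)] UNIV_I])
qed simp

lemma partials_sum:
 assumes "finite I" "!!i. i : I ==> smooth_on UNIV (f i)"
 shows "partials js (%x. SUM i:I. f i x) = (%x. SUM i:I. partials js (f i) x)"
proof (induction js)
 case (Cons j js)
 show ?case
  unfolding partials_Cons Cons.IH
  by (rule ext, rule partial_sum[OF open_UNIV assms(1) smooth_on_partials[OF assms(2)] UNIV_I])
qed simp

lemma partials_diff:
 "smooth_on UNIV f ==> smooth_on UNIV g ==> partials js (%x. f x - g x) = (%x. partials js f x - partials js g x)"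
proof (induction js)
 case (Cons j js)
 hence IH: "partials js (%x. f x - g x) = (%x. partials js f x - partials js g x)" by blast
 show ?case
  unfolding partials_Cons IH
  by (rule ext, rule partial_diff[OF open_UNIV smooth_on_partials[OF Cons.prems(1)] smooth_on_partials[OF Cons.prems(2)] UNIV_I])
qed simp

lemma partials_scale:
 fixes c :: complex
 shows "smooth_on UNIV f ==> partials js (%x. c * f x) = (%x. c * partials js f x)"
proof (induction js)
 case (Cons j js)
 hence IH: "partials js (%x. c * f x) = (%x. c * partials js f x)" by blast
 show ?case
  unfolding partials_Cons IH
  by (rule ext, rule partial_linear[OF bounded_linear_mult_right smooth_on_partials[OF Cons.prems] UNIV_I])
qed simp

lemma test_suppD:
 "g : test_functions_supp K ==> smooth_on UNIV g" "g : test_functions_supp K ==> x ~: K ==> g x = 0"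
 by (auto simp: test_functions_supp_def)

lemma test_functionsE:
 assumes "g : tests Om"
 obtains K where "compact K" "K <= Om" "g : test_functions_supp K"
 using assms by (auto simp: test_functions_def)

lemma test_smooth: "g : tests Om ==> smooth_on UNIV g"
 by (elim test_functionsE) (rule test_suppD)

lemma test_mono: "Om <= Om' ==> tests Om <= tests Om'"
 unfolding test_functions_def by blast

lemma test_functionsI: "compact K ==> K <= Om ==> g : test_functions_supp K ==> g : tests Om"
 by (auto simp: test_functions_def)

lemma test_supp_mult_smooth:
 "g : test_functions_supp K ==> smooth_on UNIV s ==> (%x. g x * s x) : test_functions_supp K"
 by (auto simp: test_functions_supp_def intro: smooth_on_mult)

lemma test_mult_smooth:
 "g : tests Om ==> smooth_on UNIV s ==> (%x. g x * s x) : tests Om"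
 by (auto simp: test_functions_def intro: test_supp_mult_smooth)

lemma test_add:
 assumes "g : tests Om" "h : tests Om"
 shows "(%x. g x + h x) : tests Om"
proof -
 obtain K K' where "compact K" "K <= Om" "g : test_functions_supp K" "compact K'" "K' <= Om" "h : test_functions_supp K'"
  using assms by (metis test_functionsE)
 thus ?thesis
  by (intro test_functionsI[of "K Un K'"]) (auto simp: test_functions_supp_def intro: smooth_on_add)
qed

lemma test_zero: "(%x. 0) : tests Om"
 by (rule test_functionsI[of "{}"]) (auto simp: test_functions_supp_def)

lemma test_sum:
 "finite I ==> (!!i. i : I ==> f i : tests Om) ==> (%x. SUM i:I. f i x) : tests Om"
 by (induction I rule: finite_induct) (auto intro: test_add test_zero)

lemma test_scale: "g : tests Om ==> (%x. c * g x) : tests Om"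
 using test_mult_smooth[of g Om "%x. c"] by (simp add: mult.commute)

lemma test_supp_partial:
 assumes "closed K" "g : test_functions_supp K"
 shows "partial j g : test_functions_supp K"
 unfolding test_functions_supp_def
proof (safe)
 show "smooth_on UNIV (partial j g)" by (rule smooth_on_partial[OF test_suppD(1)[OF assms(2)]])
 fix x assume "x ~: K"
 thus "partial j g x = 0"
  using partial_cong[of "- K" x "%x. 0" g j] assms test_suppD(2)[OF assms(2)]
  by (auto simp: open_Compl)
qed

lemma test_partial: "g : tests Om ==> partial j g : tests Om"
 by (elim test_functionsE) (auto intro!: test_functionsI test_supp_partial compact_imp_closed)

lemma test_partials: "g : tests Om ==> partials js g : tests Om"
 by (induction js) (auto simp: partials_Cons test_partial)

text \<open>The values of \<open>s\<close> outside \<open>Om\<close> are arbitrary: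
  \<open>Om\<close> and the complement of the support \<open>K\<close> cover the space, and the
  product vanishes on the latter.\<close>

lemma test_mult_local:
 assumes "open Om" "g : tests Om" "smooth_on Om s"
 shows "(%x. s x * g x) : tests Om"
proof -
 obtain K where K: "compact K" "K <= Om" "g : test_functions_supp K" using assms(2) by (rule test_functionsE)
 have "smooth_on UNIV (%x. s x * g x)"
 proof (rule smooth_on_open_Union)
  fix x :: "real^'a"
  show "EX T. open T & x : T & smooth_on T (%x. s x * g x)"
  proof (cases "x : K")
   case True
   have "smooth_on Om (%x. s x * g x)"
    by (rule smooth_on_mult[OF assms(1,3) smooth_on_subset[OF test_smooth[OF assms(2)]]]) simp
   thus ?thesis using True K assms by blast
  next
   case False
   have "smooth_on (- K) (%x. s x * g x)"
    by (rule smooth_on_cong[of _ "%x. 0"])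
     (use K test_suppD(2)[OF K(3)] compact_imp_closed in "auto simp: open_Compl")
   thus ?thesis using False K by (auto intro!: exI[of _ "- K"] simp: open_Compl compact_imp_closed)
  qed
 qed
 thus ?thesis
  using K by (intro test_functionsI[of K]) (auto simp: test_functions_supp_def)
qed

lemma test_cnj: "g : tests Om ==> (%x. cnj (g x)) : tests Om"
 by (auto simp: test_functions_def test_functions_supp_def intro!: smooth_on_linear[OF bounded_linear_cnj])

text \<open>Compactness leaves room for a ball strictly between \<open>K\<close> and the sphere.
  Having \<open>psi = 1\<close> on an open ball around \<open>K\<close>, and not only on
  \<open>K\<close>, makes derivatives of cut-off fields agree with those of the fields
  there.\<close>

lemma cutoff_exists:
 fixes x0 :: "real^'m::finite"
 assumes "compact K" "K <= ball x0 r" "0 < r"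
 obtains psi rho where "psi : tests (ball x0 r)" "K <= ball x0 rho" "rho < r" "0 < rho" "!!x. x : ball x0 rho ==> psi x = 1"
proof -
 obtain rho0 where rho0: "rho0 < r" "K <= cball x0 rho0"
 proof (cases "K = {}")
  case True
  thus ?thesis using that[of "r / 2"] assms by auto
 next
  case False
  obtain y where y: "y : K" "!!z. z : K ==> dist x0 z <= dist x0 y"
   using distance_attains_sup[OF assms(1) False] by blast
  show ?thesis
  proof (rule that)
   show "dist x0 y < r" using y(1) assms by auto
   show "K <= cball x0 (dist x0 y)" using y(2) by auto
  qed
 qed
 define rho where "rho = (max rho0 0 + r) / 2"
 have rho: "rho0 < rho" "rho < r" "0 < rho" using rho0 assms by (auto simp: rho_def max_def)
 obtain phi :: "real^'m => real" where phi: "smooth_on UNIV phi" "!!x. x : cball x0 rho ==> phi x = 1"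
  "!!x. x ~: ball x0 ((rho + r) / 2) ==> phi x = 0"
  by (rule smooth_cutoff[of rho "(rho + r) / 2" x0]) (use rho in auto)
 have "(%x. complex_of_real (phi x)) : tests (ball x0 r)"
 proof (rule test_functionsI[of "cball x0 ((rho + r) / 2)"])
  show "(%x. complex_of_real (phi x)) : test_functions_supp (cball x0 ((rho + r) / 2))"
   using phi by (auto simp: test_functions_supp_def intro!: smooth_on_linear[OF bounded_linear_of_real])
 qed (use rho in auto)
 moreover have "K <= ball x0 rho" using rho0(2) rho(1) by fastforce
 ultimately show ?thesis using that[of "%x. complex_of_real (phi x)" rho] rho phi(2) by auto
qed

section \<open>Exponentials and Fourier series with rapidly decreasing coefficients\<close>

definition ek :: "int^'m::finite => real^'m => complex" where
 "ek k x = cis (lvec k \<bullet> x)"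

lemma norm_ek [simp]: "cmod (ek k x) = 1"
 by (simp add: ek_def)

lemma ek_add: "ek (k + l) x = ek k x * ek l x"
 by (simp add: ek_def lvec_add inner_add_left cis_mult)

lemma lvec_0 [simp]: "lvec 0 = 0"
 by (simp add: lvec_def vec_eq_iff)

lemma ek_0 [simp]: "ek 0 x = 1"
 by (simp add: ek_def)

lemma ek_minus: "ek (- k) x = cnj (ek k x)"
 by (simp add: ek_def lvec_minus cis_cnj)

lemma cis_second_order: "cmod (cis th - 1 - \<i> * th) <= th^2"
proof -
 have "{..Suc 0} = {0, 1::nat}" by auto
 thus ?thesis
  using Taylor_exp[of "\<i> * of_real th" 1] by (simp add: cis_conv_exp norm_mult power2_eq_square algebra_simps)
qed

lemma inner_lattice_le: "abs (lvec k \<bullet> v) <= jb k * norm v"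
 using Cauchy_Schwarz_ineq2[of "lvec k" v] mult_right_mono[OF norm_le_jb[of k], of "norm v"] by simp

definition fseries :: "'m::finite seq => real^'m => complex" where
 "fseries a x = (INFSUM k. a k * ek k x)"

lemma fseries_summable: "rapid a ==> (%k. a k * ek k x) summable_on UNIV"
 by (rule abs_summable_summable) (use rapid_summable[of a 0] in "simp add: norm_mult")

lemma rapid_inner: "rapid a ==> rapid (%k. \<i> * of_real (lvec k \<bullet> v) * a k)"
proof (unfold rapid_def, intro allI)
 fix N assume "ALL N. EX C. ALL k. cmod (a k) * jb k ^ N <= C"
 then obtain C where C: "!!k. cmod (a k) * jb k ^ Suc N <= C" by meson
 have "cmod (\<i> * of_real (lvec k \<bullet> v) * a k) * jb k ^ N <= norm v * C" for k
 proof -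
  have "cmod (\<i> * of_real (lvec k \<bullet> v) * a k) * jb k ^ N = abs (lvec k \<bullet> v) * (cmod (a k) * jb k ^ N)"
   by (simp add: norm_mult)
  also have "... <= (jb k * norm v) * (cmod (a k) * jb k ^ N)"
   by (intro mult_right_mono inner_lattice_le) auto
  also have "... = norm v * (cmod (a k) * jb k ^ Suc N)" by simp
  also have "... <= norm v * C" by (intro mult_left_mono C) auto
  finally show ?thesis .
 qed
 thus "EX C. ALL k. cmod (\<i> * of_real (lvec k \<bullet> v) * a k) * jb k ^ N <= C" by blast
qed

text \<open>Differentiation term by term: by \<open>cis_second_order\<close> each remainder is
  quadratic in \<open>v\<close>, and the sum \<open>C\<close> of the second-order weights
  converges.\<close>

lemma fseries_has_derivative:
 fixes a :: "'m::finite seq"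
 assumes a: "rapid a"
 shows "(fseries a has_derivative (%v. fseries (%k. \<i> * of_real (lvec k \<bullet> v) * a k) x)) (at x)"
proof -
 let ?D = "%v. fseries (%k. \<i> * of_real (lvec k \<bullet> v) * a k) x"
 note s = fseries_summable[OF rapid_inner[OF a]]
 define C where "C = (INFSUM k. cmod (a k) * jb k ^ 2)"
 have bl: "bounded_linear ?D"
 proof (rule bounded_linear_intro)
  fix u v :: "real^'m" and r :: real
  show "?D (u + v) = ?D u + ?D v"
   unfolding fseries_def using infsum_add[OF s s, of u x v x]
   by (simp add: inner_add_right algebra_simps)
  show "?D (r *\<^sub>R v) = r *\<^sub>R ?D v"
   unfolding fseries_def scaleR_conv_of_real[where 'a = complex] infsum_cmult_right'[symmetric]
   by (intro infsum_cong) (simp add: mult_ac)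
  have "norm (?D v) <= (INFSUM k. norm v * (cmod (a k) * jb k ^ 1))"
   unfolding fseries_def
  proof (rule order_trans[OF norm_infsum_bound infsum_mono])
   show *: "(%k. cmod (\<i> * of_real (lvec k \<bullet> v) * a k * ek k x)) summable_on UNIV"
    using rapid_summable[OF rapid_inner[OF a, of v], of 0] by (simp add: norm_mult)
   thus "(%k. cmod (\<i> * of_real (lvec k \<bullet> v) * a k * ek k x)) summable_on UNIV" .
   show "(%k. norm v * (cmod (a k) * jb k ^ 1)) summable_on UNIV"
    by (intro summable_on_cmult_right rapid_summable a)
   show "cmod (\<i> * of_real (lvec k \<bullet> v) * a k * ek k x) <= norm v * (cmod (a k) * jb k ^ 1)" for k
    using mult_right_mono[OF inner_lattice_le[of k v], of "cmod (a k)"] by (simp add: norm_mult mult_ac)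
  qed
  thus "norm (?D v) <= norm v * (INFSUM k. cmod (a k) * jb k ^ 1)" by (simp add: infsum_cmult_right')
 qed
 have est: "cmod (fseries a (x + v) - fseries a x - ?D v) <= C * (norm v)^2" for v
 proof -
  let ?f = "%k. a k * ek k (x + v) - a k * ek k x - \<i> * of_real (lvec k \<bullet> v) * a k * ek k x"
  have eq: "fseries a (x + v) - fseries a x - ?D v = (INFSUM k. ?f k)"
   unfolding fseries_def
   by (simp add: infsum_diff summable_on_diff fseries_summable[OF a] s)
  have le: "cmod (?f k) <= (norm v)^2 * (cmod (a k) * jb k ^ 2)" for k
  proof -
   have "?f k = a k * ek k x * (cis (lvec k \<bullet> v) - 1 - \<i> * (lvec k \<bullet> v))"
    by (simp add: ek_def inner_add_right cis_mult[symmetric] algebra_simps)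
   hence "cmod (?f k) = cmod (a k) * cmod (cis (lvec k \<bullet> v) - 1 - \<i> * (lvec k \<bullet> v))"
    by (simp add: norm_mult)
   also have "... <= cmod (a k) * (lvec k \<bullet> v)^2"
    by (intro mult_left_mono cis_second_order) auto
   also have "... <= cmod (a k) * (jb k * norm v)^2"
    using power_mono[OF inner_lattice_le[of k v], of 2] by (intro mult_left_mono) auto
   finally show ?thesis by (simp add: power_mult_distrib mult_ac)
  qed
  have s2: "(%k. (norm v)^2 * (cmod (a k) * jb k ^ 2)) summable_on UNIV"
   by (intro summable_on_cmult_right rapid_summable a)
  have s3: "(%k. cmod (?f k)) summable_on UNIV"
   by (rule summable_on_comparison_test[OF s2]) (use le in auto)
  have "cmod (INFSUM k. ?f k) <= (INFSUM k. (norm v)^2 * (cmod (a k) * jb k ^ 2))"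
   by (rule order_trans[OF norm_infsum_bound[OF s3] infsum_mono[OF s3 s2 le]])
  thus ?thesis unfolding eq C_def by (simp add: infsum_cmult_right' mult.commute)
 qed
 show ?thesis
  unfolding has_derivative_at
 proof (intro conjI bl)
  have "((%h::real^'m. C * norm h) \<longlongrightarrow> C * norm (0::real^'m)) (at 0)"
   by (rule tendsto_mult[OF tendsto_const tendsto_norm[OF tendsto_ident_at]])
  hence lim: "((%h. C * norm (h::real^'m)) \<longlongrightarrow> 0) (at 0)" by simp
  show "(%h. norm (fseries a (x + h) - fseries a x - ?D h) / norm h) \<midarrow>0\<rightarrow> 0"
  proof (rule tendsto_sandwich[OF _ _ tendsto_const lim])
   show "\<forall>\<^sub>F h in at 0. norm (fseries a (x + h) - fseries a x - ?D h) / norm h <= C * norm h"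
    using est by (auto simp: eventually_at_filter divide_simps power2_eq_square mult_ac)
  qed auto
 qed
qed

lemma smooth_fseries: "rapid a ==> smooth_on UNIV (fseries a)"
proof (rule smooth_onI)
 show "rapid a ==> C_k_on n UNIV (fseries a)" for n
 proof (induction n arbitrary: a)
  case 0
  have "continuous (at x) (fseries a)" for x
   by (rule has_derivative_continuous[OF fseries_has_derivative[OF 0]])
  thus ?case by (simp add: continuous_at_imp_continuous_on)
 next
  case (Suc n)
  show ?case
   by (rule C_k_on_SucI[OF open_UNIV fseries_has_derivative[OF Suc.prems] Suc.IH[OF rapid_inner[OF Suc.prems]]])
 qed
qed

lemma ek_has_derivative: "(ek k has_derivative (%v. \<i> * of_real (lvec k \<bullet> v) * ek k x)) (at x)"
proof -
 have "((%x. exp (\<i> * of_real (lvec k \<bullet> x))) has_derivative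
   (%v. exp (\<i> * of_real (lvec k \<bullet> x)) * (\<i> * of_real (lvec k \<bullet> v)))) (at x)"
  by (rule has_derivative_compose[OF _ DERIV_exp[unfolded has_field_derivative_def]])
   (auto intro!: derivative_eq_intros)
 thus ?thesis by (simp add: ek_def[abs_def] cis_conv_exp mult_ac)
qed

lemma smooth_ek: "smooth_on UNIV (ek k)"
proof (rule smooth_onI)
 show "C_k_on n UNIV (ek k)" for n
 proof (induction n)
  case 0
  have "continuous (at x) (ek k)" for x
   by (rule has_derivative_continuous[OF ek_has_derivative])
  thus ?case by (simp add: continuous_at_imp_continuous_on)
 next
  case (Suc n)
  show ?case
   by (rule C_k_on_SucI[OF open_UNIV ek_has_derivative])
    (rule C_k_on_bounded_linear[OF bounded_linear_mult_right open_UNIV Suc])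
 qed
qed

lemma partial_ek: "partial j (ek k) x = \<i> * of_int (k $ j) * ek k x"
 using partial_has_derivative[OF ek_has_derivative] by (simp add: inner_axis lvec_def)

text \<open>A period cell. It contains \<open>ball x0 pi\<close>, and a point of that ball differs
  from every point of the cell by less than \<open>2 * pi\<close> in each coordinate; hence no two
  of them are identified by periodicity.\<close>

definition cube :: "real^'m::finite => (real^'m) set" where
 "cube x0 = cbox (x0 - (\<chi> i. pi)) (x0 + (\<chi> i. pi))"

lemma mem_cube: "x : cube x0 \<longleftrightarrow> (ALL i. abs (x $ i - x0 $ i) <= pi)"
 by (auto simp: cube_def mem_box_cart abs_le_iff algebra_simps)

lemma ball_pi_component: "x : ball x0 pi ==> abs (x $ i - x0 $ i) < pi"
 using component_le_norm_cart[of "x - x0" i] by (simp add: dist_norm norm_minus_commute)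

lemma ball_pi_subset_cube: "ball x0 pi <= cube x0"
 unfolding mem_cube subset_iff using ball_pi_component by (blast intro: less_imp_le)

lemma compact_cube: "compact (cube x0)"
 by (simp add: cube_def)

definition cube_int :: "real^'m::finite => (real^'m => complex) => complex" where
 "cube_int x0 f = (LINT x|lborel. indicator (cube x0) x *\<^sub>R f x)"

lemma cube_integrable: "continuous_on UNIV f ==> integrable lborel (%x. indicator (cube x0) x *\<^sub>R f x)"
 for f :: "real^'m::finite => 'a::{banach, second_countable_topology}"
 by (rule borel_integrable_compact[OF compact_cube]) (auto intro: continuous_on_subset)

lemma interval_int_cis:
 "(LINT x|lborel. indicator {a - pi..a + pi} x *\<^sub>R cis (of_int n * x)) = (if n = 0 then 2 * of_real pi else 0)"
proof (cases "n = 0")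
 case True
 thus ?thesis by (simp add: scaleR_conv_of_real)
next
 case False
 define F where "F = (%x::real. cis (of_int n * x) / (\<i> * of_int n))"
 have "(LINT x|lborel. indicator {a - pi..a + pi} x *\<^sub>R cis (of_int n * x)) = F (a + pi) - F (a - pi)"
 proof (rule integral_FTC_Icc)
  show "continuous_on {a - pi..a + pi} (%x. cis (of_int n * x))" by (intro continuous_intros)
  fix x
  have "((%x. exp (\<i> * (of_int n * complex_of_real x)) / (\<i> * of_int n)) has_vector_derivative
    exp (\<i> * (of_int n * complex_of_real x))) (at x within {a - pi..a + pi})"
   using False
   by (auto intro!: derivative_eq_intros has_vector_derivative_real_field simp: field_simps)
  thus "(F has_vector_derivative cis (of_int n * x)) (at x within {a - pi..a + pi})"
   by (simp add: F_def cis_conv_exp)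
 qed simp
 also have "F (a + pi) = F (a - pi)"
 proof -
  have "of_int n * (a + pi) = of_int n * (a - pi) + 2 * pi * of_int n" by (simp add: algebra_simps)
  hence "cis (of_int n * (a + pi)) = cis (of_int n * (a - pi)) * cis (2 * pi * of_int n)"
   by (simp only: cis_mult)
  moreover have "cis (2 * pi * of_int n) = 1" by (rule cis_multiple_2pi) simp
  ultimately show ?thesis by (simp add: F_def)
 qed
 finally show ?thesis using False by simp
qed

text \<open>The integral factors over the coordinates, and for \<open>k\<close> nonzero one factor
  integrates a nontrivial character over a full period.\<close>

lemma cube_int_ek:
 fixes x0 :: "real^'m::finite"
 shows "cube_int x0 (ek k) = (if k = 0 then (2 * of_real pi) ^ CARD('m) else 0)"
proof -
 interpret product_sigma_finite "%b::real^'m. lborel :: real measure" ..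
 define g where "g = (%(b::real^'m) x. indicator {x0 \<bullet> b - pi..x0 \<bullet> b + pi} x *\<^sub>R cis ((lvec k \<bullet> b) * x))"
 have n: "EX n::int. lvec k \<bullet> b = of_int n" if "b : Basis" for b
  using that by (auto simp: Basis_vec_def inner_axis lvec_def)
 have gi: "integrable lborel (g b)" for b
  unfolding g_def by (rule borel_integrable_compact) (auto intro!: continuous_intros)
 have eq: "indicator (cube x0) (SUM b:Basis. f b *\<^sub>R b) *\<^sub>R ek k (SUM b:Basis. f b *\<^sub>R b) = (PROD b:Basis. g b (f b))"
  for f :: "real^'m => real"
 proof -
  define x where "x = (SUM b:Basis. f b *\<^sub>R b)"
  have xb: "x \<bullet> b = f b" if "b : Basis" for b using that by (simp add: x_def inner_sum_left inner_Basis if_distrib cong: if_cong)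
  have "ek k x = cis (SUM b:Basis. (lvec k \<bullet> b) * (x \<bullet> b))"
   unfolding ek_def by (subst euclidean_inner) simp
  also have "... = (PROD b:Basis. cis ((lvec k \<bullet> b) * (x \<bullet> b)))"
  proof -
   have "finite B ==> cis (SUM b:B. h b) = (PROD b:B. cis (h b))" for B :: "(real^'m) set" and h
    by (induction B rule: finite_induct) (auto simp: cis_mult[symmetric])
   thus ?thesis by simp
  qed
  also have "... = (PROD b:Basis. cis ((lvec k \<bullet> b) * f b))" by (intro prod.cong refl) (simp add: xb)
  finally have e: "ek k x = (PROD b:Basis. cis ((lvec k \<bullet> b) * f b))" .
  have c: "x : cube x0 \<longleftrightarrow> (ALL b:Basis. f b : {x0 \<bullet> b - pi..x0 \<bullet> b + pi})"
   unfolding cube_def mem_box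
   by (intro ball_cong refl) (auto simp: xb Basis_vec_def inner_diff_left inner_add_left inner_axis)
  show ?thesis
  proof (cases "x : cube x0")
   case True
   hence "(PROD b:Basis. g b (f b)) = (PROD b:Basis. cis ((lvec k \<bullet> b) * f b))"
    using c by (intro prod.cong refl) (auto simp: g_def)
   thus ?thesis using True e by (simp add: x_def)
  next
   case False
   then obtain b where "b : Basis" "f b ~: {x0 \<bullet> b - pi..x0 \<bullet> b + pi}" using c by blast
   hence "g b (f b) = 0" "b : Basis" by (auto simp: g_def)
   hence "(PROD b:Basis. g b (f b)) = 0" by (metis finite_Basis prod_zero)
   thus ?thesis using False by (simp add: x_def)
  qed
 qed
 have meas: "(%x. indicator (cube x0) x *\<^sub>R ek k x) : borel_measurable borel"
  using borel_measurable_integrable[OF cube_integrable[OF smooth_on_continuous[OF smooth_ek]]] by simp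
 have "cube_int x0 (ek k) = (\<integral>f. indicator (cube x0) (SUM b:Basis. f b *\<^sub>R b) *\<^sub>R ek k (SUM b:Basis. f b *\<^sub>R b) \<partial>(\<Pi>\<^sub>M b\<in>Basis. lborel))"
  unfolding cube_int_def by (subst lborel_eq) (rule integral_distr[OF _ meas], simp)
 also have "... = (PROD b:Basis. LINT x|lborel. g b x)"
  unfolding eq by (rule product_integral_prod[OF _ gi]) simp
 also have "... = (PROD b:(Basis :: (real^'m) set). if lvec k \<bullet> b = 0 then 2 * of_real pi else 0)"
 proof (intro prod.cong refl)
  fix b :: "real^'m" assume "b : Basis"
  then obtain n :: int where "lvec k \<bullet> b = of_int n" using n by blast
  thus "(LINT x|lborel. g b x) = (if lvec k \<bullet> b = 0 then 2 * of_real pi else 0)"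
   unfolding g_def using interval_int_cis[of "x0 \<bullet> b" n] by simp
 qed
 also have "... = (if k = 0 then (2 * of_real pi) ^ CARD('m) else 0)"
 proof (cases "k = 0")
  case False
  then obtain i where "k $ i ~= 0" by (auto simp: vec_eq_iff)
  hence "lvec k \<bullet> axis i 1 ~= 0" "axis i 1 : (Basis :: (real^'m) set)"
   by (auto simp: inner_axis lvec_def Basis_vec_def)
  hence "(PROD b:(Basis :: (real^'m) set). if lvec k \<bullet> b = 0 then 2 * of_real pi else (0::complex)) = 0"
   by (intro prod_zero) auto
  thus ?thesis using False by simp
 qed simp
 finally show ?thesis .
qed

section \<open>Fourier series\<close>

lemma infsum_tail_le:
 fixes f :: "'a => 'b::banach"
 assumes "(%x. norm (f x)) summable_on UNIV" "finite F"
 shows "norm (infsum f UNIV - sum f F) <= (INFSUM x. norm (f x)) - (SUM x:F. norm (f x))"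
proof -
 have s: "f summable_on UNIV" by (rule abs_summable_summable[OF assms(1)])
 have e1: "infsum f (UNIV - F) = infsum f UNIV - sum f F"
  using infsum_Diff[OF s, of F] assms(2) by simp
 have e2: "infsum (%x. norm (f x)) (UNIV - F) = infsum (%x. norm (f x)) UNIV - (SUM x:F. norm (f x))"
  using infsum_Diff[OF assms(1), of F] assms(2) by simp
 have "(%x. norm (f x)) summable_on (UNIV - F)" by (rule summable_on_subset_banach[OF assms(1)]) simp
 hence "norm (infsum f (UNIV - F)) <= infsum (%x. norm (f x)) (UNIV - F)" by (rule norm_infsum_bound)
 thus ?thesis unfolding e1 e2 .
qed

lemma tail_tendsto_0:
 fixes f :: "'a => real"
 assumes "f summable_on UNIV"
 shows "((%F. infsum f UNIV - sum f F) \<longlongrightarrow> 0) (finite_subsets_at_top UNIV)"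
 using tendsto_diff[OF tendsto_const infsum_tendsto[OF assms], of "infsum f UNIV"] by simp

lemma test_integrable:
 assumes "g : tests Om"
 shows "integrable lborel g"
proof -
 obtain K where K: "compact K" "g : test_functions_supp K" using assms by (rule test_functionsE)
 have "integrable lborel (%x. indicator K x *\<^sub>R g x)"
  by (rule borel_integrable_compact[OF K(1)])
   (rule continuous_on_subset[OF smooth_on_continuous[OF test_suppD(1)[OF K(2)]]], simp)
 also have "(%x. indicator K x *\<^sub>R g x) = g"
  using test_suppD(2)[OF K(2)] by (auto simp: fun_eq_iff indicator_def)
 finally show ?thesis .
qed

lemma test_bounded:
 assumes "g : tests Om"
 obtains B where "0 <= B" "!!x. norm (g x) <= B"
proof -
 obtain K where K: "compact K" "g : test_functions_supp K" using assms by (rule test_functionsE)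
 have "compact (g ` K)"
  by (rule compact_continuous_image[OF continuous_on_subset[OF smooth_on_continuous[OF test_suppD(1)[OF K(2)]]] K(1)]) simp
 then obtain B where B: "!!y. y : g ` K ==> norm y <= B" by (meson compact_imp_bounded bounded_iff)
 have "norm (g x) <= max B 0" for x
  using B[of "g x"] test_suppD(2)[OF K(2), of x] by (cases "x : K") (auto simp: le_max_iff_disj)
 thus ?thesis using that[of "max B 0"] by auto
qed

lemma integral_translate:
 fixes f :: "real^'m::finite => complex"
 assumes "integrable lborel f"
 shows "integrable lborel (%x. f (c + x))" "(LINT x|lborel. f (c + x)) = (LINT x|lborel. f x)"
proof -
 have m: "f : borel_measurable borel" using borel_measurable_integrable[OF assms] by simp
 have d: "distr lborel borel ((+) c) = (lborel :: (real^'m) measure)" by (rule lborel_distr_plus)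
 show "integrable lborel (%x. f (c + x))"
  using assms integrable_distr_eq[of "(+) c" lborel borel f] m by (simp add: d)
 show "(LINT x|lborel. f (c + x)) = (LINT x|lborel. f x)"
  using integral_distr[of "(+) c" lborel borel f] m by (simp add: d)
qed

text \<open>Difference quotients have integral 0 by translation invariance of Lebesgue measure, and
  dominated convergence passes to the derivative.\<close>

lemma integral_partial_eq_0:
 fixes g :: "real^'m::finite => complex"
 assumes g: "g : tests Om"
 shows "(LINT x|lborel. partial j g x) = 0"
proof -
 obtain K where K: "compact K" "g : test_functions_supp K" using g by (rule test_functionsE)
 obtain B where B: "0 <= B" "!!x. norm (partial j g x) <= B" using test_bounded[OF test_partial[OF g, of j]] by blast
 obtain r where r: "K <= ball 0 r" by (meson K(1) bounded_subset_ballD compact_imp_bounded)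
 define e where "e = (axis j 1 :: real^'m)"
 \<comment> \<open>Steps of length at most 1 keep all difference quotients supported in one ball,
   which provides the dominating function.\<close>
 define d where "d = (%n::nat. inverse (real (Suc n)))"
 define s where "s = (%n x. (g (d n *\<^sub>R e + x) - g x) / of_real (d n))"
 have d: "0 < d n" "d n <= 1" for n by (auto simp: d_def inverse_le_1_iff)
 have ne: "norm e = 1" by (simp add: e_def)
 have sm: "smooth_on UNIV g" by (rule test_smooth[OF g])
 have hd: "(g has_derivative frechet_derivative g (at x)) (at x)" for x by (rule smooth_on_has_derivative[OF sm]) simp
 have int_s: "integrable lborel (s n)" "(LINT x|lborel. s n x) = 0" for n
 proof -
  note t = integral_translate[OF test_integrable[OF g], of "d n *\<^sub>R e"]
  show "integrable lborel (s n)" unfolding s_def using t test_integrable[OF g] by simp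
  show "(LINT x|lborel. s n x) = 0" unfolding s_def using t test_integrable[OF g] by simp
 qed
 have bound: "norm (s n x) <= B * indicator (cball 0 (abs r + 1)) x" for n x
 proof (cases "x : cball 0 (abs r + 1)")
  case True
  define p where "p = (%t. g (t *\<^sub>R e + x))"
  have hp: "(p has_derivative (%h. h *\<^sub>R partial j g (t *\<^sub>R e + x))) (at t)" for t
  proof -
   have lin: "linear (frechet_derivative g (at (t *\<^sub>R e + x)))" by (rule has_derivative_linear[OF hd])
   have "((%t. t *\<^sub>R e + x) has_derivative (%h. h *\<^sub>R e)) (at t)" by (auto intro!: derivative_eq_intros)
   from has_derivative_compose[OF this hd] show ?thesis
    by (simp add: p_def linear_scale[OF lin] partial_def flip: e_def)
  qed
  have "EX t:{0<..<d n}. norm (p (d n) - p 0) <= norm ((d n - 0) *\<^sub>R partial j g (t *\<^sub>R e + x))"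
   by (rule mvt_general[OF d(1)]) (auto intro!: hp continuous_at_imp_continuous_on has_derivative_continuous[OF hp])
  then obtain t where "norm (p (d n) - p 0) <= d n * norm (partial j g (t *\<^sub>R e + x))" using d(1)[of n] by auto
  also have "... <= d n * B" using d(1)[of n] B by (intro mult_left_mono) auto
  finally have "norm (p (d n) - p 0) / d n <= B" using d(1)[of n] by (simp add: field_simps)
  thus ?thesis using True d(1)[of n] by (simp add: s_def p_def norm_divide)
 next
  case False
  hence x: "norm x > abs r + 1" by simp
  have "norm (d n *\<^sub>R e) <= 1" using d[of n] ne by simp
  hence "norm (d n *\<^sub>R e + x) > abs r" using x norm_triangle_ineq4[of "d n *\<^sub>R e + x" "d n *\<^sub>R e"] by simp
  hence "d n *\<^sub>R e + x ~: K" "x ~: K" using x r by auto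
  thus ?thesis using False test_suppD(2)[OF K(2)] by (simp add: s_def)
 qed
 have lim: "(%n. s n x) \<longlonglongrightarrow> partial j g x" for x
 proof -
  let ?q = "%h. norm (g (x + h) - g x - frechet_derivative g (at x) h) / norm h"
  have lin: "linear (frechet_derivative g (at x))" by (rule has_derivative_linear[OF hd])
  have q: "(?q \<longlongrightarrow> 0) (at 0)" using hd[of x] by (simp add: has_derivative_at)
  have d0: "d \<longlonglongrightarrow> 0" unfolding d_def by (rule LIMSEQ_inverse_real_of_nat)
  have "filterlim (%n. d n *\<^sub>R e) (at 0) sequentially"
   unfolding filterlim_at using tendsto_scaleR[OF d0 tendsto_const[of e]] d(1) ne
   by (auto simp: less_imp_neq[THEN not_sym])
  from filterlim_compose[OF q this] have "(%n. ?q (d n *\<^sub>R e)) \<longlonglongrightarrow> 0" .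
  also have "(%n. ?q (d n *\<^sub>R e)) = (%n. norm (s n x - partial j g x))"
  proof
   fix n
   have "s n x - partial j g x = (g (x + d n *\<^sub>R e) - g x - frechet_derivative g (at x) (d n *\<^sub>R e)) / of_real (d n)"
    using d(1)[of n] by (simp add: s_def partial_def linear_scale[OF lin] diff_divide_distrib scaleR_conv_of_real[where 'a=complex] add.commute flip: e_def)
   thus "?q (d n *\<^sub>R e) = norm (s n x - partial j g x)"
    using d(1)[of n] ne by (simp add: norm_divide)
  qed
  finally show ?thesis by (simp add: tendsto_norm_zero_iff LIM_zero_iff)
 qed
 have "(%n. LINT x|lborel. s n x) \<longlonglongrightarrow> (LINT x|lborel. partial j g x)"
 proof (rule integral_dominated_convergence[where w = "%x. B * indicator (cball 0 (abs r + 1)) x"])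
  show "partial j g : borel_measurable lborel"
   using test_integrable[OF test_partial[OF g]] by auto
  show "s n : borel_measurable lborel" for n using int_s(1)[of n] by auto
  show "integrable lborel (%x. B * indicator (cball 0 (abs r + 1)) x)"
   by (intro integrable_mult_right integrable_real_indicator) (auto intro: emeasure_lborel_cball_finite[unfolded infinity_ennreal_def])
 qed (use lim bound in auto)
 thus ?thesis using int_s(2) by (simp add: LIMSEQ_const_iff)
qed

definition fc :: "(real^'m::finite => complex) => 'm seq" where
 "fc phi k = (LINT x|lborel. phi x * ek (- k) x) / (2 * of_real pi) ^ CARD('m)"

lemma test_mult_ek: "phi : tests Om ==> (%x. phi x * ek k x) : tests Om"
 by (rule test_mult_smooth[OF _ smooth_ek])

lemma fc_integrable: "phi : tests Om ==> integrable lborel (%x. phi x * ek k x)"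
 by (rule test_integrable[OF test_mult_ek])

lemma fc_add: "phi : tests Om ==> psi : tests Om ==> fc (%x. phi x + psi x) k = fc phi k + fc psi k"
 by (simp add: fc_def distrib_right fc_integrable[of _ Om] add_divide_distrib)

lemma fc_diff: "phi : tests Om ==> psi : tests Om ==> fc (%x. phi x - psi x) k = fc phi k - fc psi k"
 by (simp add: fc_def left_diff_distrib fc_integrable[of _ Om] diff_divide_distrib)

lemma fc_zero: "fc (%x. 0) k = 0"
 by (simp add: fc_def)

lemma fc_sum:
 "finite I ==> (!!i. i : I ==> f i : tests Om) ==> fc (%x. SUM i:I. f i x) k = (SUM i:I. fc (f i) k)"
 by (induction I rule: finite_induct) (auto simp: fc_zero fc_add[of _ Om] test_sum)

lemma fc_minus: "fc (%x. - phi x) k = - fc phi k"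
 by (simp add: fc_def)

lemma fc_cnj: "phi : tests Om ==> fc (%x. cnj (phi x)) = star (fc phi)"
proof
 fix k
 assume phi: "phi : tests Om"
 have "(LINT x|lborel. cnj (phi x) * ek (- k) x) = (LINT x|lborel. cnj (phi x * ek k x))"
  by (simp add: ek_minus)
 also have "... = cnj (LINT x|lborel. phi x * ek k x)"
  by (rule integral_bounded_linear[OF bounded_linear_cnj fc_integrable[OF phi]])
 finally show "fc (%x. cnj (phi x)) k = star (fc phi) k" by (simp add: fc_def star_def)
qed

lemma fc_partial:
 assumes "phi : tests Om"
 shows "fc (partial j phi) = Dop j (fc phi)"
proof
 fix k
 have eq: "partial j (%x. phi x * ek (- k) x) x = partial j phi x * ek (- k) x - \<i> * of_int (k $ j) * (phi x * ek (- k) x)" for x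
  by (subst partial_mult[OF test_smooth[OF assms] smooth_ek]) (simp_all add: partial_ek algebra_simps)
 have "0 = (LINT x|lborel. partial j (%x. phi x * ek (- k) x) x)"
  by (rule integral_partial_eq_0[OF test_mult_ek[OF assms], symmetric])
 also have "... = (LINT x|lborel. partial j phi x * ek (- k) x) - (LINT x|lborel. \<i> * of_int (k $ j) * (phi x * ek (- k) x))"
  unfolding eq
  by (rule Bochner_Integration.integral_diff)
   (auto intro: fc_integrable[OF test_partial[OF assms]] fc_integrable[OF assms])
 finally have "(LINT x|lborel. partial j phi x * ek (- k) x) = \<i> * of_int (k $ j) * (LINT x|lborel. phi x * ek (- k) x)"
  by simp
 thus "fc (partial j phi) k = Dop j (fc phi) k"
  by (simp add: fc_def Dop_def)
qed

lemma fc_bounded: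
 assumes "phi : tests Om"
 shows "EX C. ALL k. cmod (fc phi k) <= C"
proof -
 have "cmod (fc phi k) <= (LINT x|lborel. cmod (phi x)) / (2 * pi) ^ CARD('a)" for k
 proof -
  have "cmod (LINT x|lborel. phi x * ek (- k) x) <= (LINT x|lborel. cmod (phi x * ek (- k) x))"
   by (rule integral_norm_bound)
  thus ?thesis by (simp add: fc_def norm_divide norm_mult norm_power divide_right_mono)
 qed
 thus ?thesis by blast
qed

text \<open>The operator 1 minus the Laplacian multiplies the coefficients by
  \<open>(jb k)^2\<close>. Iterating it turns boundedness of coefficients into decay of every
  order.\<close>

lemma rapid_fc:
 fixes phi :: "real^'m::finite => complex"
 assumes "phi : tests Om"
 shows "rapid (fc phi)"
proof -
 have main: "EX C. ALL k. cmod (fc phi k) * jb k ^ (2 * N) <= C" if "phi : tests Om" for N phi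
  using that
 proof (induction N arbitrary: phi)
  case 0
  thus ?case using fc_bounded by fastforce
 next
  case (Suc N)
  define psi where "psi = (%x. phi x - (SUM j:UNIV. partial j (partial j phi) x))"
  have t: "partial j (partial j phi) : tests Om" for j
   by (intro test_partial Suc.prems)
  have s: "(%x. SUM j:UNIV. partial j (partial j phi) x) : tests Om"
   by (intro test_sum t finite)
  have "psi : tests Om"
   using test_add[OF Suc.prems test_scale[OF s, of "-1"]] by (simp add: psi_def)
  then obtain C where C: "!!k. cmod (fc psi k) * jb k ^ (2 * N) <= C" using Suc.IH by blast
  have ii: "\<i> * x * (\<i> * x * y) = - of_real (r^2) * y" if "x = of_real r" for x y :: complex and r :: real
   using that by (simp add: complex_eq_iff power2_eq_square)
  have "fc psi k = of_real ((jb k)^2) * fc phi k" for k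
  proof -
   have "fc psi k = fc phi k - (SUM j:UNIV. fc (partial j (partial j phi)) k)"
    unfolding psi_def by (simp add: fc_diff[OF Suc.prems s] fc_sum[OF finite t])
   also have "(SUM j:UNIV. fc (partial j (partial j phi)) k) = (SUM j:UNIV. - of_real ((real_of_int (k $ j))^2) * fc phi k)"
    by (intro sum.cong refl)
     (simp add: fc_partial[OF test_partial[OF Suc.prems]] fc_partial[OF Suc.prems] Dop_def ii[of _ "real_of_int _"])
   also have "... = - of_real (SUM j:UNIV. (real_of_int (k $ j))^2) * fc phi k"
    by (simp add: sum_distrib_right sum_negf)
   also have "(SUM j:UNIV. (real_of_int (k $ j))^2) = (norm (lvec k))^2"
    by (simp add: norm_vec_def L2_set_def lvec_def sum_nonneg)
   finally show ?thesis by (simp add: jb_square algebra_simps)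
  qed
  hence "cmod (fc phi k) * jb k ^ (2 * Suc N) = cmod (fc psi k) * jb k ^ (2 * N)" for k
   by (simp add: norm_mult power_add power2_eq_square norm_power)
  thus ?case using C by (intro exI[of _ C]) (simp only: simp_thms)
 qed
 show ?thesis
  unfolding rapid_def
 proof
  fix N
  obtain C where C: "!!k. cmod (fc phi k) * jb k ^ (2 * N) <= C" using main[OF assms, of N] by blast
  have "cmod (fc phi k) * jb k ^ N <= C" for k
  proof -
   have "cmod (fc phi k) * jb k ^ N <= cmod (fc phi k) * jb k ^ (2 * N)"
    by (intro mult_left_mono jb_power_mono) auto
   thus ?thesis using C[of k] by linarith
  qed
  thus "EX C. ALL k. cmod (fc phi k) * jb k ^ N <= C" by blast
 qed
qed

text \<open>The tail of the series is bounded uniformly in \<open>x\<close> by the tail of the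
  coefficients, so it may be integrated term by term against any integrable function.\<close>

lemma fseries_integral:
 fixes a :: "'m::finite seq"
 assumes a: "rapid a" and f: "integrable lborel f"
 shows "((%k. a k * (LINT x|lborel. ek k x * f x)) has_sum (LINT x|lborel. fseries a x * f x)) UNIV"
proof -
 have s: "(%k. cmod (a k)) summable_on UNIV" using rapid_summable[OF a, of 0] by simp
 have cont: "continuous_on UNIV (fseries a)" by (rule smooth_on_continuous[OF smooth_fseries[OF a]])
 have fm: "f : borel_measurable borel" using borel_measurable_integrable[OF f] by simp
 have ekf: "integrable lborel (%x. ek k x * f x)" for k
  by (rule Bochner_Integration.integrable_bound[OF f])
   (use borel_measurable_times[OF borel_measurable_continuous_onI[OF smooth_on_continuous[OF smooth_ek]] fm] in "auto simp: norm_mult")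
 define S where "S = (INFSUM k. cmod (a k))"
 have tail: "cmod (fseries a x - (SUM k:F. a k * ek k x)) <= S - (SUM k:F. cmod (a k))" if "finite F" for F x
  using infsum_tail_le[of "%k. a k * ek k x" F] that s by (simp add: norm_mult fseries_def S_def)
 have gf: "integrable lborel (%x. fseries a x * f x)"
 proof (rule Bochner_Integration.integrable_bound[OF integrable_mult_right[of S]])
  show "integrable lborel (%x. cmod (f x))" using f by simp
  show "(%x. fseries a x * f x) : borel_measurable lborel"
   using fm borel_measurable_continuous_onI[OF cont] by simp
  show "AE x in lborel. cmod (fseries a x * f x) <= norm (S * cmod (f x))"
  proof (rule AE_I2)
   fix x
   have "cmod (fseries a x) <= S" using tail[of "{}" x] by simp
   thus "cmod (fseries a x * f x) <= norm (S * cmod (f x))"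
    using order_trans[OF norm_ge_zero, of "fseries a x" S] by (simp add: norm_mult mult_right_mono abs_mult)
  qed
 qed
 define If where "If = (LINT x|lborel. cmod (f x))"
 have est: "cmod ((SUM k:F. a k * (LINT x|lborel. ek k x * f x)) - (LINT x|lborel. fseries a x * f x))
   <= (S - (SUM k:F. cmod (a k))) * If" if F: "finite F" for F
 proof -
  have i: "integrable lborel (%x. SUM k:F. a k * (ek k x * f x))" using ekf by auto
  have "(SUM k:F. a k * (LINT x|lborel. ek k x * f x)) - (LINT x|lborel. fseries a x * f x)
    = (LINT x|lborel. (SUM k:F. a k * (ek k x * f x)) - fseries a x * f x)"
   using ekf by (simp add: Bochner_Integration.integral_diff[OF i gf])
  also have "cmod ... <= (LINT x|lborel. (S - (SUM k:F. cmod (a k))) * cmod (f x))"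
  proof (rule order_trans[OF integral_norm_bound integral_mono])
   show "integrable lborel (%x. cmod ((SUM k:F. a k * (ek k x * f x)) - fseries a x * f x))"
    using i gf by (intro integrable_norm Bochner_Integration.integrable_diff)
   show "integrable lborel (%x. (S - (SUM k:F. cmod (a k))) * cmod (f x))" using f by simp
   fix x
   have "(SUM k:F. a k * (ek k x * f x)) - fseries a x * f x = - ((fseries a x - (SUM k:F. a k * ek k x)) * f x)"
    by (simp add: left_diff_distrib sum_distrib_right mult.assoc)
   thus "cmod ((SUM k:F. a k * (ek k x * f x)) - fseries a x * f x) <= (S - (SUM k:F. cmod (a k))) * cmod (f x)"
    using mult_right_mono[OF tail[OF F, of x], of "cmod (f x)"] by (simp only: norm_minus_cancel norm_mult) simp
  qed
  finally show ?thesis by (simp add: If_def)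
 qed
 have "((%F. (S - (SUM k:F. cmod (a k))) * If) \<longlongrightarrow> 0) (finite_subsets_at_top UNIV)"
  using tendsto_mult_left_zero[OF tail_tendsto_0[OF s]] by (simp add: S_def)
 hence "((%F. (SUM k:F. a k * (LINT x|lborel. ek k x * f x)) - (LINT x|lborel. fseries a x * f x)) \<longlongrightarrow> 0) (finite_subsets_at_top UNIV)"
  by (rule Lim_null_comparison[rotated])
   (use est in \<open>auto simp: eventually_finite_subsets_at_top intro!: exI[of _ "{}"]\<close>)
 thus ?thesis unfolding has_sum_def by (simp add: LIM_zero_iff)
qed

section \<open>Uniqueness and inversion for Fourier coefficients\<close>

inductive trig :: "(real^'m::finite => complex) => bool" where
 trig_ek: "trig (ek k)"
| trig_scale: "trig f ==> trig (%x. c * f x)"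
| trig_add: "trig f ==> trig g ==> trig (%x. f x + g x)"

lemma trig_mult: "trig f ==> trig g ==> trig (%x. f x * g x)"
proof (induction rule: trig.induct)
 case (trig_ek k)
 from trig_ek show ?case
 proof (induction rule: trig.induct)
  case (trig_ek l)
  have "(%x. ek k x * ek l x) = ek (k + l)" by (simp add: ek_add fun_eq_iff)
  thus ?case by (simp add: trig.trig_ek)
 next
  case (trig_scale f c)
  show ?case using trig.trig_scale[OF trig_scale.IH, of c] by (simp add: mult_ac)
 next
  case (trig_add f g)
  show ?case using trig.trig_add[OF trig_add.IH] by (simp add: distrib_left)
 qed
next
 case (trig_scale f c)
 show ?case using trig.trig_scale[OF trig_scale.IH[OF trig_scale.prems], of c] by (simp add: mult_ac)
next
 case (trig_add f h)
 show ?case using trig.trig_add[OF trig_add.IH(1)[OF trig_add.prems] trig_add.IH(2)[OF trig_add.prems]]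
  by (simp add: distrib_right)
qed

lemma trig_const: "trig (%x. c)"
 using trig_scale[OF trig_ek[of 0], of c] by simp

lemma trig_power: "trig f ==> trig (%x. f x ^ n)"
 by (induction n) (auto simp: trig_const trig_mult)

lemma trig_prod: "finite I ==> (!!i. i : I ==> trig (f i)) ==> trig (%x. PROD i:I. f i x)"
 by (induction I rule: finite_induct) (auto simp: trig_const trig_mult)

lemma trig_continuous: "trig f ==> continuous_on UNIV f"
 by (induction rule: trig.induct) (auto intro: continuous_intros smooth_on_continuous[OF smooth_ek])

text \<open>A trigonometric polynomial with values between 0 and 1 which, on the period cell around
  a nearby centre, takes the value 1 at \<open>y\<close> only; its powers concentrate at
  \<open>y\<close>.\<close>

definition peak :: "real^'m::finite => real^'m => real" where
 "peak y x = (PROD j:UNIV. (1 + cos (x $ j - y $ j)) / 2)"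

lemma trig_peak: "trig (%x. complex_of_real (peak y x))"
proof -
 have "trig (%x. complex_of_real ((1 + cos (x $ j - y $ j)) / 2))" for j
 proof -
  have lv: "lvec (axis j 1) \<bullet> x = x $ j" for x :: "real^'a"
  proof -
   have "lvec (axis j 1) = axis j 1" by (simp add: lvec_def vec_eq_iff axis_def)
   thus ?thesis by (simp add: inner_axis')
  qed
  have "trig (%x. 1/2 + (cis (- (y $ j)) / 4 * ek (axis j 1) x + cis (y $ j) / 4 * ek (- axis j 1) x))"
   by (intro trig_add trig_scale trig_ek trig_const)
  also have "(%x. 1/2 + (cis (- (y $ j)) / 4 * ek (axis j 1) x + cis (y $ j) / 4 * ek (- axis j 1) x))
   = (%x. complex_of_real ((1 + cos (x $ j - y $ j)) / 2))"
  proof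
   fix x :: "real^'a"
   define th where "th = x $ j - y $ j"
   have "cis (- (y $ j)) * ek (axis j 1) x = cis th" "cis (y $ j) * ek (- axis j 1) x = cis (- th)"
    by (simp_all add: ek_def lvec_minus lv cis_mult th_def)
   moreover have "cis th + cis (- th) = 2 * complex_of_real (cos th)"
    by (simp add: complex_eq_iff)
   ultimately show "1/2 + (cis (- (y $ j)) / 4 * ek (axis j 1) x + cis (y $ j) / 4 * ek (- axis j 1) x)
     = complex_of_real ((1 + cos (x $ j - y $ j)) / 2)"
    by (simp add: th_def field_simps)
  qed
  finally show ?thesis .
 qed
 hence "trig (%x. PROD j:UNIV. complex_of_real ((1 + cos (x $ j - y $ j)) / 2))"
  by (intro trig_prod finite)
 thus ?thesis by (simp add: peak_def)
qed

lemma cos_eq_1_small: "abs th < 2 * pi ==> cos th = 1 ==> th = 0"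
proof -
 assume a: "abs th < 2 * pi" "cos th = 1"
 then obtain n :: int where n: "th = of_int n * 2 * pi" using cos_one_2pi_int by blast
 hence "abs (real_of_int n) * (2 * pi) < 1 * (2 * pi)" using a(1) by (simp add: abs_mult)
 hence "abs (real_of_int n) < 1" using pi_gt_zero by (simp only: mult_less_cancel_right)
 thus ?thesis using n by simp
qed

lemma peak_props:
 shows "0 <= peak y x" "peak y x <= 1" "peak y y = 1"
  "y : ball x0 pi ==> x : cube x0 ==> x ~= y ==> peak y x < 1"
proof -
 have f: "0 <= (1 + cos t) / 2" "(1 + cos t) / 2 <= 1" for t :: real
  using cos_ge_minus_one[of t] cos_le_one[of t] by (simp_all, linarith)
 show "0 <= peak y x" unfolding peak_def by (intro prod_nonneg f)
 show "peak y x <= 1" unfolding peak_def by (intro prod_le_1) (use f in auto)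
 show "peak y y = 1" by (simp add: peak_def)
 assume y: "y : ball x0 pi" and x: "x : cube x0" "x ~= y"
 obtain j where j: "x $ j ~= y $ j" using x(2) by (auto simp: vec_eq_iff)
 have "abs (x $ j - y $ j) < 2 * pi"
  using ball_pi_component[OF y, of j] x(1)[unfolded mem_cube, rule_format, of j] by linarith
 hence "cos (x $ j - y $ j) ~= 1" using cos_eq_1_small j by fastforce
 hence lt: "(1 + cos (x $ j - y $ j)) / 2 < 1" using cos_le_one[of "x $ j - y $ j"] by (simp add: less_le)
 have "peak y x = (1 + cos (x $ j - y $ j)) / 2 * (PROD j:UNIV - {j}. (1 + cos (x $ j - y $ j)) / 2)"
  unfolding peak_def by (rule prod.remove) auto
 also have "... <= (1 + cos (x $ j - y $ j)) / 2 * 1"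
  by (intro mult_left_mono prod_le_1 conjI f)
 also have "... < 1" using lt by simp
 finally show "peak y x < 1" .
qed

lemma continuous_peak: "continuous_on UNIV (peak y)"
 unfolding peak_def[abs_def] by (intro continuous_intros) simp

text \<open>All integrals of \<open>h\<close> against trigonometric polynomials vanish, in
  particular against powers of \<open>peak y\<close>. If \<open>h y\<close> were nonzero, the
  contribution near \<open>y\<close> would be at least of size \<open>p ^ n\<close>, the negative
  part at most of size \<open>q ^ n\<close>, with \<open>q < p\<close>.\<close>

lemma fourier_uniqueness:
 fixes h :: "real^'m::finite => complex"
 assumes h: "continuous_on UNIV h" and z: "!!k. cube_int x0 (%x. h x * ek k x) = 0" and y: "y : ball x0 pi"
 shows "h y = 0"
proof (rule ccontr)
 assume ny: "h y ~= 0"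
 have trig0: "cube_int x0 (%x. h x * f x) = 0" if "trig f" for f
  using that
 proof (induction rule: trig.induct)
  case (trig_ek k)
  show ?case by (rule z)
 next
  case (trig_scale f c)
  have "cube_int x0 (%x. h x * (c * f x)) = c * cube_int x0 (%x. h x * f x)"
   unfolding cube_int_def
   by (subst integral_mult_right_zero[symmetric]) (intro Bochner_Integration.integral_cong refl, simp)
  thus ?case using trig_scale.IH by simp
 next
  case (trig_add f g)
  have i: "integrable lborel (%x. indicator (cube x0) x *\<^sub>R (h x * f x))"
   "integrable lborel (%x. indicator (cube x0) x *\<^sub>R (h x * g x))"
   by (intro cube_integrable continuous_on_mult h trig_continuous trig_add.hyps)+
  show ?case
   using trig_add.IH i unfolding cube_int_def by (simp add: distrib_left scaleR_add_right)
 qed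
 \<comment> \<open>Multiplication by \<open>cnj (h y)\<close> makes the value at \<open>y\<close>
   real and positive, so the integrand has a sign near \<open>y\<close>.\<close>
 define H where "H = (%x. Re (cnj (h y) * h x))"
 define kap where "kap = peak y"
 have H: "continuous_on UNIV H" unfolding H_def by (intro continuous_intros h)
 have kap: "continuous_on UNIV kap" unfolding kap_def by (rule continuous_peak)
 have int0: "(LINT x|lborel. indicator (cube x0) x *\<^sub>R (H x * kap x ^ n)) = 0" for n
 proof -
  have c: "continuous_on UNIV (%x. h x * of_real (kap x) ^ n)" by (intro continuous_intros h kap)
  have "(LINT x|lborel. indicator (cube x0) x *\<^sub>R (H x * kap x ^ n)) =
    (LINT x|lborel. Re (cnj (h y) * (indicator (cube x0) x *\<^sub>R (h x * of_real (kap x) ^ n))))"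
   by (intro Bochner_Integration.integral_cong refl)
    (simp add: H_def algebra_simps flip: of_real_power)
  also have "... = Re (LINT x|lborel. cnj (h y) * (indicator (cube x0) x *\<^sub>R (h x * of_real (kap x) ^ n)))"
   by (rule integral_Re) (intro integrable_mult_right cube_integrable c)
  also have "(LINT x|lborel. cnj (h y) * (indicator (cube x0) x *\<^sub>R (h x * of_real (kap x) ^ n))) =
    cnj (h y) * cube_int x0 (%x. h x * of_real (kap x) ^ n)"
   unfolding cube_int_def by (rule integral_mult_right_zero)
  also have "... = 0" unfolding kap_def using trig0[OF trig_power[OF trig_peak]] by simp
  finally show ?thesis by simp
 qed
 have Hy: "H y = (cmod (h y))^2" unfolding cmod_power2 by (simp add: H_def power2_eq_square)
 define c where "c = (cmod (h y))^2 / 2"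
 have c: "0 < c" using ny by (simp add: c_def)
 obtain B where B: "!!x. x : cube x0 ==> abs (H x) <= B"
 proof -
  have "compact (H ` cube x0)" by (rule compact_continuous_image[OF continuous_on_subset[OF H] compact_cube]) simp
  thus ?thesis using that by (metis bounded_iff compact_imp_bounded image_eqI real_norm_def)
 qed
 have B0: "0 <= B" using B[of y] ball_pi_subset_cube y by fastforce
 have opn: "open (H -` {c<..} Int ball x0 pi)"
  using continuous_open_vimage[of "{c<..}" H] H by (auto intro!: open_Int simp: continuous_on_eq_continuous_at)
 have "y : H -` {c<..} Int ball x0 pi" using y c by (simp add: Hy c_def)
 then obtain dl where dl: "0 < dl" "ball y dl <= H -` {c<..} Int ball x0 pi" using opn openE by blast
 have "compact (cube x0 - ball y dl)" by (intro compact_diff compact_cube) auto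
 then obtain q where q: "0 <= q" "q < 1" "!!x. x : cube x0 - ball y dl ==> kap x <= q"
 proof (cases "cube x0 - ball y dl = {}")
  case True
  show ?thesis by (rule that[of 0]) (simp_all only: True empty_iff zero_less_one order_refl)
 next
  case False
  assume "compact (cube x0 - ball y dl)"
  then obtain m where m: "m : cube x0 - ball y dl" "!!x. x : cube x0 - ball y dl ==> kap x <= kap m"
   using continuous_attains_sup[OF _ False continuous_on_subset[OF kap]] by blast
  show ?thesis
  proof (rule that)
   show "0 <= kap m" unfolding kap_def by (rule peak_props)
   have "m ~= y" using m(1) dl(1) by auto
   thus "kap m < 1" unfolding kap_def using m(1) by (intro peak_props(4)[OF y]) auto
  qed (rule m(2))
 qed
 \<comment> \<open>Strictly between \<open>q\<close>, which bounds \<open>kap\<close> away from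
   \<open>y\<close>, and \<open>kap y = 1\<close>.\<close>
 define p where "p = (1 + q) / 2"
 have p: "q < p" "p < 1" "0 < p" using q by (auto simp: p_def)
 have "open (kap -` {p<..} Int ball y dl)"
  using continuous_open_vimage[of "{p<..}" kap] kap by (auto intro!: open_Int simp: continuous_on_eq_continuous_at)
 moreover have "y : kap -` {p<..} Int ball y dl" using p dl peak_props(3)[of y] by (simp add: kap_def)
 ultimately obtain dl' where dl': "0 < dl'" "ball y dl' <= kap -` {p<..} Int ball y dl" using openE by blast
 define v where "v = measure lborel (ball y dl')"
 define V where "V = measure lborel (cube x0)"
 have v: "0 < v" unfolding v_def by (rule content_ball_pos[OF dl'(1)])
 have le: "c * p ^ n * v <= B * q ^ n * V" for n
 proof -
  have bi: "integrable lborel (%x. c * p ^ n * indicator (ball y dl') x - B * q ^ n * indicator (cube x0) x :: real)"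
   by (intro Bochner_Integration.integrable_diff integrable_mult_right)
    (auto simp: cube_def intro!: integrable_real_indicator emeasure_lborel_ball_finite[unfolded infinity_ennreal_def] emeasure_lborel_cbox_finite[unfolded infinity_ennreal_def])
  have "(LINT x|lborel. c * p ^ n * indicator (ball y dl') x - B * q ^ n * indicator (cube x0) x) <=
    (LINT x|lborel. indicator (cube x0) x *\<^sub>R (H x * kap x ^ n))"
  proof (rule integral_mono[OF bi])
   show "integrable lborel (%x. indicator (cube x0) x *\<^sub>R (H x * kap x ^ n))"
    by (intro cube_integrable continuous_intros H kap)
   fix x
   have k0: "0 <= kap x" unfolding kap_def by (rule peak_props)
   have Bq: "0 <= B * q ^ n" using B0 q by simp
   show "c * p ^ n * indicator (ball y dl') x - B * q ^ n * indicator (cube x0) x <= indicator (cube x0) x *\<^sub>R (H x * kap x ^ n)"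
   proof (cases "x : ball y dl")
    case True
    hence xc: "x : cube x0" using dl(2) ball_pi_subset_cube by blast
    have Hx: "c <= H x" using True dl(2) by (auto simp: less_imp_le)
    show ?thesis
    proof (cases "x : ball y dl'")
     case True
     hence "p <= kap x" using dl'(2) by (auto simp: less_imp_le)
     hence "c * p ^ n <= H x * kap x ^ n" using Hx c p by (intro mult_mono power_mono) auto
     thus ?thesis using Bq xc True by simp
    next
     case False
     have "0 <= H x * kap x ^ n" using Hx c k0 by simp
     thus ?thesis using Bq xc False by simp
    qed
   next
    case False
    hence nb: "x ~: ball y dl'" using dl'(2) by blast
    show ?thesis
    proof (cases "x : cube x0")
     case True
     have "abs (H x * kap x ^ n) <= B * q ^ n"
      unfolding abs_mult using B[OF True] q(3)[of x] True False k0 B0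
      by (intro mult_mono) (auto simp: power_abs intro: power_mono)
     thus ?thesis using True nb by simp
    qed (use nb in simp)
   qed
  qed
  moreover have "(LINT x|lborel. c * p ^ n * indicator (ball y dl') x - B * q ^ n * indicator (cube x0) x) =
    c * p ^ n * v - B * q ^ n * V"
   by (subst Bochner_Integration.integral_diff)
    (auto simp: v_def V_def cube_def intro!: integrable_real_indicator emeasure_lborel_ball_finite[unfolded infinity_ennreal_def] emeasure_lborel_cbox_finite[unfolded infinity_ennreal_def])
  ultimately show ?thesis using int0[of n] by simp
 qed
 have "(%n. (q / p) ^ n * (B * V)) \<longlonglongrightarrow> 0 * (B * V)"
  using p q by (intro tendsto_mult LIMSEQ_power_zero tendsto_const) auto
 moreover have "c * v <= (q / p) ^ n * (B * V)" for n
 proof -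
  have "p ^ n * (c * v) <= q ^ n * (B * V)" using le[of n] by (simp add: mult_ac)
  thus ?thesis using p by (simp add: power_divide field_simps)
 qed
 ultimately have "c * v <= 0" using LIMSEQ_le_const[of "%n. (q / p) ^ n * (B * V)" 0 "c * v"] by auto
 thus False using c v by (simp add: mult_le_0_iff)
qed

text \<open>By orthogonality, \<open>phi\<close> and its Fourier series have the same integrals
  against all exponentials over the cell; uniqueness applies to their difference.\<close>

theorem fourier_inversion:
 fixes phi :: "real^'m::finite => complex"
 assumes phi: "phi : tests (ball x0 pi)" and y: "y : ball x0 pi"
 shows "phi y = fseries (fc phi) y"
proof -
 have r: "rapid (fc phi)" by (rule rapid_fc[OF phi])
 have cg: "continuous_on UNIV (fseries (fc phi))" by (rule smooth_on_continuous[OF smooth_fseries[OF r]])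
 have cphi: "continuous_on UNIV phi" by (rule smooth_on_continuous[OF test_smooth[OF phi]])
 have ce: "continuous_on UNIV (ek k)" for k by (rule smooth_on_continuous[OF smooth_ek])
 define P where "P = (2 * complex_of_real pi) ^ CARD('m)"
 have P: "P ~= 0" by (simp add: P_def)
 have "fseries (fc phi) y - phi y = 0"
 proof (rule fourier_uniqueness[OF _ _ y])
  show "continuous_on UNIV (%x. fseries (fc phi) x - phi x)" by (intro continuous_intros cg cphi)
  fix k
  have i1: "integrable lborel (%x. indicator (cube x0) x *\<^sub>R (fseries (fc phi) x * ek k x))"
   "integrable lborel (%x. indicator (cube x0) x *\<^sub>R (phi x * ek k x))"
   "integrable lborel (%x. indicator (cube x0) x *\<^sub>R ek k x)"
   by (intro cube_integrable continuous_intros cg cphi ce)+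
  have "cube_int x0 (%x. (fseries (fc phi) x - phi x) * ek k x) =
    cube_int x0 (%x. fseries (fc phi) x * ek k x) - cube_int x0 (%x. phi x * ek k x)"
   unfolding cube_int_def using i1 by (simp add: left_diff_distrib scaleR_diff_right)
  also have "cube_int x0 (%x. phi x * ek k x) = fc phi (- k) * P"
  proof -
   have "phi x = 0" if "x ~: cube x0" for x
   proof -
    obtain K where "K <= ball x0 pi" "phi : test_functions_supp K" using phi by (rule test_functionsE)
    thus ?thesis using that ball_pi_subset_cube test_suppD(2) by blast
   qed
   hence "(%x. indicator (cube x0) x *\<^sub>R (phi x * ek k x)) = (%x. phi x * ek k x)"
    by (auto simp: indicator_def fun_eq_iff)
   thus ?thesis using P by (simp add: cube_int_def fc_def P_def)
  qed
  also have "cube_int x0 (%x. fseries (fc phi) x * ek k x) = fc phi (- k) * P"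
  proof -
   have "((%l. fc phi l * (LINT x|lborel. ek l x * (indicator (cube x0) x *\<^sub>R ek k x))) has_sum
     (LINT x|lborel. fseries (fc phi) x * (indicator (cube x0) x *\<^sub>R ek k x))) UNIV"
    by (rule fseries_integral[OF r i1(3)])
   moreover have "(LINT x|lborel. ek l x * (indicator (cube x0) x *\<^sub>R ek k x)) = (if l = - k then P else 0)" for l
   proof -
    have "(LINT x|lborel. ek l x * (indicator (cube x0) x *\<^sub>R ek k x)) = cube_int x0 (ek (l + k))"
     unfolding cube_int_def by (intro Bochner_Integration.integral_cong refl) (simp add: ek_add)
    thus ?thesis by (simp add: cube_int_ek P_def eq_neg_iff_add_eq_0)
   qed
   moreover have "(LINT x|lborel. fseries (fc phi) x * (indicator (cube x0) x *\<^sub>R ek k x)) = cube_int x0 (%x. fseries (fc phi) x * ek k x)"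
    unfolding cube_int_def by (intro Bochner_Integration.integral_cong refl) simp
   ultimately have "((%l. fc phi l * (if l = - k then P else 0)) has_sum cube_int x0 (%x. fseries (fc phi) x * ek k x)) UNIV"
    by simp
   moreover have "((%l. fc phi l * (if l = - k then P else 0)) has_sum (fc phi (- k) * P)) UNIV"
    using has_sum_cong_neutral[of UNIV "{- k}" "%l. fc phi l * (if l = - k then P else 0)" "%l. fc phi l * P" "fc phi (- k) * P"]
     has_sum_finite[of "{- k}" "%l. fc phi l * P"] by auto
   ultimately show ?thesis by (rule has_sum_unique)
  qed
  finally show "cube_int x0 (%x. (fseries (fc phi) x - phi x) * ek k x) = 0" by simp
 qed
 thus ?thesis by simp
qed

section \<open>Fourier coefficients of localised distributions\<close>

lemma partials_mult_bound:
 fixes h :: "real^'m::finite => complex"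
 assumes "compact K" "h : test_functions_supp K"
 shows "EX C>=0. ALL g B. smooth_on UNIV g --> 0 <= B -->
  (ALL is. length is <= length js --> (ALL x:K. cmod (partials is g x) <= B)) -->
  (ALL x. cmod (partials js (%x. h x * g x) x) <= C * B)"
 using assms(2)
proof (induction js arbitrary: h rule: rev_induct)
 case Nil
 have "h : tests K" by (rule test_functionsI[OF assms(1) subset_refl Nil])
 then obtain A where A: "0 <= A" "!!x. cmod (h x) <= A" using test_bounded by blast
 have "cmod (h x * g x) <= A * B" if "0 <= B" "ALL x:K. cmod (g x) <= B" for g B x
  using A that test_suppD(2)[OF Nil, of x]
  by (cases "x : K") (simp_all add: norm_mult mult_mono')
 thus ?case using A(1) by (intro exI[of _ A]) auto
next
 case (snoc j js)
 have dh: "partial j h : test_functions_supp K"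
  by (rule test_supp_partial[OF compact_imp_closed[OF assms(1)] snoc.prems])
 obtain C1 where C1: "0 <= C1" "!!g B. smooth_on UNIV g ==> 0 <= B ==>
   (ALL is. length is <= length js --> (ALL x:K. cmod (partials is g x) <= B)) ==>
   (ALL x. cmod (partials js (%x. h x * g x) x) <= C1 * B)"
  using snoc.IH[OF snoc.prems] by (elim exE conjE) blast
 obtain C2 where C2: "0 <= C2" "!!g B. smooth_on UNIV g ==> 0 <= B ==>
   (ALL is. length is <= length js --> (ALL x:K. cmod (partials is g x) <= B)) ==>
   (ALL x. cmod (partials js (%x. partial j h x * g x) x) <= C2 * B)"
  using snoc.IH[OF dh] by (elim exE conjE) blast
 have sh: "smooth_on UNIV h" by (rule test_suppD(1)[OF snoc.prems])
 show ?case
 proof (intro exI[of _ "C2 + C1"] conjI allI impI)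
  fix g :: "real^'m => complex" and B x
  assume g: "smooth_on UNIV g" and B: "0 <= B"
   and le: "ALL is. length is <= length (js @ [j]) --> (ALL x:K. cmod (partials is g x) <= B)"
  have sg: "smooth_on UNIV (partial j g)" by (rule smooth_on_partial[OF g])
  have "partial j (%x. h x * g x) = (%x. partial j h x * g x + h x * partial j g x)"
   using partial_mult[OF sh g] by (simp add: fun_eq_iff)
  hence "partials (js @ [j]) (%x. h x * g x) =
    (%x. partials js (%x. partial j h x * g x) x + partials js (%x. h x * partial j g x) x)"
   unfolding partials_snoc
   by (simp add: partials_add[OF smooth_on_mult[OF open_UNIV smooth_on_partial[OF sh] g] smooth_on_mult[OF open_UNIV sh sg]])
  moreover have "cmod (partials js (%x. partial j h x * g x) x) <= C2 * B"
   using C2(2)[OF g B] le by simp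
  moreover have "cmod (partials js (%x. h x * partial j g x) x) <= C1 * B"
  proof -
   have "ALL is. length is <= length js --> (ALL x:K. cmod (partials is (partial j g) x) <= B)"
    using le by (metis length_append_singleton not_less_eq_eq partials_snoc)
   thus ?thesis using C1(2)[OF sg B] by blast
  qed
  ultimately show "cmod (partials (js @ [j]) (%x. h x * g x) x) <= (C2 + C1) * B"
   unfolding distrib_right by (simp only: norm_triangle_mono)
 qed (simp add: C1(1) C2(1))
qed

text \<open>The order \<open>N\<close> depends on the compact set only, the constant also on
  \<open>h\<close>. Through \<open>Fc_polynomial_bound\<close> this gives \<open>hloc_start\<close>
  one Sobolev order for all cut-offs supported in a ball.\<close>

lemma distribution_mult_bound:
 fixes u :: "(real^'m::finite => complex) => complex"
 assumes u: "distribution_on Om u" and K: "compact K" "K <= Om"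
 shows "EX N. ALL h:test_functions_supp K. EX C>=0. ALL g B. smooth_on UNIV g --> 0 <= B -->
  (ALL is. length is <= N --> (ALL x:K. cmod (partials is g x) <= B)) --> cmod (u (%x. h x * g x)) <= C * B"
proof -
 obtain C N where CN: "!!g. g : test_functions_supp K ==>
   cmod (u g) <= C * (\<Sum>js | length js <= N. SUP x. cmod (partials js g x))"
 proof -
  have "EX C N. ALL g:test_functions_supp K. cmod (u g) <= C * (\<Sum>js | length js <= N. SUP x. cmod (partials js g x))"
   using conjunct2[OF u[unfolded distribution_on_def], rule_format, OF conjI[OF K]] .
  thus ?thesis by (elim exE) (rule that, erule bspec)
 qed
 show ?thesis
 proof (intro exI[of _ N] ballI)
  fix h :: "real^'m => complex"
  assume h: "h : test_functions_supp K"
  define c where "c js = (SOME C. 0 <= C & (ALL g B. smooth_on UNIV g --> 0 <= B -->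
   (ALL is. length is <= length js --> (ALL x:K. cmod (partials is g x) <= B)) -->
   (ALL x. cmod (partials js (%x. h x * g x) x) <= C * B)))" for js
  have c: "0 <= c js & (ALL g B. smooth_on UNIV g --> 0 <= B -->
   (ALL is. length is <= length js --> (ALL x:K. cmod (partials is g x) <= B)) -->
   (ALL x. cmod (partials js (%x. h x * g x) x) <= c js * B))" for js
   unfolding c_def by (rule someI_ex[OF partials_mult_bound[OF K(1) h]])
  show "EX C>=0. ALL g B. smooth_on UNIV g --> 0 <= B -->
   (ALL is. length is <= N --> (ALL x:K. cmod (partials is g x) <= B)) --> cmod (u (%x. h x * g x)) <= C * B"
  proof (intro exI[of _ "abs C * (\<Sum>js | length js <= N. c js)"] conjI allI impI)
   show "0 <= abs C * (\<Sum>js | length js <= N. c js)" using c by (auto intro!: mult_nonneg_nonneg sum_nonneg)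
   fix g :: "real^'m => complex" and B
   assume g: "smooth_on UNIV g" "0 <= B"
    and le: "ALL is. length is <= N --> (ALL x:K. cmod (partials is g x) <= B)"
   have b: "cmod (partials js (%x. h x * g x) x) <= c js * B" if "length js <= N" for js x
    using conjunct2[OF c[of js], rule_format, OF g, of x] le that by auto
   define S where "S js = (SUP x. cmod (partials js (%x. h x * g x) x))" for js
   have S: "0 <= S js" "S js <= c js * B" if "length js <= N" for js
   proof -
    have "bdd_above (range (%x. cmod (partials js (%x. h x * g x) x)))"
     using b[OF that] by (intro bdd_aboveI2[of _ _ "c js * B"]) auto
    hence "cmod (partials js (%x. h x * g x) 0) <= S js" unfolding S_def by (intro cSUP_upper) auto
    thus "0 <= S js" by (rule order_trans[OF norm_ge_zero])
    show "S js <= c js * B" unfolding S_def using b[OF that] by (intro cSUP_least) auto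
   qed
   have "cmod (u (%x. h x * g x)) <= C * (\<Sum>js | length js <= N. S js)"
    unfolding S_def by (rule CN[OF test_supp_mult_smooth[OF h g(1)]])
   also have "... <= abs C * (\<Sum>js | length js <= N. S js)"
    using S by (intro mult_right_mono sum_nonneg) auto
   also have "... <= abs C * (\<Sum>js | length js <= N. c js * B)"
    using S by (intro mult_left_mono sum_mono) auto
   finally show "cmod (u (%x. h x * g x)) <= abs C * (\<Sum>js | length js <= N. c js) * B"
    by (simp add: sum_distrib_right mult.assoc)
  qed
 qed
qed

lemma dist_linear:
 assumes "distribution_on Om u" "g : tests Om" "h : tests Om"
 shows "u (%x. a * g x + b * h x) = a * u g + b * u h"
 using conjunct1[OF assms(1)[unfolded distribution_on_def], rule_format, OF assms(2,3)] .

lemma dist_add: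
 assumes "distribution_on Om u" "g : tests Om" "h : tests Om"
 shows "u (%x. g x + h x) = u g + u h"
 using dist_linear[OF assms, of 1 1] by simp

lemma dist_diff:
 assumes "distribution_on Om u" "g : tests Om" "h : tests Om"
 shows "u (%x. g x - h x) = u g - u h"
 using dist_linear[OF assms, of 1 "-1"] by simp

lemma dist_scale:
 assumes "distribution_on Om u" "g : tests Om"
 shows "u (%x. a * g x) = a * u g"
 using dist_linear[OF assms assms(2), of a 0] by simp

lemma dist_zero: "distribution_on Om u ==> u (%x. 0) = 0"
 using dist_scale[OF _ test_zero, of Om u 0] by simp

lemma dist_sum:
 assumes "distribution_on Om u" "finite I" "!!i. i : I ==> f i : tests Om"
 shows "u (%x. SUM i:I. f i x) = (SUM i:I. u (f i))"
 using assms(2,3)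
 by (induction I rule: finite_induct)
  (auto simp: dist_zero[OF assms(1)] dist_add[OF assms(1)] test_sum)

text \<open>The coefficients of the distribution \<open>eta u\<close>, without the normalising
  factor of \<open>fc\<close>.\<close>

definition Fc :: "((real^'m::finite => complex) => complex) => (real^'m => complex) => 'm seq" where
 "Fc u eta k = u (%x. eta x * ek (- k) x)"

lemma partials_ek: "partials js (ek k) = (%x. (\<Prod>j\<leftarrow>js. \<i> * of_int (k $ j)) * ek k x)"
proof (induction js)
 case (Cons j js)
 show ?case
  unfolding partials_Cons Cons.IH
  by (auto simp: fun_eq_iff partial_ek partial_linear[OF bounded_linear_mult_right smooth_ek UNIV_I])
qed simp

lemma Fc_polynomial_bound:
 fixes u :: "(real^'m::finite => complex) => complex"
 assumes "distribution_on Om u" "compact K" "K <= Om"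
 shows "EX N. ALL eta:test_functions_supp K. EX C. ALL k. cmod (Fc u eta k) <= C * jb k ^ N"
proof -
 obtain N where N: "!!h. h : test_functions_supp K ==> EX C>=0. ALL g B. smooth_on UNIV g --> 0 <= B -->
  (ALL is. length is <= N --> (ALL x:K. cmod (partials is g x) <= B)) --> cmod (u (%x. h x * g x)) <= C * B"
  using distribution_mult_bound[OF assms] by blast
 have e: "cmod (partials is (ek k) x) <= jb k ^ N" if "length is <= N" for "is" and k :: "int^'m" and x
 proof -
  have "cmod (\<Prod>j\<leftarrow>is. \<i> * of_int (k $ j)) <= jb k ^ length is"
   using component_le_jb by (induction "is") (auto simp: norm_mult intro!: mult_mono)
  thus ?thesis using jb_power_mono[OF that, of k] by (simp add: partials_ek norm_mult)
 qed
 show ?thesis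
 proof (intro exI[of _ N] ballI)
  fix eta assume "eta : test_functions_supp K"
  then obtain C where C: "!!g B. smooth_on UNIV g ==> 0 <= B ==>
   (ALL is. length is <= N --> (ALL x:K. cmod (partials is g x) <= B)) ==> cmod (u (%x. eta x * g x)) <= C * B"
   using N by blast
  have "cmod (Fc u eta k) <= C * jb k ^ N" for k
   unfolding Fc_def using C[OF smooth_ek, of "jb (- k) ^ N" "- k"] e[of _ "- k"] by simp
  thus "EX C. ALL k. cmod (Fc u eta k) <= C * jb k ^ N" by blast
 qed
qed

lemma temp_Fc:
 assumes "distribution_on Om u" "eta : tests Om"
 shows "temp (Fc u eta)"
proof -
 obtain K where K: "compact K" "K <= Om" "eta : test_functions_supp K" using assms(2) by (rule test_functionsE)
 thus ?thesis using Fc_polynomial_bound[OF assms(1) K(1,2)] unfolding temp_def by blast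
qed

lemma fc_partials: "phi : tests Om ==> fc (partials js phi) k = (\<Prod>j\<leftarrow>js. \<i> * of_int (k $ j)) * fc phi k"
 by (induction js) (simp_all add: partials_Cons fc_partial[OF test_partials] Dop_def)

text \<open>On the support of \<open>h\<close>, finitely many derivatives control \<open>u\<close>,
  and for each of them the Fourier series of \<open>phi\<close> converges uniformly; hence
  \<open>u\<close> may be applied term by term. Consequently multiplication of distributions is
  convolution of coefficients (\<open>Mop_Fc\<close>).\<close>

lemma distribution_fourier_series:
 fixes u :: "(real^'m::finite => complex) => complex"
 assumes u: "distribution_on Om u" and Om: "Om <= ball x0 pi" and h: "h : tests Om"
  and phi: "phi : tests (ball x0 pi)"
 shows "((%l. fc phi l * u (%x. h x * ek l x)) has_sum u (%x. h x * phi x)) UNIV"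
proof -
 obtain K where K: "compact K" "K <= Om" "h : test_functions_supp K" using h by (rule test_functionsE)
 obtain N C where C: "0 <= C" "!!g B. smooth_on UNIV g ==> 0 <= B ==>
   (!!is x. length is <= N ==> x : K ==> cmod (partials is g x) <= B) ==> cmod (u (%x. h x * g x)) <= C * B"
 proof -
  obtain N where "ALL h:test_functions_supp K. EX C>=0. ALL g B. smooth_on UNIV g --> 0 <= B -->
   (ALL is. length is <= N --> (ALL x:K. cmod (partials is g x) <= B)) --> cmod (u (%x. h x * g x)) <= C * B"
   using distribution_mult_bound[OF u K(1,2)] ..
  from bspec[OF this K(3)] obtain C where "0 <= C" "ALL g B. smooth_on UNIV g --> 0 <= B -->
   (ALL is. length is <= N --> (ALL x:K. cmod (partials is g x) <= B)) --> cmod (u (%x. h x * g x)) <= C * B"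
   by blast
  thus ?thesis by (intro that[of C N]) simp_all
 qed
 define I where "I = {is :: 'm list. length is <= N}"
 have fin: "finite I" using finite_lists_length_le[of "UNIV :: 'm set" N] by (simp add: I_def)
 define a where "a is = fc (partials is phi)" for "is"
 have t: "partials is phi : tests (ball x0 pi)" for "is" by (rule test_partials[OF phi])
 have sa: "(%l. cmod (a is l)) summable_on UNIV" for "is"
  unfolding a_def using rapid_summable[OF rapid_fc[OF t], where N = 0] by simp
 define eps where "eps is F = (INFSUM l. cmod (a is l)) - (SUM l:F. cmod (a is l))" for "is" F
 have e0: "0 <= eps is F" if "finite F" for "is" F
  using infsum_mono_neutral[of "%l. cmod (a is l)" F "%l. cmod (a is l)" UNIV] sa[of "is"] that
  by (simp add: eps_def)
 define S where "S F x = (SUM l:F. fc phi l * ek l x)" for F x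
 have sE: "smooth_on UNIV (%x. c * ek l x)" for c l by (intro smooth_on_mult open_UNIV smooth_on_const smooth_ek)
 have sS: "smooth_on UNIV (S F)" if "finite F" for F unfolding S_def by (intro smooth_on_sum open_UNIV that sE)
 have sphi: "smooth_on UNIV phi" by (rule test_smooth[OF phi])
 have est: "cmod (u (%x. h x * (S F x - phi x))) <= C * (SUM is:I. eps is F)" if F: "finite F" for F
 proof (rule C(2))
  show "smooth_on UNIV (%x. S F x - phi x)" by (intro smooth_on_diff open_UNIV sS F sphi)
  show "0 <= (SUM is:I. eps is F)" by (intro sum_nonneg e0 F)
  fix "is" :: "'m list" and x assume i: "length is <= N" and x: "x : K"
  have "partials is (%x. S F x - phi x) x = (SUM l:F. a is l * ek l x) - partials is phi x"
   unfolding partials_diff[OF sS[OF F] sphi] unfolding S_def partials_sum[OF F sE] partials_scale[OF smooth_ek]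
   by (simp add: partials_ek a_def fc_partials[OF phi] mult_ac)
  also have "partials is phi x = fseries (a is) x"
   unfolding a_def by (rule fourier_inversion[OF t]) (use x K Om in auto)
  also have "cmod ((SUM l:F. a is l * ek l x) - fseries (a is) x) <= eps is F"
   using infsum_tail_le[where f = "%l. a is l * ek l x", OF _ F] sa[of "is"]
   by (simp add: norm_mult fseries_def eps_def norm_minus_commute)
  also have "... <= (SUM is:I. eps is F)"
   by (rule member_le_sum) (use i e0[OF F] fin in "auto simp: I_def")
  finally show "cmod (partials is (%x. S F x - phi x) x) <= (SUM is:I. eps is F)" .
 qed
 have eq: "u (%x. h x * (S F x - phi x)) = (SUM l:F. fc phi l * u (%x. h x * ek l x)) - u (%x. h x * phi x)"
  if F: "finite F" for F
 proof -
  have te: "(%x. h x * ek l x) : tests Om" for l by (rule test_mult_ek[OF h])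
  have ts: "(%x. fc phi l * (h x * ek l x)) : tests Om" for l by (rule test_scale[OF te])
  have "u (%x. h x * (S F x - phi x)) = u (%x. (SUM l:F. fc phi l * (h x * ek l x)) - h x * phi x)"
   by (rule arg_cong[of _ _ u]) (simp add: fun_eq_iff S_def right_diff_distrib sum_distrib_left mult_ac)
  also have "... = (SUM l:F. u (%x. fc phi l * (h x * ek l x))) - u (%x. h x * phi x)"
   by (simp add: dist_diff[OF u test_sum[OF F ts] test_mult_smooth[OF h sphi]] dist_sum[OF u F ts])
  finally show ?thesis by (simp add: dist_scale[OF u te])
 qed
 have "((%F. eps is F) \<longlongrightarrow> 0) (finite_subsets_at_top UNIV)" for "is"
  unfolding eps_def by (rule tail_tendsto_0[OF sa])
 hence "((%F. C * (SUM is:I. eps is F)) \<longlongrightarrow> C * (SUM is:I. 0)) (finite_subsets_at_top UNIV)"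
  by (intro tendsto_intros)
 hence "((%F. C * (SUM is:I. eps is F)) \<longlongrightarrow> 0) (finite_subsets_at_top UNIV)" by simp
 hence "((%F. (SUM l:F. fc phi l * u (%x. h x * ek l x)) - u (%x. h x * phi x)) \<longlongrightarrow> 0) (finite_subsets_at_top UNIV)"
  by (rule Lim_null_comparison[rotated])
   (use est eq in \<open>auto simp: eventually_finite_subsets_at_top intro!: exI[of _ "{}"]\<close>)
 thus ?thesis unfolding has_sum_def by (simp add: LIM_zero_iff)
qed

lemma Mop_Fc:
 assumes u: "distribution_on Om u" and Om: "Om <= ball x0 pi" and eta: "eta : tests Om"
  and phi: "phi : tests (ball x0 pi)"
 shows "Mop (fc phi) (Fc u eta) = Fc u (%x. phi x * eta x)"
proof
 fix k
 have "(%x. eta x * ek (- (k - l)) x) = (%x. eta x * ek (- k) x * ek l x)" for l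
  by (simp add: fun_eq_iff mult.assoc flip: ek_add)
 hence "Mop (fc phi) (Fc u eta) k = (INFSUM l. fc phi l * u (%x. eta x * ek (- k) x * ek l x))"
  by (simp add: Mop_def Fc_def)
 also have "... = u (%x. eta x * ek (- k) x * phi x)"
  by (rule infsumI[OF distribution_fourier_series[OF u Om test_mult_ek[OF eta] phi]])
 finally show "Mop (fc phi) (Fc u eta) k = Fc u (%x. phi x * eta x) k" by (simp add: Fc_def mult_ac)
qed

text \<open>The product rule for \<open>eta u\<close>: the term \<open>- u (partial j ...)\<close>
  is, by duality, the coefficient of \<open>eta\<close> times the derivative of
  \<open>u\<close>.\<close>

lemma Dop_Fc:
 assumes u: "distribution_on Om u" and eta: "eta : tests Om"
 shows "Dop j (Fc u eta) k = Fc u (partial j eta) k - u (partial j (%x. eta x * ek (- k) x))"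
proof -
 have e: "partial j (%x. eta x * ek (- k) x) = (%x. partial j eta x * ek (- k) x - \<i> * of_int (k $ j) * (eta x * ek (- k) x))"
  using partial_mult[OF test_smooth[OF eta] smooth_ek[of "- k"] UNIV_I, of j]
  by (simp add: fun_eq_iff partial_ek algebra_simps)
 show ?thesis
  unfolding e dist_diff[OF u test_mult_ek[OF test_partial[OF eta]] test_scale[OF test_mult_ek[OF eta]]]
   dist_scale[OF u test_mult_ek[OF eta]]
  by (simp add: Fc_def Dop_def)
qed

text \<open>Exhibits \<open>fc\<close> as a multiple of \<open>Fc\<close> for the distribution 1, so
  that \<open>fc_mult\<close> follows from \<open>Mop_Fc\<close>.\<close>

lemma distribution_integral:
 fixes Om :: "(real^'m::finite) set"
 shows "distribution_on Om (%g. LINT x|lborel. g x)"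
 unfolding distribution_on_def
proof (intro conjI ballI allI impI)
 fix g h :: "real^'m => complex" and a b
 assume "g : tests Om" "h : tests Om"
 thus "(LINT x|lborel. a * g x + b * h x) = a * (LINT x|lborel. g x) + b * (LINT x|lborel. h x)"
  using test_integrable by (subst Bochner_Integration.integral_add) auto
next
 fix K :: "(real^'m) set"
 assume K: "compact K & K <= Om"
 have e: "{js :: 'm list. length js <= 0} = {[]}" by auto
 have "cmod (LINT x|lborel. g x) <= measure lborel K * (SUP x. cmod (g x))" if g: "g : test_functions_supp K" for g
 proof -
  have gt: "g : tests K" using K by (intro test_functionsI[OF _ subset_refl g]) simp
  obtain B where B: "!!x. cmod (g x) <= B" using test_bounded[OF gt] by blast
  have le: "cmod (g x) <= (SUP x. cmod (g x))" for x
   by (rule cSUP_upper[OF UNIV_I]) (rule bdd_aboveI2[where M = B], rule B)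
  have iK: "integrable lborel (%x. indicator K x * (SUP x. cmod (g x)))"
   using K emeasure_compact_finite[of K]
   by (intro integrable_mult_left integrable_real_indicator) (auto intro: borel_compact)
  have "cmod (LINT x|lborel. g x) <= (LINT x|lborel. cmod (g x))" by (rule integral_norm_bound)
  also have "... <= (LINT x|lborel. indicator K x * (SUP x. cmod (g x)))"
   by (rule integral_mono[OF integrable_norm[OF test_integrable[OF gt]] iK])
    (use le test_suppD(2)[OF g] in "auto simp: indicator_def")
  finally show ?thesis by simp
 qed
 thus "EX C N. ALL g:test_functions_supp K. cmod (LINT x|lborel. g x) <= C * (\<Sum>js | length js <= N. SUP x. cmod (partials js g x))"
  using e by (intro exI[of _ "measure lborel K"] exI[of _ 0]) simp
qed

lemma fc_mult:
 assumes "phi : tests (ball x0 pi)" "psi : tests (ball x0 pi)"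
 shows "fc (%x. phi x * psi x) = Mop (fc phi) (fc psi)"
proof -
 let ?c = "(2 * complex_of_real pi) ^ CARD('a)"
 have e: "fc phi = (%k. inverse ?c * Fc (%g. LINT x|lborel. g x) phi k)" for phi :: "real^'a => complex"
  by (simp add: fun_eq_iff fc_def Fc_def field_simps)
 have "fc (%x. phi x * psi x) = (%k. inverse ?c * Mop (fc phi) (Fc (%g. LINT x|lborel. g x) psi) k)"
  unfolding Mop_Fc[OF distribution_integral subset_refl assms(2,1)] by (rule e)
 also have "... = Mop (%k. inverse ?c * Fc (%g. LINT x|lborel. g x) psi k) (fc phi)"
  unfolding Mop_scale_left by (simp only: Mop_sym[of "Fc _ _"])
 also have "... = Mop (fc psi) (fc phi)" by (simp only: e[symmetric])
 finally show ?thesis by (simp only: Mop_sym)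
qed

section \<open>Vector fields as operators on coefficients\<close>

definition tfield :: "real^'m::finite => (real^'m => complex^'m) => bool" where
 "tfield x0 xi \<longleftrightarrow> (ALL j. (%x. xi x $ j) : tests (ball x0 pi))"

definition dirv :: "(real^'m::finite => 'k::real_normed_field^'m) => (real^'m => 'k) => real^'m => 'k" where
 "dirv xi f x = (SUM j:UNIV. xi x $ j * partial j f x)"

definition cbr :: "(real^'m::finite => 'k::real_normed_field^'m) => (real^'m => 'k^'m) => real^'m => 'k^'m" where
 "cbr xi eta x = (SUM j:UNIV. xi x $ j *s partial j eta x - eta x $ j *s partial j xi x)"

text \<open>The operator \<open>xi + b\<close> acting on coefficients; the zeroth-order part is
  carried along because adjoints produce divergences.\<close>

definition vop :: "(real^'m::finite => complex^'m) => (real^'m => complex) => 'm seq => 'm seq" where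
 "vop xi b v k = (SUM j:UNIV. Mop (fc (%x. xi x $ j)) (Dop j v) k) + Mop (fc b) v k"

lemma tfieldD: "tfield x0 xi ==> (%x. xi x $ j) : tests (ball x0 pi)"
 by (simp add: tfield_def)

lemma smooth_on_components:
 assumes "open S" "!!j. smooth_on S (%x. f x $ j)"
 shows "smooth_on S f"
 using smooth_on_vec_lambda[of S "%j x. f x $ j"] assms by simp

lemma tfield_smooth: "tfield x0 xi ==> smooth_on UNIV xi"
 by (intro smooth_on_components open_UNIV test_smooth[OF tfieldD])

lemma partial_component:
 "smooth_on S f ==> x : S ==> partial j f x $ l = partial j (%x. f x $ l) x"
 using partial_linear[OF bounded_linear_vec_nth] by metis

lemma cbr_component:
 assumes "smooth_on S xi" "smooth_on S eta" "x : S"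
 shows "cbr xi eta x $ l = (SUM j:UNIV. xi x $ j * partial j (%x. eta x $ l) x - eta x $ j * partial j (%x. xi x $ l) x)"
 using assms by (simp add: cbr_def partial_component)

lemma cbr_component_dirv:
 assumes "smooth_on S xi" "smooth_on S eta" "x : S"
 shows "cbr xi eta x $ l = dirv xi (%x. eta x $ l) x - dirv eta (%x. xi x $ l) x"
 by (simp add: cbr_component[OF assms] dirv_def sum_subtractf)

lemma dirv_test:
 assumes "!!j. (%x. xi x $ j) : tests Om" "smooth_on UNIV f"
 shows "dirv xi f : tests Om"
 unfolding dirv_def[abs_def]
 by (intro test_sum finite test_mult_smooth[OF assms(1)] smooth_on_partial assms(2))

lemma test_diff: "g : tests Om ==> h : tests Om ==> (%x. g x - h x) : tests Om"
 using test_add[of g Om "%x. - 1 * h x"] test_scale[of h Om "- 1"] by simp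

lemma test_minus: "g : tests Om ==> (%x. - g x) : tests Om"
 using test_scale[of g Om "- 1"] by simp

lemma tfield_cbr:
 assumes "tfield x0 xi" "tfield x0 eta"
 shows "tfield x0 (cbr xi eta)"
 unfolding tfield_def
proof
 fix l
 have "(%x. cbr xi eta x $ l) = (%x. dirv xi (%x. eta x $ l) x - dirv eta (%x. xi x $ l) x)"
  using cbr_component_dirv[OF tfield_smooth[OF assms(1)] tfield_smooth[OF assms(2)]] by (simp add: fun_eq_iff)
 also have "... : tests (ball x0 pi)"
  by (intro test_diff dirv_test tfieldD assms test_smooth[OF tfieldD[OF assms(1)]] test_smooth[OF tfieldD[OF assms(2)]])
 finally show "(%x. cbr xi eta x $ l) : tests (ball x0 pi)" .
qed

lemma Mop_fc_mult:
 assumes "phi : tests (ball x0 pi)" "psi : tests (ball x0 pi)" "temp v"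
 shows "Mop (fc phi) (Mop (fc psi) v) = Mop (fc (%x. phi x * psi x)) v"
 unfolding fc_mult[OF assms(1,2)] by (rule Mop_assoc[symmetric]) (intro rapid_fc[OF assms(1)] rapid_fc[OF assms(2)] assms(3))+

lemma Mop_fc_add:
 assumes "phi : tests Om" "psi : tests Om" "temp v"
 shows "Mop (fc (%x. phi x + psi x)) v = (%k. Mop (fc phi) v k + Mop (fc psi) v k)"
 using Mop_add_left[OF rapid_fc[OF assms(1)] rapid_fc[OF assms(2)] assms(3)]
 by (simp add: fc_add[OF assms(1,2), abs_def])

lemma Mop_fc_minus: "Mop (fc (%x. - phi x)) v = (%k. - Mop (fc phi) v k)"
 by (simp add: fc_minus[abs_def] Mop_minus_left)

lemma Mop_fc_diff:
 assumes "phi : tests Om" "psi : tests Om" "temp v"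
 shows "Mop (fc (%x. phi x - psi x)) v = (%k. Mop (fc phi) v k - Mop (fc psi) v k)"
 using Mop_fc_add[OF assms(1) test_minus[OF assms(2)] assms(3)] by (simp add: Mop_fc_minus)

lemma Mop_fc_sum:
 assumes "finite I" "!!i. i : I ==> f i : tests Om" "temp v"
 shows "Mop (fc (%x. SUM i:I. f i x)) v = (%k. SUM i:I. Mop (fc (f i)) v k)"
 using assms(1,2)
proof (induction I rule: finite_induct)
 case empty
 show ?case by (simp add: fc_zero[abs_def] Mop_zero_left)
next
 case (insert i I)
 show ?case
  using insert Mop_fc_add[OF _ test_sum[OF insert.hyps(1)] assms(3), of "f i" Om f]
  by simp
qed

lemma temp_sum: "finite I ==> (!!i. i : I ==> temp (f i)) ==> temp (%k. SUM i:I. f i k)"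
 by (induction I rule: finite_induct) (auto intro: temp_add rapid_imp_temp rapid_zero)

lemma lin_op_sum:
 assumes "lin_op A" "finite I" "!!i. i : I ==> temp (f i)"
 shows "A (%k. SUM i:I. f i k) = (%k. SUM i:I. A (f i) k)"
 using assms(2,3)
proof (induction I rule: finite_induct)
 case empty
 have "A (%k. 0 - 0) = (%k. A (%k. 0) k - A (%k. 0) k)"
  using rapid_zero rapid_imp_temp lin_op_diff[OF assms(1), of "%k. 0" "%k. 0"] by blast
 thus ?case by simp
next
 case (insert i I)
 show ?case
  using insert lin_op_add[OF assms(1), of "f i" "%k. SUM i:I. f i k"] temp_sum[OF insert.hyps(1), of f] by simp
qed

lemma FO_vop:
 assumes "tfield x0 xi" "b : tests (ball x0 pi)"
 shows "FO (vop xi b)"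
 unfolding vop_def[abs_def]
 by (intro FO_add FO_sum finite FO_Mop_Dop FO_Mop rapid_fc[OF tfieldD[OF assms(1)]] rapid_fc[OF assms(2)])

definition conjf :: "(real^'m::finite => complex^'m) => real^'m => complex^'m" where
 "conjf xi x = cnj_vec (xi x)"

definition diverg :: "(real^'m::finite => complex^'m) => real^'m => complex" where
 "diverg xi x = (SUM j:UNIV. partial j (%x. xi x $ j) x)"

lemma conjf_component [simp]: "conjf xi x $ j = cnj (xi x $ j)"
 by (simp add: conjf_def cnj_vec_def)

lemma conjf_conjf [simp]: "conjf (conjf xi) = xi"
 by (simp add: fun_eq_iff vec_eq_iff)

lemma tfield_conjf: "tfield x0 xi ==> tfield x0 (conjf xi)"
 by (simp add: tfield_def test_cnj)

lemma tfield_uminus: "tfield x0 xi ==> tfield x0 (%x. - xi x)"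
 by (simp add: tfield_def test_minus)

lemma diverg_test: "tfield x0 xi ==> diverg xi : tests (ball x0 pi)"
 unfolding diverg_def[abs_def] by (intro test_sum finite test_partial tfieldD)

lemma Mop_fc_vop:
 assumes "tfield x0 xi" "a : tests (ball x0 pi)" "b : tests (ball x0 pi)" "temp v"
 shows "vop xi a (Mop (fc b) v) = (%k. (SUM j:UNIV. Mop (fc (%x. xi x $ j * b x)) (Dop j v) k)
  + Mop (fc (%x. dirv xi b x + a x * b x)) v k)"
proof
 fix k
 note t = tfieldD[OF assms(1)]
 note tb = temp_Mop[OF rapid_fc[OF assms(3)]]
 have "Mop (fc (%x. xi x $ j)) (Dop j (Mop (fc b) v)) k =
   Mop (fc (%x. xi x $ j * b x)) (Dop j v) k + Mop (fc (%x. xi x $ j * partial j b x)) v k" for j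
  unfolding Dop_Mop[OF rapid_fc[OF assms(3)] assms(4)] fc_partial[OF assms(3), symmetric]
  using Mop_add_right[OF rapid_fc[OF t] tb[OF temp_Dop[OF assms(4)]] temp_Mop[OF rapid_fc[OF test_partial[OF assms(3)]] assms(4)]]
  by (simp add: Mop_fc_mult[OF t assms(3) temp_Dop[OF assms(4)]] Mop_fc_mult[OF t test_partial[OF assms(3)] assms(4)])
 moreover have "Mop (fc (dirv xi b)) v k = (SUM j:UNIV. Mop (fc (%x. xi x $ j * partial j b x)) v k)"
  unfolding dirv_def[abs_def]
  by (subst Mop_fc_sum[OF finite _ assms(4)])
   (auto intro: test_mult_smooth[OF t] test_smooth[OF test_partial[OF assms(3)]])
 moreover have "Mop (fc (%x. dirv xi b x + a x * b x)) v = (%k. Mop (fc (dirv xi b)) v k + Mop (fc (%x. a x * b x)) v k)"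
  by (rule Mop_fc_add[OF dirv_test[OF t test_smooth[OF assms(3)]]
     test_mult_smooth[OF assms(2) test_smooth[OF assms(3)]] assms(4)])
 ultimately show "vop xi a (Mop (fc b) v) k = (SUM j:UNIV. Mop (fc (%x. xi x $ j * b x)) (Dop j v) k)
   + Mop (fc (%x. dirv xi b x + a x * b x)) v k"
  unfolding vop_def by (simp add: sum.distrib Mop_fc_mult[OF assms(2,3,4)])
qed

lemma adjoint_vop:
 assumes "tfield x0 xi" "b : tests (ball x0 pi)"
 shows "adjoint (vop xi b) (vop (%x. - conjf xi x) (%x. cnj (b x) - diverg (conjf xi) x))"
proof -
 define A where "A j v = Mop (fc (%x. xi x $ j)) (Dop j v)" for j v
 define B where "B j v k = - Mop (fc (%x. cnj (xi x $ j))) (Dop j v) k - Mop (fc (partial j (%x. cnj (xi x $ j)))) v k" for j v k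
 note t = tfieldD[OF assms(1)]
 note tc = test_cnj[OF t]
 have FA: "FO (A j)" for j unfolding A_def[abs_def] by (intro FO_Mop_Dop rapid_fc[OF t])
 have FB: "FO (B j)" for j
  unfolding B_def[abs_def]
  by (intro FO_diff FO_minus FO_Mop_Dop FO_Mop rapid_fc[OF tc] rapid_fc[OF test_partial[OF tc]])
 have ad: "adjoint (A j) (B j)" for j
  unfolding A_def[abs_def] B_def[abs_def]
  using adjoint_Mop_Dop[OF rapid_fc[OF t], of j] by (simp add: fc_partial[OF tc] fc_cnj[OF t])
 have sum: "finite I ==> adjoint (%v k. (SUM j:I. A j v k) + Mop (fc b) v k)
   (%v k. (SUM j:I. B j v k) + Mop (fc (%x. cnj (b x))) v k)" for I
 proof (induction I rule: finite_induct)
  case empty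
  show ?case using adjoint_Mop[OF rapid_fc[OF assms(2)]] by (simp add: fc_cnj[OF assms(2)])
 next
  case (insert i I)
  have r: "rapid (fc b)" "rapid (fc (%x. cnj (b x)))" by (rule rapid_fc[OF assms(2)] rapid_fc[OF test_cnj[OF assms(2)]])+
  have "adjoint (%v k. A i v k + ((SUM j:I. A j v k) + Mop (fc b) v k))
    (%v k. B i v k + ((SUM j:I. B j v k) + Mop (fc (%x. cnj (b x))) v k))"
   by (rule adjoint_add[OF ad insert.IH FA _ FB]) (intro FO_add FO_sum insert.hyps(1) FA FB FO_Mop r)+
  thus ?case using insert.hyps by (simp add: add.assoc)
 qed
 have eq: "vop (%x. - conjf xi x) (%x. cnj (b x) - diverg (conjf xi) x) v =
   (%k. (SUM j:UNIV. B j v k) + Mop (fc (%x. cnj (b x))) v k)" if "temp v" for v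
 proof -
  have "Mop (fc (diverg (conjf xi))) v = (%k. SUM j:UNIV. Mop (fc (partial j (%x. cnj (xi x $ j)))) v k)"
   unfolding diverg_def[abs_def] using Mop_fc_sum[OF finite test_partial[OF tc] that] by simp
  thus ?thesis
   by (simp add: vop_def fun_eq_iff B_def Mop_fc_minus sum_subtractf sum_negf
     Mop_fc_diff[OF test_cnj[OF assms(2)] diverg_test[OF tfield_conjf[OF assms(1)]] that])
 qed
 show ?thesis
  using sum[OF finite, of UNIV] unfolding adjoint_def
  by (simp add: eq[OF rapid_imp_temp]) (simp add: vop_def[abs_def] A_def)
qed

lemma cm_vop:
 assumes "tfield x0 xi" "tfield x0 eta" "a : tests (ball x0 pi)" "b : tests (ball x0 pi)" "temp v"
 shows "cm (vop xi a) (vop eta b) v = vop (cbr xi eta) (%x. dirv xi b x - dirv eta a x) v"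
proof -
 have main: "vop xi a (vop eta b v) = (%k. (SUM l:UNIV. SUM j:UNIV. Mop (fc (%x. xi x $ j * eta x $ l)) (Dop j (Dop l v)) k)
   + (SUM l:UNIV. Mop (fc (dirv xi (%x. eta x $ l))) (Dop l v) k)
   + (SUM l:UNIV. Mop (fc (%x. a x * eta x $ l)) (Dop l v) k) + (SUM l:UNIV. Mop (fc (%x. xi x $ l * b x)) (Dop l v) k)
   + Mop (fc (dirv xi b)) v k + Mop (fc (%x. a x * b x)) v k)"
  if xi: "tfield x0 xi" and eta: "tfield x0 eta" and ta: "a : tests (ball x0 pi)" and tb: "b : tests (ball x0 pi)"
  for xi eta a b
 proof -
  note lin = FO_lin[OF FO_vop[OF xi ta]]
  note tl = tfieldD[OF eta]
  have tM: "temp (Mop (fc (%x. eta x $ l)) (Dop l v))" for l by (intro temp_Mop rapid_fc[OF tl] temp_Dop assms(5))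
  have tMb: "temp (Mop (fc b) v)" by (intro temp_Mop rapid_fc[OF tb] assms(5))
  have tD: "temp (Dop l v)" for l by (intro temp_Dop assms(5))
  have split: "Mop (fc (%x. dirv xi c x + a x * c x)) w = (%k. Mop (fc (dirv xi c)) w k + Mop (fc (%x. a x * c x)) w k)"
   if "c : tests (ball x0 pi)" "temp w" for c w
   by (rule Mop_fc_add[OF dirv_test[OF tfieldD[OF xi] test_smooth[OF that(1)]]
      test_mult_smooth[OF ta test_smooth[OF that(1)]] that(2)])
  have "vop xi a (vop eta b v) = vop xi a (%k. (SUM l:UNIV. Mop (fc (%x. eta x $ l)) (Dop l v) k) + Mop (fc b) v k)"
   by (simp add: vop_def[of eta, abs_def])
  also have "... = (%k. (SUM l:UNIV. vop xi a (Mop (fc (%x. eta x $ l)) (Dop l v)) k) + vop xi a (Mop (fc b) v) k)"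
   by (subst lin_op_add[OF lin temp_sum[OF finite tM] tMb], subst lin_op_sum[OF lin finite tM]) simp
  finally show ?thesis
   by (simp add: Mop_fc_vop[OF xi ta tl tD] Mop_fc_vop[OF xi ta tb assms(5)] split[OF tl tD] split[OF tb assms(5)] fun_eq_iff sum.distrib)
 qed
 \<comment> \<open>This symmetry removes the second-order terms of \<open>main\<close> from the
   commutator.\<close>
 have sym: "(SUM l:UNIV. SUM j:UNIV. Mop (fc (%x. eta x $ j * xi x $ l)) (Dop j (Dop l v)) k) =
   (SUM l:UNIV. SUM j:UNIV. Mop (fc (%x. xi x $ j * eta x $ l)) (Dop j (Dop l v)) k)" for k
  by (subst sum.swap) (simp add: mult.commute Dop_commute)
 note t1 = tfieldD[OF assms(1)] and t2 = tfieldD[OF assms(2)]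
 have d: "dirv xi (%x. eta x $ l) : tests (ball x0 pi)" "dirv eta (%x. xi x $ l) : tests (ball x0 pi)"
  "dirv xi b : tests (ball x0 pi)" "dirv eta a : tests (ball x0 pi)" for l
  by (intro dirv_test t1 t2 test_smooth[OF t1] test_smooth[OF t2]
    test_smooth[OF assms(3)] test_smooth[OF assms(4)])+
 have "(%x. cbr xi eta x $ l) = (%x. dirv xi (%x. eta x $ l) x - dirv eta (%x. xi x $ l) x)" for l
  using cbr_component_dirv[OF tfield_smooth[OF assms(1)] tfield_smooth[OF assms(2)]] by (simp add: fun_eq_iff)
 hence rhs: "vop (cbr xi eta) (%x. dirv xi b x - dirv eta a x) v k =
   (SUM l:UNIV. Mop (fc (dirv xi (%x. eta x $ l))) (Dop l v) k) - (SUM l:UNIV. Mop (fc (dirv eta (%x. xi x $ l))) (Dop l v) k)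
   + Mop (fc (dirv xi b)) v k - Mop (fc (dirv eta a)) v k" for k
  by (simp add: vop_def Mop_fc_diff[OF d(1,2) temp_Dop[OF assms(5)]] Mop_fc_diff[OF d(3,4) assms(5)] sum_subtractf)
 show ?thesis
  by (rule ext) (simp add: cm_def main[OF assms(1,2,3,4)] main[OF assms(2,1,4,3)] sym rhs mult.commute)
qed

text \<open>Read off the Fourier series: after a cut-off equal to 1 near \<open>x\<close>,
  derivatives are multiplications of the coefficients by frequencies, and these commute.\<close>

lemma partial_commute:
 fixes f :: "real^'m::finite => complex"
 assumes S: "open S" "x : S" and f: "smooth_on S f"
 shows "partial i (partial j f) x = partial j (partial i f) x"
proof -
 obtain e where e: "0 < e" "ball x e <= S" using S openE by blast
 define r where "r = min e pi"
 have r: "0 < r" "ball x r <= S" "ball x r <= ball x pi" using e pi_gt_zero by (auto simp: r_def)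
 have "compact {x}" "{x} <= ball x r" using r by auto
 then obtain psi rho where psi: "psi : tests (ball x r)" "0 < rho" "rho < r" "!!y. y : ball x rho ==> psi y = 1"
  using cutoff_exists[of "{x}" x r] r(1) by metis
 define g where "g = (%y. f y * psi y)"
 have "g : tests (ball x r)"
  unfolding g_def by (rule test_mult_local[OF open_ball psi(1) smooth_on_subset[OF f r(2)]])
 hence g: "g : tests (ball x pi)" using test_mono[OF r(3)] by blast
 have x: "x : ball x pi" "x : ball x rho" using psi(2) by auto
 have "partial i (partial j g) x = fseries (fc (partial i (partial j g))) x"
  by (rule fourier_inversion[OF test_partial[OF test_partial[OF g]] x(1)])
 also have "fc (partial i (partial j g)) = fc (partial j (partial i g))"
  by (simp only: fc_partial[OF test_partial[OF g]] fc_partial[OF g] Dop_commute[of i j])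
 also have "fseries (fc (partial j (partial i g))) x = partial j (partial i g) x"
  by (rule fourier_inversion[OF test_partial[OF test_partial[OF g]] x(1), symmetric])
 finally have *: "partial i (partial j g) x = partial j (partial i g) x" .
 have sub: "ball x rho <= S" using psi(3) r(2) by auto
 have f': "smooth_on (ball x rho) f" by (rule smooth_on_subset[OF f sub])
 have p: "partial i g y = partial i f y" if "y : ball x rho" for y i
  by (rule partial_cong[OF open_ball that _ f']) (simp add: g_def psi(4))
 have "partial i (partial j g) x = partial i (partial j f) x" for i j
  by (rule partial_cong[OF open_ball x(2) _ smooth_on_partial[OF f']]) (simp add: p)
 thus ?thesis using * by simp
qed

lemma partial_commute_of_real:
 fixes f :: "real^'m::finite => real"
 assumes S: "open S" "x : S" and f: "smooth_on S f"
 shows "partial i (partial j (%x. of_real (f x) :: 'k::real_normed_field)) x = partial j (partial i (%x. of_real (f x))) x"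
proof -
 have e: "partial i (partial j (%x. of_real (f x) :: 'b::real_normed_field)) x = of_real (partial i (partial j f) x)" for i j
 proof -
  have "partial i (partial j (%x. of_real (f x) :: 'b)) x = partial i (%x. of_real (partial j f x)) x"
   by (rule partial_cong[OF S _ smooth_on_linear[OF bounded_linear_of_real S(1) smooth_on_partial[OF f]]])
    (rule partial_linear[OF bounded_linear_of_real f, symmetric])
  thus ?thesis by (simp add: partial_linear[OF bounded_linear_of_real smooth_on_partial[OF f] S(2)])
 qed
 have "complex_of_real (partial i (partial j f) x) = complex_of_real (partial j (partial i f) x)"
  unfolding e[symmetric] by (rule partial_commute[OF S smooth_on_linear[OF bounded_linear_of_real S(1) f]])
 thus ?thesis by (simp add: e)
qed

lemma smooth_on_vec_scale:
 fixes f :: "'e::euclidean_space => 'k::real_normed_field" and xi :: "'e => 'k^'n::finite"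
 assumes "open S" "smooth_on S f" "smooth_on S xi"
 shows "smooth_on S (%x. f x *s xi x)"
 by (rule smooth_on_components[OF assms(1)]) (simp add: smooth_on_mult[OF assms(1,2) smooth_on_vec_nth[OF assms(1,3)]])

section \<open>Calculus of brackets in coordinates\<close>

lemma smooth_on_dirv:
 "open S ==> smooth_on S xi ==> smooth_on S f ==> smooth_on S (dirv xi f)"
 unfolding dirv_def[abs_def]
 by (intro smooth_on_sum finite smooth_on_mult smooth_on_vec_nth smooth_on_partial)

lemma smooth_on_cbr:
 assumes "open S" "smooth_on S xi" "smooth_on S eta"
 shows "smooth_on S (cbr xi eta)"
 unfolding cbr_def[abs_def]
 by (intro smooth_on_sum smooth_on_diff smooth_on_vec_scale smooth_on_vec_nth smooth_on_partial finite assms)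

lemma dirv_cong:
 assumes "open S" "x : S" "xi x = xi' x" "!!y. y : S ==> f y = g y" "smooth_on S f"
 shows "dirv xi' g x = dirv xi f x"
 by (simp add: dirv_def assms(3) partial_cong[OF assms(1,2,4,5)])

lemma cbr_cong:
 assumes "open S" "x : S" "!!y. y : S ==> xi y = xi' y" "!!y. y : S ==> eta y = eta' y" "smooth_on S xi" "smooth_on S eta"
 shows "cbr xi' eta' x = cbr xi eta x"
 by (simp add: cbr_def assms(2) assms(3,4)[symmetric] partial_cong[OF assms(1,2,3,5)] partial_cong[OF assms(1,2,4,6)])

lemma dirv_diff_right:
 "open S ==> smooth_on S f ==> smooth_on S g ==> x : S ==> dirv xi (%x. f x - g x) x = dirv xi f x - dirv xi g x"
 by (simp add: dirv_def partial_diff right_diff_distrib sum_subtractf)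

lemma dirv_mult:
 "smooth_on S f ==> smooth_on S g ==> x : S ==> dirv xi (%x. f x * g x) x = dirv xi f x * g x + f x * dirv xi g x"
 by (simp add: dirv_def partial_mult distrib_left sum.distrib sum_distrib_left sum_distrib_right mult_ac)

lemma dirv_sum_right:
 "open S ==> finite I ==> (!!i. i : I ==> smooth_on S (f i)) ==> x : S ==>
  dirv xi (%x. SUM i:I. f i x) x = (SUM i:I. dirv xi (f i) x)"
 unfolding dirv_def by (simp add: partial_sum sum_distrib_left) (rule sum.swap)

text \<open>\<open>sym\<close> is a hypothesis because the scalar field is generic. It is supplied
  by \<open>partial_commute\<close> for complex functions and by
  \<open>partial_commute_of_real\<close> for coordinate functions.\<close>

lemma dirv_cbr:
 assumes S: "open S" "x : S" and s: "smooth_on S xi" "smooth_on S eta" "smooth_on S f"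
  and sym: "!!i j. partial i (partial j f) x = partial j (partial i f) x"
 shows "dirv (cbr xi eta) f x = dirv xi (dirv eta f) x - dirv eta (dirv xi f) x"
proof -
 have dd: "dirv xi (dirv eta f) x = (SUM l:UNIV. dirv xi (%x. eta x $ l) x * partial l f x) +
   (SUM l:UNIV. SUM j:UNIV. eta x $ l * (xi x $ j * partial j (partial l f) x))"
  if "smooth_on S eta" for xi eta
 proof -
  note c = smooth_on_vec_nth[OF S(1) that] and p = smooth_on_partial[OF s(3)]
  have "dirv xi (dirv eta f) x = (SUM l:UNIV. dirv xi (%x. eta x $ l * partial l f x) x)"
   unfolding dirv_def[of eta, abs_def] by (rule dirv_sum_right[OF S(1) finite smooth_on_mult[OF S(1) c p] S(2)])
  also have "... = (SUM l:UNIV. dirv xi (%x. eta x $ l) x * partial l f x + eta x $ l * dirv xi (partial l f) x)"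
   by (simp add: dirv_mult[OF c p S(2)])
  finally show ?thesis by (simp add: sum.distrib dirv_def[of xi "partial _ f"] sum_distrib_left)
 qed
 have swap: "(SUM l:UNIV. SUM j:UNIV. eta x $ l * (xi x $ j * partial j (partial l f) x)) =
   (SUM l:UNIV. SUM j:UNIV. xi x $ l * (eta x $ j * partial j (partial l f) x))"
  by (subst sum.swap) (simp add: mult.left_commute sym)
 have "dirv (cbr xi eta) f x = (SUM l:UNIV. (dirv xi (%x. eta x $ l) x - dirv eta (%x. xi x $ l) x) * partial l f x)"
  by (simp add: dirv_def[of "cbr _ _"] cbr_component_dirv[OF s(1,2) S(2)])
 thus ?thesis
  by (simp add: dd[OF s(2)] dd[OF s(1)] swap left_diff_distrib sum_subtractf)
qed

text \<open>Each component of a bracket is a difference of directional derivatives of components,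
  and \<open>dirv_cbr\<close> reduces both sides to the same iterated derivatives.\<close>

lemma cbr_jacobi:
 fixes a b c :: "real^'m::finite => complex^'m"
 assumes S: "open S" "x : S" and s: "smooth_on S a" "smooth_on S b" "smooth_on S c"
 shows "cbr (cbr a b) c x = cbr a (cbr b c) x - cbr b (cbr a c) x"
proof -
 have "cbr (cbr a b) c x $ l = (cbr a (cbr b c) x - cbr b (cbr a c) x) $ l" for l
 proof -
  have sc: "smooth_on S (%x. f x $ l)" if "smooth_on S f" for f :: "real^'m => complex^'m"
   by (rule smooth_on_vec_nth[OF S(1) that])
  have d: "dirv d (%x. cbr e f x $ l) x = dirv d (dirv e (%x. f x $ l)) x - dirv d (dirv f (%x. e x $ l)) x"
   if "smooth_on S e" "smooth_on S f" for d e f :: "real^'m => complex^'m"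
  proof -
   have "dirv d (%x. cbr e f x $ l) x = dirv d (%x. dirv e (%x. f x $ l) x - dirv f (%x. e x $ l) x) x"
    by (rule dirv_cong[OF S refl])
     (auto simp: cbr_component_dirv[OF that] intro!: smooth_on_diff smooth_on_dirv S sc that)
   also have "... = dirv d (dirv e (%x. f x $ l)) x - dirv d (dirv f (%x. e x $ l)) x"
    by (rule dirv_diff_right[OF S(1) _ _ S(2)]) (intro smooth_on_dirv S(1) sc that)+
   finally show ?thesis .
  qed
  have br: "dirv (cbr e f) (%x. g x $ l) x = dirv e (dirv f (%x. g x $ l)) x - dirv f (dirv e (%x. g x $ l)) x"
   if "smooth_on S e" "smooth_on S f" "smooth_on S g" for e f g :: "real^'m => complex^'m"
   by (rule dirv_cbr[OF S that(1,2) sc[OF that(3)] partial_commute[OF S sc[OF that(3)]]])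
  note cb = smooth_on_cbr[OF S(1)]
  show ?thesis
   by (simp add: cbr_component_dirv[OF cb[OF s(1,2)] s(3) S(2)] cbr_component_dirv[OF s(1) cb[OF s(2,3)] S(2)]
     cbr_component_dirv[OF s(2) cb[OF s(1,3)] S(2)] d s br)
 qed
 thus ?thesis by (simp add: vec_eq_iff)
qed

lemma cbr_add_left:
 assumes "smooth_on S xi" "smooth_on S xi'" "x : S"
 shows "cbr (%x. xi x + xi' x) eta x = cbr xi eta x + cbr xi' eta x"
 by (simp add: cbr_def partial_add[OF assms] vector_add_ldistrib vector_sadd_rdistrib sum.distrib sum_subtractf algebra_simps)

lemma cbr_zero_left [simp]: "cbr (%x. 0) eta x = 0"
 by (simp add: cbr_def vec_eq_iff)

lemma cbr_sum_left:
 "finite I ==> open S ==> (!!i. i : I ==> smooth_on S (xi i)) ==> x : S ==>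
  cbr (%x. SUM i:I. xi i x) eta x = (SUM i:I. cbr (xi i) eta x)"
proof (induction I rule: finite_induct)
 case (insert i I)
 thus ?case
  using cbr_add_left[of S "xi i" "%x. SUM i:I. xi i x" x eta] smooth_on_sum[of S I xi] by simp
qed simp

lemma cbr_scale_left:
 assumes "smooth_on S f" "smooth_on S xi" "x : S" "open S"
 shows "cbr (%x. f x *s xi x) eta x = f x *s cbr xi eta x - dirv eta f x *s xi x"
proof -
 have p: "partial j (%x. f x *s xi x) x = partial j f x *s xi x + f x *s partial j xi x" for j
 proof -
  have "partial j (%x. f x *s xi x) x $ l = (partial j f x *s xi x + f x *s partial j xi x) $ l" for l
   by (simp add: partial_component[OF smooth_on_vec_scale[OF assms(4,1,2)] assms(3)]
     partial_mult[OF assms(1) smooth_on_vec_nth[OF assms(4,2)] assms(3)] partial_component[OF assms(2,3)])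
  thus ?thesis by (simp add: vec_eq_iff)
 qed
 have "cbr (%x. f x *s xi x) eta x $ l = (f x *s cbr xi eta x - dirv eta f x *s xi x) $ l" for l
  by (simp add: cbr_def p dirv_def sum_distrib_left sum_distrib_right sum_subtractf[symmetric] algebra_simps)
 thus ?thesis by (simp add: vec_eq_iff)
qed

lemma partial_cnj: "smooth_on S f ==> x : S ==> partial j (%x. cnj (f x)) x = cnj (partial j f x)"
 by (rule partial_linear[OF bounded_linear_cnj])

lemma smooth_on_cnj: "open S ==> smooth_on S f ==> smooth_on S (%x. cnj (f x))"
 by (rule smooth_on_linear[OF bounded_linear_cnj])

lemma smooth_on_conjf: "open S ==> smooth_on S xi ==> smooth_on S (conjf xi)"
 by (rule smooth_on_components) (simp_all add: smooth_on_cnj smooth_on_vec_nth)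

lemma conjf_cbr:
 assumes "open S" "smooth_on S xi" "smooth_on S eta" "x : S"
 shows "conjf (cbr xi eta) x = cbr (conjf xi) (conjf eta) x"
proof -
 have "conjf (cbr xi eta) x $ l = cbr (conjf xi) (conjf eta) x $ l" for l
  by (simp add: cbr_component[OF assms(2,3,4)]
    cbr_component[OF smooth_on_conjf[OF assms(1,2)] smooth_on_conjf[OF assms(1,3)] assms(4)]
    partial_cnj[OF smooth_on_vec_nth[OF assms(1,2)] assms(4)] partial_cnj[OF smooth_on_vec_nth[OF assms(1,3)] assms(4)])
 thus ?thesis by (simp add: vec_eq_iff)
qed

lemma Hsob_mono: "Hsob s v ==> t <= s ==> Hsob t v"
 unfolding Hsob_def
 by (rule conjunct1[OF Hs_mono[where C = 1]]) (auto intro!: mult_right_mono powr_mono jb_ge_1)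

lemma Hsob_add: "Hsob s u ==> Hsob s v ==> Hsob s (%k. u k + v k)"
 unfolding Hsob_def by (rule conjunct1[OF Hs_add])

lemma Hsob_diff: "Hsob s u ==> Hsob s v ==> Hsob s (%k. u k - v k)"
 unfolding Hsob_def by (rule conjunct1[OF Hs_diff])

lemma Hsob_minus [simp]: "Hsob s (%k. - v k) \<longleftrightarrow> Hsob s v"
 unfolding Hsob_def by simp

lemma Hsob_zero [simp]: "Hsob s (%k. 0)"
 by (simp add: Hsob_def Hs_def)

lemma Hsob_sum: "finite I ==> (!!i. i : I ==> Hsob s (f i)) ==> Hsob s (%k. SUM i:I. f i k)"
 by (induction I rule: finite_induct) (auto intro: Hsob_add)

lemma Hsob_add_iff: "Hsob s v ==> Hsob s (%k. u k + v k) \<longleftrightarrow> Hsob s u"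
 using Hsob_diff[of s "%k. u k + v k" v] Hsob_add[of s u v] by auto

lemma order_op_mono:
 fixes A :: "'m::finite seq => 'm seq"
 assumes "order_op r A" "r <= r'"
 shows "order_op r' A"
proof -
 have "bd (wt (real r) 0) (%t. A)" using assms(1) by (simp add: order_op_def)
 hence "bd (wt (real r') 0) (%t. A)"
  by (rule bd_mono[where K = 1]) (use assms(2) in "auto simp: less_imp_le[OF wt_pos] intro!: wt_mono")
 thus ?thesis using assms(1) by (simp add: order_op_def)
qed

lemma order_op_2_FO: "FO P ==> order_op 2 P"
 by (rule order_op_mono[OF order_op_FO]) auto

lemma order_op_2_id: "order_op 2 (%v. v)"
 by (rule order_op_mono[OF order_op_id]) auto

text \<open>The index set consists of the pairs of order and operator themselves, so that callers
  can list the known regularity as a finite set.\<close>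

lemma regularity_pairs:
 fixes P :: "(real \<times> ('m::finite seq => 'm seq)) set"
 assumes "finite P" "!!s A. (s, A) : P ==> order_op 2 A" "order_op 2 A0"
  and "!!beta G. (!!s A. (s, A) : P ==> Qdom s beta (%t. A) G) ==> Qdom s0 beta (%t. A0) G"
  and "temp v" "!!s A. (s, A) : P ==> Hsob s (A v)"
 shows "Hsob s0 (A0 v)"
 by (rule regularity_from_estimate[of P snd A0 fst s0 v]) (use assms in "auto")

definition cut :: "(real^'m::finite => complex) => (real^'m => complex^'m) => real^'m => complex^'m" where
 "cut psi xi x = psi x *s xi x"

definition nvop :: "(real^'m::finite => complex^'m) => 'm seq => 'm seq" where
 "nvop xi = vop xi (%x. 0)"

text \<open>The adjoint of \<open>nvop xi\<close>: minus the conjugate field, up to order zero.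
  \<open>cnj 0\<close> keeps the shape that \<open>adjoint_vop\<close> yields for
  \<open>b = 0\<close>.\<close>

definition avop :: "(real^'m::finite => complex^'m) => 'm seq => 'm seq" where
 "avop xi = vop (%x. - conjf xi x) (%x. cnj 0 - diverg (conjf xi) x)"

lemma avop_coefficient: "tfield x0 xi ==> (%x. cnj 0 - diverg (conjf xi) x) : tests (ball x0 pi)"
 using test_minus[OF diverg_test[OF tfield_conjf]] by simp

lemma FO_nvop: "tfield x0 xi ==> FO (nvop xi)"
 unfolding nvop_def by (rule FO_vop[OF _ test_zero])

lemma FO_avop: "tfield x0 xi ==> FO (avop xi)"
 unfolding avop_def by (rule FO_vop[OF tfield_uminus[OF tfield_conjf] avop_coefficient])

lemma adjoint_nvop: "tfield x0 xi ==> adjoint (nvop xi) (avop xi)"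
 unfolding nvop_def avop_def by (rule adjoint_vop[OF _ test_zero])

lemma tfield_cut:
 assumes "psi : tests (ball x0 r)" "smooth_on (ball x0 r) xi" "r <= pi"
 shows "tfield x0 (cut psi xi)"
 unfolding tfield_def cut_def
proof
 fix j
 have "(%x. xi x $ j * psi x) : tests (ball x0 r)"
  by (rule test_mult_local[OF open_ball assms(1) smooth_on_vec_nth[OF open_ball assms(2)]])
 thus "(%x. (psi x *s xi x) $ j) : tests (ball x0 pi)"
  using test_mono[OF subset_ball[OF assms(3)]] by (auto simp: mult.commute)
qed

section \<open>Gain of regularity along vector fields\<close>

text \<open>The bound \<open>R <= pi\<close> confines all supports to one period cell, where Fourier
  inversion holds.\<close>

locale local_dist =
 fixes u :: "(real^'m::finite => complex) => complex" and x0 :: "real^'m" and R :: real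
 assumes R: "0 < R" "R <= pi" and dist: "distribution_on (ball x0 R) u"
begin

abbreviation T :: "real => (real^'m => complex) set" where
 "T r \<equiv> tests (ball x0 r)"

abbreviation sm :: "real => (real^'m => complex^'m) => bool" where
 "sm r \<equiv> smooth_on (ball x0 r)"

text \<open>The coefficients of \<open>eta\<close> times the distribution \<open>xi u\<close>, which
  is defined by duality. As no derivative falls on \<open>eta\<close> from outside, a factor of
  \<open>xi\<close> can be moved into \<open>eta\<close> (\<open>dF_scale\<close>), and only the
  values of \<open>xi\<close> where \<open>eta\<close> is nonzero matter
  (\<open>dF_cong\<close>).\<close>

definition dF :: "(real^'m => complex^'m) => (real^'m => complex) => 'm seq" where
 "dF xi eta k = - u (%x. SUM j:UNIV. partial j (%x. xi x $ j * eta x * ek (- k) x) x)"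

lemma T_mono: "eta : T r ==> r <= r' ==> eta : T r'"
 using test_mono[OF subset_ball] by blast

lemma component_test: "sm r xi ==> eta : T r ==> (%x. xi x $ j * eta x) : T r"
 by (rule test_mult_local[OF open_ball _ smooth_on_vec_nth[OF open_ball]])

lemma dF_integrand_test:
 assumes "sm r xi" "eta : T r" "r <= R"
 shows "(%x. SUM j:UNIV. partial j (%x. xi x $ j * eta x * ek k x) x) : T R"
 by (intro test_sum finite test_partial test_mult_ek T_mono[OF component_test[OF assms(1,2)] assms(3)])

lemma dF_cong:
 assumes "!!x. eta x ~= 0 ==> xi x = xi' x"
 shows "dF xi eta = dF xi' eta"
proof -
 have "xi x $ j * eta x = xi' x $ j * eta x" for x j using assms by (cases "eta x = 0") auto
 thus ?thesis by (simp only: dF_def fun_eq_iff) simp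
qed

lemma dF_zero: "(!!x. eta x ~= 0 ==> xi x = 0) ==> dF xi eta = (%k. 0)"
 using dF_cong[of eta xi "%x. 0"] dist_zero[OF dist] by (simp add: dF_def[abs_def])

lemma dF_scale: "dF (%x. f x *s xi x) eta = dF xi (%x. f x * eta x)"
 by (simp add: dF_def fun_eq_iff mult.assoc mult.left_commute)

lemma dF_add:
 assumes "sm r xi" "sm r xi'" "eta : T r" "r <= R"
 shows "dF (%x. xi x + xi' x) eta = (%k. dF xi eta k + dF xi' eta k)"
proof
 fix k
 have t: "smooth_on UNIV (%x. xi x $ j * eta x * ek (- k) x)" if "sm r xi" for xi j
  by (rule test_smooth[OF test_mult_ek[OF component_test[OF that assms(3)]]])
 have "(%x. SUM j:UNIV. partial j (%x. (xi x + xi' x) $ j * eta x * ek (- k) x) x) =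
   (%x. (SUM j:UNIV. partial j (%x. xi x $ j * eta x * ek (- k) x) x) + (SUM j:UNIV. partial j (%x. xi' x $ j * eta x * ek (- k) x) x))"
  by (simp add: fun_eq_iff distrib_right partial_add[OF t[OF assms(1)] t[OF assms(2)] UNIV_I] sum.distrib)
 thus "dF (%x. xi x + xi' x) eta k = dF xi eta k + dF xi' eta k"
  by (simp add: dF_def dist_add[OF dist dF_integrand_test[OF assms(1,3,4)] dF_integrand_test[OF assms(2,3,4)]])
qed

lemma dF_minus:
 assumes "sm r xi" "eta : T r" "r <= R"
 shows "dF (%x. - xi x) eta = (%k. - dF xi eta k)"
proof -
 have "(%k. dF xi eta k + dF (%x. - xi x) eta k) = dF (%x. xi x + - xi x) eta"
  by (rule dF_add[OF assms(1) smooth_on_minus[OF open_ball assms(1)] assms(2,3), symmetric])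
 also have "... = (%k. 0)" by (rule dF_zero) simp
 finally show ?thesis by (simp add: fun_eq_iff add_eq_0_iff)
qed

lemma dF_diff:
 assumes "sm r xi" "sm r xi'" "eta : T r" "r <= R"
 shows "dF (%x. xi x - xi' x) eta = (%k. dF xi eta k - dF xi' eta k)"
 using dF_add[OF assms(1) smooth_on_minus[OF open_ball assms(2)] assms(3,4)] dF_minus[OF assms(2,3,4)] by simp

lemma dF_sum:
 assumes "finite I" "!!i. i : I ==> sm r (xi i)" "eta : T r" "r <= R"
 shows "dF (%x. SUM i:I. xi i x) eta = (%k. SUM i:I. dF (xi i) eta k)"
 using assms(1,2)
proof (induction I rule: finite_induct)
 case empty
 show ?case by (simp add: dF_zero)
next
 case (insert i I)
 thus ?case
  using dF_add[OF insert.prems[OF insertI1] smooth_on_sum[OF open_ball insert.hyps(1), of x0 r xi] assms(3,4)] by simp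
qed

lemma Fc_add:
 assumes "eta : T R" "eta' : T R"
 shows "Fc u (%x. eta x + eta' x) = (%k. Fc u eta k + Fc u eta' k)"
 by (simp add: Fc_def fun_eq_iff distrib_right dist_add[OF dist test_mult_ek[OF assms(1)] test_mult_ek[OF assms(2)]])

lemma Fc_zero: "Fc u (%x. 0) = (%k. 0)"
 by (simp add: Fc_def fun_eq_iff dist_zero[OF dist])

lemma Fc_sum:
 "finite I ==> (!!i. i : I ==> f i : T R) ==> Fc u (%x. SUM i:I. f i x) = (%k. SUM i:I. Fc u (f i) k)"
proof (induction I rule: finite_induct)
 case (insert i I)
 thus ?case using Fc_add[of "f i" "%x. SUM i:I. f i x"] test_sum[of I f "ball x0 R"] by simp
qed (simp add: Fc_zero)

text \<open>The product rule for \<open>(xi + b) (eta u)\<close>. The last term is again a cut-off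
  of \<open>u\<close>, hence as regular as \<open>u\<close>; so the regularity of the operator on
  coefficients and of \<open>dF xi eta\<close> are equivalent.\<close>

lemma vop_Fc:
 assumes xi: "tfield x0 xi" and b: "b : T pi" and eta: "eta : T R"
 shows "vop xi b (Fc u eta) = (%k. dF xi eta k + Fc u (%x. dirv xi eta x + b x * eta x) k)"
proof
 fix k
 note sub = subset_ball[OF R(2), of x0] and t = tfieldD[OF xi] and tF = temp_Fc[OF dist eta]
 note MF = Mop_Fc[OF dist sub eta]
 have sxi: "smooth_on UNIV (%x. xi x $ j)" for j by (rule test_smooth[OF t])
 have seta: "smooth_on UNIV eta" by (rule test_smooth[OF eta])
 have m: "(%x. g x * eta x) : T R" if "smooth_on UNIV g" for g
  using test_mult_smooth[OF eta that] by (simp add: mult.commute)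
 have d: "(%x. xi x $ j * partial j eta x) : T R" for j
  using test_mult_smooth[OF test_partial[OF eta] sxi] by (simp add: mult.commute)
 have "Mop (fc (%x. xi x $ j)) (Dop j (Fc u eta)) k =
   Fc u (%x. xi x $ j * partial j eta x) k - u (partial j (%x. xi x $ j * eta x * ek (- k) x))" for j
 proof -
  have "Mop (fc (%x. xi x $ j)) (Dop j (Fc u eta)) k =
    Dop j (Mop (fc (%x. xi x $ j)) (Fc u eta)) k - Mop (fc (partial j (%x. xi x $ j))) (Fc u eta) k"
   by (simp add: Dop_Mop[OF rapid_fc[OF t] tF] fc_partial[OF t])
  also have "... = Fc u (partial j (%x. xi x $ j * eta x)) k - u (partial j (%x. xi x $ j * eta x * ek (- k) x))
    - Fc u (%x. partial j (%x. xi x $ j) x * eta x) k"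
   unfolding MF[OF t] MF[OF test_partial[OF t]] Dop_Fc[OF dist m[OF sxi]] ..
  also have "Fc u (partial j (%x. xi x $ j * eta x)) k =
    Fc u (%x. partial j (%x. xi x $ j) x * eta x) k + Fc u (%x. xi x $ j * partial j eta x) k"
   using Fc_add[OF m[OF smooth_on_partial[OF sxi]] d]
   by (simp add: partial_mult[OF sxi seta UNIV_I, abs_def] fun_eq_iff)
  finally show ?thesis by simp
 qed
 moreover have "Mop (fc b) (Fc u eta) = Fc u (%x. b x * eta x)" by (rule MF[OF b])
 moreover have "Fc u (%x. dirv xi eta x + b x * eta x) k =
   (SUM j:UNIV. Fc u (%x. xi x $ j * partial j eta x) k) + Fc u (%x. b x * eta x) k"
  unfolding dirv_def
  by (subst Fc_add[OF test_sum[OF finite d] m[OF test_smooth[OF b]]])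
   (simp add: Fc_sum[OF finite d])
 moreover have "dF xi eta k = - (SUM j:UNIV. u (partial j (%x. xi x $ j * eta x * ek (- k) x)))"
  unfolding dF_def
  by (subst dist_sum[OF dist finite]) (intro test_partial test_mult_ek m[OF sxi], simp)
 ultimately show "vop xi b (Fc u eta) k = dF xi eta k + Fc u (%x. dirv xi eta x + b x * eta x) k"
  by (simp add: vop_def sum_subtractf)
qed

definition hloc :: "real => real => bool" where
 "hloc s r \<longleftrightarrow> (ALL eta:T r. Hsob s (Fc u eta))"

lemma hlocD: "hloc s r ==> eta : T r ==> t <= s ==> Hsob t (Fc u eta)"
 unfolding hloc_def using Hsob_mono by blast

lemma vop_test:
 assumes "tfield x0 xi" "b : T pi" "eta : T r"
 shows "(%x. dirv xi eta x + b x * eta x) : T r"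
proof -
 have "(%x. xi x $ j * partial j eta x) : T r" for j
  using test_mult_smooth[OF test_partial[OF assms(3)] test_smooth[OF tfieldD[OF assms(1)]]]
  by (simp add: mult.commute)
 moreover have "(%x. b x * eta x) : T r"
  using test_mult_smooth[OF assms(3) test_smooth[OF assms(2)]] by (simp add: mult.commute)
 ultimately show ?thesis unfolding dirv_def by (intro test_add test_sum finite)
qed

lemma Hsob_vop:
 assumes "hloc s r" "r <= R" "eta : T r" "tfield x0 xi" "b : T pi" "t <= s"
 shows "Hsob t (vop xi b (Fc u eta)) \<longleftrightarrow> Hsob t (dF xi eta)"
 unfolding vop_Fc[OF assms(4,5) T_mono[OF assms(3,2)]]
 by (rule Hsob_add_iff[OF hlocD[OF assms(1) vop_test[OF assms(4,5,3)] assms(6)]])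

lemma Hsob_nvop:
 assumes "hloc s r" "r <= R" "eta : T r" "sm r xi" "psi : T r" "t <= s"
 shows "Hsob t (nvop (cut psi xi) (Fc u eta)) \<longleftrightarrow> Hsob t (dF xi (%x. psi x * eta x))"
 unfolding nvop_def
 using Hsob_vop[OF assms(1-3) tfield_cut[OF assms(5,4) order_trans[OF assms(2) R(2)]] test_zero assms(6)]
 by (simp add: dF_scale cut_def[abs_def])

lemma Hsob_avop:
 assumes "hloc s r" "r <= R" "eta : T r" "sm r xi" "psi : T r" "t <= s"
 shows "Hsob t (avop (cut psi xi) (Fc u eta)) \<longleftrightarrow> Hsob t (dF (conjf xi) (%x. cnj (psi x) * eta x))"
proof -
 have t: "tfield x0 (cut psi xi)" by (rule tfield_cut[OF assms(5,4) order_trans[OF assms(2) R(2)]])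
 have s: "smooth_on (ball x0 r) (conjf (cut psi xi))" by (rule smooth_on_subset[OF tfield_smooth[OF tfield_conjf[OF t]]]) simp
 have c: "conjf (cut psi xi) = (%x. cnj (psi x) *s conjf xi x)" by (simp add: fun_eq_iff vec_eq_iff cut_def)
 show ?thesis
  unfolding avop_def Hsob_vop[OF assms(1-3) tfield_uminus[OF tfield_conjf[OF t]] avop_coefficient[OF t] assms(6)]
   dF_minus[OF s assms(3,2)] Hsob_minus
  by (simp add: c dF_scale)
qed

text \<open>\<open>eps\<close> depends neither on \<open>s\<close>, so that the bootstrap can be
  iterated, nor on \<open>r\<close>. Brackets gain on the same balls as the fields, since the room
  for cut-offs is found between the support of \<open>eta\<close> and the sphere of radius
  \<open>r\<close>.\<close>

definition gain :: "real => real => (real^'m => complex^'m) => bool" where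
 "gain eps r0 Y \<longleftrightarrow> 0 < r0 & r0 <= R & sm r0 Y &
  (ALL r s. 0 < r --> r <= r0 --> hloc s r --> (ALL eta:T r. Hsob (s + eps - 1) (dF Y eta)))"

text \<open>A gain is required of the field and of its conjugate: bracket estimates use an operator
  together with its adjoint, which is minus the conjugate up to order zero.\<close>

definition good :: "(real^'m => complex^'m) => bool" where
 "good Y \<longleftrightarrow> (EX eps r0. 0 < eps & eps <= 1 & gain eps r0 Y & gain eps r0 (conjf Y))"

lemma gainD:
 assumes "gain eps r0 Y"
 shows "0 < r0" "r0 <= R" "sm r0 Y"
  and "!!r s eta. 0 < r ==> r <= r0 ==> hloc s r ==> eta : T r ==> Hsob (s + eps - 1) (dF Y eta)"
 using assms unfolding gain_def by blast+

lemma gainI: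
 assumes "0 < r0" "r0 <= R" "sm r0 Y"
  and "!!r s eta. 0 < r ==> r <= r0 ==> hloc s r ==> eta : T r ==> Hsob (s + eps - 1) (dF Y eta)"
 shows "gain eps r0 Y"
 using assms unfolding gain_def by blast

lemma gain_mono:
 assumes "gain eps r0 Y" "eps' <= eps" "0 < r'" "r' <= r0"
 shows "gain eps' r' Y"
proof (rule gainI)
 show "sm r' Y" using gainD(3)[OF assms(1)] assms(4) smooth_on_subset subset_ball by blast
 fix r s eta assume "0 < r" "r <= r'" "hloc s r" "eta : T r"
 hence "Hsob (s + eps - 1) (dF Y eta)" using gainD(4)[OF assms(1), of r s eta] assms(4) by simp
 thus "Hsob (s + eps' - 1) (dF Y eta)" by (rule Hsob_mono) (use assms(2) in simp)
qed (use assms gainD(2)[OF assms(1)] in auto)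

lemma gain_cong:
 assumes "gain eps r0 Y" "!!x. x : ball x0 r0 ==> Y x = Y' x"
 shows "gain eps r0 Y'"
proof (rule gainI)
 show "sm r0 Y'" by (rule smooth_on_cong[OF open_ball assms(2) gainD(3)[OF assms(1)]])
 fix r s eta assume r: "0 < r" "r <= r0" "hloc s r" and eta: "eta : T r"
 have "dF Y eta = dF Y' eta"
 proof (rule dF_cong)
  fix x assume "eta x ~= 0"
  hence "x : ball x0 r" using eta by (meson subset_iff test_functionsE test_suppD(2))
  thus "Y x = Y' x" using assms(2) r(2) by simp
 qed
 thus "Hsob (s + eps - 1) (dF Y' eta)" using gainD(4)[OF assms(1) r eta] by simp
qed (use gainD[OF assms(1)] in auto)

lemma gain_add:
 assumes "gain eps r0 Y" "gain eps r0 Y'"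
 shows "gain eps r0 (%x. Y x + Y' x)"
proof (rule gainI)
 fix r s eta assume r: "0 < r" "r <= r0" "hloc s r" and eta: "eta : T r"
 have "dF (%x. Y x + Y' x) eta = (%k. dF Y eta k + dF Y' eta k)"
  by (rule dF_add[OF gainD(3)[OF assms(1)] gainD(3)[OF assms(2)] T_mono[OF eta r(2)] gainD(2)[OF assms(1)]])
 thus "Hsob (s + eps - 1) (dF (%x. Y x + Y' x) eta)"
  using gainD(4)[OF assms(1) r eta] gainD(4)[OF assms(2) r eta] by (simp add: Hsob_add)
qed (use gainD[OF assms(1)] gainD(3)[OF assms(2)] in "auto intro: smooth_on_add")

lemma gain_scale:
 assumes "gain eps r0 Y" "smooth_on (ball x0 r0) f"
 shows "gain eps r0 (%x. f x *s Y x)"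
proof (rule gainI)
 fix r s eta assume r: "0 < r" "r <= r0" "hloc s r" and eta: "eta : T r"
 have "(%x. f x * eta x) : T r"
  by (rule test_mult_local[OF open_ball eta smooth_on_subset[OF assms(2) subset_ball[OF r(2)]]])
 thus "Hsob (s + eps - 1) (dF (%x. f x *s Y x) eta)"
  unfolding dF_scale by (rule gainD(4)[OF assms(1) r])
qed (use gainD[OF assms(1)] assms(2) in "auto intro: smooth_on_vec_scale")

lemma goodE:
 assumes "good Y"
 obtains eps r0 where "0 < eps" "eps <= 1" "gain eps r0 Y" "gain eps r0 (conjf Y)"
 using assms unfolding good_def by blast

lemma good_conjf: "good Y ==> good (conjf Y)"
 unfolding good_def by auto

lemma good_cong:
 assumes "good Y" "open S" "x0 : S" "!!x. x : S ==> Y x = Y' x"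
 shows "good Y'"
proof -
 obtain eps r0 where e: "0 < eps" "eps <= 1" "gain eps r0 Y" "gain eps r0 (conjf Y)" using assms(1) by (rule goodE)
 obtain d where d: "0 < d" "ball x0 d <= S" using assms(2,3) openE by blast
 define r where "r = min r0 d"
 have r: "0 < r" "r <= r0" "ball x0 r <= S" using d gainD(1)[OF e(3)] by (auto simp: r_def)
 have "gain eps r Y'" by (rule gain_cong[OF gain_mono[OF e(3) order_refl r(1,2)]]) (use assms(4) r in auto)
 moreover have "gain eps r (conjf Y')"
  by (rule gain_cong[OF gain_mono[OF e(4) order_refl r(1,2)]]) (use assms(4) r in "auto simp: conjf_def")
 ultimately show ?thesis using e unfolding good_def by blast
qed

lemma good_add:
 assumes "good Y" "good Y'"
 shows "good (%x. Y x + Y' x)"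
proof -
 obtain eps r where e: "0 < eps" "eps <= 1" "gain eps r Y" "gain eps r (conjf Y)" using assms(1) by (rule goodE)
 obtain eps' r' where e': "0 < eps'" "eps' <= 1" "gain eps' r' Y'" "gain eps' r' (conjf Y')" using assms(2) by (rule goodE)
 let ?e = "min eps eps'" and ?r = "min r r'"
 have r: "0 < ?r" using gainD(1)[OF e(3)] gainD(1)[OF e'(3)] by simp
 have "conjf (%x. Y x + Y' x) = (%x. conjf Y x + conjf Y' x)" by (simp add: fun_eq_iff vec_eq_iff)
 moreover have "gain ?e ?r (%x. Y x + Y' x)" "gain ?e ?r (%x. conjf Y x + conjf Y' x)"
  by (intro gain_add gain_mono[OF e(3)] gain_mono[OF e(4)] gain_mono[OF e'(3)] gain_mono[OF e'(4)] r; simp)+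
 ultimately show ?thesis using e e' unfolding good_def by (intro exI[of _ ?e] exI[of _ ?r]) auto
qed

lemma good_scale:
 assumes "good Y" "open S" "x0 : S" "smooth_on S f"
 shows "good (%x. f x *s Y x)"
proof -
 obtain eps r0 where e: "0 < eps" "eps <= 1" "gain eps r0 Y" "gain eps r0 (conjf Y)" using assms(1) by (rule goodE)
 obtain d where d: "0 < d" "ball x0 d <= S" using assms(2,3) openE by blast
 define r where "r = min r0 d"
 have r: "0 < r" "r <= r0" "ball x0 r <= S" using d gainD(1)[OF e(3)] by (auto simp: r_def)
 have f: "smooth_on (ball x0 r) f" by (rule smooth_on_subset[OF assms(4) r(3)])
 have "conjf (%x. f x *s Y x) = (%x. cnj (f x) *s conjf Y x)" by (simp add: fun_eq_iff vec_eq_iff)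
 moreover have "gain eps r (%x. f x *s Y x)" "gain eps r (%x. cnj (f x) *s conjf Y x)"
  by (intro gain_scale gain_mono[OF e(3)] gain_mono[OF e(4)] order_refl r f smooth_on_cnj open_ball)+
 ultimately show ?thesis using e unfolding good_def by auto
qed

lemma good_zero: "good (%x. 0)"
proof -
 have "gain 1 R (%x. 0)" by (rule gainI) (use R in "auto simp: dF_zero")
 moreover have "conjf (%x. 0) = (%x::real^'m. 0)" by (simp add: fun_eq_iff vec_eq_iff)
 ultimately show ?thesis unfolding good_def by (rule_tac exI[of _ 1], rule_tac exI[of _ R]) simp
qed

lemma good_sum: "finite I ==> (!!i. i : I ==> good (f i)) ==> good (%x. SUM i:I. f i x)"
 by (induction I rule: finite_induct) (auto intro: good_add good_zero)

lemma good_uminus: "good Y ==> good (%x. - Y x)"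
 using good_scale[of Y UNIV "%x. - 1"] by (simp add: vector_smult_lneg)

lemma good_diff: "good Y ==> good Y' ==> good (%x. Y x - Y' x)"
 using good_add[OF _ good_uminus] by fastforce

lemma good_smooth: "good Y ==> EX r>0. sm r Y"
 by (meson goodE gainD)

lemma cutoff_near:
 assumes "eta : T r" "0 < r"
 obtains psi rho where "psi : T r" "0 < rho" "rho < r" "!!x. x : ball x0 rho ==> psi x = 1" "!!x. eta x ~= 0 ==> x : ball x0 rho"
proof -
 obtain K where K: "compact K" "K <= ball x0 r" "eta : test_functions_supp K" using assms(1) by (rule test_functionsE)
 obtain psi rho where "psi : T r" "K <= ball x0 rho" "rho < r" "0 < rho" "!!x. x : ball x0 rho ==> psi x = 1"
  using cutoff_exists[OF K(1,2) assms(2)] by metis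
 moreover have "eta x ~= 0 ==> x : K" for x using test_suppD(2)[OF K(3)] by blast
 ultimately show ?thesis using that[of psi rho] by blast
qed

end

context local_dist
begin

lemma cut_eq: "psi x = 1 ==> cut psi xi x = xi x"
 by (simp add: cut_def)

lemma cbr_cut:
 assumes "sm r xi" "sm r eta" "rho < r" "!!x. x : ball x0 rho ==> psi x = 1" "x : ball x0 rho"
 shows "cbr (cut psi xi) (cut psi eta) x = cbr xi eta x"
proof -
 have sub: "ball x0 rho <= ball x0 r" using assms(3) by (intro subset_ball) simp
 show ?thesis
  by (rule cbr_cong[OF open_ball assms(5) _ _ smooth_on_subset[OF assms(1) sub] smooth_on_subset[OF assms(2) sub]])
   (simp_all add: cut_eq assms(4))
qed

lemma dirv_zero [simp]: "dirv xi (%x. 0) x = 0"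
 by (simp add: dirv_def)

lemma Hsob_cm:
 assumes "hloc s r" "0 < r" "r <= R" "eta : T r" "tfield x0 xi" "tfield x0 \<zeta>" "t <= s"
 shows "Hsob t (cm (nvop xi) (nvop \<zeta>) (Fc u eta)) \<longleftrightarrow> Hsob t (dF (cbr xi \<zeta>) eta)"
proof -
 have "cm (nvop xi) (nvop \<zeta>) (Fc u eta) = vop (cbr xi \<zeta>) (%x. dirv xi (%x. 0) x - dirv \<zeta> (%x. 0) x) (Fc u eta)"
  unfolding nvop_def
  by (rule cm_vop[OF assms(5,6) test_zero test_zero temp_Fc[OF dist T_mono[OF assms(4,3)]]])
 thus ?thesis
  using Hsob_vop[OF assms(1,3,4) tfield_cbr[OF assms(5,6)] test_zero assms(7)] by simp
qed

lemma gain_kills: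
 assumes "0 < r0" "r0 <= R" "sm r0 Z" "!!eta. eta : T r0 ==> dF Z eta = (%k. 0)"
 shows "gain eps r0 Z"
 by (rule gainI[OF assms(1-3)]) (simp add: assms(4)[OF T_mono])

text \<open>As \<open>Z u = 0\<close>, the hypothesis \<open>dZ\<close> of
  \<open>estimate_half\<close> holds on every cut-off of \<open>u\<close>. Cutting off
  \<open>Z\<close> is harmless because \<open>psi = 1\<close> on the support of
  \<open>eta\<close>.\<close>

lemma gain_half:
 assumes r0: "0 < r0" "r0 <= R" "sm r0 Z" "!!eta. eta : T r0 ==> dF Z eta = (%k. 0)"
 shows "gain (1/2) r0 (conjf Z)"
proof (rule gainI[OF r0(1,2) smooth_on_conjf[OF open_ball r0(3)]])
 fix r s eta assume r: "0 < r" "r <= r0" and h: "hloc s r" and eta: "eta : T r"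
 obtain psi rho where psi: "psi : T r" "!!x. x : ball x0 rho ==> psi x = 1" "!!x. eta x ~= 0 ==> x : ball x0 rho"
  using cutoff_near[OF eta r(1)] by metis
 have rR: "r <= R" using r r0 by simp
 have sZ: "sm r Z" by (rule smooth_on_subset[OF r0(3) subset_ball[OF r(2)]])
 have tf: "tfield x0 (cut psi Z)" by (rule tfield_cut[OF psi(1) sZ order_trans[OF rR R(2)]])
 have psieta: "(%x. psi x * eta x) = eta" "(%x. cnj (psi x) * eta x) = eta" using psi(2,3) by fastforce+
 define P where "P = {(s, %v::'m seq. v), (s - 1/2, nvop (cut psi Z))}"
 have "Hsob (s - 1/2) (avop (cut psi Z) (Fc u eta))"
 proof (rule regularity_pairs[where P = P and ?A0.0 = "avop (cut psi Z)"])
  show "finite P" by (simp add: P_def)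
  show "order_op 2 A" if "(t, A) : P" for t A
   using that by (auto simp: P_def intro: order_op_2_id order_op_2_FO FO_nvop[OF tf])
  show "order_op 2 (avop (cut psi Z))" by (rule order_op_2_FO[OF FO_avop[OF tf]])
  show "Qdom (s - 1/2) beta (%t. avop (cut psi Z)) G"
   if "!!t A. (t, A) : P ==> Qdom t beta (%t. A) G" for beta G
   by (rule estimate_half[OF FO_nvop[OF tf] FO_avop[OF tf] adjoint_nvop[OF tf]]) (rule that, simp add: P_def)+
  show "temp (Fc u eta)" by (rule temp_Fc[OF dist T_mono[OF eta rR]])
  have le: "s - 1/2 <= s" by simp
  have "Hsob (s - 1/2) (nvop (cut psi Z) (Fc u eta))"
   unfolding Hsob_nvop[OF h rR eta sZ psi(1) le] psieta
   by (simp add: r0(4)[OF T_mono[OF eta r(2)]])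
  thus "Hsob t (A (Fc u eta))" if "(t, A) : P" for t A
   using that hlocD[OF h eta order_refl] by (auto simp: P_def)
 qed
 thus "Hsob (s + 1/2 - 1) (dF (conjf Z) eta)"
  using Hsob_avop[OF h rR eta sZ psi(1), of "s - 1/2"] psieta by simp
qed

lemma good_kills:
 assumes "0 < r0" "r0 <= R" "sm r0 Z" "!!eta. eta : T r0 ==> dF Z eta = (%k. 0)"
 shows "good Z"
 unfolding good_def using gain_kills[OF assms] gain_half[OF assms] by (intro exI[of _ "1/2"] exI[of _ r0]) auto

text \<open>For cut-off fields the bracket is a commutator of operators on sequences, up to order
  zero, and \<open>estimate_commutator\<close> applies. The cut-offs equal 1 near the support of
  \<open>eta\<close>, so \<open>dF\<close> sees the true bracket.\<close>

lemma gain_commutator: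
 assumes X: "gain 1 r0 X" "gain 1 r0 (conjf X)" and Y: "gain eps r0 Y" "gain eps r0 (conjf Y)" and eps: "0 < eps" "eps <= 1"
 shows "gain (eps/2) r0 (cbr X Y)"
proof (rule gainI[OF gainD(1,2)[OF X(1)] smooth_on_cbr[OF open_ball gainD(3)[OF X(1)] gainD(3)[OF Y(1)]]])
 fix r s eta assume r: "0 < r" "r <= r0" and h: "hloc s r" and eta: "eta : T r"
 obtain psi rho where psi: "psi : T r" "rho < r" "!!x. x : ball x0 rho ==> psi x = 1" "!!x. eta x ~= 0 ==> x : ball x0 rho"
  using cutoff_near[OF eta r(1)] by metis
 have rR: "r <= R" using r gainD(2)[OF X(1)] by simp
 have sX: "sm r X" and sY: "sm r Y"
  by (rule smooth_on_subset[OF gainD(3)[OF X(1)] subset_ball[OF r(2)]] smooth_on_subset[OF gainD(3)[OF Y(1)] subset_ball[OF r(2)]])+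
 let ?X = "cut psi X" and ?Y = "cut psi Y"
 have tX: "tfield x0 ?X" and tY: "tfield x0 ?Y"
  using tfield_cut[OF psi(1) _ order_trans[OF rR R(2)]] sX sY by auto
 have psieta: "(%x. psi x * eta x) = eta" "(%x. cnj (psi x) * eta x) = eta" using psi(3,4) by fastforce+
 define P where "P = {(s, %v::'m seq. v), (s, nvop ?X), (s, avop ?X), (s + eps - 1, nvop ?Y), (s + eps - 1, avop ?Y)}"
 have "Hsob (s + eps/2 - 1) (cm (nvop ?X) (nvop ?Y) (Fc u eta))"
 proof (rule regularity_pairs[where P = P and ?A0.0 = "cm (nvop ?X) (nvop ?Y)"])
  show "finite P" by (simp add: P_def)
  show "order_op 2 A" if "(t, A) : P" for t A
   using that by (auto simp: P_def intro: order_op_2_id order_op_2_FO FO_nvop[OF tX] FO_nvop[OF tY] FO_avop[OF tX] FO_avop[OF tY])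
  show "order_op 2 (cm (nvop ?X) (nvop ?Y))" by (rule order_op_2_FO[OF FO_cm[OF FO_nvop[OF tX] FO_nvop[OF tY]]])
  show "Qdom (s + eps/2 - 1) beta (%t. cm (nvop ?X) (nvop ?Y)) G"
   if "!!t A. (t, A) : P ==> Qdom t beta (%t. A) G" for beta G
   by (rule estimate_commutator[OF FO_nvop[OF tX] FO_avop[OF tX] adjoint_nvop[OF tX] FO_nvop[OF tY] FO_avop[OF tY] adjoint_nvop[OF tY] _ eps(2)])
    (simp, (rule that, simp add: P_def)+)
  show "temp (Fc u eta)" by (rule temp_Fc[OF dist T_mono[OF eta rR]])
  have le: "s + eps - 1 <= s" using eps by simp
  show "Hsob t (A (Fc u eta))" if "(t, A) : P" for t A
   using that hlocD[OF h eta order_refl] gainD(4)[OF X(1) r h eta] gainD(4)[OF X(2) r h eta]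
    gainD(4)[OF Y(1) r h eta] gainD(4)[OF Y(2) r h eta]
   by (auto simp: P_def psieta Hsob_nvop[OF h rR eta sX psi(1) order_refl] Hsob_avop[OF h rR eta sX psi(1) order_refl]
     Hsob_nvop[OF h rR eta sY psi(1) le] Hsob_avop[OF h rR eta sY psi(1) le])
 qed
 hence "Hsob (s + eps/2 - 1) (dF (cbr ?X ?Y) eta)"
  by (subst (asm) Hsob_cm[OF h r(1) rR eta tX tY]) (use eps in auto)
 also have "dF (cbr ?X ?Y) eta = dF (cbr X Y) eta"
  by (rule dF_cong) (rule cbr_cut[OF sX sY psi(2,3) psi(4)])
 finally show "Hsob (s + eps/2 - 1) (dF (cbr X Y) eta)" .
qed

lemma gain_conjf_cbr:
 assumes "gain eps r0 (cbr (conjf X) (conjf Y))" "sm r0 X" "sm r0 Y"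
 shows "gain eps r0 (conjf (cbr X Y))"
 by (rule gain_cong[OF assms(1)]) (rule conjf_cbr[OF open_ball assms(2,3), symmetric])

lemma good_commutator:
 assumes X: "gain 1 r0 X" "gain 1 r0 (conjf X)" and Y: "good Y"
 shows "good (cbr X Y)"
proof -
 obtain eps r' where e: "0 < eps" "eps <= 1" "gain eps r' Y" "gain eps r' (conjf Y)" using Y by (rule goodE)
 define r where "r = min r0 r'"
 have r: "0 < r" "r <= r0" "r <= r'" using gainD(1)[OF X(1)] gainD(1)[OF e(3)] by (auto simp: r_def)
 note X' = gain_mono[OF X(1) order_refl r(1,2)] gain_mono[OF X(2) order_refl r(1,2)]
  and Y' = gain_mono[OF e(3) order_refl r(1,3)] gain_mono[OF e(4) order_refl r(1,3)]
 have "gain (eps/2) r (cbr X Y)" by (rule gain_commutator[OF X' Y' e(1,2)])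
 moreover have "gain (eps/2) r (cbr (conjf X) (conjf Y))"
  by (rule gain_commutator[OF X'(2) _ Y'(2) _ e(1,2)]) (simp_all add: X' Y')
 hence "gain (eps/2) r (conjf (cbr X Y))" by (rule gain_conjf_cbr[OF _ gainD(3)[OF X'(1)] gainD(3)[OF Y'(1)]])
 ultimately show ?thesis unfolding good_def using e by (intro exI[of _ "eps/2"] exI[of _ r]) auto
qed

end

text \<open>The data of \<open>V2_of\<close> in a chart: the \<open>Z j\<close> and \<open>L\<close>
  annihilate \<open>u\<close>, and \<open>rel\<close> is the relation defining \<open>L\<close>. The
  indices will be positions in the list \<open>Zs\<close>.\<close>

locale CR_family = local_dist u x0 R
 for u :: "(real^'m::finite => complex) => complex" and x0 R +
 fixes J :: "nat set" and Z :: "nat => real^'m => complex^'m" and L :: "real^'m => complex^'m" and r0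
 assumes J: "finite J" and r0: "0 < r0" "r0 <= R"
  and Z: "!!j. j : J ==> sm r0 (Z j)" "!!j eta. j : J ==> eta : T r0 ==> dF (Z j) eta = (%k. 0)"
  and L: "sm r0 L" "!!eta. eta : T r0 ==> dF L eta = (%k. 0)"
  and rel: "!!x. x : ball x0 r0 ==> (SUM j:J. cbr (Z j) (conjf (Z j)) x) = conjf L x - L x"
begin

text \<open>The error term of the energy identity. Its first-order part cancels where
  \<open>psi = 1\<close>, but not where \<open>psi\<close> varies; hence it enters the estimates as
  a first-order operator, and only its value on cut-offs of \<open>u\<close> is known to be
  regular.\<close>

definition EE :: "(real^'m => complex) => 'm seq => 'm seq" where
 "EE psi v k = (SUM j:J. cm (nvop (cut psi (Z j))) (avop (cut psi (Z j))) v k) - nvop (cut psi L) v k - avop (cut psi L) v k"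

lemma cbr_uminus_right: "open S ==> smooth_on S eta ==> x : S ==> cbr xi (%x. - eta x) x = - cbr xi eta x"
 by (simp add: cbr_def partial_minus vector_smult_rneg vector_smult_lneg sum_negf[symmetric])

context
 fixes s r eta psi rho
 assumes h: "hloc s r" and r: "0 < r" "r <= r0" and eta: "eta : T r"
  and psi': "psi : T r" "rho < r" "ALL x:ball x0 rho. psi x = 1" "ALL x. eta x ~= 0 --> x : ball x0 rho"
begin

lemmas psi = psi'(1,2) psi'(3)[rule_format] psi'(4)[rule_format]

lemma rR: "r <= R" using r r0 by simp

lemma smr: "sm r0 xi ==> sm r xi"
 using smooth_on_subset subset_ball[OF r(2)] by blast

lemma tfield_cut_r0: "sm r0 xi ==> tfield x0 (cut psi xi)"
 by (rule tfield_cut[OF psi(1) smr order_trans[OF rR R(2)]])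

lemma psi_eta: "(%x. psi x * eta x) = eta" "(%x. cnj (psi x) * eta x) = eta"
 using psi(3,4) by fastforce+

lemmas tZ = tfield_cut_r0[OF Z(1)] and tL = tfield_cut_r0[OF L(1)]

lemma FO_EE: "FO (EE psi)"
 unfolding EE_def[abs_def]
 by (intro FO_diff FO_sum J FO_cm FO_nvop[OF tZ] FO_avop[OF tZ] FO_nvop[OF tL] FO_avop[OF tL])

lemma Hsob_Z: "j : J ==> Hsob s (nvop (cut psi (Z j)) (Fc u eta))"
 using Z(2)[OF _ T_mono[OF eta r(2)]] by (simp add: Hsob_nvop[OF h rR eta smr[OF Z(1)] psi(1) order_refl] psi_eta)

lemma Hsob_L: "Hsob s (nvop (cut psi L) (Fc u eta))"
 using L(2)[OF T_mono[OF eta r(2)]] by (simp add: Hsob_nvop[OF h rR eta smr[OF L(1)] psi(1) order_refl] psi_eta)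

text \<open>Since adjoints are minus conjugates up to order zero, the first-order part is minus the
  sum of the \<open>[Z j, conjf (Z j)]\<close>, minus \<open>L\<close>, plus \<open>conjf L\<close>.
  By \<open>rel\<close> it vanishes on the support of \<open>eta\<close>, and cut-offs of
  \<open>u\<close> remain.\<close>

lemma Hsob_EE: "Hsob s (EE psi (Fc u eta))"
proof -
 define z where "z j = cut psi (Z j)" for j
 define l where "l = cut psi L"
 define b where "b xi = (%x. cnj 0 - diverg (conjf xi) x)" for xi :: "real^'m => complex^'m"
 have tz: "tfield x0 (z j)" if "j : J" for j unfolding z_def by (rule tZ[OF that])
 have tl: "tfield x0 l" unfolding l_def by (rule tL)
 have nz: "tfield x0 (%x. - conjf (z j) x)" if "j : J" for j by (intro tfield_uminus tfield_conjf tz that)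
 have nl: "tfield x0 (%x. - conjf l x)" by (intro tfield_uminus tfield_conjf tl)
 define br where "br j = cbr (z j) (%x. - conjf (z j) x)" for j
 define g where "g j = (%x. dirv (br j) eta x + (dirv (z j) (b (z j)) x - dirv (%x. - conjf (z j) x) (%x. 0) x) * eta x)" for j
 define g1 where "g1 = (%x. dirv l eta x + 0 * eta x)"
 define g2 where "g2 = (%x. dirv (%x. - conjf l x) eta x + b l x * eta x)"
 have tbr: "tfield x0 (br j)" if "j : J" for j unfolding br_def by (rule tfield_cbr[OF tz[OF that] nz[OF that]])
 have bt: "b xi : T pi" if "tfield x0 xi" for xi unfolding b_def by (rule avop_coefficient[OF that])
 have cf: "(%x. dirv (z j) (b (z j)) x - dirv (%x. - conjf (z j) x) (%x. 0) x) : T pi" if "j : J" for j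
  by (intro test_diff dirv_test tfieldD[OF tz] tfieldD[OF nz] test_smooth[OF bt[OF tz]] smooth_on_const that)
 note etaR = T_mono[OF eta rR]
 have e1: "cm (nvop (z j)) (avop (z j)) (Fc u eta) k = dF (br j) eta k + Fc u (g j) k" if "j : J" for j k
  unfolding nvop_def avop_def b_def[symmetric] br_def g_def
  by (simp only: cm_vop[OF tz[OF that] nz[OF that] test_zero bt[OF tz[OF that]] temp_Fc[OF dist etaR]]
    vop_Fc[OF tbr[OF that, unfolded br_def] cf[OF that] etaR])
 have e2: "nvop l (Fc u eta) k = dF l eta k + Fc u g1 k" for k
  unfolding nvop_def g1_def by (simp only: vop_Fc[OF tl test_zero etaR])
 have e3: "avop l (Fc u eta) k = dF (%x. - conjf l x) eta k + Fc u g2 k" for k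
  unfolding avop_def b_def[symmetric] g2_def by (simp only: vop_Fc[OF nl bt[OF tl] etaR])
 have smf: "sm r xi" if "tfield x0 xi" for xi by (rule smooth_on_subset[OF tfield_smooth[OF that]]) simp
 have s2: "sm r (%x. SUM j:J. br j x)" by (intro smooth_on_sum open_ball J smf tbr)
 have "(%k. (SUM j:J. dF (br j) eta k) - dF l eta k - dF (%x. - conjf l x) eta k) =
   dF (%x. (SUM j:J. br j x) - l x - - conjf l x) eta"
  by (simp only: dF_sum[OF J smf[OF tbr] eta rR] dF_diff[OF smooth_on_diff[OF open_ball s2 smf[OF tl]] smf[OF nl] eta rR]
    dF_diff[OF s2 smf[OF tl] eta rR])
 also have "... = (%k. 0)"
 proof (rule dF_zero)
  fix x assume "eta x ~= 0"
  hence x: "x : ball x0 rho" by (rule psi(4))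
  have xr: "x : ball x0 r0" using x psi(2) r(2) by auto
  have sub: "ball x0 rho <= ball x0 r0" using psi(2) r(2) by (intro subset_ball) simp
  have "br j x = - cbr (Z j) (conjf (Z j)) x" if "j : J" for j
  proof -
   have sZ: "smooth_on (ball x0 rho) (Z j)" by (rule smooth_on_subset[OF Z(1)[OF that] sub])
   have "br j x = cbr (Z j) (%x. - conjf (Z j) x) x"
    unfolding br_def
    by (rule cbr_cong[OF open_ball x _ _ sZ smooth_on_minus[OF open_ball smooth_on_conjf[OF open_ball sZ]]])
     (simp_all add: z_def cut_eq psi(3) conjf_def)
   thus ?thesis by (simp add: cbr_uminus_right[OF open_ball smooth_on_conjf[OF open_ball sZ] x])
  qed
  hence "(SUM j:J. br j x) = L x - conjf L x" using rel[OF xr] by (simp add: sum_negf)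
  thus "(SUM j:J. br j x) - l x - - conjf l x = 0" by (simp add: l_def cut_eq psi(3)[OF x] conjf_def)
 qed
 finally have "dF l eta k + dF (%x. - conjf l x) eta k = (SUM j:J. dF (br j) eta k)" for k
  by (simp add: fun_eq_iff diff_eq_eq add.commute)
 hence "EE psi (Fc u eta) = (%k. (SUM j:J. Fc u (g j) k) - Fc u g1 k - Fc u g2 k)"
  by (simp add: fun_eq_iff EE_def e1 e2 e3 sum.distrib algebra_simps flip: z_def l_def)
 moreover have "g j : T r" if "j : J" for j unfolding g_def by (rule vop_test[OF tbr[OF that] cf[OF that] eta])
 moreover have "g1 : T r" unfolding g1_def by (rule vop_test[OF tl test_zero eta])
 moreover have "g2 : T r" unfolding g2_def by (rule vop_test[OF nl bt[OF tl] eta])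
 ultimately show ?thesis using hlocD[OF h _ order_refl] by (simp add: Hsob_diff Hsob_sum[OF J])
qed

lemma Hsob_full:
 assumes i: "i : J"
 shows "Hsob s (avop (cut psi (Z i)) (Fc u eta))"
proof -
 define P where "P = {(s, %v::'m seq. v), (s, nvop (cut psi L)), (s, EE psi)} Un (%j. (s, nvop (cut psi (Z j)))) ` J"
 show ?thesis
 proof (rule regularity_pairs[where P = P and ?A0.0 = "avop (cut psi (Z i))"])
  show "finite P" by (simp add: P_def J)
  show "order_op 2 A" if "(t, A) : P" for t A
   using that by (auto simp: P_def intro: order_op_2_id order_op_2_FO FO_nvop[OF tZ] FO_nvop[OF tL] FO_EE)
  show "order_op 2 (avop (cut psi (Z i)))" by (rule order_op_2_FO[OF FO_avop[OF tZ[OF i]]])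
  show "Qdom s beta (%t. avop (cut psi (Z i))) G"
   if "!!t A. (t, A) : P ==> Qdom t beta (%t. A) G" for beta G
   by (rule estimate_full[OF J FO_nvop[OF tZ] FO_avop[OF tZ] adjoint_nvop[OF tZ] FO_nvop[OF tL] FO_avop[OF tL]
      adjoint_nvop[OF tL] EE_def FO_EE _ _ _ _ i])
    ((assumption | rule that, simp add: P_def)+)
  show "temp (Fc u eta)" by (rule temp_Fc[OF dist T_mono[OF eta rR]])
  show "Hsob t (A (Fc u eta))" if "(t, A) : P" for t A
   using that hlocD[OF h eta order_refl] Hsob_Z Hsob_L Hsob_EE by (auto simp: P_def)
 qed
qed

end

lemma gain_Z:
 assumes "j : J"
 shows "gain 1 r0 (Z j)" "gain 1 r0 (conjf (Z j))"
proof -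
 show "gain 1 r0 (Z j)" by (rule gain_kills[OF r0 Z(1)[OF assms] Z(2)[OF assms]])
 show "gain 1 r0 (conjf (Z j))"
 proof (rule gainI[OF r0 smooth_on_conjf[OF open_ball Z(1)[OF assms]]])
  fix r s eta assume r: "0 < r" "r <= r0" and h: "hloc s r" and eta: "eta : T r"
  obtain psi rho where psi: "psi : T r" "rho < r" "!!x. x : ball x0 rho ==> psi x = 1" "!!x. eta x ~= 0 ==> x : ball x0 rho"
   using cutoff_near[OF eta r(1)] by metis
  have c': "ALL x:ball x0 rho. psi x = 1" "ALL x. eta x ~= 0 --> x : ball x0 rho" using psi(3,4) by blast+
  note c = h r eta psi(1,2) c'
  show "Hsob (s + 1 - 1) (dF (conjf (Z j)) eta)"
   using Hsob_full[OF c assms] Hsob_avop[OF h rR[OF c] eta smr[OF c Z(1)[OF assms]] psi(1) order_refl] psi_eta[OF c] by simp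
 qed
qed

lemma gain_L:
 assumes Y: "gain eps r1 Y" "gain eps r1 (conjf Y)" and eps: "0 < eps" "eps <= 1" and r1: "r1 <= r0"
 shows "gain (eps/4) r1 (cbr L Y)"
proof -
 have L': "sm r1 L" by (rule smooth_on_subset[OF L(1) subset_ball[OF r1]])
 show ?thesis
 proof (rule gainI[OF gainD(1,2)[OF Y(1)] smooth_on_cbr[OF open_ball L' gainD(3)[OF Y(1)]]])
  fix r s eta assume r: "0 < r" "r <= r1" and h: "hloc s r" and eta: "eta : T r"
  obtain psi rho where psi: "psi : T r" "rho < r" "!!x. x : ball x0 rho ==> psi x = 1" "!!x. eta x ~= 0 ==> x : ball x0 rho"
   using cutoff_near[OF eta r(1)] by metis
  have c': "ALL x:ball x0 rho. psi x = 1" "ALL x. eta x ~= 0 --> x : ball x0 rho" using psi(3,4) by blast+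
  note c = h r(1) order_trans[OF r(2) r1] eta psi(1,2) c'
  note rR = rR[OF c] and tZ = tZ[OF c] and tL = tL[OF c]
  have sY: "sm r Y" by (rule smooth_on_subset[OF gainD(3)[OF Y(1)] subset_ball[OF r(2)]])
  have tY: "tfield x0 (cut psi Y)" by (rule tfield_cut[OF psi(1) sY order_trans[OF rR R(2)]])
  have le: "s + eps - 1 <= s" using eps by simp
  have HY: "Hsob (s + eps - 1) (nvop (cut psi Y) (Fc u th))" "Hsob (s + eps - 1) (avop (cut psi Y) (Fc u th))"
   if th: "th : T r" for th
  proof -
   have "(%x. psi x * th x) : T r" "(%x. cnj (psi x) * th x) : T r"
    using test_mult_smooth[OF th test_smooth[OF psi(1)]]
     test_mult_smooth[OF th test_smooth[OF test_cnj[OF psi(1)]]] by (simp_all add: mult.commute)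
   note t = this
   show "Hsob (s + eps - 1) (nvop (cut psi Y) (Fc u th))"
    by (rule iffD2[OF Hsob_nvop[OF h rR th sY psi(1) le] gainD(4)[OF Y(1) r h t(1)]])
   show "Hsob (s + eps - 1) (avop (cut psi Y) (Fc u th))"
    by (rule iffD2[OF Hsob_avop[OF h rR th sY psi(1) le] gainD(4)[OF Y(2) r h t(2)]])
  qed
  \<comment> \<open>Because \<open>Z j\<close> annihilates \<open>u\<close>, its operator maps the
    coefficients of \<open>eta u\<close> to those of another cut-off of \<open>u\<close>, on which
    \<open>Y\<close> gains as before.\<close>
  have HYZ: "Hsob (s + eps - 1) (nvop (cut psi Y) (nvop (cut psi (Z j)) (Fc u eta)))" if j: "j : J" for j
  proof -
   have "nvop (cut psi (Z j)) (Fc u eta) = Fc u (%x. dirv (cut psi (Z j)) eta x + 0 * eta x)"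
    unfolding nvop_def vop_Fc[OF tZ[OF j] test_zero T_mono[OF eta rR]]
    using Z(2)[OF j T_mono[OF eta c(3)]] psi_eta[OF c] by (simp add: cut_def[abs_def] dF_scale)
   thus ?thesis using HY(1)[OF vop_test[OF tZ[OF j] test_zero eta]] by simp
  qed
  define P where "P = {(s, %v::'m seq. v), (s, nvop (cut psi L)), (s, EE psi), (s + eps - 1, nvop (cut psi Y)), (s + eps - 1, avop (cut psi Y))}
   Un (%j. (s, nvop (cut psi (Z j)))) ` J Un (%j. (s, avop (cut psi (Z j)))) ` J
   Un (%j. (s + eps - 1, %v. nvop (cut psi Y) (nvop (cut psi (Z j)) v))) ` J"
  have "Hsob (s + eps/4 - 1) (cm (nvop (cut psi L)) (nvop (cut psi Y)) (Fc u eta))"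
  proof (rule regularity_pairs[where P = P and ?A0.0 = "cm (nvop (cut psi L)) (nvop (cut psi Y))"])
   show "finite P" by (simp add: P_def J)
   show "order_op 2 A" if "(t, A) : P" for t A
    using that by (auto simp: P_def intro: order_op_2_id order_op_2_FO FO_nvop[OF tZ] FO_avop[OF tZ] FO_nvop[OF tL] FO_EE[OF c]
      FO_nvop[OF tY] FO_avop[OF tY] order_op_comp[OF FO_nvop[OF tY] FO_nvop[OF tZ]])
   show "order_op 2 (cm (nvop (cut psi L)) (nvop (cut psi Y)))" by (rule order_op_2_FO[OF FO_cm[OF FO_nvop[OF tL] FO_nvop[OF tY]]])
   show "Qdom (s + eps/4 - 1) beta (%t. cm (nvop (cut psi L)) (nvop (cut psi Y))) G"
    if "!!t A. (t, A) : P ==> Qdom t beta (%t. A) G" for beta G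
    by (rule estimate_drift[OF J FO_nvop[OF tZ] FO_avop[OF tZ] adjoint_nvop[OF tZ] FO_nvop[OF tL] FO_avop[OF tL]
       adjoint_nvop[OF tL] EE_def FO_EE[OF c] FO_nvop[OF tY] FO_avop[OF tY] adjoint_nvop[OF tY] _ _ eps(2)])
     ((assumption | (rule that, simp add: P_def) | (use eps in simp; fail))+)
   show "temp (Fc u eta)" by (rule temp_Fc[OF dist T_mono[OF eta rR]])
   show "Hsob t (A (Fc u eta))" if "(t, A) : P" for t A
    using that hlocD[OF h eta order_refl] Hsob_Z[OF c] Hsob_L[OF c] Hsob_EE[OF c] Hsob_full[OF c] HY[OF eta] HYZ by (auto simp: P_def)
  qed
  hence "Hsob (s + eps/4 - 1) (dF (cbr (cut psi L) (cut psi Y)) eta)"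
   by (subst (asm) Hsob_cm[OF h r(1) rR eta tL tY]) (use eps in auto)
  also have "dF (cbr (cut psi L) (cut psi Y)) eta = dF (cbr L Y) eta"
   by (rule dF_cong) (rule cbr_cut[OF smr[OF c L(1)] sY psi(2,3) psi(4)])
  finally show "Hsob (s + eps/4 - 1) (dF (cbr L Y) eta)" .
 qed
qed

lemma good_cbr_Z:
 assumes "j : J" "good Y"
 shows "good (cbr (Z j) Y)" "good (cbr (conjf (Z j)) Y)"
 using good_commutator[OF gain_Z[OF assms(1)] assms(2)] good_commutator[OF gain_Z(2)[OF assms(1)] _ assms(2)]
  gain_Z(1)[OF assms(1)] by simp_all

text \<open>By the relation between the \<open>Z\<^sub>j\<close> and \<open>L\<close> and the Jacobi identity, bracketing with \<open>conjf L\<close>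
 reduces to bracketing with \<open>L\<close>, \<open>Z\<^sub>j\<close> and \<open>conjf Z\<^sub>j\<close>.\<close>

lemma good_cbr_L:
 assumes Y: "good Y"
 shows "good (cbr L Y)" "good (cbr (conjf L) Y)"
proof -
 have both: "EX eps r. 0 < eps & eps <= 1 & r <= r0 & sm r Y & gain eps r (cbr L Y) & gain eps r (cbr (conjf L) Y)" if Y: "good Y" for Y
 proof -
  obtain eps r' where e: "0 < eps" "eps <= 1" "gain eps r' Y" "gain eps r' (conjf Y)" using Y by (rule goodE)
  define W where "W = (%x. SUM j:J. cbr (Z j) (cbr (conjf (Z j)) Y) x - cbr (conjf (Z j)) (cbr (Z j) Y) x)"
  have "good W" unfolding W_def by (intro good_sum J good_diff good_cbr_Z Y)
  then obtain eps' r'' where e': "0 < eps'" "eps' <= 1" "gain eps' r'' W" by (rule goodE)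
  define r where "r = min r0 (min r' r'')"
  have r: "0 < r" "r <= r0" "r <= r'" "r <= r''" using r0 gainD(1)[OF e(3)] gainD(1)[OF e'(3)] by (auto simp: r_def)
  define dl where "dl = min (eps/4) eps'"
  have dl: "0 < dl" "dl <= 1" "dl <= eps/4" "dl <= eps'" using e e' by (auto simp: dl_def)
  have sY: "sm r Y" by (rule smooth_on_subset[OF gainD(3)[OF e(3)] subset_ball[OF r(3)]])
  have sZ: "sm r (Z j)" "sm r (conjf (Z j))" if "j : J" for j
   by (rule smooth_on_subset[OF Z(1)[OF that] subset_ball[OF r(2)]]
     smooth_on_conjf[OF open_ball smooth_on_subset[OF Z(1)[OF that] subset_ball[OF r(2)]]])+
  have sL: "sm r L" by (rule smooth_on_subset[OF L(1) subset_ball[OF r(2)]])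
  have gL: "gain dl r (cbr L Y)"
   by (rule gain_mono[OF gain_L[OF gain_mono[OF e(3) order_refl r(1,3)] gain_mono[OF e(4) order_refl r(1,3)] e(1,2) r(2)] dl(3) r(1) order_refl])
  have "gain dl r (%x. cbr L Y x + W x)" by (rule gain_add[OF gL gain_mono[OF e'(3) dl(4) r(1,4)]])
  hence "gain dl r (cbr (conjf L) Y)"
  proof (rule gain_cong)
   fix x assume x: "x : ball x0 r"
   have s: "sm r (cbr (Z j) (conjf (Z j)))" if "j : J" for j by (intro smooth_on_cbr open_ball sZ that)
   have "cbr (conjf L) Y x = cbr (%x. L x + (SUM j:J. cbr (Z j) (conjf (Z j)) x)) Y x"
    by (rule cbr_cong[OF open_ball x _ refl smooth_on_add[OF open_ball sL smooth_on_sum[OF open_ball J s]] sY])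
     (use rel r(2) in simp)
   also have "... = cbr L Y x + (SUM j:J. cbr (cbr (Z j) (conjf (Z j))) Y x)"
    by (simp add: cbr_add_left[OF sL smooth_on_sum[OF open_ball J s] x] cbr_sum_left[OF J open_ball s x])
   also have "(SUM j:J. cbr (cbr (Z j) (conjf (Z j))) Y x) = W x"
    unfolding W_def by (intro sum.cong refl cbr_jacobi[OF open_ball x sZ sY])
   finally show "cbr L Y x + W x = cbr (conjf L) Y x" by simp
  qed
  thus ?thesis using dl r(2) sY gL by blast
 qed
 show "good (cbr L Y)" "good (cbr (conjf L) Y)"
 proof -
  obtain eps r where e: "0 < eps" "eps <= 1" "r <= r0" "sm r Y" "gain eps r (cbr L Y)" "gain eps r (cbr (conjf L) Y)"
   using both[OF Y] by blast
  \<comment> \<open>\<open>conjf (cbr L Y)\<close> is \<open>cbr (conjf L) (conjf Y)\<close>, so the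
    conjugate half of \<open>good\<close> comes from \<open>both\<close> applied to
    \<open>conjf Y\<close>.\<close>
  obtain eps' r' where e': "0 < eps'" "eps' <= 1" "r' <= r0" "gain eps' r' (cbr L (conjf Y))" "gain eps' r' (cbr (conjf L) (conjf Y))"
   using both[OF good_conjf[OF Y]] by blast
  define dl where "dl = min eps eps'"
  define q where "q = min r r'"
  have q: "0 < q" "q <= r" "q <= r'" using gainD(1)[OF e(5)] gainD(1)[OF e'(4)] by (auto simp: q_def)
  have dl: "0 < dl" "dl <= 1" "dl <= eps" "dl <= eps'" using e e' by (auto simp: dl_def)
  have sL: "sm q L" by (rule smooth_on_subset[OF L(1) subset_ball[OF order_trans[OF q(2) e(3)]]])
  have sY: "sm q Y" by (rule smooth_on_subset[OF e(4) subset_ball[OF q(2)]])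
  note g = gain_mono[OF e(5) dl(3) q(1,2)] gain_mono[OF e(6) dl(3) q(1,2)]
  have "gain dl q (conjf (cbr L Y))" by (rule gain_conjf_cbr[OF gain_mono[OF e'(5) dl(4) q(1,3)] sL sY])
  moreover have "gain dl q (conjf (cbr (conjf L) Y))"
   by (rule gain_conjf_cbr[OF _ smooth_on_conjf[OF open_ball sL] sY]) (simp add: gain_mono[OF e'(4) dl(4) q(1,3)])
  ultimately show "good (cbr L Y)" "good (cbr (conjf L) Y)" using g dl(1,2) unfolding good_def by blast+
 qed
qed

end

section \<open>Bootstrapping to smoothness\<close>

lemma Hsob_Suc:
 fixes v :: "'m::finite seq"
 assumes "Hsob s v" "!!j. Hsob s (Dop j v)"
 shows "Hsob (s + 1) v"
proof -
 have "(%k. (jb k powr s * cmod (v k))^2 + (SUM j:UNIV. (jb k powr s * cmod (Dop j v k))^2)) summable_on UNIV"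
  using assms infsum_sum'[of UNIV "%j k. (jb k powr s * cmod (Dop j v k))^2" UNIV]
  unfolding Hsob_def Hs_def by (intro summable_on_add) auto
 moreover have "(jb k powr s * cmod (v k))^2 + (SUM j:UNIV. (jb k powr s * cmod (Dop j v k))^2) = (jb k powr (s + 1) * cmod (v k))^2" for k
 proof -
  have n: "(norm (lvec k))^2 = (SUM j:UNIV. (real_of_int (k $ j))^2)"
   by (simp add: norm_vec_def L2_set_def lvec_def sum_nonneg)
  have "(SUM j:UNIV. (jb k powr s * cmod (Dop j v k))^2) = (jb k powr s * cmod (v k))^2 * (norm (lvec k))^2"
   by (simp add: n Dop_def norm_mult power_mult_distrib sum_distrib_left mult_ac)
  also have "(jb k powr s * cmod (v k))^2 + ... = (jb k powr s * cmod (v k))^2 * (jb k)^2"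
   by (simp add: jb_square distrib_left)
  finally show ?thesis by (simp add: powr_add power_mult_distrib mult_ac)
 qed
 ultimately show ?thesis unfolding Hsob_def Hs_def by simp
qed

lemma rapid_Hsob:
 assumes "!!s. Hsob s v"
 shows "rapid v"
 unfolding rapid_def
proof
 fix N
 have s: "(%k. (jb k powr real N * cmod (v k))^2) summable_on UNIV" using assms[of "real N"] by (simp add: Hsob_def Hs_def)
 have "cmod (v k) * jb k ^ N <= sqrt (INFSUM k. (jb k powr real N * cmod (v k))^2)" for k
 proof (rule real_le_rsqrt)
  have "(SUM k:{k}. (jb k powr real N * cmod (v k))^2) <= (INFSUM k. (jb k powr real N * cmod (v k))^2)"
   by (rule finite_sum_le_infsum[OF s]) auto
  thus "(cmod (v k) * jb k ^ N)^2 <= (INFSUM k. (jb k powr real N * cmod (v k))^2)"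
   by (simp add: powr_realpow mult.commute)
 qed
 thus "EX C. ALL k. cmod (v k) * jb k ^ N <= C" by blast
qed

lemma smooth_on_inverse_complex:
 fixes f :: "'e::euclidean_space => complex"
 assumes "open S" "smooth_on S f" "!!x. x : S ==> f x ~= 0"
 shows "smooth_on S (%x. inverse (f x))"
proof (rule smooth_on_cong[OF assms(1)])
 have r: "smooth_on S (%x. Re (f x))" "smooth_on S (%x. Im (f x))"
  by (rule smooth_on_linear[OF bounded_linear_Re assms(1,2)] smooth_on_linear[OF bounded_linear_Im assms(1,2)])+
 show "smooth_on S (%x. inverse (Re (f x) * Re (f x) + Im (f x) * Im (f x)) *\<^sub>R cnj (f x))"
  by (intro smooth_on_scaleR smooth_on_inverse smooth_on_add smooth_on_mult r smooth_on_linear[OF bounded_linear_cnj] assms(1,2))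
   (use assms(3) in "auto simp: complex_eq_iff sum_squares_eq_zero_iff")
qed (simp add: complex_eq_iff power2_eq_square divide_inverse mult.commute)

lemma smooth_on_det:
 fixes A :: "'e::euclidean_space => 'k::real_normed_field^'n^'n::finite"
 assumes "open S" "!!i j. smooth_on S (%x. A x $ i $ j)"
 shows "smooth_on S (%x. det (A x))"
 unfolding det_def
 by (intro smooth_on_sum smooth_on_mult smooth_on_prod smooth_on_const assms finite)

context local_dist
begin

lemma gain_sum:
 assumes "0 < r0" "r0 <= R" "finite I" "!!i. i : I ==> gain eps r0 (f i)"
 shows "gain eps r0 (%x. SUM i:I. f i x)"
 using assms(3,4)
proof (induction I rule: finite_induct)
 case empty
 show ?case by (rule gainI) (use assms in "auto simp: dF_zero")
qed (simp add: gain_add)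

lemma common_gain:
 assumes "finite I" "!!i. i : I ==> good (Y i)"
 shows "EX eps r0. 0 < eps & eps <= 1 & 0 < r0 & r0 <= R & (ALL i:I. gain eps r0 (Y i))"
 using assms
proof (induction I rule: finite_induct)
 case empty
 show ?case by (rule_tac exI[of _ 1], rule_tac exI[of _ R]) (use R in simp)
next
 case (insert i I)
 obtain eps r0 where e: "0 < eps" "eps <= 1" "0 < r0" "r0 <= R" "!!i. i : I ==> gain eps r0 (Y i)" using insert by auto
 obtain eps' r' where e': "0 < eps'" "eps' <= 1" "gain eps' r' (Y i)" using insert.prems goodE by (metis insertI1)
 let ?r = "min r0 r'"
 have r: "0 < ?r" using e gainD(1)[OF e'(3)] by simp
 have "gain (min eps eps') ?r (Y i)" by (rule gain_mono[OF e'(3) _ r]) auto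
 moreover have "gain (min eps eps') ?r (Y j)" if "j : I" for j by (rule gain_mono[OF e(5)[OF that] _ r]) auto
 ultimately show ?case using e e' r by (rule_tac exI[of _ "min eps eps'"], rule_tac exI[of _ ?r]) auto
qed

text \<open>For the constant coordinate fields the gain controls all first derivatives of
  \<open>eta u\<close> in order \<open>s + eps - 1\<close>, and this is order \<open>s + eps\<close>
  for \<open>eta u\<close> itself.\<close>

lemma hloc_step:
 assumes "0 < r" "r <= r1" "0 < eps" "eps <= 1" "!!j. gain eps r1 (%x. axis j 1)" "hloc s r"
 shows "hloc (s + eps) r"
 unfolding hloc_def
proof
 fix eta assume eta: "eta : T r"
 have etaR: "eta : T R" by (rule T_mono[OF eta]) (use assms(2) gainD(2)[OF assms(5)] in "rule order_trans")
 have dF: "dF (%x. axis j 1) eta k = - u (partial j (%x. eta x * ek (- k) x))" for j k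
 proof -
  have "(SUM i:UNIV. partial i (%x. axis j 1 $ i * eta x * ek (- k) x) x) = partial j (%x. eta x * ek (- k) x) x" for x
  proof -
   have "(SUM i:UNIV. partial i (%x. axis j 1 $ i * eta x * ek (- k) x) x) = (SUM i:{j}. partial i (%x. axis j 1 $ i * eta x * ek (- k) x) x)"
    by (rule sum.mono_neutral_right) (auto simp: axis_def)
   thus ?thesis by (simp add: axis_def)
  qed
  thus ?thesis by (simp add: dF_def)
 qed
 have "Hsob (s + eps - 1) (Dop j (Fc u eta))" for j
 proof -
  have "Dop j (Fc u eta) = (%k. Fc u (partial j eta) k + dF (%x. axis j 1) eta k)"
   using Dop_Fc[OF dist etaR] by (simp add: dF fun_eq_iff)
  moreover have "Hsob (s + eps - 1) (Fc u (partial j eta))"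
   by (rule hlocD[OF assms(6) test_partial[OF eta]]) (use assms in simp)
  ultimately show ?thesis using gainD(4)[OF assms(5,1,2,6) eta] by (simp add: Hsob_add)
 qed
 moreover have "Hsob (s + eps - 1) (Fc u eta)" by (rule hlocD[OF assms(6) eta]) (use assms in simp)
 ultimately show "Hsob (s + eps) (Fc u eta)" using Hsob_Suc[of "s + eps - 1" "Fc u eta"] by simp
qed

text \<open>On the compact ball \<open>cball x0 r\<close> the distribution has finite order, which
  yields one Sobolev order for all cut-offs.\<close>

lemma hloc_start:
 assumes "r < R"
 shows "EX s. hloc s r"
proof -
 have "cball x0 r <= ball x0 R" using assms by (auto simp: subset_iff)
 then obtain N where N: "!!eta. eta : test_functions_supp (cball x0 r) ==> EX C. ALL k. cmod (Fc u eta k) <= C * jb k ^ N"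
  using Fc_polynomial_bound[OF dist compact_cball] by metis
 have "hloc (- real N - real CARD('m)) r"
  unfolding hloc_def
 proof
  fix eta assume "eta : T r"
  then obtain K where "K <= ball x0 r" "eta : test_functions_supp K" by (rule test_functionsE)
  hence "eta : test_functions_supp (cball x0 r)" unfolding test_functions_supp_def using ball_subset_cball by blast
  then obtain C where "ALL k. cmod (Fc u eta k) <= C * jb k ^ N" using N by blast
  thus "Hsob (- real N - real CARD('m)) (Fc u eta)" by (intro poly_Hsob[of _ C N]) auto
 qed
 thus ?thesis by blast
qed

text \<open>Where the \<open>Y i\<close> form a frame, Cramer's rule expresses the coordinate fields
  through them with smooth coefficients, and gains pass to such combinations.\<close>

lemma constant_gain:
 fixes Y :: "'m => real^'m => complex^'m"
 assumes good: "!!i. good (Y i)" and ne: "det (\<chi> i. Y i x0) ~= 0"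
 shows "EX eps r1. 0 < eps & eps <= 1 & 0 < r1 & r1 <= R & (ALL j. gain eps r1 (%x. axis j 1))"
proof -
 obtain eps r0 where e: "0 < eps" "eps <= 1" "0 < r0" "r0 <= R" and g: "!!i. gain eps r0 (Y i)"
  using common_gain[of UNIV Y] good by auto
 define A where "A x = transpose (\<chi> i. Y i x)" for x
 have sA: "smooth_on (ball x0 r0) (%x. A x $ i $ j)" for i j
  unfolding A_def transpose_def using smooth_on_vec_nth[OF open_ball gainD(3)[OF g]] by simp
 have sd: "smooth_on (ball x0 r0) (%x. det (A x))" by (rule smooth_on_det[OF open_ball sA])
 have "open (ball x0 r0 Int (%x. det (A x)) -` (- {0}))"
  by (rule continuous_open_preimage[OF smooth_on_continuous[OF sd]]) auto
 moreover have "x0 : ball x0 r0 Int (%x. det (A x)) -` (- {0})" using ne e by (simp add: A_def det_transpose)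
 ultimately obtain r1 where r1: "0 < r1" "ball x0 r1 <= ball x0 r0 Int (%x. det (A x)) -` (- {0})" using openE by blast
 define r where "r = min r1 r0"
 have r: "0 < r" "r <= r0" "ball x0 r <= ball x0 r0" "!!x. x : ball x0 r ==> det (A x) ~= 0"
  using r1 e by (auto simp: r_def)
 have "gain eps r (%x. axis j 1)" for j
 proof -
  define c where "c k x = det (\<chi> i l. if l = k then axis j 1 $ i else A x $ i $ l) * inverse (det (A x))" for k x
  have sc: "smooth_on (ball x0 r) (c k)" for k
  proof -
   have "smooth_on (ball x0 r) (%x. (\<chi> i l. if l = k then axis j 1 $ i else A x $ i $ l) $ i $ l)" for i l
    using smooth_on_subset[OF sA r(3)] by (cases "l = k") simp_all
   thus ?thesis
    unfolding c_def
    by (intro smooth_on_mult open_ball smooth_on_det smooth_on_inverse_complex smooth_on_subset[OF sd r(3)] r(4))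
  qed
  have "gain eps r (%x. SUM k:UNIV. c k x *s Y k x)"
   by (intro gain_sum r(1) order_trans[OF r(2) e(4)] finite gain_scale gain_mono[OF g order_refl r(1,2)] sc)
  thus ?thesis
  proof (rule gain_cong)
   fix x assume x: "x : ball x0 r"
   have "A x *v (\<chi> k. c k x) = axis j 1"
    using cramer[OF r(4)[OF x], of "\<chi> k. c k x" "axis j 1"] by (simp add: c_def divide_inverse)
   hence "(SUM k:UNIV. A x $ i $ k * c k x) = axis j 1 $ i" for i
    by (simp add: vec_eq_iff matrix_vector_mult_def)
   thus "(SUM k:UNIV. c k x *s Y k x) = axis j 1"
    by (simp add: vec_eq_iff A_def transpose_def mult.commute)
  qed
 qed
 thus ?thesis using e r by (intro exI[of _ eps] exI[of _ r]) auto
qed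

theorem smooth_of_spanning:
 fixes Y :: "'m => real^'m => complex^'m"
 assumes "!!i. good (Y i)" and "det (\<chi> i. Y i x0) ~= 0"
 shows "EX rho f. 0 < rho & rho <= R & smooth_on UNIV f & (ALL g:T rho. u g = (LINT x|lborel. f x * g x))"
proof -
 obtain eps r1 where e: "0 < eps" "eps <= 1" "0 < r1" "r1 <= R" and g: "!!j. gain eps r1 (%x. axis j 1)"
  using constant_gain[of Y] assms by blast
 \<comment> \<open>Halving \<open>R\<close> provides the strict inequality asked for by
   \<open>hloc_start\<close>.\<close>
 define r where "r = min r1 (R/2)"
 have r: "0 < r" "r <= r1" "r < R" using e R by (auto simp: r_def)
 obtain s0 where s0: "hloc s0 r" using hloc_start[OF r(3)] by blast
 have it: "hloc (s0 + real n * eps) r" for n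
 proof (induction n)
  case (Suc n)
  show ?case using hloc_step[OF r(1,2) e(1,2) g Suc] by (simp add: algebra_simps)
 qed (simp add: s0)
 have all: "Hsob s (Fc u eta)" if "eta : T r" for s eta
 proof -
  obtain n where "s - s0 < real n * eps" using reals_Archimedean3[OF e(1)] by blast
  thus ?thesis using hlocD[OF it[of n] that, of s] by simp
 qed
 have "compact {x0}" "{x0} <= ball x0 r" using r by auto
 then obtain eta rho where eta: "eta : T r" "0 < rho" "rho < r" "!!x. x : ball x0 rho ==> eta x = 1"
  using cutoff_exists[of "{x0}" x0 r] r(1) by metis
 have etaR: "eta : T R" by (rule T_mono[OF eta(1)]) (use r in simp)
 have rap: "rapid (Fc u eta)" by (rule rapid_Hsob[OF all[OF eta(1)]])
 define P where "P = (2 * complex_of_real pi) ^ CARD('m)"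
 define f where "f x = inverse P * fseries (Fc u eta) x" for x
 have "u h = (LINT x|lborel. f x * h x)" if h: "h : T rho" for h
 proof -
  have h': "h : T pi" by (rule T_mono[OF h]) (use eta r R in simp)
  have "h x * eta x = h x" for x
  proof (cases "x : ball x0 rho")
   case False
   obtain K where "K <= ball x0 rho" "h : test_functions_supp K" using h by (rule test_functionsE)
   thus ?thesis using False test_suppD(2) by fastforce
  qed (simp add: eta(4))
  hence "(%x. h x * eta x) = h" by (rule ext)
  \<comment> \<open>The coefficient at frequency 0 is the value of the functional; writing it as a
    convolution yields Parseval's formula.\<close>
  hence "u h = Fc u (%x. h x * eta x) 0" by (simp only: Fc_def) simp
  also have "... = Mop (Fc u eta) (fc h) 0"
   unfolding Mop_Fc[OF dist subset_ball[OF R(2)] etaR h', symmetric] by (simp only: Mop_sym)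
  also have "... = (INFSUM l. inverse P * (Fc u eta l * (LINT x|lborel. ek l x * h x)))"
   by (simp add: Mop_def fc_def P_def divide_inverse mult_ac)
  also have "... = inverse P * (LINT x|lborel. fseries (Fc u eta) x * h x)"
   by (rule infsumI[OF has_sum_cmult_right[OF fseries_integral[OF rap test_integrable[OF h]]]])
  also have "... = (LINT x|lborel. f x * h x)"
   unfolding f_def mult.assoc by (rule integral_mult_right_zero[symmetric])
  finally show ?thesis .
 qed
 moreover have "smooth_on UNIV f" unfolding f_def by (intro smooth_on_mult open_UNIV smooth_on_const smooth_fseries rap)
 ultimately show ?thesis using eta r by (intro exI[of _ rho] exI[of _ f]) auto
qed

end

section \<open>Transfer to the manifold\<close>

lemma partial_compose:
 fixes tau :: "real^'m::finite => real^'n::finite" and g :: "real^'n => 'b::real_normed_vector"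
 assumes "smooth_on S tau" "x : S" "smooth_on T g" "tau x : T"
 shows "partial j (%x. g (tau x)) x = (SUM l:UNIV. partial j (%x. tau x $ l) x *\<^sub>R partial l g (tau x))"
proof -
 note dg = smooth_on_has_derivative[OF assms(3,4)]
 have lin: "linear (frechet_derivative g (at (tau x)))" by (rule has_derivative_linear[OF dg])
 have "partial j (%x. g (tau x)) x = frechet_derivative g (at (tau x)) (partial j tau x)"
  using partial_has_derivative[OF has_derivative_compose[OF smooth_on_has_derivative[OF assms(1,2)] dg], of j]
  by (simp add: partial_def)
 also have "partial j tau x = (SUM l:UNIV. partial j (%x. tau x $ l) x *\<^sub>R axis l 1)"
  using basis_expansion[of "partial j tau x", symmetric]
  by (simp add: partial_component[OF assms(1,2)] scalar_mult_eq_scaleR)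
 finally show ?thesis by (simp add: linear_sum[OF lin] linear_scale[OF lin] partial_def[of _ g])
qed

section \<open>Charts, coordinate changes and invariance of the bracket\<close>

context smooth_manifold
begin

lemma chart_at: "chart_at p : atlas" "p : dom_of (chart_at p)"
proof -
 have "p : (\<Union>c\<in>atlas. dom_of c)" using charts_cover by simp
 hence "EX c. c : atlas & p : dom_of c" by blast
 thus "chart_at p : atlas" "p : dom_of (chart_at p)"
  unfolding chart_at_def by (rule someI2_ex; simp)+
qed

context
 fixes c assumes c: "c : atlas"
begin

lemma homeo: "homeomorphism (dom_of c) (coord c ` dom_of c) (coord c) (inv_coord c)"
 using chart_homeomorphism[OF c] by blast

lemma inv_coord_coord [simp]: "p : dom_of c ==> inv_coord c (coord c p) = p"
 using homeomorphism_apply1[OF homeo] .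

lemma img_iff: "x : coord c ` (U Int dom_of c) \<longleftrightarrow> x : coord c ` dom_of c & inv_coord c x : U"
 by auto

lemma inv_coord_dom: "x : coord c ` dom_of c ==> inv_coord c x : dom_of c & coord c (inv_coord c x) = x"
 by auto

lemma open_img: "open U ==> open (coord c ` (U Int dom_of c))"
proof -
 assume "open U"
 have "open (coord c ` dom_of c Int inv_coord c -` U)"
  using chart_homeomorphism[OF c] homeomorphism_cont2[OF homeo] `open U`
  by (intro continuous_open_preimage) auto
 also have "coord c ` dom_of c Int inv_coord c -` U = coord c ` (U Int dom_of c)" by auto
 finally show ?thesis .
qed

lemma trans_map_coord [simp]: "p : dom_of c ==> trans_map c d (coord c p) = coord d p"
 by (simp add: trans_map_def)

lemma open_dom: "open (dom_of c)"
 using chart_homeomorphism[OF c] by blast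

lemma open_preimage: "open S ==> open (dom_of c Int coord c -` S)"
 by (rule continuous_open_preimage[OF homeomorphism_cont1[OF homeo] open_dom])

end

lemma open_overlap: "c : atlas ==> d : atlas ==> open (coord c ` (dom_of c Int dom_of d))"
 using open_img[of c "dom_of d"] open_dom[of d] by (simp add: Int_commute)

lemma trans_jac_partial:
 assumes "c : atlas" "d : atlas" "x : coord c ` (dom_of c Int dom_of d)"
 shows "trans_jac c d x $ i $ j = partial j (%x. trans_map c d x $ i) x"
 using partial_component[OF charts_compatible[OF assms(1,2)] assms(3), of j i]
 by (simp add: trans_jac_def matrix_def partial_def)

lemma smooth_trans_component:
 assumes "c : atlas" "d : atlas"
 shows "smooth_on (coord c ` (dom_of c Int dom_of d)) (%x. trans_map c d x $ i)"
 by (rule smooth_on_vec_nth[OF open_overlap[OF assms] charts_compatible[OF assms]])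

lemma smooth_trans_jac:
 assumes "c : atlas" "d : atlas"
 shows "smooth_on (coord c ` (dom_of c Int dom_of d)) (%x. trans_jac c d x $ i $ j)"
 by (rule smooth_on_cong[OF open_overlap[OF assms] trans_jac_partial[OF assms, symmetric] smooth_on_partial[OF smooth_trans_component[OF assms]]])

lemma trans_jac_comp:
 assumes "c : atlas" "d : atlas" "e : atlas" "p : dom_of c" "p : dom_of d" "p : dom_of e"
 shows "trans_jac c e (coord c p) $ i $ j = (SUM l:UNIV. trans_jac d e (coord d p) $ i $ l * trans_jac c d (coord c p) $ l $ j)"
proof -
 define S where "S = coord c ` ((dom_of d Int dom_of e) Int dom_of c)"
 have S: "open S" "coord c p : S"
  unfolding S_def using assms by (auto intro!: open_img open_dom)
 have sub: "S <= coord c ` (dom_of c Int dom_of d)" "S <= coord c ` (dom_of c Int dom_of e)" by (auto simp: S_def)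
 have m: "coord c p : coord c ` (dom_of c Int dom_of d)" "coord c p : coord c ` (dom_of c Int dom_of e)"
  "coord d p : coord d ` (dom_of d Int dom_of e)" using assms by auto
 have "trans_jac c e (coord c p) $ i $ j = partial j (%x. trans_map c e x $ i) (coord c p)"
  by (rule trans_jac_partial[OF assms(1,3) m(2)])
 also have "... = partial j (%x. trans_map d e (trans_map c d x) $ i) (coord c p)"
  by (rule partial_cong[OF S, symmetric])
   (use assms(1,2) in "auto simp: S_def intro!: smooth_on_subset[OF smooth_trans_component[OF assms(1,3)]]")
 also have "... = (SUM l:UNIV. partial j (%x. trans_map c d x $ l) (coord c p) *\<^sub>R
   partial l (%x. trans_map d e x $ i) (trans_map c d (coord c p)))"
  by (rule partial_compose[OF charts_compatible[OF assms(1,2)] m(1) smooth_trans_component[OF assms(2,3)]])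
   (use m(3) assms in simp)
 finally show ?thesis
  using assms by (simp add: trans_jac_partial[OF assms(1,2) m(1)] trans_jac_partial[OF assms(2,3) m(3)] mult.commute)
qed

lemma trans_jac_refl:
 assumes "c : atlas" "p : dom_of c"
 shows "trans_jac c c (coord c p) $ i $ j = (if i = j then 1 else 0)"
proof -
 have m: "coord c p : coord c ` (dom_of c Int dom_of c)" using assms by auto
 have "trans_jac c c (coord c p) $ i $ j = partial j (%x. trans_map c c x $ i) (coord c p)"
  by (rule trans_jac_partial[OF assms(1,1) m])
 also have "... = partial j (%x. x $ i) (coord c p)"
  by (rule partial_cong[OF open_overlap[OF assms(1,1)] m])
   (use assms(1) open_overlap[OF assms(1,1)] in "auto intro!: smooth_on_bounded_linear bounded_linear_vec_nth")
 also have "... = axis j 1 $ i"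
  by (rule partial_has_derivative[OF bounded_linear.has_derivative[OF bounded_linear_vec_nth has_derivative_ident]])
 finally show ?thesis by (simp add: axis_def)
qed

lemma vf_coord_at:
 assumes "c : atlas" "p : dom_of c"
 shows "vf_coord c X (coord c p) $ i =
  (SUM j:UNIV. of_real (trans_jac (chart_at p) c (coord (chart_at p) p) $ i $ j) * X p $ j)"
 using assms by (simp add: vf_coord_def)

lemma vf_coord_chart_at: "vf_coord (chart_at p) X (coord (chart_at p) p) = X p"
 by (simp add: vec_eq_iff vf_coord_at[OF chart_at] trans_jac_refl[OF chart_at] of_real_def if_distrib[of "%x. x *\<^sub>R 1"] cong: if_cong)
  (simp add: if_distrib[of "%x. x * _"] cong: if_cong)

lemma vf_coord_trans:
 assumes "c : atlas" "d : atlas" "p : dom_of c" "p : dom_of d"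
 shows "vf_coord d X (coord d p) $ i =
  (SUM j:UNIV. of_real (trans_jac c d (coord c p) $ i $ j) * vf_coord c X (coord c p) $ j)"
proof -
 have "(SUM j:UNIV. of_real (trans_jac c d (coord c p) $ i $ j) * vf_coord c X (coord c p) $ j) =
  (SUM j:UNIV. SUM k:UNIV. of_real (trans_jac c d (coord c p) $ i $ j * trans_jac (chart_at p) c (coord (chart_at p) p) $ j $ k) * X p $ k)"
  by (simp add: vf_coord_at[OF assms(1,3)] sum_distrib_left mult.assoc)
 also have "... = (SUM k:UNIV. of_real (trans_jac (chart_at p) d (coord (chart_at p) p) $ i $ k) * X p $ k)"
  unfolding trans_jac_comp[OF chart_at(1) assms(1,2) chart_at(2) assms(3,4)] of_real_sum sum_distrib_right
  by (rule sum.swap)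
 finally show ?thesis by (simp add: vf_coord_at[OF assms(2,4)])
qed

text \<open>Components are derivatives of coordinate functions; this reduces the invariance of the
  bracket to \<open>dirv_cbr\<close>.\<close>

lemma vf_coord_dirv:
 fixes X :: "'a => 'k::real_normed_field^'m"
 assumes "c : atlas" "d : atlas" "p : dom_of c" "p : dom_of d"
 shows "vf_coord d X (coord d p) $ i = dirv (vf_coord c X) (%x. of_real (trans_map c d x $ i)) (coord c p)"
proof -
 have m: "coord c p : coord c ` (dom_of c Int dom_of d)" using assms by auto
 show ?thesis
  unfolding vf_coord_trans[OF assms] dirv_def
  by (simp add: partial_linear[OF bounded_linear_of_real smooth_trans_component[OF assms(1,2)] m]
    trans_jac_partial[OF assms(1,2) m] mult.commute)
qed

lemma smooth_vf_coord_trans: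
 fixes X :: "'a => 'k::real_normed_field^'m"
 assumes "c : atlas" "d : atlas" "open U" "U <= dom_of c Int dom_of d" "smooth_on (coord c ` U) (vf_coord c X)"
 shows "smooth_on (coord d ` U) (vf_coord d X)"
proof (rule smooth_on_components)
 have U: "coord c ` U = coord c ` (U Int dom_of c)" "coord d ` U = coord d ` (U Int dom_of d)" using assms(4) by (auto simp: Int_absorb2)
 have o: "open (coord c ` U)" "open (coord d ` U)" unfolding U using assms(1-3) by (auto intro: open_img)
 thus "open (coord d ` U)" by blast
 fix i
 have s: "smooth_on (coord d ` U) (trans_map d c)" by (rule smooth_on_subset[OF charts_compatible[OF assms(2,1)]]) (use assms(4) in auto)
 have im: "trans_map d c ` (coord d ` U) <= coord c ` U" using assms(2,4) by (force simp: subset_iff)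
 have "smooth_on (coord c ` U) (%x. SUM j:UNIV. of_real (trans_jac c d x $ i $ j) * vf_coord c X x $ j)"
  by (intro smooth_on_sum smooth_on_mult o finite smooth_on_vec_nth assms(5) smooth_on_linear[OF bounded_linear_of_real]
    smooth_on_subset[OF smooth_trans_jac[OF assms(1,2)]]) (use assms(4) in auto)
 from smooth_on_compose[OF o(2,1) im s this]
 show "smooth_on (coord d ` U) (%x. vf_coord d X x $ i)"
 proof (rule smooth_on_cong[OF o(2), rotated])
  fix y assume "y : coord d ` U"
  then obtain p where "p : U" and y: "y = coord d p" by blast
  hence "p : dom_of c" "p : dom_of d" using assms(4) by auto
  thus "(SUM j:UNIV. of_real (trans_jac c d (trans_map d c y) $ i $ j) * vf_coord c X (trans_map d c y) $ j) = vf_coord d X y $ i"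
   using assms(1,2) vf_coord_trans[of c d p X i] y by simp
 qed
qed

text \<open>\<open>bracket\<close> is computed at each point in that point's preferred chart
  \<open>d\<close>. Its components in \<open>c\<close> are its derivatives of the coordinate
  functions of \<open>c\<close> written in \<open>d\<close>; \<open>dirv_cbr\<close> turns these
  into iterated derivatives, and the chain rule carries them back to \<open>c\<close>.\<close>

theorem vf_coord_bracket:
 fixes X Y :: "'a => 'k::real_normed_field^'m"
 assumes c: "c : atlas" and S: "open S" "S <= coord c ` dom_of c" "x : S"
  and X: "smooth_on S (vf_coord c X)" and Y: "smooth_on S (vf_coord c Y)"
 shows "vf_coord c (bracket X Y) x = cbr (vf_coord c X) (vf_coord c Y) x"
proof -
 define p where "p = inv_coord c x"
 have p: "p : dom_of c" "coord c p = x" using inv_coord_dom[OF c] S by (auto simp: p_def)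
 define d where "d = chart_at p"
 have d: "d : atlas" "p : dom_of d" unfolding d_def by (rule chart_at)+
 define U where "U = (dom_of c Int coord c -` S) Int dom_of d"
 have oU: "open U" unfolding U_def by (intro open_Int open_preimage c S(1) open_dom d)
 have U: "U <= dom_of c Int dom_of d" "p : U" using p d S by (auto simp: U_def)
 have cU: "coord c ` U <= S" by (auto simp: U_def)
 have Ui: "coord c ` U = coord c ` (U Int dom_of c)" "coord d ` U = coord d ` (U Int dom_of d)" using U by (auto simp: Int_absorb2)
 have o: "open (coord c ` U)" "open (coord d ` U)" unfolding Ui by (intro open_img c d oU)+
 define y where "y = coord d p"
 have y: "y : coord d ` U" using U by (auto simp: y_def)
 have ty: "trans_map d c y = x" using d p by (simp add: y_def)
 have Xd: "smooth_on (coord d ` U) (vf_coord d X)" "smooth_on (coord d ` U) (vf_coord d Y)"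
  by (rule smooth_vf_coord_trans[OF c d(1) oU U(1) smooth_on_subset[OF X cU]]
    smooth_vf_coord_trans[OF c d(1) oU U(1) smooth_on_subset[OF Y cU]])+
 have tau: "smooth_on (coord d ` U) (trans_map d c)" by (rule smooth_on_subset[OF charts_compatible[OF d(1) c]]) (use U in auto)
 have taui: "smooth_on (coord d ` U) (%y. trans_map d c y $ i)" for i by (rule smooth_on_vec_nth[OF o(2) tau])
 have "vf_coord c (bracket X Y) x $ i = cbr (vf_coord c X) (vf_coord c Y) x $ i" for i
 proof -
  define tau where "tau = (%y. of_real (trans_map d c y $ i) :: 'k)"
  have stau: "smooth_on (coord d ` U) tau" unfolding tau_def by (rule smooth_on_linear[OF bounded_linear_of_real o(2) taui])
  have dd: "dirv (vf_coord d X) (dirv (vf_coord d Y) tau) y = dirv (vf_coord c X) (%x. vf_coord c Y x $ i) x"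
   if Y: "smooth_on S (vf_coord c Y)" "smooth_on (coord d ` U) (vf_coord d Y)" for X Y :: "'a => 'k^'m"
  proof -
   have g: "smooth_on (coord c ` U) (%x. vf_coord c Y x $ i)"
    by (rule smooth_on_vec_nth[OF o(1) smooth_on_subset[OF Y(1) cU]])
   have "dirv (vf_coord d X) (dirv (vf_coord d Y) tau) y = dirv (vf_coord d X) (%y. vf_coord c Y (trans_map d c y) $ i) y"
   proof (rule dirv_cong[OF o(2) y refl, symmetric])
    show "smooth_on (coord d ` U) (dirv (vf_coord d Y) tau)" by (rule smooth_on_dirv[OF o(2) Y(2) stau])
    fix z assume "z : coord d ` U"
    then obtain q where q: "q : U" "z = coord d q" by blast
    moreover have "q : dom_of d" "q : dom_of c" using q U by auto
    ultimately show "dirv (vf_coord d Y) tau z = vf_coord c Y (trans_map d c z) $ i"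
     using vf_coord_dirv[OF d(1) c, of q Y i] d(1) by (simp add: tau_def)
   qed
   also have "... = (SUM j:UNIV. SUM l:UNIV. of_real (trans_jac d c y $ l $ j) * vf_coord d X y $ j * partial l (%x. vf_coord c Y x $ i) x)"
   proof -
    have yt: "trans_map d c y : coord c ` U" unfolding ty using p U(2) by (metis imageI)
    have yo: "y : coord d ` (dom_of d Int dom_of c)" using y U by auto
    show ?thesis
     by (simp add: dirv_def partial_compose[OF tau y g yt] ty sum_distrib_left scaleR_conv_of_real
       trans_jac_partial[OF d(1) c yo] mult_ac)
   qed
   also have "... = (SUM l:UNIV. vf_coord c X x $ l * partial l (%x. vf_coord c Y x $ i) x)"
    by (subst sum.swap) (simp add: vf_coord_trans[OF d(1) c d(2) p(1), unfolded p(2)] y_def sum_distrib_right)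
   finally show ?thesis by (simp add: dirv_def)
  qed
  have "vf_coord c (bracket X Y) x $ i = dirv (cbr (vf_coord d X) (vf_coord d Y)) tau y"
  proof -
   have "vf_coord c (bracket X Y) x $ i = dirv (vf_coord d (bracket X Y)) tau y"
    using vf_coord_dirv[OF d(1) c d(2) p(1), of "bracket X Y" i] by (simp add: p(2) y_def tau_def)
   also have "vf_coord d (bracket X Y) y = cbr (vf_coord d X) (vf_coord d Y) y"
    unfolding y_def d_def vf_coord_chart_at by (simp add: bracket_def cbr_def Let_def)
   hence "dirv (vf_coord d (bracket X Y)) tau y = dirv (cbr (vf_coord d X) (vf_coord d Y)) tau y" by (simp add: dirv_def)
   finally show ?thesis .
  qed
  also have "... = dirv (vf_coord d X) (dirv (vf_coord d Y) tau) y - dirv (vf_coord d Y) (dirv (vf_coord d X) tau) y"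
   by (rule dirv_cbr[OF o(2) y Xd stau]) (unfold tau_def, rule partial_commute_of_real[OF o(2) y taui])
  also have "... = cbr (vf_coord c X) (vf_coord c Y) x $ i"
   unfolding dd[OF Y Xd(2)] dd[OF X Xd(1)] cbr_component_dirv[OF X Y S(3)] ..
  finally show ?thesis .
 qed
 thus ?thesis by (simp add: vec_eq_iff)
qed

end

lemma dirv_const [simp]: "dirv xi (%x. a) x = 0"
 by (simp add: dirv_def)

section \<open>Fields whose brackets preserve goodness\<close>

context local_dist
begin

text \<open>By the Jacobi identity this class is closed under brackets, and it is a module over
  smooth functions. Hence it contains whole Lie modules once it contains their generators, which is
  how \<open>V2\<close> is reached.\<close>

definition DC :: "(real^'m => complex^'m) => bool" where
 "DC xi \<longleftrightarrow> good xi & (ALL Y. good Y --> good (cbr xi Y))"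

lemma DC_good: "DC xi ==> good xi"
 by (simp add: DC_def)

lemma DC_cbr: "DC xi ==> good Y ==> good (cbr xi Y)"
 by (simp add: DC_def)

lemma common_smooth:
 assumes "good a" "good b" "good c"
 obtains r where "0 < r" "sm r a" "sm r b" "sm r c"
proof -
 obtain r1 r2 r3 where r: "0 < r1" "sm r1 a" "0 < r2" "sm r2 b" "0 < r3" "sm r3 c"
  using good_smooth[OF assms(1)] good_smooth[OF assms(2)] good_smooth[OF assms(3)] by metis
 have "sm (min r1 (min r2 r3)) a" "sm (min r1 (min r2 r3)) b" "sm (min r1 (min r2 r3)) c"
  by (rule smooth_on_subset[OF r(2) subset_ball] smooth_on_subset[OF r(4) subset_ball] smooth_on_subset[OF r(6) subset_ball]; simp)+
 thus ?thesis using r by (intro that[of "min r1 (min r2 r3)"]) auto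
qed

lemma DC_cong:
 assumes "DC xi" "open S" "x0 : S" "!!x. x : S ==> xi x = xi' x"
 shows "DC xi'"
proof -
 have "good (cbr xi' Y)" if Y: "good Y" for Y
 proof -
  obtain r where r: "0 < r" "sm r xi" "sm r Y" using common_smooth[OF DC_good[OF assms(1)] Y Y] by metis
  have s: "smooth_on (S Int ball x0 r) xi" "smooth_on (S Int ball x0 r) Y"
   by (rule smooth_on_subset[OF r(2)] smooth_on_subset[OF r(3)]; simp)+
  have o: "open (S Int ball x0 r)" using assms(2) by auto
  show ?thesis
   by (rule good_cong[OF DC_cbr[OF assms(1) Y] o])
    (use assms(3,4) r(1) in "auto intro!: cbr_cong[OF o _ _ _ s, symmetric]")
 qed
 thus ?thesis using good_cong[OF DC_good[OF assms(1)] assms(2-4)] by (simp add: DC_def)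
qed

lemma DC_add:
 assumes "DC xi" "DC xi'"
 shows "DC (%x. xi x + xi' x)"
 unfolding DC_def
proof (intro conjI allI impI)
 show "good (%x. xi x + xi' x)" by (intro good_add DC_good assms)
 fix Y assume Y: "good Y"
 obtain r where r: "0 < r" "sm r xi" "sm r xi'" using common_smooth[OF DC_good[OF assms(1)] DC_good[OF assms(2)] Y] by metis
 show "good (cbr (%x. xi x + xi' x) Y)"
  by (rule good_cong[OF good_add[OF DC_cbr[OF assms(1) Y] DC_cbr[OF assms(2) Y]] open_ball[of x0 r]])
   (use r in "auto simp: cbr_add_left[OF r(2,3)]")
qed

text \<open>The bracket of \<open>f xi\<close> with \<open>Y\<close> is \<open>f\<close> times that
  of \<open>xi\<close>, minus \<open>(Y f) xi\<close>. The last term is good because goodness of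
  \<open>xi\<close> is part of \<open>DC\<close>.\<close>

lemma DC_scale:
 assumes "DC xi" "open S" "x0 : S" "smooth_on S f"
 shows "DC (%x. f x *s xi x)"
 unfolding DC_def
proof (intro conjI allI impI)
 show "good (%x. f x *s xi x)" by (rule good_scale[OF DC_good[OF assms(1)] assms(2-4)])
 fix Y assume Y: "good Y"
 obtain r where r: "0 < r" "sm r xi" "sm r Y" using common_smooth[OF DC_good[OF assms(1)] Y Y] by metis
 let ?S = "S Int ball x0 r"
 have s: "smooth_on ?S xi" "smooth_on ?S Y" "smooth_on ?S f"
  by (rule smooth_on_subset[OF r(2)] smooth_on_subset[OF r(3)] smooth_on_subset[OF assms(4)]; simp)+
 have o: "open ?S" "x0 : ?S" using assms(2,3) r(1) by auto
 have "good (%x. f x *s cbr xi Y x - dirv Y f x *s xi x)"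
  by (intro good_diff good_scale[OF DC_cbr[OF assms(1) Y] assms(2-4)] good_scale[OF DC_good[OF assms(1)] o]
    smooth_on_dirv[OF o(1) s(2,3)])
 thus "good (cbr (%x. f x *s xi x) Y)"
  by (rule good_cong[OF _ o]) (simp add: cbr_scale_left[OF s(3,1) _ o(1)])
qed

lemma DC_zero: "DC (%x. 0)"
 unfolding DC_def using good_zero by (auto simp: good_zero cbr_zero_left[abs_def])

lemma DC_bracket:
 assumes "DC a" "DC b"
 shows "DC (cbr a b)"
 unfolding DC_def
proof (intro conjI allI impI)
 show "good (cbr a b)" by (rule DC_cbr[OF assms(1) DC_good[OF assms(2)]])
 fix Y assume Y: "good Y"
 obtain r where r: "0 < r" "sm r a" "sm r b" "sm r Y" using common_smooth[OF DC_good[OF assms(1)] DC_good[OF assms(2)] Y] by metis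
 have "good (%x. cbr a (cbr b Y) x - cbr b (cbr a Y) x)"
  by (intro good_diff DC_cbr assms Y)
 thus "good (cbr (cbr a b) Y)"
  by (rule good_cong[OF _ open_ball[of x0 r]]) (use r in "auto simp: cbr_jacobi[OF open_ball _ r(2-4)]")
qed

end

section \<open>Sections on the manifold as fields in a chart\<close>

definition cxv :: "real^'m => complex^'m::finite" where
 "cxv v = (\<chi> j. of_real (v $ j))"

lemma cxv_Re: "cxv (Re_vec z) = (1/2) *s z + (1/2) *s cnj_vec z"
 by (simp add: vec_eq_iff cxv_def Re_vec_def cnj_vec_def complex_eq_iff)

lemma cxv_Im: "cxv (Im_vec z) = (- \<i>/2) *s z + (\<i>/2) *s cnj_vec z"
 by (simp add: vec_eq_iff cxv_def Im_vec_def cnj_vec_def complex_eq_iff)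

lemma Re_vec_cxv [simp]: "Re_vec (cxv v) = v"
 by (simp add: vec_eq_iff cxv_def Re_vec_def)

lemma cxv_cbr:
 assumes "open S" "x : S" "smooth_on S xi" "smooth_on S eta"
 shows "cxv (cbr xi eta x) = cbr (%x. cxv (xi x)) (%x. cxv (eta x)) x"
proof -
 have s: "smooth_on S (%x. cxv (f x))" if "smooth_on S f" for f :: "real^'a => real^'a"
  unfolding cxv_def
  by (intro smooth_on_vec_lambda assms(1) smooth_on_linear[OF bounded_linear_of_real] smooth_on_vec_nth that)
 have "cxv (cbr xi eta x) $ l = cbr (%x. cxv (xi x)) (%x. cxv (eta x)) x $ l" for l
  unfolding cbr_component[OF s[OF assms(3)] s[OF assms(4)] assms(2)]
  by (simp add: cxv_def cbr_component[OF assms(3,4,2)]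
    partial_linear[OF bounded_linear_of_real smooth_on_vec_nth[OF assms(1,3)] assms(2)]
    partial_linear[OF bounded_linear_of_real smooth_on_vec_nth[OF assms(1,4)] assms(2)])
 thus ?thesis by (simp add: vec_eq_iff)
qed

context smooth_manifold
begin

lemma vf_coord_Re: "vf_coord c (Re_vec o Z) x = Re_vec (vf_coord c Z x)"
 by (simp add: vf_coord_def Re_vec_def vec_eq_iff Let_def)

lemma vf_coord_Im: "vf_coord c (Im_vec o Z) x = Im_vec (vf_coord c Z x)"
 by (simp add: vf_coord_def Im_vec_def vec_eq_iff Let_def)

lemma vf_coord_cnj: "vf_coord c (cnj_vec o Z) = conjf (vf_coord c Z)"
 by (simp add: vf_coord_def cnj_vec_def vec_eq_iff Let_def fun_eq_iff)

lemma vf_coord_zero: "vf_coord c (%p. 0) x = 0"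
 by (simp add: vf_coord_def vec_eq_iff Let_def)

lemma vf_coord_add: "vf_coord c (%p. X p + Y p) x = vf_coord c X x + vf_coord c Y x"
 by (simp add: vf_coord_def vec_eq_iff Let_def distrib_left sum.distrib)

lemma vf_coord_diff: "vf_coord c (%p. X p - Y p) x = vf_coord c X x - vf_coord c Y x"
 by (simp add: vf_coord_def vec_eq_iff Let_def right_diff_distrib sum_subtractf)

lemma vf_coord_scale: "vf_coord c (%p. f p *\<^sub>R X p) x = f (inv_coord c x) *\<^sub>R vf_coord c X x"
 by (simp add: vf_coord_def vec_eq_iff Let_def sum_distrib_left scaleR_sum_right)

lemma vf_coord_sum: "vf_coord c (%p. SUM i:I. X i p) x = (SUM i:I. vf_coord c (X i) x)"
 by (induction I rule: infinite_finite_induct) (simp_all add: vf_coord_zero vf_coord_add)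

lemma vf_coord_cong: "X (inv_coord c x) = Y (inv_coord c x) ==> vf_coord c X x = vf_coord c Y x"
 by (simp add: vf_coord_def Let_def)

lemma smooth_vf_subset: "smooth_vf U X ==> V <= U ==> smooth_vf V X"
 unfolding smooth_vf_def by (meson Int_mono image_mono order_refl smooth_on_subset)

end

locale CR_local = almost_CR_manifold atlas T01 n + local_dist "u c" "coord c q" R
 for atlas :: "('a::{t2_space,second_countable_topology}, 'm::finite) chart set"
  and T01 n and u :: "('a, 'm) chart => (real^'m => complex) => complex" and c q R +
 fixes W
 assumes c: "c : atlas" "q : dom_of c" and W: "open W" "q : W"
  and CR: "CR_distribution W u" and sub: "ball (coord c q) R <= coord c ` (W Int dom_of c)"
begin

lemma neighbourhood:
 assumes "open V" "q : V"
 shows "open (coord c ` (V Int dom_of c))" "coord c q : coord c ` (V Int dom_of c)"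
 using open_img[OF c(1) assms(1)] assms c by auto

text \<open>A single radius serves all sections over \<open>V\<close>, as it depends only on where
  \<open>V\<close> and \<open>W\<close> contain a coordinate ball. \<open>generators_DC\<close>
  needs it for a whole list of sections at once.\<close>

lemma Z_kills:
 assumes V: "open V" "q : V"
 shows "EX r. 0 < r & r <= R & ball (coord c q) r <= coord c ` (V Int dom_of c) &
  (ALL Z:Z_sheaf V. sm r (vf_coord c Z) & (ALL eta:T r. dF (vf_coord c Z) eta = (%k. 0)))"
proof -
 have V': "open (V Int W)" "q : V Int W" using V W by auto
 obtain e where e: "0 < e" "ball (coord c q) e <= coord c ` (V Int W Int dom_of c)"
  using neighbourhood[OF V'] openE by metis
 define r where "r = min e R"
 have r: "0 < r" "r <= R" "ball (coord c q) r <= coord c ` (V Int W Int dom_of c)" using e R by (auto simp: r_def)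
 have "sm r (vf_coord c Z) & (ALL eta:T r. dF (vf_coord c Z) eta = (%k. 0))" if Z: "Z : Z_sheaf V" for Z
 proof (intro conjI ballI)
  have Z': "Z : Z_sheaf (V Int W)" using Z smooth_vf_subset[of V Z "V Int W"] by (auto simp: Z_sheaf_def)
  thus "sm r (vf_coord c Z)" using c(1) smooth_on_subset[OF _ r(3)] by (auto simp: Z_sheaf_def smooth_vf_def)
  fix eta assume eta: "eta : T r"
  have "dF (vf_coord c Z) eta k = apply_vf Z u c (%x. eta x * ek (- k) x)" for k
   by (simp add: dF_def apply_vf_def mult.assoc)
  moreover have "apply_vf Z u c (%x. eta x * ek (- k) x) = 0" for k
  proof -
   have "(%x. eta x * ek (- k) x) : tests (coord c ` (V Int W Int dom_of c))"
    using test_mult_ek[OF eta] test_mono[OF r(3)] by blast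
   thus ?thesis using CR Z' V'(1) c(1) unfolding CR_distribution_def by blast
  qed
  ultimately show "dF (vf_coord c Z) eta = (%k. 0)" by auto
 qed
 thus ?thesis using r by blast
qed

lemma good_Z: "open V ==> q : V ==> Z : Z_sheaf V ==> good (vf_coord c Z)"
 using Z_kills[of V] good_kills by blast

definition cF :: "('a => real^'m) => real^'m => complex^'m" where
 "cF X x = cxv (vf_coord c X x)"

lemma cF_Re: "cF (Re_vec o Z) = (%x. (1/2) *s vf_coord c Z x + (1/2) *s conjf (vf_coord c Z) x)"
 by (simp add: fun_eq_iff cF_def vf_coord_Re cxv_Re conjf_def)

lemma cF_Im: "cF (Im_vec o Z) = (%x. (- \<i>/2) *s vf_coord c Z x + (\<i>/2) *s conjf (vf_coord c Z) x)"
 by (simp add: fun_eq_iff cF_def vf_coord_Im cxv_Im conjf_def)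

lemma good_H:
 assumes "open V" "q : V" "X : H_sheaf V"
 shows "good (cF X)"
proof -
 obtain Z where Z: "Z : Z_sheaf V" "X = Re_vec o Z" using assms(3) by (auto simp: H_sheaf_def)
 have g: "good (vf_coord c Z)" by (rule good_Z[OF assms(1,2) Z(1)])
 show ?thesis
  unfolding Z(2) cF_Re
  by (intro good_add good_scale[OF g, of UNIV] good_scale[OF good_conjf[OF g], of UNIV] smooth_on_const) auto
qed

lemma cF_cong:
 assumes "open V" "q : V" "!!p. p : V ==> X p = Y p"
 shows "good (cF X) ==> good (cF Y)" "DC (cF X) ==> DC (cF Y)"
proof -
 have e: "cF X x = cF Y x" if "x : coord c ` (V Int dom_of c)" for x
  using that assms(3) c(1) by (auto simp: cF_def intro!: arg_cong[of _ _ cxv] vf_coord_cong)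
 show "good (cF X) ==> good (cF Y)" by (rule good_cong[OF _ neighbourhood[OF assms(1,2)] e])
 show "DC (cF X) ==> DC (cF Y)" by (rule DC_cong[OF _ neighbourhood[OF assms(1,2)] e])
qed

text \<open>The equality is claimed only near the centre of the chart ball, where goodness
  guarantees the smoothness that \<open>vf_coord_bracket\<close> requires.\<close>

lemma cF_bracket:
 assumes "good (cF X)" "good (cF Y)"
 shows "EX r>0. ALL x:ball (coord c q) r. cbr (cF X) (cF Y) x = cF (bracket X Y) x"
proof -
 obtain r' where r': "0 < r'" "sm r' (cF X)" "sm r' (cF Y)" using common_smooth[OF assms assms(2)] by metis
 define r where "r = min r' R"
 have r: "0 < r" "ball (coord c q) r <= ball (coord c q) r'" "ball (coord c q) r <= coord c ` dom_of c"
  using r'(1) R sub by (auto simp: r_def)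
 have s: "smooth_on (ball (coord c q) r) (vf_coord c X)" if "sm r' (cF X)" for X
 proof -
  have "smooth_on (ball (coord c q) r) (%x. Re_vec (cF X x))"
   unfolding Re_vec_def
   by (intro smooth_on_vec_lambda open_ball smooth_on_linear[OF bounded_linear_Re] smooth_on_vec_nth smooth_on_subset[OF that r(2)])
  thus ?thesis by (simp add: cF_def)
 qed
 have "cbr (cF X) (cF Y) x = cF (bracket X Y) x" if "x : ball (coord c q) r" for x
  using vf_coord_bracket[OF c(1) open_ball r(3) that s[OF r'(2)] s[OF r'(3)]]
   cxv_cbr[OF open_ball that s[OF r'(2)] s[OF r'(3)]] by (simp add: cF_def[abs_def])
 thus ?thesis using r(1) by blast
qed

lemma good_bracket:
 assumes "DC (cF X)" "good (cF Y)"
 shows "good (cF (bracket X Y))"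
proof -
 obtain r where "0 < r" "ALL x:ball (coord c q) r. cbr (cF X) (cF Y) x = cF (bracket X Y) x"
  using cF_bracket[OF DC_good[OF assms(1)] assms(2)] by blast
 thus ?thesis by (intro good_cong[OF DC_cbr[OF assms] open_ball[of "coord c q" r]]) auto
qed

lemma DC_cF_bracket:
 assumes "DC (cF X)" "DC (cF Y)"
 shows "DC (cF (bracket X Y))"
proof -
 obtain r where "0 < r" "ALL x:ball (coord c q) r. cbr (cF X) (cF Y) x = cF (bracket X Y) x"
  using cF_bracket[OF DC_good[OF assms(1)] DC_good[OF assms(2)]] by blast
 thus ?thesis by (intro DC_cong[OF DC_bracket[OF assms] open_ball[of "coord c q" r]]) auto
qed

lemma smooth_fun_coord:
 assumes "smooth_fun U f" "open U"
 shows "smooth_on (coord c ` (U Int dom_of c)) (%x. complex_of_real (f (inv_coord c x)))"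
 using assms(1) c(1) open_img[OF c(1) assms(2)]
 by (intro smooth_on_linear[OF bounded_linear_of_real]) (auto simp: smooth_fun_def o_def)

lemma cF_scale: "cF (%p. f p *\<^sub>R X p) = (%x. complex_of_real (f (inv_coord c x)) *s cF X x)"
 by (simp add: fun_eq_iff vec_eq_iff cF_def vf_coord_scale cxv_def)

lemma cF_add: "cF (%p. X p + Y p) = (%x. cF X x + cF Y x)"
 by (simp add: fun_eq_iff vec_eq_iff cF_def vf_coord_add cxv_def)

lemma cF_zero: "cF (%p. 0) = (%x. 0)"
 by (simp add: fun_eq_iff vec_eq_iff cF_def vf_coord_zero cxv_def)

lemma lie_module_DC:
 assumes U: "open U" "q : U" and S: "!!X. X : S ==> DC (cF X)"
 shows "X : lie_module U S ==> DC (cF X)"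
proof (induction rule: lie_module.induct)
 case (scale X f)
 show ?case unfolding cF_scale by (rule DC_scale[OF scale.IH neighbourhood[OF U] smooth_fun_coord[OF scale.hyps(2) U(1)]])
qed (simp_all add: S cF_zero DC_zero cF_add DC_add DC_cF_bracket)

lemma sheafifyE:
 assumes "X : sheafify G U" "q : U"
 obtains V Y where "open V" "q : V" "V <= U" "Y : G V" "!!p. p : V ==> Y p = X p"
 using assms unfolding sheafify_def by auto

text \<open>In the chart the list \<open>Zs\<close> and \<open>L\<^sub>0\<close> form a
  \<open>CR_family\<close>. Real and imaginary parts are constant combinations of the fields and
  their conjugates, which all lie in \<open>DC\<close>.\<close>

lemma generators_DC:
 assumes V: "open V" "q : V" and Zs: "ALL Z:set Zs. Z : Z_sheaf V" and L0: "L\<^sub>0 : Z_sheaf V"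
  and rel: "ALL p:V. (\<Sum>Z\<leftarrow>Zs. bracket Z (cnj_vec o Z) p) = cnj_vec (L\<^sub>0 p) - L\<^sub>0 p"
  and X: "X : (%Z. Re_vec o Z) ` set Zs Un (%Z. Im_vec o Z) ` set Zs Un {Re_vec o L\<^sub>0}"
 shows "DC (cF X)"
proof -
 obtain r where r: "0 < r" "r <= R" "ball (coord c q) r <= coord c ` (V Int dom_of c)"
  and k: "!!Z. Z : Z_sheaf V ==> sm r (vf_coord c Z)" "!!Z eta. Z : Z_sheaf V ==> eta : T r ==> dF (vf_coord c Z) eta = (%k. 0)"
  using Z_kills[OF V] by metis
 define Z where "Z j = vf_coord c (Zs ! j)" for j
 define L where "L = vf_coord c L\<^sub>0"
 have mem: "Zs ! j : Z_sheaf V" if "j : {..<length Zs}" for j using that Zs by auto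
 interpret F: CR_family "u c" "coord c q" R "{..<length Zs}" Z L r
 proof
  fix x assume x: "x : ball (coord c q) r"
  define p where "p = inv_coord c x"
  have p: "p : V" using subsetD[OF r(3) x] unfolding img_iff[OF c(1)] p_def by blast
  have "(\<Sum>j<length Zs. cbr (Z j) (conjf (Z j)) x) = (\<Sum>j<length Zs. vf_coord c (bracket (Zs ! j) (cnj_vec o Zs ! j)) x)"
  proof (rule sum.cong[OF refl])
   fix j assume j: "j : {..<length Zs}"
   have s: "sm r (vf_coord c (Zs ! j))" by (rule k(1)[OF mem[OF j]])
   show "cbr (Z j) (conjf (Z j)) x = vf_coord c (bracket (Zs ! j) (cnj_vec o Zs ! j)) x"
    unfolding Z_def vf_coord_cnj[symmetric]
    by (rule vf_coord_bracket[OF c(1) open_ball _ x s, symmetric])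
     (use r(3) smooth_on_conjf[OF open_ball s] in "auto simp: vf_coord_cnj")
  qed
  also have "... = vf_coord c (%p. \<Sum>j<length Zs. bracket (Zs ! j) (cnj_vec o Zs ! j) p) x"
   by (rule vf_coord_sum[symmetric])
  also have "... = vf_coord c (%p. (cnj_vec o L\<^sub>0) p - L\<^sub>0 p) x"
   by (rule vf_coord_cong)
    (use rel p in "simp add: p_def[symmetric] sum_list_sum_nth atLeast0LessThan")
  finally show "(\<Sum>j<length Zs. cbr (Z j) (conjf (Z j)) x) = conjf L x - L x"
   unfolding vf_coord_diff vf_coord_cnj L_def .
 qed (use r k mem L0 in "auto simp: Z_def L_def")
 have DZ: "DC (Z j)" "DC (conjf (Z j))" if "j : {..<length Zs}" for j
  using F.good_cbr_Z[OF that] good_Z[OF V mem[OF that]] good_conjf by (auto simp: DC_def Z_def)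
 have DL: "DC L" "DC (conjf L)"
  using F.good_cbr_L good_Z[OF V L0] good_conjf by (auto simp: DC_def L_def)
 have comb: "DC (%x. a *s xi x + b *s conjf xi x)" if "DC xi" "DC (conjf xi)" for a b xi
  by (intro DC_add DC_scale[OF that(1), of UNIV] DC_scale[OF that(2), of UNIV] smooth_on_const) auto
 from X consider j where "j : {..<length Zs}" "X = Re_vec o Zs ! j" | j where "j : {..<length Zs}" "X = Im_vec o Zs ! j"
  | "X = Re_vec o L\<^sub>0" by (auto simp: in_set_conv_nth)
 thus ?thesis
  by cases (simp_all only: cF_Re cF_Im Z_def[symmetric] L_def[symmetric] comb DZ DL)
qed

lemma V2_of_DC:
 assumes "q : U" "X : V2_of tau U"
 shows "DC (cF X)"
proof -
 obtain V Y where V: "open V" "q : V" and "V <= U" and Y: "Y : {X. EX Zs. EX L\<^sub>0:Z_sheaf V. represents V Zs tau &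
  (ALL q:V. (\<Sum>Z\<leftarrow>Zs. bracket Z (cnj_vec o Z) q) = cnj_vec (L\<^sub>0 q) - L\<^sub>0 q) &
  X : lie_module V ((%Z. Re_vec o Z) ` set Zs Un (%Z. Im_vec o Z) ` set Zs Un {Re_vec o L\<^sub>0})}"
  and YX: "!!p. p : V ==> Y p = X p"
  by (rule sheafifyE[OF assms(2)[unfolded V2_of_def] assms(1)]) (rule that)
 from Y[unfolded mem_Collect_eq] obtain Zs L\<^sub>0 where L0: "L\<^sub>0 : Z_sheaf V" and rep: "represents V Zs tau"
  and rel: "ALL q:V. (\<Sum>Z\<leftarrow>Zs. bracket Z (cnj_vec o Z) q) = cnj_vec (L\<^sub>0 q) - L\<^sub>0 q"
  and mem: "Y : lie_module V ((%Z. Re_vec o Z) ` set Zs Un (%Z. Im_vec o Z) ` set Zs Un {Re_vec o L\<^sub>0})"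
  by (elim exE bexE conjE)
 have Zs: "ALL Z:set Zs. Z : Z_sheaf V" using rep by (auto simp: represents_def)
 have "DC (cF Y)" by (rule lie_module_DC[OF V generators_DC[OF V Zs L0 rel] mem])
 thus ?thesis using cF_cong(2)[OF V, of Y X] YX by blast
qed

lemma V2_DC:
 assumes "q : U" "X : V2 U"
 shows "DC (cF X)"
proof -
 obtain V Y where V: "open V" "q : V" and "V <= U" and Y: "Y : lie_module V (\<Union>tau\<in>ker_levi_sheaf V. V2_of tau V)"
  and YX: "!!p. p : V ==> Y p = X p"
  by (rule sheafifyE[OF assms(2)[unfolded V2_def lie_sheaf_def] assms(1)]) (rule that)
 have "DC (cF Y)" by (rule lie_module_DC[OF V _ Y]) (use V2_of_DC[OF V(2)] in blast)
 thus ?thesis using cF_cong(2)[OF V, of Y X] YX by blast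
qed

lemma Y_sheaf_good:
 assumes "q : U" "X : Y_sheaf U"
 shows "good (cF X)"
proof -
 obtain V Y where V: "open V" "q : V" and "V <= U" and Y: "Y : module_span V (iterated_commutators (V2 V) (H_sheaf V))"
  and YX: "!!p. p : V ==> Y p = X p"
  by (rule sheafifyE[OF assms(2)[unfolded Y_sheaf_def relative_lie_sheaf_def] assms(1)]) (rule that)
 have g: "good (cF B)" if "B : iterated_commutators (V2 V) (H_sheaf V)" for B
  using that
 proof (induction rule: iterated_commutators.induct)
  case (base B)
  show ?case by (rule good_H[OF V base])
 next
  case (step A B)
  show ?case by (rule good_bracket[OF V2_DC[OF V(2) step.hyps(1)] step.IH])
 qed
 obtain k f B where f: "!!i. i < k ==> smooth_fun V (f i)" and B: "!!i. i < k ==> B i : iterated_commutators (V2 V) (H_sheaf V)"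
  and eq: "Y = (%p. \<Sum>i<(k::nat). f i p *\<^sub>R B i p)" using Y by (auto simp: module_span_def fun_eq_iff)
 have "cF Y = (%x. \<Sum>i<k. cF (%p. f i p *\<^sub>R B i p) x)"
  by (simp add: fun_eq_iff vec_eq_iff eq cF_def vf_coord_sum cxv_def)
 moreover have "good (cF (%p. f i p *\<^sub>R B i p))" if "i < k" for i
  unfolding cF_scale by (rule good_scale[OF g[OF B[OF that]] neighbourhood[OF V] smooth_fun_coord[OF f[OF that] V(1)]])
 ultimately have "good (cF Y)" by (simp only:) (rule good_sum, auto)
 thus ?thesis using cF_cong(1)[OF V, of Y X] YX by blast
qed

end

text \<open>The library proves the change of variables formula for well-ordered index types only; \<open>'a wo\<close>
 is a copy of the finite type \<open>'a\<close> with an arbitrary well-order.\<close>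

typedef 'a wo = "UNIV :: 'a set" morphisms unwo wo by auto

lemma wo_unwo [simp]: "wo (unwo i) = i" "unwo (wo j) = j"
 by (simp_all add: unwo_inverse wo_inverse)

lemma bij_wo: "bij wo" "bij unwo"
 by (rule bijI'; metis wo_unwo)+

instance wo :: (finite) finite
proof
 have "finite (range (wo :: 'a => 'a wo))" by simp
 thus "finite (UNIV :: 'a wo set)" by (simp add: bij_is_surj[OF bij_wo(1)])
qed

definition wo_rank :: "'a::finite wo => nat" where
 "wo_rank i = (SOME f :: 'a => nat. inj f) (unwo i)"

lemma inj_wo_rank: "inj wo_rank"
proof -
 have "EX f :: 'a => nat. inj f" using finite_imp_inj_to_nat_seg[of "UNIV :: 'a set"] by auto
 hence "inj (SOME f :: 'a => nat. inj f)" by (rule someI_ex)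
 from inj_compose[OF this bij_is_inj[OF bij_wo(2)]] show ?thesis by (simp add: wo_rank_def[abs_def] o_def)
qed

instantiation wo :: (finite) wellorder
begin

definition less_eq_wo :: "'a wo => 'a wo => bool" where
 "i <= j \<longleftrightarrow> wo_rank i <= wo_rank j"

definition less_wo :: "'a wo => 'a wo => bool" where
 "i < j \<longleftrightarrow> wo_rank i < wo_rank j"

instance
proof
 fix P :: "'a wo => bool" and a
 assume step: "!!x. (!!y. y < x ==> P y) ==> P x"
 show "P a"
 proof (induction "wo_rank a" arbitrary: a rule: less_induct)
  case less
  show ?case by (rule step, rule less, simp add: less_wo_def)
 qed
next
 fix i j :: "'a wo"
 assume "i <= j" "j <= i"
 hence "wo_rank i = wo_rank j" by (simp add: less_eq_wo_def)
 thus "i = j" by (rule injD[OF inj_wo_rank])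
qed (auto simp: less_eq_wo_def less_wo_def)

end

section \<open>Reindexing and the change of variables formula\<close>

lemma det_reindex:
 fixes A :: "'k::comm_ring_1^'m::finite^'m"
 shows "det (\<chi> i j. A $ unwo i $ unwo j) = det A"
proof -
 define c where "c p = wo o p o unwo" for p :: "'m => 'm"
 have per: "{p :: 'n::finite => 'n. p permutes UNIV} = {p. bij p}" by (auto simp: permutes_univ bij_iff)
 have bc: "bij_betw c {p. p permutes UNIV} {p. p permutes UNIV}"
  unfolding per
  by (rule bij_betw_byWitness[where f' = "%p. unwo o p o wo"])
   (auto simp: c_def fun_eq_iff intro!: bij_comp bij_wo)
 have "det (\<chi> i j. A $ unwo i $ unwo j) = (SUM p:{p. p permutes UNIV}. of_int (sign (c p)) * (PROD i:UNIV. A $ unwo i $ unwo (c p i)))"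
  unfolding det_def by (simp add: sum.reindex_bij_betw[OF bc, symmetric])
 also have "... = det A"
  unfolding det_def
 proof (rule sum.cong[OF refl])
  fix p :: "'m => 'm" assume p: "p : {p. p permutes UNIV}"
  have inj: "inj (wo :: 'm => 'm wo)" using bij_wo(1) by (rule bij_is_inj)
  have "c p = map_permutation UNIV wo p"
  proof
   fix i
   show "c p i = map_permutation UNIV wo p i"
    using map_permutation_apply[OF inj, of "unwo i" p] by (simp add: c_def)
  qed
  hence "sign (c p) = sign p" using sign_map_permutation[OF inj, of p] p by simp
  moreover have "(PROD i:UNIV. A $ unwo i $ unwo (c p i)) = (PROD i:UNIV. A $ i $ p i)"
   using prod.reindex_bij_betw[OF bij_wo(2), of "%i. A $ i $ p i"] by (simp add: c_def)
  ultimately show "of_int (sign (c p)) * (PROD i:UNIV. A $ unwo i $ unwo (c p i)) = of_int (sign p) * (PROD i:UNIV. A $ i $ p i)" by simp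
 qed
 finally show ?thesis .
qed

definition rix :: "real^'m::finite => real^'m wo" where
 "rix x = (\<chi> i. x $ unwo i)"

definition unrix :: "real^'m wo => real^'m::finite" where
 "unrix y = (\<chi> i. y $ wo i)"

lemma rix_unrix [simp]: "rix (unrix y) = y" "unrix (rix x) = x"
 by (simp_all add: rix_def unrix_def vec_eq_iff)

lemma linear_rix: "linear rix" "linear unrix"
 by (auto intro!: linearI simp: rix_def unrix_def vec_eq_iff)

lemma has_derivative_rix: "(rix has_derivative rix) F" "(unrix has_derivative unrix) G"
 by (auto intro!: bounded_linear_imp_has_derivative linear_conv_bounded_linear[THEN iffD1] linear_rix)

lemma prod_Basis_cart: "(PROD b:Basis. x \<bullet> b) = (PROD i:UNIV. (x :: real^'n::finite) $ i)"
proof -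
 have B: "(Basis :: (real^'n) set) = range (%i. axis i 1)" by (auto simp: Basis_vec_def)
 have "inj (%i::'n. axis i (1::real))" by (auto simp: inj_def axis_eq_axis)
 thus ?thesis unfolding B by (subst prod.reindex) (simp_all add: inner_axis)
qed

text \<open>Both measures agree on boxes, because reindexing merely permutes the side
  lengths.\<close>

lemma lborel_unrix: "distr lborel borel unrix = (lborel :: (real^'m::finite) measure)"
proof (rule lborel_eqI[symmetric])
 have m: "(unrix :: real^'m wo => real^'m) : borel_measurable borel"
  by (intro borel_measurable_continuous_onI linear_continuous_on linear_conv_bounded_linear[THEN iffD1] linear_rix)
 fix l w :: "real^'m"
 assume le: "!!b. b : Basis ==> l \<bullet> b <= w \<bullet> b"
 have lw: "l $ i <= w $ i" for i using le[of "axis i 1"] by (simp add: inner_axis axis_in_Basis_iff)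
 have "unrix -` box l w = box (rix l) (rix w)"
 proof -
  have "(ALL i. l $ i < y $ wo i & y $ wo i < w $ i) \<longleftrightarrow> (ALL i. l $ unwo i < y $ i & y $ i < w $ unwo i)" for y :: "real^'m wo"
   by (metis wo_unwo)
  thus ?thesis by (auto simp: mem_box_cart rix_def unrix_def)
 qed
 hence "emeasure (distr lborel borel unrix) (box l w) = emeasure lborel (box (rix l) (rix w))"
  using m by (simp add: emeasure_distr)
 also have "... = ennreal (PROD b:Basis. (rix w - rix l) \<bullet> b)"
 proof (rule emeasure_lborel_box)
  fix b :: "real^'m wo" assume "b : Basis"
  then obtain i where "b = axis i 1" by (auto simp: Basis_vec_def)
  thus "rix l \<bullet> b <= rix w \<bullet> b" using lw by (simp add: inner_axis rix_def)
 qed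
 also have "(PROD b:Basis. (rix w - rix l) \<bullet> b) = (PROD b:Basis. (w - l) \<bullet> b)"
  unfolding prod_Basis_cart
  using prod.reindex_bij_betw[OF bij_wo(2), of "%i. w $ i - l $ i"] by (simp add: rix_def)
 finally show "emeasure (distr lborel borel unrix) (box l w) = (PROD b:Basis. (w - l) \<bullet> b)" .
qed simp

lemma integral_unrix:
 fixes h :: "real^'m::finite => complex"
 assumes "integrable lborel h"
 shows "integrable lborel (%y. h (unrix y))" "(LINT y|lborel. h (unrix y)) = (LINT x|lborel. h x)"
proof -
 have m: "unrix : measurable lborel (borel :: (real^'m) measure)"
  by (simp, intro borel_measurable_continuous_onI linear_continuous_on linear_conv_bounded_linear[THEN iffD1] linear_rix)
 have h: "h : borel_measurable borel" using borel_measurable_integrable[OF assms] by simp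
 show "integrable lborel (%y. h (unrix y))"
  using assms integrable_distr_eq[OF m h] by (simp add: lborel_unrix)
 show "(LINT y|lborel. h (unrix y)) = (LINT x|lborel. h x)"
  using integral_distr[OF m h] by (simp add: lborel_unrix)
qed

text \<open>Packs a complex integrand into a vector of \<open>real^2\<close>, the form of integrand
  in \<open>has_absolute_integral_change_of_variables\<close>.\<close>

definition re_im :: "complex => real^2" where
 "re_im z = (\<chi> i. if i = 1 then Re z else Im z)"

lemma re_im_inject: "re_im z = re_im w ==> z = w"
 by (auto simp: re_im_def vec_eq_iff forall_2 complex_eq_iff)

lemma bounded_linear_re_im: "bounded_linear re_im"
 by (intro linear_conv_bounded_linear[THEN iffD1] linearI) (auto simp: re_im_def vec_eq_iff)

lemma integral_re_im:
 fixes h :: "real^'n::finite => complex"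
 assumes "integrable lborel h" "!!x. x ~: A ==> h x = 0"
 shows "(%x. re_im (h x)) absolutely_integrable_on A" "integral A (%x. re_im (h x)) = re_im (LINT x|lborel. h x)"
proof -
 have i: "integrable lborel (%x. re_im (h x))" by (rule integrable_bounded_linear[OF bounded_linear_re_im assms(1)])
 have e: "(%x. indicator A x *\<^sub>R re_im (h x)) = (%x. re_im (h x))" "(%x. if x : A then re_im (h x) else 0) = (%x. re_im (h x))"
  using assms(2) linear_0[OF bounded_linear.linear[OF bounded_linear_re_im]] by (auto simp: fun_eq_iff indicator_def)
 have m: "(%x. re_im (h x)) : borel_measurable lborel" by (rule borel_measurable_integrable[OF i])
 show "(%x. re_im (h x)) absolutely_integrable_on A"
  unfolding set_integrable_def e integrable_completion[OF m] by (rule i)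
 have "integral A (%x. re_im (h x)) = integral UNIV (%x. re_im (h x))"
  using Henstock_Kurzweil_Integration.integral_restrict_UNIV[of A "%x. re_im (h x)"] unfolding e by simp
 also have "... = (LINT x|lborel. re_im (h x))" by (rule integral_lborel[OF i])
 also have "... = re_im (LINT x|lborel. h x)" by (rule integral_bounded_linear[OF bounded_linear_re_im assms(1)])
 finally show "integral A (%x. re_im (h x)) = re_im (LINT x|lborel. h x)" .
qed

theorem change_of_variables:
 fixes tau :: "real^'m::finite => real^'m" and k :: "real^'m => complex"
 assumes S: "open S" "!!x. x : S ==> (tau has_derivative D x) (at x)" "inj_on tau S"
  and i1: "integrable lborel (%x. if x : S then of_real (abs (det (matrix (D x)))) * k (tau x) else 0)" (is "integrable _ ?K")
  and k: "integrable lborel k" "!!y. y ~: tau ` S ==> k y = 0"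
 shows "(LINT x|lborel. (if x : S then of_real (abs (det (matrix (D x)))) * k (tau x) else 0)) = (LINT y|lborel. k y)"
proof -
 define S' where "S' = unrix -` S"
 define g where "g y = rix (tau (unrix y))" for y
 define g' where "g' y v = rix (D (unrix y) (unrix v))" for y v
 have cont: "continuous_on UNIV (unrix :: real^'m wo => real^'m)"
  by (intro linear_continuous_on linear_conv_bounded_linear[THEN iffD1] linear_rix)
 have "open S'" unfolding S'_def using cont by (intro continuous_open_vimage[OF S(1)]) (simp add: continuous_on_eq_continuous_at)
 hence lS: "S' : sets lebesgue" by (simp add: borel_open)
 have gd: "(g has_derivative g' y) (at y within S')" if "y : S'" for y
 proof -
  have "unrix y : S" using that by (simp add: S'_def)
  from has_derivative_compose[OF has_derivative_rix(2) S(2)[OF this]]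
  have "((%y. tau (unrix y)) has_derivative (%v. D (unrix y) (unrix v))) (at y)" .
  from has_derivative_compose[OF this has_derivative_rix(1)]
  have "(g has_derivative g' y) (at y)" by (simp add: g_def[abs_def] g'_def[abs_def])
  thus ?thesis by (rule has_derivative_at_withinI)
 qed
 have inj: "inj_on g S'"
  using S(3) unfolding inj_on_def S'_def g_def by (metis rix_unrix vimageE)
 have img: "g ` S' = unrix -` (tau ` S)"
 proof
  show "unrix -` (tau ` S) <= g ` S'"
  proof
   fix y :: "real^'m wo" assume "y : unrix -` (tau ` S)"
   then obtain x where "x : S" "unrix y = tau x" by auto
   hence "y = g (rix x)" "rix x : S'" by (simp_all add: g_def S'_def) (metis rix_unrix(1))
   thus "y : g ` S'" by blast
  qed
 qed (auto simp: g_def S'_def)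
 have dt: "det (matrix (g' y)) = det (matrix (D (unrix y)))" if "y : S'" for y
 proof -
  have "matrix (g' y) = (\<chi> i j. matrix (D (unrix y)) $ unwo i $ unwo j)"
  proof -
   have "unrix (axis j 1 :: real^'m wo) = axis (unwo j) 1" for j
    by (auto simp: unrix_def vec_eq_iff axis_def)
   thus ?thesis by (simp add: matrix_def g'_def rix_def)
  qed
  thus ?thesis by (simp add: det_reindex)
 qed
 let ?f = "%y. re_im (k (unrix y))"
 have F: "abs (det (matrix (g' y))) *\<^sub>R ?f (g y) = re_im (?K (unrix y))" if "y : S'" for y
  using that linear_scale[OF bounded_linear.linear[OF bounded_linear_re_im]]
  by (simp add: dt g_def S'_def flip: scaleR_conv_of_real)
 have cov: "((%y. abs (det (matrix (g' y))) *\<^sub>R ?f (g y)) absolutely_integrable_on S' &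
   integral S' (%y. abs (det (matrix (g' y))) *\<^sub>R ?f (g y)) = b) \<longleftrightarrow>
   (?f absolutely_integrable_on (g ` S') & integral (g ` S') ?f = b)" for b
  by (rule has_absolute_integral_change_of_variables[OF lS gd inj])
 have r: "(%y. re_im (?K (unrix y))) absolutely_integrable_on S'"
  "integral S' (%y. re_im (?K (unrix y))) = re_im (LINT y|lborel. ?K (unrix y))"
  by (rule integral_re_im[OF integral_unrix(1)[OF i1]]; simp add: S'_def)+
 have "(%y. abs (det (matrix (g' y))) *\<^sub>R ?f (g y)) absolutely_integrable_on S'"
  by (rule iffD2[OF set_integrable_cong[OF refl refl F] r(1)])
 moreover have "integral S' (%y. abs (det (matrix (g' y))) *\<^sub>R ?f (g y)) = integral S' (%y. re_im (?K (unrix y)))"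
  by (rule integral_cong[OF F])
 ultimately have "(%y. abs (det (matrix (g' y))) *\<^sub>R ?f (g y)) absolutely_integrable_on S' &
   integral S' (%y. abs (det (matrix (g' y))) *\<^sub>R ?f (g y)) = re_im (LINT y|lborel. ?K (unrix y))"
  using r(2) by simp
 hence "?f absolutely_integrable_on (g ` S') & integral (g ` S') ?f = re_im (LINT y|lborel. ?K (unrix y))"
  by (rule iffD1[OF cov])
 hence "integral (g ` S') ?f = re_im (LINT y|lborel. ?K (unrix y))" ..
 moreover have "integral (g ` S') ?f = re_im (LINT y|lborel. k (unrix y))"
  by (rule integral_re_im(2)[OF integral_unrix(1)[OF k(1)]]) (simp add: img k(2))
 ultimately have "(LINT y|lborel. ?K (unrix y)) = (LINT y|lborel. k (unrix y))" by (intro re_im_inject) (rule trans[OF sym])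
 thus ?thesis by (simp only: integral_unrix(2)[OF i1] integral_unrix(2)[OF k(1)])
qed

lemma smooth_on_abs:
 fixes f :: "'e::euclidean_space => real"
 assumes S: "open S" and f: "smooth_on S f" and ne: "!!x. x : S ==> f x ~= 0"
 shows "smooth_on S (%x. abs (f x))"
proof (rule smooth_on_open_Union)
 fix x assume x: "x : S"
 have o: "open (S Int f -` {0<..})" "open (S Int f -` {..<0})"
  by (rule continuous_open_preimage[OF smooth_on_continuous[OF f] S]; simp)+
 have "smooth_on (S Int f -` {0<..}) (%x. abs (f x))"
  by (rule smooth_on_cong[OF o(1) _ smooth_on_subset[OF f]]) auto
 moreover have "smooth_on (S Int f -` {..<0}) (%x. abs (f x))"
  by (rule smooth_on_cong[OF o(2) _ smooth_on_minus[OF o(2) smooth_on_subset[OF f]]]) auto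
 ultimately show "EX T. open T & x : T & smooth_on T (%x. abs (f x))"
  using o x ne[OF x] by (cases "0 < f x") auto
qed

lemma det_of_real: "det (\<chi> i j. of_real (A $ i $ j)) = (of_real (det A) :: complex)"
 by (simp add: det_def)

context smooth_manifold
begin

lemma trans_jac_det:
 assumes "c : atlas" "d : atlas" "p : dom_of c" "p : dom_of d"
 shows "det (trans_jac c d (coord c p)) ~= 0"
proof -
 have "trans_jac d c (coord d p) ** trans_jac c d (coord c p) = mat 1"
  using trans_jac_comp[OF assms(1,2,1,3,4,3)] trans_jac_refl[OF assms(1,3)]
  by (simp add: matrix_matrix_mult_def mat_def vec_eq_iff)
 hence "det (trans_jac d c (coord d p)) * det (trans_jac c d (coord c p)) = 1"
  by (metis det_I det_mul)
 thus ?thesis by auto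
qed

text \<open>The transition map carries the support of \<open>g\<close> to the compact set
  \<open>K'\<close>, off which the pullback vanishes. \<open>V\<close> may exceed \<open>V'\<close>
  because the transformation law of \<open>distribution\<close> cuts off at the whole overlap, while
  \<open>g\<close> lives on a smaller set.\<close>

lemma pullback_test:
 assumes c: "c : atlas" and d: "d : atlas" and V: "open V" "V <= dom_of c Int dom_of d" and V': "V' <= V"
  and g: "g : tests (coord d ` V')"
 shows "(%x. if x : coord c ` V then of_real (abs (det (trans_jac c d x))) * g (trans_map c d x) else 0)
  : tests (coord c ` V')" (is "?h : _")
proof -
 obtain K where K: "compact K" "K <= coord d ` V'" "g : test_functions_supp K" using g by (rule test_functionsE)
 define K' where "K' = trans_map d c ` K"
 have KV: "K <= coord d ` (dom_of d Int dom_of c)"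
  by (rule subset_trans[OF K(2) image_mono]) (use V(2) V' in auto)
 have cK: "compact K'"
  unfolding K'_def
  by (rule compact_continuous_image[OF continuous_on_subset[OF smooth_on_continuous[OF charts_compatible[OF d c]] KV] K(1)])
 have KV': "K' <= coord c ` V'"
 proof
  fix x assume "x : K'"
  then obtain p where "p : V'" "x = trans_map d c (coord d p)" using K(2) by (auto simp: K'_def)
  moreover have "p : dom_of d" using calculation(1) V V' by auto
  ultimately show "x : coord c ` V'" using d by auto
 qed
 have Vi: "coord c ` V = coord c ` (V Int dom_of c)" using V(2) by (auto simp: Int_absorb2)
 have o: "open (coord c ` V)" unfolding Vi by (rule open_img[OF c V(1)])
 have sub: "coord c ` V <= coord c ` (dom_of c Int dom_of d)" using V(2) by auto
 have zero: "?h x = 0" if "x ~: K'" for x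
 proof (cases "x : coord c ` V")
  case True
  then obtain p where p: "p : V" "x = coord c p" by auto
  hence "p : dom_of c" "p : dom_of d" using V(2) by auto
  hence "trans_map d c (trans_map c d x) = x" using c d p by simp
  hence "trans_map c d x ~: K" using that by (metis K'_def imageI)
  thus ?thesis using test_suppD(2)[OF K(3)] by simp
 qed simp
 have "smooth_on (coord c ` V) (%x. complex_of_real (abs (det (trans_jac c d x))) * g (trans_map c d x))"
 proof (intro smooth_on_mult o)
  have "smooth_on (coord c ` V) (%x. det (trans_jac c d x))"
   by (rule smooth_on_det[OF o smooth_on_subset[OF smooth_trans_jac[OF c d] sub]])
  hence "smooth_on (coord c ` V) (%x. abs (det (trans_jac c d x)))"
   by (rule smooth_on_abs[OF o]) (use trans_jac_det[OF c d] V(2) in auto)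
  thus "smooth_on (coord c ` V) (%x. complex_of_real (abs (det (trans_jac c d x))))"
   by (rule smooth_on_linear[OF bounded_linear_of_real o])
  show "smooth_on (coord c ` V) (%x. g (trans_map c d x))"
   by (rule smooth_on_compose[OF o open_UNIV subset_UNIV smooth_on_subset[OF charts_compatible[OF c d] sub] test_smooth[OF g]])
 qed
 hence s1: "smooth_on (coord c ` V) ?h" by (rule smooth_on_cong[OF o, rotated]) simp
 have s2: "smooth_on (- K') ?h"
  by (rule smooth_on_cong[OF _ _ smooth_on_const[of _ 0]]) (use cK zero in "auto simp: compact_imp_closed open_Compl")
 have "smooth_on UNIV ?h"
 proof (rule smooth_on_open_Union)
  fix x
  show "EX T. open T & x : T & smooth_on T ?h"
   using s1 s2 o cK KV' V' by (cases "x : K'") (blast intro: open_Compl compact_imp_closed)+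
 qed
 hence "?h : test_functions_supp K'" using zero by (simp only: test_functions_supp_def mem_Collect_eq) blast
 thus ?thesis by (rule test_functionsI[OF cK KV'])
qed

text \<open>A density found in one chart is read as a function on the manifold and represents
  \<open>u\<close> in every chart: the Jacobian in the transformation law of
  \<open>distribution\<close> is the one of the change of variables formula.\<close>

lemma smooth_distribution_chart:
 assumes u: "distribution W u" and W: "open W" and c: "c : atlas"
  and B: "open B" "B <= coord c ` (W Int dom_of c)"
  and f: "smooth_on UNIV f" "!!g. g : tests B ==> u c g = (LINT x|lborel. f x * g x)"
 shows "smooth_distribution (dom_of c Int coord c -` B) u"
proof -
 define W' where "W' = dom_of c Int coord c -` B"
 have W': "open W'" "W' <= W Int dom_of c"
 proof -
  show "open W'" unfolding W'_def by (rule open_preimage[OF c B(1)])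
  show "W' <= W Int dom_of c"
  proof
   fix p assume p: "p : W'"
   then obtain p' where "p' : W" "p' : dom_of c" "coord c p = coord c p'" using B(2) by (auto simp: W'_def)
   thus "p : W Int dom_of c" using p c by (metis Int_iff W'_def inv_coord_coord)
  qed
 qed
 define F where "F = (%p. f (coord c p))"
 have F: "F (inv_coord d y) = f (trans_map d c y)" for d y by (simp add: F_def trans_map_def)
 have sF: "smooth_on (coord d ` (W' Int dom_of d)) (%y. F (inv_coord d y))" if d: "d : atlas" for d
  unfolding F
  by (rule smooth_on_compose[OF open_img[OF d W'(1)] open_UNIV subset_UNIV smooth_on_subset[OF charts_compatible[OF d c]] f(1)])
   (use W'(2) in auto)
 have "u d g = (LINT y|lborel. F (inv_coord d y) * g y)"
  if d: "d : atlas" and g: "g : tests (coord d ` (W' Int dom_of d))" for d g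
 proof -
  define V where "V = W Int dom_of c Int dom_of d"
  have V: "open V" "V <= dom_of c Int dom_of d" "W' Int dom_of d <= V"
   unfolding V_def using W open_dom[OF c] open_dom[OF d] W'(2) by auto
  define h where "h = (%x. if x : coord c ` V then of_real (abs (det (trans_jac c d x))) * g (trans_map c d x) else 0)"
  have th: "h : tests (coord c ` (W' Int dom_of d))" unfolding h_def by (rule pullback_test[OF c d V g])
  have Vi: "coord c ` V = coord c ` (V Int dom_of c)" using V(2) by (auto simp: Int_absorb2)
  have o: "open (coord c ` V)" unfolding Vi by (rule open_img[OF c V(1)])
  have "u d g = u c h"
   unfolding h_def V_def
   using u c d g test_mono[of "coord d ` (W' Int dom_of d)" "coord d ` (W Int dom_of c Int dom_of d)"] V(3)
   unfolding distribution_def V_def by (meson image_mono subset_iff)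
  also have "... = (LINT x|lborel. f x * h x)"
   by (rule f(2)) (use th test_mono[of "coord c ` (W' Int dom_of d)" B] in "auto simp: W'_def")
  also have "... = (LINT x|lborel. (if x : coord c ` V then of_real (abs (det (matrix (frechet_derivative (trans_map c d) (at x))))) *
    (F (inv_coord d (trans_map c d x)) * g (trans_map c d x)) else 0))"
  proof (intro Bochner_Integration.integral_cong refl)
   fix x
   have "F (inv_coord d (trans_map c d x)) = f x" if "x : coord c ` V"
    using that V(2) c d by (auto simp: F_def subset_iff)
   thus "f x * h x = (if x : coord c ` V then of_real (abs (det (matrix (frechet_derivative (trans_map c d) (at x))))) *
    (F (inv_coord d (trans_map c d x)) * g (trans_map c d x)) else 0)" by (simp add: h_def trans_jac_def)
  qed
  also have "... = (LINT y|lborel. F (inv_coord d y) * g y)"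
  proof (rule change_of_variables[OF o])
   have tk: "(%y. F (inv_coord d y) * g y) : tests (coord d ` (W' Int dom_of d))"
    by (rule test_mult_local[OF open_img[OF d W'(1)] g sF[OF d]])
   show "integrable lborel (%y. F (inv_coord d y) * g y)" by (rule test_integrable[OF tk])
   have "integrable lborel (%x. if x : coord c ` V then of_real (abs (det (trans_jac c d x))) *
     (F (inv_coord d (trans_map c d x)) * g (trans_map c d x)) else 0)"
    by (rule test_integrable[OF pullback_test[OF c d V tk]])
   thus "integrable lborel (%x. if x : coord c ` V then of_real (abs (det (matrix (frechet_derivative (trans_map c d) (at x))))) *
     (F (inv_coord d (trans_map c d x)) * g (trans_map c d x)) else 0)" by (simp only: trans_jac_def)
   show "(trans_map c d has_derivative frechet_derivative (trans_map c d) (at x)) (at x)" if "x : coord c ` V" for x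
    by (rule smooth_on_has_derivative[OF charts_compatible[OF c d]]) (use that V(2) in auto)
   show "inj_on (trans_map c d) (coord c ` V)"
   proof (rule inj_onI)
    fix x y assume "x : coord c ` V" "y : coord c ` V" and e: "trans_map c d x = trans_map c d y"
    then obtain p p' where p: "p : V" "p' : V" "x = coord c p" "y = coord c p'" by auto
    hence "coord d p = coord d p'" using e V(2) c by (auto simp: subset_iff)
    hence "p = p'" using p V(2) d by (metis IntE inv_coord_coord subsetD)
    thus "x = y" using p by simp
   qed
   fix y assume y: "y ~: trans_map c d ` coord c ` V"
   have "y ~: coord d ` (W' Int dom_of d)"
   proof
    assume "y : coord d ` (W' Int dom_of d)"
    then obtain p where p: "p : V" "y = coord d p" using V(3) by auto
    hence "y = trans_map c d (coord c p)" using V(2) c by (auto simp: subset_iff)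
    thus False using y p by blast
   qed
   moreover obtain K where "K <= coord d ` (W' Int dom_of d)" "g : test_functions_supp K" using g by (rule test_functionsE)
   ultimately show "F (inv_coord d y) * g y = 0" using test_suppD(2) by fastforce
  qed
  finally show ?thesis .
 qed
 thus ?thesis
  unfolding smooth_distribution_def W'_def[symmetric]
  using sF by (intro exI[of _ F]) (auto simp: smooth_fun_def o_def)
qed

end

lemma distribution_on_subset:
 assumes "distribution_on Om u" "Om' <= Om"
 shows "distribution_on Om' u"
 unfolding distribution_on_def
proof (intro conjI ballI allI impI)
 fix g h a b assume "g : tests Om'" "h : tests Om'"
 thus "u (%x. a * g x + b * h x) = a * u g + b * u h"
  using test_mono[OF assms(2)] by (intro dist_linear[OF assms(1)]) auto
next
 fix K assume "compact K & K <= Om'"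
 hence "compact K & K <= Om" using assms(2) by blast
 from conjunct2[OF assms(1)[unfolded distribution_on_def], THEN spec, THEN mp, OF this]
 show "EX C N. ALL g:test_functions_supp K. cmod (u g) <= C * (\<Sum>js | length js <= N. SUP x. cmod (partials js g x))" .
qed

section \<open>Property (H) from the spanning condition\<close>

context almost_CR_manifold
begin

lemma CR_local_exists:
 assumes c: "c : atlas" "q : dom_of c" and W: "open W" "q : W" and CR: "CR_distribution W u"
 shows "EX R. CR_local atlas T01 n u c q R W"
proof -
 have o: "open (coord c ` (W Int dom_of c))" by (rule open_img[OF c(1) W(1)])
 have "coord c q : coord c ` (W Int dom_of c)" using c W by auto
 then obtain e where e: "0 < e" "ball (coord c q) e <= coord c ` (W Int dom_of c)" using o openE by blast
 define R where "R = min e pi"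
 have R: "0 < R" "R <= pi" "ball (coord c q) R <= coord c ` (W Int dom_of c)" using e by (auto simp: R_def)
 have "distribution_on (coord c ` (W Int dom_of c)) (u c)" using CR c(1) by (simp add: CR_distribution_def distribution_def)
 hence "distribution_on (ball (coord c q) R) (u c)" by (rule distribution_on_subset[OF _ R(3)])
 hence "CR_local atlas T01 n u c q R W"
  by unfold_locales (use R c W CR in auto)
 thus ?thesis ..
qed

text \<open>Gives access to \<open>CR_local\<close> before any distribution is chosen; smoothness of
  the sections \<open>Y i\<close> in the chart is then a by-product of their being good.\<close>

lemma zero_CR: "CR_distribution UNIV (%c g. 0)"
 unfolding CR_distribution_def distribution_def distribution_on_def apply_vf_def
 by (auto intro!: exI[of _ 0])

theorem property_H_of_spanning:
 assumes span: "{Y p | Y. Y : Y_sheaf UNIV} = (UNIV :: (real^'m) set)"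
 shows "property_H_at p"
proof -
 define c where "c = chart_at p"
 have c: "c : atlas" "p : dom_of c" unfolding c_def by (rule chart_at)+
 have "EX Y. Y : Y_sheaf UNIV & Y p = axis i 1" for i :: 'm
 proof -
  have "axis i 1 : {Y p | Y. Y : Y_sheaf UNIV}" unfolding span by simp
  thus ?thesis by force
 qed
 then obtain Y where Y: "!!i. Y i : Y_sheaf UNIV" "!!i. Y i p = axis i 1" by metis
 define A where "A x = (\<chi> i. vf_coord c (Y i) x)" for x
 have Ap: "A (coord c p) = mat 1"
  unfolding A_def c_def vf_coord_chart_at Y(2) by (simp add: mat_def axis_def vec_eq_iff)
 obtain r where r: "0 < r" "ball (coord c p) r <= coord c ` dom_of c" "!!i. smooth_on (ball (coord c p) r) (vf_coord c (Y i))"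
 proof -
  obtain R where "CR_local atlas T01 n (%c g. 0) c p R UNIV" using CR_local_exists[OF c open_UNIV UNIV_I zero_CR] ..
  then interpret P: CR_local atlas T01 n "%c g. 0" c p R UNIV .
  obtain eps r0 where e: "0 < r0" "r0 <= R" "!!i. P.gain eps r0 (P.cF (Y i))"
   using P.common_gain[of UNIV "%i. P.cF (Y i)"] P.Y_sheaf_good[OF UNIV_I Y(1)] by auto
  have "smooth_on (ball (coord c p) r0) (%x. Re_vec (P.cF (Y i) x))" for i
   unfolding Re_vec_def
   by (intro smooth_on_vec_lambda open_ball smooth_on_linear[OF bounded_linear_Re] smooth_on_vec_nth P.gainD(3)[OF e(3)])
  hence "smooth_on (ball (coord c p) r0) (vf_coord c (Y i))" for i by (simp add: P.cF_def)
  moreover have "ball (coord c p) r0 <= coord c ` dom_of c" using P.sub subset_ball[OF e(2), of "coord c p"] by auto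
  ultimately show ?thesis using that e(1) by blast
 qed
 \<comment> \<open>Spanning is assumed at \<open>p\<close> alone; on \<open>B\<close> the
   determinant stays nonzero, so the same sections span at every point of \<open>U\<close>.\<close>
 define B where "B = ball (coord c p) r Int (%x. det (A x)) -` (- {0})"
 have "smooth_on (ball (coord c p) r) (%x. det (A x))"
  by (rule smooth_on_det[OF open_ball]) (simp add: A_def smooth_on_vec_nth[OF open_ball r(3)])
 hence "open B" unfolding B_def by (intro continuous_open_preimage smooth_on_continuous) auto
 define U where "U = dom_of c Int coord c -` B"
 have "open U" unfolding U_def by (rule open_preimage[OF c(1) `open B`])
 moreover have "p : U" using c r(1) Ap by (simp add: U_def B_def)
 moreover have "property_H U"
  unfolding property_H_def
 proof (intro ballI allI impI)
  fix q W u assume q: "q : U" and W: "open W & q : W & W <= U & CR_distribution W u"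
  have cq: "q : dom_of c" using q by (simp add: U_def)
  obtain R where "CR_local atlas T01 n u c q R W" using CR_local_exists[OF c(1) cq] W by blast
  then interpret P: CR_local atlas T01 n u c q R W .
  have "(\<chi> i. P.cF (Y i) (coord c q)) = (\<chi> i j. of_real (A (coord c q) $ i $ j))"
   by (simp add: vec_eq_iff P.cF_def cxv_def A_def)
  hence "det (\<chi> i. P.cF (Y i) (coord c q)) ~= 0"
   using q by (simp add: det_of_real U_def B_def)
  then obtain rho f where rho: "0 < rho" "rho <= R" "smooth_on UNIV f"
   "!!g. g : tests (ball (coord c q) rho) ==> u c g = (LINT x|lborel. f x * g x)"
   using P.smooth_of_spanning[of "%i. P.cF (Y i)"] P.Y_sheaf_good[OF UNIV_I Y(1)] by blast
  have sub: "ball (coord c q) rho <= coord c ` (W Int dom_of c)" using P.sub subset_ball[OF rho(2)] by blast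
  define W' where "W' = dom_of c Int coord c -` ball (coord c q) rho"
  have "distribution W u" using W by (simp add: CR_distribution_def)
  hence "smooth_distribution W' u"
   unfolding W'_def by (rule smooth_distribution_chart[OF _ conjunct1[OF W] c(1) open_ball sub rho(3)]) (rule rho(4))
  moreover have "open W'" unfolding W'_def by (rule open_preimage[OF c(1) open_ball])
  moreover have "q : W'" using cq rho(1) by (simp add: W'_def)
  moreover have "W' <= W"
  proof
   fix x assume x: "x : W'"
   hence "coord c x : coord c ` (W Int dom_of c)" using sub unfolding W'_def by blast
   then obtain x' where "x' : W" "x' : dom_of c" "coord c x = coord c x'" by auto
   thus "x : W" using x c(1) by (metis Int_iff W'_def inv_coord_coord)
  qed
  ultimately show "EX W'. open W' & q : W' & W' <= W & smooth_distribution W' u" by blast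
 qed
 ultimately show ?thesis unfolding property_H_at_def by blast
qed

end

theorem theorem3p2:
  fixes atlas :: "('a::{t2_space,second_countable_topology}, 'm::finite) chart set"
    and T01 :: "'a \<Rightarrow> (complex^'m) set" and n :: nat and p :: 'a
  assumes "almost_CR_manifold atlas T01 n"
    and "{Y p | Y. Y \<in> almost_CR_manifold.Y_sheaf atlas T01 UNIV} = (UNIV :: (real^'m) set)"
  shows "almost_CR_manifold.property_H_at atlas T01 p"
  by (rule almost_CR_manifold.property_H_of_spanning[OF assms])

end
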